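(* Let $\epsilon>0$. Suppose we are given a graph $G=(V,E)$ with $n$ vertices and non-negative edge weights with aspect ratio at most $W$, a $(1+\epsilon,O(\log n))$-hopset $G'=(V,H)$ of $G$, and a subset $S\subseteq V$ of $|S|=n^{\sigma}$ sources. Let $A$ be the weighted adjacency matrix of $(V,E\cup H)$ (with $0$ on the diagonal and $\infty$ for non-edges), $B^{(0)}$ the submatrix of $A$ formed by the rows of $S$, and for $i=0,1,\dots,O(\log n)$ let $B^{(i+1)}=B^{(i)}\star_{\xi}A$, a $(1+\xi)$-approximate distance product, with $\xi=\epsilon/\Theta(\log n)$. Then this computes $(1+O(\epsilon))$-approximate $S\times V$ distances within $O(\log W)\cdot\tilde O(1/\epsilon)\cdot n^{\omega(\sigma)+o(1)}$ centralized time, or within parallel polylogarithmic in $n$ time and work bounded by this expression.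
   Context: A $(1+\epsilon,\beta)$-hopset of $G$ is a weighted graph $(V,H)$ such that for every pair $(u,v)$ with $v$ reachable from $u$, $d_G(u,v)\le d^{(\beta)}_{G\cup H}(u,v)\le(1+\epsilon)d_G(u,v)$, where $d^{(\beta)}$ is the shortest path length using at most $\beta$ edges. The distance product of an $n^{\sigma}\times n$ matrix $B$ and an $n\times n$ matrix $A$ is $C[i,j]=\min_t(B[i,t]+A[t,j])$; a $(1+\xi)$-approximate distance product is a matrix $C'$ with $C[i,j]\le C'[i,j]\le(1+\xi)C[i,j]$ for all entries. The aspect ratio is the ratio of largest to smallest non-zero weight. $\omega(\sigma)$ is the exponent of multiplying an $n^{\sigma}\times n$ by an $n\times n$ matrix.
   Formalization: Unreachable pairs are covered only if H joins no vertices unreachable in G; constants are uniform for ε up to any fixed bound; parallel time also has polylog(1/ε); output is shown to be an iterate B^(i) only if positive H-weights are within a poly(n) factor of G's. *)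

theory Defs
  imports
    "HOL-Analysis.Analysis"
    "HOL-Library.Log_Nat"
    "Graph_Theory.Pair_Digraph"
    "Graph_Theory.Shortest_Path"
begin

section \<open>Hopsets\<close>

text \<open>
  Graphs are directed; an undirected graph is a symmetric one. Exact distances are those of the
  library, \<^const>\<open>wf_digraph.\<mu>\<close>, with value infinity for unreachable pairs.
\<close>

definition hop_dist :: "('v, 'e) pre_digraph \<Rightarrow> 'e weight_fun \<Rightarrow> nat \<Rightarrow> 'v \<Rightarrow> 'v \<Rightarrow> ereal" where
  "hop_dist G w \<beta> u v =
     (INF p\<in>{p. pre_digraph.awalk G u p v \<and> length p \<le> \<beta>}. ereal (wf_digraph.awalk_cost w p))"

text \<open>The union keeps parallel arcs, so an edge of \<open>G\<close> and an edge of \<open>H\<close> with the same ends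
  retain their own weights.\<close>

definition graph_union :: "('v, 'e) pre_digraph \<Rightarrow> ('v, 'f) pre_digraph \<Rightarrow> ('v, 'e + 'f) pre_digraph" where
  "graph_union G H =
     \<lparr> verts = verts G \<union> verts H, arcs = Inl ` arcs G \<union> Inr ` arcs H,
       tail = case_sum (tail G) (tail H), head = case_sum (head G) (head H) \<rparr>"

definition weighted_graph :: "('v, 'e) pre_digraph \<Rightarrow> 'e weight_fun \<Rightarrow> bool" where
  "weighted_graph G w \<longleftrightarrow> fin_digraph G \<and> (\<forall>e\<in>arcs G. 0 \<le> w e)"

definition hopset ::
  "real \<Rightarrow> nat \<Rightarrow> ('v, 'e) pre_digraph \<Rightarrow> 'e weight_fun \<Rightarrow> ('v, 'f) pre_digraph \<Rightarrow> 'f weight_fun \<Rightarrow> bool" where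
  "hopset \<epsilon> \<beta> G wG H wH \<longleftrightarrow>
     weighted_graph H wH \<and> verts H = verts G \<and>
     (\<forall>u v. u \<rightarrow>\<^sup>*\<^bsub>G\<^esub> v \<longrightarrow>
        wf_digraph.\<mu> G wG u v \<le> hop_dist (graph_union G H) (case_sum wG wH) \<beta> u v \<and>
        hop_dist (graph_union G H) (case_sum wG wH) \<beta> u v \<le> ereal (1 + \<epsilon>) * wf_digraph.\<mu> G wG u v)"

definition aspect_ratio_at_most :: "('v, 'e) pre_digraph \<Rightarrow> 'e weight_fun \<Rightarrow> real \<Rightarrow> bool" where
  "aspect_ratio_at_most G w W \<longleftrightarrow> (\<forall>e\<in>arcs G. \<forall>f\<in>arcs G. 0 < w e \<longrightarrow> w f \<le> W * w e)"


section \<open>Approximate distance products\<close>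

text \<open>The infimum over no arcs is infinity, the entry of a non-edge.\<close>

definition adj_matrix :: "('v, 'e) pre_digraph \<Rightarrow> 'e weight_fun \<Rightarrow> 'v \<Rightarrow> 'v \<Rightarrow> ereal" where
  "adj_matrix G w u v =
     (if u = v then 0 else (INF e\<in>{e \<in> arcs G. tail G e = u \<and> head G e = v}. ereal (w e)))"

definition dist_product :: "'v set \<Rightarrow> ('u \<Rightarrow> 'v \<Rightarrow> ereal) \<Rightarrow> ('v \<Rightarrow> 'v \<Rightarrow> ereal) \<Rightarrow> 'u \<Rightarrow> 'v \<Rightarrow> ereal" where
  "dist_product V B A i j = (INF t\<in>V. B i t + A t j)"

definition approx_dist_product ::
  "real \<Rightarrow> 'u set \<Rightarrow> 'v set \<Rightarrow> ('u \<Rightarrow> 'v \<Rightarrow> ereal) \<Rightarrow> ('v \<Rightarrow> 'v \<Rightarrow> ereal) \<Rightarrow> ('u \<Rightarrow> 'v \<Rightarrow> ereal) \<Rightarrow> bool" where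
  "approx_dist_product \<xi> S V B A C' \<longleftrightarrow>
     (\<forall>i\<in>S. \<forall>j\<in>V. dist_product V B A i j \<le> C' i j \<and> C' i j \<le> ereal (1 + \<xi>) * dist_product V B A i j)"

text \<open>\<open>B i\<close> accounts for walks with at most \<open>i + 1\<close> edges, as \<open>B 0\<close> consists of rows of \<open>A\<close>;
  a hopset with hop bound \<open>\<beta>\<close> therefore calls for \<open>m = \<beta> - 1\<close> products.\<close>

definition iterated_products ::
  "real \<Rightarrow> 'v set \<Rightarrow> 'v set \<Rightarrow> ('v \<Rightarrow> 'v \<Rightarrow> ereal) \<Rightarrow> nat \<Rightarrow> (nat \<Rightarrow> 'v \<Rightarrow> 'v \<Rightarrow> ereal) \<Rightarrow> bool" where
  "iterated_products \<xi> S V A m B \<longleftrightarrow>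
     (\<forall>u\<in>S. \<forall>v\<in>V. B 0 u v = A u v) \<and>
     (\<forall>i<m. approx_dist_product \<xi> S V (B i) A (B (Suc i)))"

text \<open>
  A hopset is constrained only on reachable pairs, so its edges may join vertices that are not
  connected in \<open>G\<close>, and then no estimate from \<open>G \<union> H\<close> recognises all unreachable pairs. Such pairs
  are therefore covered (with exact distance infinity) provided the hopset creates no new
  reachability; reachable pairs are always covered.
\<close>

definition approx_distances ::
  "real \<Rightarrow> ('v, 'e) pre_digraph \<Rightarrow> 'e weight_fun \<Rightarrow> ('v, 'f) pre_digraph \<Rightarrow> 'v set \<Rightarrow> ('v \<Rightarrow> 'v \<Rightarrow> ereal) \<Rightarrow> bool" where
  "approx_distances r G w H S X \<longleftrightarrow>
     (\<forall>u\<in>S. \<forall>v\<in>verts G.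
        u \<rightarrow>\<^sup>*\<^bsub>G\<^esub> v \<or> (\<forall>e\<in>arcs H. tail H e \<rightarrow>\<^sup>*\<^bsub>G\<^esub> head H e) \<longrightarrow>
        wf_digraph.\<mu> G w u v \<le> X u v \<and> X u v \<le> ereal r * wf_digraph.\<mu> G w u v)"

text \<open>The positive hopset weights lie within a factor \<open>q\<close> of the range of positive weights of
  \<open>G\<close>, so that the aspect ratio of the union is at most \<open>q\<^sup>2\<close> times that of \<open>G\<close>. Edges
  representing (approximate) distances in \<open>G\<close> satisfy this with \<open>q\<close> linear in the number of vertices.\<close>

definition within_range ::
  "real \<Rightarrow> ('v, 'e) pre_digraph \<Rightarrow> 'e weight_fun \<Rightarrow> ('v, 'f) pre_digraph \<Rightarrow> 'f weight_fun \<Rightarrow> bool" where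
  "within_range q G wG H wH \<longleftrightarrow>
     (\<forall>h\<in>arcs H. 0 < wH h \<longrightarrow>
        (\<exists>e\<in>arcs G. 0 < wG e \<and> wG e \<le> q * wH h) \<and> (\<exists>f\<in>arcs G. wH h \<le> q * wG f))"


section \<open>The exponent of rectangular matrix multiplication\<close>

text \<open>
  Straight-line programs over the rationals. Every instruction appends one value to the list of
  values computed so far, which initially holds the inputs; operands are positions in that list.
\<close>

datatype slp_instr = Const rat | Plus nat nat | Minus nat nat | Times nat nat

fun slp_value :: "rat list \<Rightarrow> slp_instr \<Rightarrow> rat" where
  "slp_value vs (Const q) = q"
| "slp_value vs (Plus i j) = vs ! i + vs ! j"
| "slp_value vs (Minus i j) = vs ! i - vs ! j"
| "slp_value vs (Times i j) = vs ! i * vs ! j"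

fun slp_legal :: "nat \<Rightarrow> slp_instr \<Rightarrow> bool" where
  "slp_legal l (Const q) \<longleftrightarrow> True"
| "slp_legal l (Plus i j) \<longleftrightarrow> i < l \<and> j < l"
| "slp_legal l (Minus i j) \<longleftrightarrow> i < l \<and> j < l"
| "slp_legal l (Times i j) \<longleftrightarrow> i < l \<and> j < l"

definition slp_wf :: "nat \<Rightarrow> slp_instr list \<Rightarrow> bool" where
  "slp_wf l is \<longleftrightarrow> (\<forall>k<length is. slp_legal (l + k) (is ! k))"

definition slp_run :: "slp_instr list \<Rightarrow> rat list \<Rightarrow> rat list" where
  "slp_run is vs = foldl (\<lambda>us c. us @ [slp_value us c]) vs is"

definition mm_inputs :: "nat \<Rightarrow> nat \<Rightarrow> nat \<Rightarrow> (nat \<Rightarrow> nat \<Rightarrow> rat) \<Rightarrow> (nat \<Rightarrow> nat \<Rightarrow> rat) \<Rightarrow> rat list" where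
  "mm_inputs p q r X Y =
     concat (map (\<lambda>i. map (X i) [0..<q]) [0..<p]) @ concat (map (\<lambda>j. map (Y j) [0..<r]) [0..<q])"

definition slp_multiplies :: "nat \<Rightarrow> nat \<Rightarrow> nat \<Rightarrow> slp_instr list \<Rightarrow> bool" where
  "slp_multiplies p q r is \<longleftrightarrow>
     slp_wf (p * q + q * r) is \<and>
     (\<exists>out. \<forall>i<p. \<forall>k<r. out i k < p * q + q * r + length is \<and>
        (\<forall>X Y. slp_run is (mm_inputs p q r X Y) ! out i k = (\<Sum>j<q. X i j * Y j k)))"

definition power_ceil :: "nat \<Rightarrow> real \<Rightarrow> nat" where
  "power_ceil n \<sigma> = nat \<lceil>real n powr \<sigma>\<rceil>"

definition mm_exponent :: "real \<Rightarrow> real" where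
  "mm_exponent \<sigma> =
     Inf {\<tau>. \<exists>c. \<forall>n\<ge>1. \<exists>is. slp_multiplies (power_ceil n \<sigma>) n n is \<and> real (length is) \<le> c * real n powr \<tau>}"


section \<open>Machine model\<close>

text \<open>
  A parallel random access machine with exclusive writes and concurrent reads, programmed in a
  structured language. Scalars are private to a parallel branch; the memory, a collection of named
  integer arrays, is shared. The execution relation records the work (total cost of all operations,
  hence the running time of a sequential execution) and the depth (parallel running time).

  The machine has words of \<open>w\<close> bits. The work of an operation is the number of words of its operands
  and its result, the usual logarithmic cost criterion counted in words; its depth is logarithmic in
  that number. Integers exceeding a word are thus allowed but charged for.
\<close>

datatype operand = Lit int | Var string

text \<open>\<open>Shift\<close> multiplies by a power of two, rounding down when the exponent is negative;
  \<open>Quot\<close> is division rounding down.\<close>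

datatype binop = Add | Sub | Mul | Quot | Shift

datatype com =
    Skip
  | Op string binop operand operand
  | BitLen string operand
  | Load string string operand
  | Store string operand operand
  | Seq com com
  | IfLess operand operand com com
  | WhileLess operand operand com
  | ParFor string operand com

type_synonym scalars = "string \<Rightarrow> int"
type_synonym cell = "string \<times> int"
type_synonym state = "scalars \<times> (cell \<Rightarrow> int)"

fun operand_val :: "scalars \<Rightarrow> operand \<Rightarrow> int" where
  "operand_val s (Lit z) = z"
| "operand_val s (Var x) = s x"

fun binop_val :: "binop \<Rightarrow> int \<Rightarrow> int \<Rightarrow> int" where
  "binop_val Add y z = y + z"
| "binop_val Sub y z = y - z"
| "binop_val Mul y z = y * z"
| "binop_val Quot y z = y div z"
| "binop_val Shift y z = (if 0 \<le> z then y * 2 ^ nat z else y div 2 ^ nat (- z))"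

definition bit_length :: "int \<Rightarrow> nat" where
  "bit_length z = floorlog 2 (nat \<bar>z\<bar>)"

definition num_words :: "nat \<Rightarrow> int \<Rightarrow> nat" where
  "num_words w z = 1 + bit_length z div w"

definition depth_cost :: "nat \<Rightarrow> nat" where
  "depth_cost t = 1 + floorlog 2 t"

definition op_cost :: "nat \<Rightarrow> int list \<Rightarrow> nat" where
  "op_cost w zs = sum_list (map (num_words w) zs)"

text \<open>
  \<open>exec w c st st' t d R U\<close>: on words of \<open>w\<close> bits, \<open>c\<close> started in \<open>st\<close> terminates in \<open>st'\<close> with work
  \<open>t\<close> and depth \<open>d\<close>, reading the cells \<open>R\<close> and writing the cells \<open>U\<close>. The branches of a parallel loop
  are isolated, and the loop is stuck if a branch accesses a cell written by another branch.
  Spawning \<open>N\<close> branches costs logarithmic depth and work linear in \<open>N\<close>.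
\<close>

inductive exec :: "nat \<Rightarrow> com \<Rightarrow> state \<Rightarrow> state \<Rightarrow> nat \<Rightarrow> nat \<Rightarrow> cell set \<Rightarrow> cell set \<Rightarrow> bool" for w where
  exec_Skip: "exec w Skip st st 1 1 {} {}"
| exec_Op:
    "\<lbrakk> y = operand_val s a; z = operand_val s b; r = binop_val f y z; t = op_cost w [y, z, r] \<rbrakk>
     \<Longrightarrow> exec w (Op x f a b) (s, m) (s(x := r), m) t (depth_cost t) {} {}"
| exec_BitLen:
    "\<lbrakk> y = operand_val s a; r = int (bit_length y); t = op_cost w [y, r] \<rbrakk>
     \<Longrightarrow> exec w (BitLen x a) (s, m) (s(x := r), m) t (depth_cost t) {} {}"
| exec_Load:
    "\<lbrakk> i = operand_val s a; r = m (A, i); t = op_cost w [i, r] \<rbrakk>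
     \<Longrightarrow> exec w (Load x A a) (s, m) (s(x := r), m) t (depth_cost t) {(A, i)} {}"
| exec_Store:
    "\<lbrakk> i = operand_val s a; y = operand_val s b; t = op_cost w [i, y] \<rbrakk>
     \<Longrightarrow> exec w (Store A a b) (s, m) (s, m((A, i) := y)) t (depth_cost t) {} {(A, i)}"
| exec_Seq:
    "\<lbrakk> exec w c1 st1 st2 t1 d1 R1 U1; exec w c2 st2 st3 t2 d2 R2 U2 \<rbrakk>
     \<Longrightarrow> exec w (Seq c1 c2) st1 st3 (t1 + t2) (d1 + d2) (R1 \<union> R2) (U1 \<union> U2)"
| exec_IfLess:
    "\<lbrakk> y = operand_val s a; z = operand_val s b; t0 = op_cost w [y, z];
       exec w (if y < z then c1 else c2) (s, m) st' t d R U \<rbrakk>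
     \<Longrightarrow> exec w (IfLess a b c1 c2) (s, m) st' (t0 + t) (depth_cost t0 + d) R U"
| exec_WhileEnd:
    "\<lbrakk> y = operand_val s a; z = operand_val s b; t = op_cost w [y, z]; \<not> y < z \<rbrakk>
     \<Longrightarrow> exec w (WhileLess a b c) (s, m) (s, m) t (depth_cost t) {} {}"
| exec_WhileStep:
    "\<lbrakk> y = operand_val s a; z = operand_val s b; t0 = op_cost w [y, z]; y < z;
       exec w c (s, m) st1 t1 d1 R1 U1; exec w (WhileLess a b c) st1 st2 t2 d2 R2 U2 \<rbrakk>
     \<Longrightarrow> exec w (WhileLess a b c) (s, m) st2 (t0 + t1 + t2) (depth_cost t0 + d1 + d2) (R1 \<union> R2) (U1 \<union> U2)"
| exec_ParFor:
    "\<lbrakk> y = operand_val s a; N = nat y;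
       \<forall>i<N. exec w c (s(x := int i), m) (sb i, mb i) (tb i) (db i) (Rb i) (Ub i);
       \<forall>i<N. \<forall>j<N. i \<noteq> j \<longrightarrow> Ub i \<inter> (Rb j \<union> Ub j) = {};
       \<forall>k. (\<forall>i<N. k \<in> Ub i \<longrightarrow> m' k = mb i k) \<and> ((\<forall>i<N. k \<notin> Ub i) \<longrightarrow> m' k = m k);
       t0 = op_cost w [y] \<rbrakk>
     \<Longrightarrow> exec w (ParFor x a c) (s, m) (s, m')
           (t0 + (\<Sum>i<N. num_words w (int i) + tb i))
           (depth_cost t0 + depth_cost N + Max (insert 0 (db ` {..<N})))
           (\<Union>i<N. Rb i) (\<Union>i<N. Ub i)"


section \<open>Encoding of instances and results\<close>

text \<open>Nonnegative rationals are stored as a numerator and a denominator, infinity as a zero denominator.\<close>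

definition cell_value :: "(cell \<Rightarrow> int) \<Rightarrow> string \<Rightarrow> string \<Rightarrow> int \<Rightarrow> ereal" where
  "cell_value m num den k =
     (if m (den, k) = 0 then \<infinity> else ereal (real_of_int (m (num, k)) / real_of_int (m (den, k))))"

definition stores_graph ::
  "nat \<Rightarrow> (cell \<Rightarrow> int) \<Rightarrow> string \<Rightarrow> string \<Rightarrow> nat \<Rightarrow> nat rel \<Rightarrow> (nat \<times> nat) weight_fun \<Rightarrow> bool" where
  "stores_graph w m num den n E wt \<longleftrightarrow>
     (\<forall>u<n. \<forall>v<n. let k = int (u * n + v) in
        cell_value m num den k = (if (u, v) \<in> E then ereal (wt (u, v)) else \<infinity>) \<and>
        0 \<le> m (num, k) \<and> m (num, k) < 2 ^ w \<and> 0 \<le> m (den, k) \<and> m (den, k) < 2 ^ w)"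

text \<open>
  Vertices are \<open>0, \<dots>, n - 1\<close>, and each input number other than the accuracy parameter
  \<open>\<lceil>1 / \<epsilon>\<rceil>\<close> fits in a machine word. Unlisted cells and scalars are arbitrary.
\<close>

definition stores_instance ::
  "nat \<Rightarrow> nat \<Rightarrow> nat rel \<Rightarrow> (nat \<times> nat) weight_fun \<Rightarrow> nat rel \<Rightarrow> (nat \<times> nat) weight_fun \<Rightarrow>
   nat set \<Rightarrow> nat \<Rightarrow> real \<Rightarrow> state \<Rightarrow> bool" where
  "stores_instance w n E wE H wH S \<beta> \<epsilon> st \<longleftrightarrow>
     int n < 2 ^ w \<and> int \<beta> < 2 ^ w \<and>
     fst st ''n'' = int n \<and> fst st ''s'' = int (card S) \<and>
     fst st ''hops'' = int \<beta> \<and> fst st ''accuracy'' = \<lceil>1 / \<epsilon>\<rceil> \<and>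
     bij_betw (\<lambda>i. snd st (''source'', int i)) {..<card S} (int ` S) \<and>
     stores_graph w (snd st) ''G_num'' ''G_den'' n E wE \<and>
     stores_graph w (snd st) ''H_num'' ''H_den'' n H wH"

text \<open>Row \<open>i\<close> of the output belongs to the \<open>i\<close>-th source as enumerated in the input.\<close>

definition outputs :: "nat \<Rightarrow> nat set \<Rightarrow> state \<Rightarrow> state \<Rightarrow> (nat \<Rightarrow> nat \<Rightarrow> ereal) \<Rightarrow> bool" where
  "outputs n S st st' X \<longleftrightarrow>
     (\<forall>i<card S. \<forall>v<n.
        cell_value (snd st') ''D_num'' ''D_den'' (int (i * n + v)) =
          X (nat (snd st (''source'', int i))) v)"

definition vgraph :: "nat \<Rightarrow> nat rel \<Rightarrow> (nat, nat \<times> nat) pre_digraph" where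
  "vgraph n E = with_proj \<lparr> pverts = {..<n}, parcs = E \<rparr>"

end

theory Submission
  imports Defs "HOL-Computational_Algebra.Polynomial"
begin

text \<open>
  A product of rows with the matrix of \<open>G \<union> H\<close> prolongs walks by one edge, so \<open>\<beta> - 1\<close> approximate products
  yield the \<open>\<beta>\<close>-hop distances up to a factor \<open>(1 + \<xi>) ^ (\<beta> - 1) = 1 + O(\<epsilon>)\<close>.

  The program rounds all weights up to multiples of a unit so small that \<open>\<beta>\<close> units are at most \<open>\<epsilon>\<close> times
  the least positive weight of \<open>G\<close>, and drops weights too large to matter; the remaining integers have
  \<open>O(log W + log n + log (1 / \<epsilon>))\<close> bits. For each binary scale \<open>j\<close>, the entries are divided by \<open>2 ^ j\<close>, rounded up,
  cut off at \<open>M = O((1 / \<epsilon>) log n)\<close>, and \<open>x\<close> is encoded as \<open>2 ^ (L (M - x))\<close>: in an ordinary matrix product of encodings,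
  the leading digit in base \<open>2 ^ L\<close> shows the minimum of the sums. The least value over all scales is accurate up to
  the factor \<open>1 + 4 / M\<close>.

  Ordinary products come from one straight-line program, for a single fixed size whose length nearly attains the exponent:
  its bilinear part is an identity over the integers up to a common denominator, which is applied recursively.
\<close>

section \<open>Expressions compiled to machine commands\<close>

text \<open>The exponent is an infimum over families with a different straight-line program for
  every size, whereas one machine program must serve all inputs. For a single size \<open>q\<close>
  so large that the constant factor of the family is at most a small power of \<open>q\<close>,
  recursion on that one program is nearly as good as the whole family. Recursion replaces entries by
  matrices, which do not commute, so a program that multiplies arbitrary intermediate values has to
  be reduced to its bilinear part first. The machine only knows integers, hence the common
  denominator, whose power \<open>D ^ kk\<close> is divided out at the end.

  The factor \<open>1 / \<epsilon>\<close> of the work comes from the length of the encoded numbers,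
  about \<open>M * log n\<close> bits, which are paid for in words; the factor \<open>log W\<close>
  comes from the number of scales.

  Rounding of the weights can be charged to the error of a product. With one hop there is no
  product, and the result has to consist of exact entries; this case is treated separately and
  outputs the stored fractions themselves.\<close>

datatype expr =
    ELit int
  | EVar string
  | EBin binop expr expr
  | EBits expr
  | ELoad string expr
  | EIf expr expr expr expr

fun ev :: "expr => scalars => (cell => int) => int" where
  "ev (ELit z) s m = z"
| "ev (EVar x) s m = s x"
| "ev (EBin f a b) s m = binop_val f (ev a s m) (ev b s m)"
| "ev (EBits a) s m = int (bit_length (ev a s m))"
| "ev (ELoad A a) s m = m (A, ev a s m)"
| "ev (EIf a b c d) s m = (if ev a s m < ev b s m then ev c s m else ev d s m)"

text \<open>Only leaves, loaded cells and shift amounts are constrained, and of the two branches of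
  a conditional only the one taken. The size of intermediate results then follows from the shape of
  the expression (\<open>ev_bound\<close>), so that no proof about the program has to bound them one
  by one.\<close>

fun esafe :: "nat => expr => scalars => (cell => int) => bool" where
  "esafe B (ELit z) s m \<longleftrightarrow> \<bar>z\<bar> < 2 ^ B"
| "esafe B (EVar x) s m \<longleftrightarrow> \<bar>s x\<bar> < 2 ^ B"
| "esafe B (EBin f a b) s m \<longleftrightarrow> esafe B a s m \<and> esafe B b s m \<and> (f = Shift \<longrightarrow> ev b s m \<le> int B)"
| "esafe B (EBits a) s m \<longleftrightarrow> esafe B a s m"
| "esafe B (ELoad A a) s m \<longleftrightarrow> esafe B a s m \<and> \<bar>m (A, ev a s m)\<bar> < 2 ^ B"
| "esafe B (EIf a b c d) s m \<longleftrightarrow> esafe B a s m \<and> esafe B b s m \<and>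
     (if ev a s m < ev b s m then esafe B c s m else esafe B d s m)"

text \<open>Measures the bits of a value in units of \<open>B\<close>. The extra 1 at a node pays
  for the carry of a sum or for a left shift by up to \<open>B\<close> positions.\<close>

fun esz :: "expr => nat" where
  "esz (ELit z) = 1"
| "esz (EVar x) = 1"
| "esz (EBin f a b) = esz a + esz b + 1"
| "esz (EBits a) = esz a + 1"
| "esz (ELoad A a) = esz a + 1"
| "esz (EIf a b c d) = esz a + esz b + esz c + esz d + 1"

text \<open>With \<open>L = esz e\<close>, an operand or a result fills at most
  \<open>2 * L * u\<close> words, where \<open>u\<close> belongs to \<open>B\<close> bits. An
  operation with two operands and a result thus has work at most \<open>6 * L * u\<close>, and
  \<open>depth_cost_le\<close> turns this into depth at most \<open>(6 * L + 1) * du\<close>; the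
  factor 7 covers both.\<close>

fun ecost :: "expr => nat" where
  "ecost (ELit z) = 7"
| "ecost (EVar x) = 7"
| "ecost (EBin f a b) = ecost a + ecost b + 7 * esz (EBin f a b)"
| "ecost (EBits a) = ecost a + 7 * esz (EBits a)"
| "ecost (ELoad A a) = ecost a + 7 * esz (ELoad A a)"
| "ecost (EIf a b c d) = ecost a + ecost b + ecost c + ecost d + 7 * esz (EIf a b c d)"

fun earr :: "expr => string set" where
  "earr (ELit z) = {}"
| "earr (EVar x) = {}"
| "earr (EBin f a b) = earr a \<union> earr b"
| "earr (EBits a) = earr a"
| "earr (ELoad A a) = insert A (earr a)"
| "earr (EIf a b c d) = earr a \<union> earr b \<union> earr c \<union> earr d"

definition temp :: "string => bool" where
  "temp x \<longleftrightarrow> x \<noteq> [] \<and> hd x = CHR ''_''"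

definition tmp :: "nat => string" where
  "tmp d = replicate (Suc d) CHR ''_''"

lemma temp_tmp [simp]: "temp (tmp d)"
  by (simp add: temp_def tmp_def)

lemma tmp_eq_iff [simp]: "tmp i = tmp j \<longleftrightarrow> i = j"
  by (metis tmp_def length_replicate nat.inject)

fun evok :: "expr => bool" where
  "evok (ELit z) \<longleftrightarrow> True"
| "evok (EVar x) \<longleftrightarrow> \<not> temp x"
| "evok (EBin f a b) \<longleftrightarrow> evok a \<and> evok b"
| "evok (EBits a) \<longleftrightarrow> evok a"
| "evok (ELoad A a) \<longleftrightarrow> evok a"
| "evok (EIf a b c d) \<longleftrightarrow> evok a \<and> evok b \<and> evok c \<and> evok d"

text \<open>\<open>d\<close> is the height of an evaluation stack: code at height \<open>d\<close>
  leaves its result in \<open>tmp d\<close> and touches no lower scratch scalar, so the second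
  operand is computed at \<open>Suc d\<close> while the first one waits in
  \<open>tmp d\<close>.\<close>

fun cmp :: "nat => expr => com" where
  "cmp d (ELit z) = Op (tmp d) Add (Lit z) (Lit 0)"
| "cmp d (EVar x) = Op (tmp d) Add (Var x) (Lit 0)"
| "cmp d (EBin f a b) =
     Seq (cmp d a) (Seq (cmp (Suc d) b) (Op (tmp d) f (Var (tmp d)) (Var (tmp (Suc d)))))"
| "cmp d (EBits a) = Seq (cmp d a) (BitLen (tmp d) (Var (tmp d)))"
| "cmp d (ELoad A a) = Seq (cmp d a) (Load (tmp d) A (Var (tmp d)))"
| "cmp d (EIf a b c e) =
     Seq (cmp d a) (Seq (cmp (Suc d) b)
       (IfLess (Var (tmp d)) (Var (tmp (Suc d))) (cmp d c) (cmp d e)))"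

lemma esz_pos [simp]: "0 < esz e" "Suc 0 \<le> esz e"
  by (induction e) auto

lemma esz1: "1 \<le> esz e"
  using esz_pos(2) by simp

lemma ecost_ge: "7 * esz e \<le> ecost e"
  by (induction e) auto

definition agree :: "scalars => scalars => bool" where
  "agree s s' \<longleftrightarrow> (\<forall>x. \<not> temp x \<longrightarrow> s x = s' x)"

lemma ev_agree: "evok e ==> agree s s' ==> ev e s m = ev e s' m"
  by (induction e) (auto simp: agree_def)

lemma esafe_agree: "evok e ==> agree s s' ==> esafe B e s m = esafe B e s' m"
proof -
  assume "evok e" and ag: "agree s s'"
  note eq = ev_agree[OF _ ag, of _ m]
  show ?thesis using \<open>evok e\<close>
    by (induction e) (use ag in \<open>auto simp: eq agree_def\<close>)
qed

lemma abs_div_le: "\<bar>y div z\<bar> \<le> \<bar>y :: int\<bar>"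
proof (cases "z = 0")
  case False
  show ?thesis
  proof (cases "y \<ge> 0")
    case True
    show ?thesis
    proof (cases "z > 0")
      case True
      then have "y div z \<le> y" using \<open>y \<ge> 0\<close>
        by (metis div_by_1 int_one_le_iff_zero_less zdiv_mono2 zero_less_one)
      moreover have "0 \<le> y div z" using True \<open>y \<ge> 0\<close> by (simp add: pos_imp_zdiv_nonneg_iff)
      ultimately show ?thesis by simp
    next
      case neg: False
      then have "y div z = (- y) div (- z)" by simp
      moreover have "(- y) div (- z) \<ge> - y"
        using neg False \<open>y \<ge> 0\<close> by (smt (verit) div_by_1 zdiv_mono2_neg div_0)
      moreover have "(- y) div (- z) \<le> 0"
        using neg False \<open>y \<ge> 0\<close> by (smt (verit) div_nonpos_pos_le0)
      ultimately show ?thesis using \<open>y \<ge> 0\<close> by linarith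
    qed
  next
    case ny: False
    show ?thesis
    proof (cases "z > 0")
      case True
      then have "y div z \<ge> y" using ny by (smt (verit) div_by_1 zdiv_mono2_neg)
      moreover have "y div z \<le> 0" using True ny by (smt (verit) div_nonpos_pos_le0)
      ultimately show ?thesis using ny by linarith
    next
      case neg: False
      then have "y div z = (- y) div (- z)" by simp
      moreover have "(- y) div (- z) \<le> - y" using neg False ny
        by (smt (verit) div_by_1 zdiv_mono2)
      moreover have "(- y) div (- z) \<ge> 0" using neg False ny
        by (smt (verit) pos_imp_zdiv_nonneg_iff)
      ultimately show ?thesis using ny by linarith
    qed
  qed
qed simp

lemma bit_length_le: "\<bar>v\<bar> < 2 ^ L ==> bit_length v \<le> L"
  unfolding bit_length_def by (subst floorlog_le_iff) (auto simp: nat_less_iff)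

lemma pow_bound_mono: "(x::int) < 2 ^ k ==> k \<le> l ==> x < 2 ^ l"
  by (rule less_le_trans[OF _ power_increasing]) auto

lemma ev_bound:
  assumes "B \<ge> 1" "esafe B e s m"
  shows "\<bar>ev e s m\<bar> < 2 ^ (esz e * B)"
  using assms(2)
proof (induction e)
  case (EBin f a b)
  let ?x = "ev a s m" and ?y = "ev b s m"
  have a: "\<bar>?x\<bar> < 2 ^ (esz a * B)" and b: "\<bar>?y\<bar> < 2 ^ (esz b * B)" using EBin by auto
  let ?E = "(esz a + esz b + 1) * B"
  have E: "?E = esz a * B + esz b * B + B" by (simp add: algebra_simps)
  have a': "\<bar>?x\<bar> < 2 ^ (esz a * B + esz b * B)" "\<bar>?y\<bar> < 2 ^ (esz a * B + esz b * B)"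
    using a b by (auto elim: pow_bound_mono)
  have two: "2 * 2 ^ (esz a * B + esz b * B) \<le> (2::int) ^ ?E"
    using \<open>B \<ge> 1\<close> unfolding E power_add by (simp add: self_le_power)
  show ?case
  proof (cases f)
    case Add then show ?thesis using a' two by simp
  next
    case Sub then show ?thesis using a' two by simp
  next
    case Mul
    have "\<bar>?x * ?y\<bar> < 2 ^ (esz a * B) * 2 ^ (esz b * B)"
      unfolding abs_mult using a b by (intro mult_strict_mono) auto
    also have "\<dots> \<le> 2 ^ ?E" unfolding power_add[symmetric] E by (intro power_increasing) auto
    finally show ?thesis using Mul by simp
  next
    case Quot
    have "\<bar>?x div ?y\<bar> < 2 ^ (esz a * B)" using abs_div_le[of ?x ?y] a by linarith
    then have "\<bar>?x div ?y\<bar> < 2 ^ ?E" by (rule pow_bound_mono) (simp add: algebra_simps)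
    then show ?thesis using Quot by simp
  next
    case Shift
    show ?thesis
    proof (cases "0 \<le> ?y")
      case True
      have "\<bar>?x * 2 ^ nat ?y\<bar> < 2 ^ (esz a * B) * 2 ^ B"
        unfolding abs_mult using a EBin.prems Shift True
        by (intro mult_strict_mono' less_le_trans[OF a] mult_less_le_imp_less power_increasing) (auto simp: nat_le_iff)
      also have "\<dots> \<le> 2 ^ ?E" unfolding power_add[symmetric] E by (intro power_increasing) auto
      finally show ?thesis using Shift True by simp
    next
      case False
      have "\<bar>?x div 2 ^ nat (- ?y)\<bar> < 2 ^ (esz a * B)" using abs_div_le[of ?x "2 ^ nat (- ?y)"] a by linarith
      then have "\<bar>?x div 2 ^ nat (- ?y)\<bar> < 2 ^ ?E" by (rule pow_bound_mono) (simp add: algebra_simps)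
      then show ?thesis using Shift False by simp
    qed
  qed
next
  case (EBits a)
  then have "bit_length (ev a s m) \<le> esz a * B" by (intro bit_length_le) auto
  then have "int (bit_length (ev a s m)) < 2 ^ (esz a * B)"
    using less_exp[of "esz a * B"] by (metis le_less_trans of_nat_less_iff of_nat_numeral of_nat_power)
  then have "int (bit_length (ev a s m)) < 2 ^ ((esz a + 1) * B)" by (rule pow_bound_mono) simp
  then show ?case by simp
next
  case (ELoad A a)
  then have "\<bar>m (A, ev a s m)\<bar> < 2 ^ B" by simp
  then have "\<bar>m (A, ev a s m)\<bar> < 2 ^ ((esz a + 1) * B)" by (rule pow_bound_mono) simp
  then show ?case by simp
next
  case (EIf a b c d)
  show ?case
  proof (cases "ev a s m < ev b s m")
    case True
    then have "\<bar>ev c s m\<bar> < 2 ^ (esz c * B)" using EIf by simp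
    then have "\<bar>ev c s m\<bar> < 2 ^ (esz (EIf a b c d) * B)" by (rule pow_bound_mono) (intro mult_le_mono1, simp)
    then show ?thesis using True by simp
  next
    case False
    then have "\<bar>ev d s m\<bar> < 2 ^ (esz d * B)" using EIf by simp
    then have "\<bar>ev d s m\<bar> < 2 ^ (esz (EIf a b c d) * B)" by (rule pow_bound_mono) (intro mult_le_mono1, simp)
    then show ?thesis using False by simp
  qed
qed auto

section \<open>Words, costs and the execution of compiled expressions\<close>

lemma num_words_le:
  assumes "\<bar>v\<bar> < 2 ^ (L * B)" "1 \<le> L"
  shows "num_words w v \<le> 2 * L * (1 + B div w)"
proof -
  have "bit_length v div w \<le> (L * B) div w" using bit_length_le[OF assms(1)] by (rule div_le_mono)
  also have "(L * B) div w \<le> L * (B div w) + L"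
  proof (cases "w = 0")
    case False
    have "B < (B div w + 1) * w" using False
      by (metis div_less_iff_less_mult less_add_one neq0_conv)
    then have "L * B \<le> (L * (B div w + 1)) * w" by (metis less_imp_le mult.assoc mult_le_mono2)
    then have "(L * B) div w \<le> ((L * (B div w + 1)) * w) div w" by (rule div_le_mono)
    then show ?thesis using False by (simp add: algebra_simps)
  qed simp
  finally have "num_words w v \<le> 1 + (L * (B div w) + L)" unfolding num_words_def by simp
  also have "\<dots> \<le> 2 * L * (1 + B div w)" using assms(2) by (simp add: algebra_simps)
  finally show ?thesis .
qed

lemma floorlog_mult_le: "floorlog 2 (x * y) \<le> floorlog 2 x + floorlog 2 y"
proof -
  have "x < 2 ^ floorlog 2 x" "y < 2 ^ floorlog 2 y"
    using floorlog_le_iff[of 2 x "floorlog 2 x"] floorlog_le_iff[of 2 y "floorlog 2 y"] by auto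
  then have "x * y < 2 ^ floorlog 2 x * 2 ^ floorlog 2 y" by (intro mult_strict_mono) auto
  then show ?thesis by (subst floorlog_le_iff) (auto simp: power_add)
qed

lemma floorlog_le_self: "floorlog 2 x \<le> x"
  by (subst floorlog_le_iff) auto

lemma depth_cost_mono: "x \<le> y ==> depth_cost x \<le> depth_cost y"
  unfolding depth_cost_def by (simp add: floorlog_mono)

text \<open>The logarithm turns the factor \<open>c\<close> into a summand, and
  \<open>depth_cost u\<close> is at least 1. In this crude multiplicative form, work and depth are
  bounded by the same multiples of \<open>u\<close> and \<open>du\<close>.\<close>

lemma depth_cost_le:
  assumes "t \<le> c * u" shows "depth_cost t \<le> (c + 1) * depth_cost u"
proof -
  have "depth_cost t \<le> depth_cost (c * u)" by (rule depth_cost_mono[OF assms])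
  also have "\<dots> \<le> c + depth_cost u" unfolding depth_cost_def
    using floorlog_mult_le[of c u] floorlog_le_self[of c] by linarith
  also have "\<dots> \<le> (c + 1) * depth_cost u" by (auto simp: depth_cost_def)
  finally show ?thesis .
qed

text \<open>\<open>Nx < 2 ^ B\<close> makes every branch index of a parallel loop a safe
  integer.\<close>

locale mach =
  fixes w B G Nx :: nat
  assumes B1: "1 \<le> B" and Nx: "Nx < 2 ^ B"
begin

definition u where "u = 1 + B div w"
definition du where "du = depth_cost u"

lemma u1: "1 \<le> u" and du1: "1 \<le> du" by (auto simp: u_def du_def depth_cost_def)

lemma nwL: "\<bar>v\<bar> < 2 ^ (L * B) ==> L \<le> L' ==> 1 \<le> L ==> num_words w v \<le> 2 * L' * u"
  using num_words_le[of v L B w] unfolding u_def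
  by (meson le_trans mult_le_mono1 mult_le_mono2)

lemma nw0: "num_words w 0 \<le> 2 * L * u" if "1 \<le> L" for L
  using nwL[of 0 L L] that by simp

lemma nwE: "esafe B e s m ==> esz e \<le> L ==> num_words w (ev e s m) \<le> 2 * L * u"
  by (rule nwL[OF ev_bound[OF B1]]) auto

lemma depthL: "t \<le> 6 * L * u ==> 1 \<le> L ==> depth_cost t \<le> 7 * L * du"
  unfolding du_def
  by (rule order_trans[OF depth_cost_le]) (assumption, simp add: algebra_simps)

lemma op3:
  assumes "num_words w x \<le> 2 * L * u" "num_words w y \<le> 2 * L * u" "num_words w z \<le> 2 * L * u" "1 \<le> L"
  shows "op_cost w [x, y, z] \<le> 7 * L * u" "depth_cost (op_cost w [x, y, z]) \<le> 7 * L * du"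
    "op_cost w [x, y] \<le> 7 * L * u" "depth_cost (op_cost w [x, y]) \<le> 7 * L * du"
    "op_cost w [x] \<le> 7 * L * u" "depth_cost (op_cost w [x]) \<le> 7 * L * du"
proof -
  have 3: "op_cost w [x, y, z] \<le> 6 * L * u" "op_cost w [x, y] \<le> 6 * L * u" "op_cost w [x] \<le> 6 * L * u"
    using assms by (auto simp: op_cost_def)
  show "op_cost w [x, y, z] \<le> 7 * L * u" "op_cost w [x, y] \<le> 7 * L * u" "op_cost w [x] \<le> 7 * L * u"
    using 3 by (auto elim!: order_trans)
  show "depth_cost (op_cost w [x, y, z]) \<le> 7 * L * du" "depth_cost (op_cost w [x, y]) \<le> 7 * L * du"
    "depth_cost (op_cost w [x]) \<le> 7 * L * du"
    using depthL[OF 3(1) assms(4)] depthL[OF 3(2) assms(4)] depthL[OF 3(3) assms(4)] by auto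
qed

text \<open>The write set is empty and the reads stay within the arrays named in the expression.
  This excludes conflicts when the code becomes the body of a parallel loop that writes to another
  array.\<close>

lemma cmp_exec:
  assumes "evok e" "esafe B e s m"
  shows "\<exists>s' t d' R. exec w (cmp d e) (s, m) (s', m) t d' R {} \<and> s' (tmp d) = ev e s m \<and>
     (\<forall>x. (\<forall>j\<ge>d. x \<noteq> tmp j) \<longrightarrow> s' x = s x) \<and> t \<le> ecost e * u \<and> d' \<le> ecost e * du \<and> R \<subseteq> earr e \<times> UNIV"
  using assms
proof (induction e arbitrary: d s)
  case (ELit z)
  have "num_words w z \<le> 2 * 1 * u" "num_words w 0 \<le> 2 * 1 * u"
    using nwE[OF ELit(2), of 1] nw0[of 1] by auto
  note b = op3[OF this(1,2,1)]
  have "exec w (cmp d (ELit z)) (s, m) (s(tmp d := z), m) (op_cost w [z, 0, z]) (depth_cost (op_cost w [z, 0, z])) {} {}"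
    by (auto intro!: exec_Op[where y=z and z=0])
  then show ?case using b by fastforce
next
  case (EVar x)
  have "num_words w (s x) \<le> 2 * 1 * u" "num_words w 0 \<le> 2 * 1 * u"
    using nwE[OF EVar(2), of 1] nw0[of 1] by auto
  note b = op3[OF this(1,2,1)]
  have "exec w (cmp d (EVar x)) (s, m) (s(tmp d := s x), m) (op_cost w [s x, 0, s x]) (depth_cost (op_cost w [s x, 0, s x])) {} {}"
    by (auto intro!: exec_Op[where y="s x" and z=0])
  then show ?case using b by fastforce
next
  case (EBin f a b)
  obtain s1 t1 d1 R1 where 1: "exec w (cmp d a) (s, m) (s1, m) t1 d1 R1 {}" "s1 (tmp d) = ev a s m"
    "\<forall>x. (\<forall>j\<ge>d. x \<noteq> tmp j) \<longrightarrow> s1 x = s x" "t1 \<le> ecost a * u" "d1 \<le> ecost a * du" "R1 \<subseteq> earr a \<times> UNIV"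
    using EBin.IH(1)[of s d] EBin.prems by auto
  have ag: "agree s1 s" using 1(3) temp_tmp unfolding agree_def by metis
  have sb: "esafe B b s1 m" "ev b s1 m = ev b s m"
    using EBin.prems ev_agree[OF _ ag] esafe_agree[OF _ ag] by auto
  obtain s2 t2 d2 R2 where 2: "exec w (cmp (Suc d) b) (s1, m) (s2, m) t2 d2 R2 {}" "s2 (tmp (Suc d)) = ev b s1 m"
    "\<forall>x. (\<forall>j\<ge>Suc d. x \<noteq> tmp j) \<longrightarrow> s2 x = s1 x" "t2 \<le> ecost b * u" "d2 \<le> ecost b * du" "R2 \<subseteq> earr b \<times> UNIV"
    using EBin.IH(2)[of s1 "Suc d"] EBin.prems sb by auto
  have v: "s2 (tmp d) = ev a s m" "s2 (tmp (Suc d)) = ev b s m"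
    using 1 2 sb by auto
  let ?r = "ev (EBin f a b) s m" and ?t = "op_cost w [ev a s m, ev b s m, ev (EBin f a b) s m]"
  have ex: "exec w (Op (tmp d) f (Var (tmp d)) (Var (tmp (Suc d)))) (s2, m) (s2(tmp d := ?r), m) ?t (depth_cost ?t) {} {}"
    by (rule exec_Op) (auto simp: v)
  note full = exec_Seq[OF 1(1) exec_Seq[OF 2(1) ex]]
  have "num_words w (ev a s m) \<le> 2 * esz (EBin f a b) * u" "num_words w (ev b s m) \<le> 2 * esz (EBin f a b) * u"
    "num_words w ?r \<le> 2 * esz (EBin f a b) * u"
    using EBin.prems by (intro nwE; simp del: ev.simps)+
  note b = op3(1,2)[OF this esz1]
  show ?case
    apply (rule exI, rule exI, rule exI, rule exI, rule conjI, simp only: cmp.simps, rule full[simplified])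
    using 1 2 b by (auto simp: algebra_simps)
next
  case (EBits a)
  obtain s1 t1 d1 R1 where 1: "exec w (cmp d a) (s, m) (s1, m) t1 d1 R1 {}" "s1 (tmp d) = ev a s m"
    "\<forall>x. (\<forall>j\<ge>d. x \<noteq> tmp j) \<longrightarrow> s1 x = s x" "t1 \<le> ecost a * u" "d1 \<le> ecost a * du" "R1 \<subseteq> earr a \<times> UNIV"
    using EBits.IH[of s d] EBits.prems by auto
  let ?r = "ev (EBits a) s m" and ?t = "op_cost w [ev a s m, ev (EBits a) s m]"
  have ex: "exec w (BitLen (tmp d) (Var (tmp d))) (s1, m) (s1(tmp d := ?r), m) ?t (depth_cost ?t) {} {}"
    by (rule exec_BitLen) (auto simp: 1)
  note full = exec_Seq[OF 1(1) ex]
  have "num_words w (ev a s m) \<le> 2 * esz (EBits a) * u" "num_words w ?r \<le> 2 * esz (EBits a) * u"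
    using EBits.prems by (intro nwE; simp del: ev.simps)+
  note b = op3(3,4)[OF this this(1) esz1]
  show ?case
    apply (rule exI, rule exI, rule exI, rule exI, rule conjI, simp only: cmp.simps, rule full[simplified])
    using 1 b by (auto simp: algebra_simps)
next
  case (ELoad A a)
  obtain s1 t1 d1 R1 where 1: "exec w (cmp d a) (s, m) (s1, m) t1 d1 R1 {}" "s1 (tmp d) = ev a s m"
    "\<forall>x. (\<forall>j\<ge>d. x \<noteq> tmp j) \<longrightarrow> s1 x = s x" "t1 \<le> ecost a * u" "d1 \<le> ecost a * du" "R1 \<subseteq> earr a \<times> UNIV"
    using ELoad.IH[of s d] ELoad.prems by auto
  let ?r = "ev (ELoad A a) s m" and ?t = "op_cost w [ev a s m, ev (ELoad A a) s m]"
  have ex: "exec w (Load (tmp d) A (Var (tmp d))) (s1, m) (s1(tmp d := ?r), m) ?t (depth_cost ?t) {(A, ev a s m)} {}"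
    by (rule exec_Load) (auto simp: 1)
  note full = exec_Seq[OF 1(1) ex]
  have "num_words w (ev a s m) \<le> 2 * esz (ELoad A a) * u" "num_words w ?r \<le> 2 * esz (ELoad A a) * u"
    using ELoad.prems by (intro nwE; simp del: ev.simps)+
  note b = op3(3,4)[OF this this(1) esz1]
  show ?case
    apply (rule exI, rule exI, rule exI, rule exI, rule conjI, simp only: cmp.simps, rule full[simplified])
    using 1 b by (auto simp: algebra_simps)
next
  case (EIf a b c e)
  obtain s1 t1 d1 R1 where 1: "exec w (cmp d a) (s, m) (s1, m) t1 d1 R1 {}" "s1 (tmp d) = ev a s m"
    "\<forall>x. (\<forall>j\<ge>d. x \<noteq> tmp j) \<longrightarrow> s1 x = s x" "t1 \<le> ecost a * u" "d1 \<le> ecost a * du" "R1 \<subseteq> earr a \<times> UNIV"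
    using EIf.IH(1)[of s d] EIf.prems by auto
  have ag: "agree s1 s" using 1(3) temp_tmp unfolding agree_def by metis
  have sb: "esafe B b s1 m" "ev b s1 m = ev b s m"
    using EIf.prems ev_agree[OF _ ag] esafe_agree[OF _ ag] by auto
  obtain s2 t2 d2 R2 where 2: "exec w (cmp (Suc d) b) (s1, m) (s2, m) t2 d2 R2 {}" "s2 (tmp (Suc d)) = ev b s1 m"
    "\<forall>x. (\<forall>j\<ge>Suc d. x \<noteq> tmp j) \<longrightarrow> s2 x = s1 x" "t2 \<le> ecost b * u" "d2 \<le> ecost b * du" "R2 \<subseteq> earr b \<times> UNIV"
    using EIf.IH(2)[of s1 "Suc d"] EIf.prems sb by auto
  have v: "s2 (tmp d) = ev a s m" "s2 (tmp (Suc d)) = ev b s m"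
    using 1 2 sb by auto
  have ag2: "agree s2 s" using 1(3) 2(3) temp_tmp unfolding agree_def by metis
  let ?t = "op_cost w [ev a s m, ev b s m]"
  \<comment> \<open>Both branches are treated at once; the conditional is charged with the cost of
    both, so that the bound does not depend on the outcome of the test.\<close>
  define c' where "c' = (if ev a s m < ev b s m then c else e)"
  have c': "esafe B c' s2 m" "ev c' s2 m = ev (EIf a b c e) s m" "evok c'"
    using EIf.prems ev_agree[OF _ ag2] esafe_agree[OF _ ag2] by (auto simp: c'_def)
  have "\<exists>s' t d' R. exec w (cmp d c') (s2, m) (s', m) t d' R {} \<and> s' (tmp d) = ev c' s2 m \<and>
     (\<forall>x. (\<forall>j\<ge>d. x \<noteq> tmp j) \<longrightarrow> s' x = s2 x) \<and> t \<le> ecost c' * u \<and> d' \<le> ecost c' * du \<and> R \<subseteq> earr c' \<times> UNIV"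
    using EIf.IH(3)[of s2 d] EIf.IH(4)[of s2 d] c' unfolding c'_def by (auto split: if_splits)
  then obtain s3 t3 d3 R3 where 3: "exec w (cmp d c') (s2, m) (s3, m) t3 d3 R3 {}" "s3 (tmp d) = ev c' s2 m"
    "\<forall>x. (\<forall>j\<ge>d. x \<noteq> tmp j) \<longrightarrow> s3 x = s2 x" "t3 \<le> ecost c' * u" "d3 \<le> ecost c' * du" "R3 \<subseteq> earr c' \<times> UNIV"
    by blast
  have ex: "exec w (IfLess (Var (tmp d)) (Var (tmp (Suc d))) (cmp d c) (cmp d e)) (s2, m) (s3, m)
      (?t + t3) (depth_cost ?t + d3) R3 {}"
    by (rule exec_IfLess) (use 3 in \<open>auto simp: v c'_def\<close>)
  note full = exec_Seq[OF 1(1) exec_Seq[OF 2(1) ex]]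
  have "num_words w (ev a s m) \<le> 2 * esz (EIf a b c e) * u" "num_words w (ev b s m) \<le> 2 * esz (EIf a b c e) * u"
    using EIf.prems by (intro nwE; simp del: ev.simps)+
  note b = op3(3,4)[OF this this(1) esz1]
  have cc: "ecost c' \<le> ecost c + ecost e" "earr c' \<subseteq> earr c \<union> earr e" by (auto simp: c'_def)
  have t3: "t3 \<le> (ecost c + ecost e) * u" "d3 \<le> (ecost c + ecost e) * du"
    using 3(4,5) cc(1) by (meson le_trans mult_le_mono1)+
  show ?case
    apply (rule exI, rule exI, rule exI, rule exI, rule conjI, simp only: cmp.simps, rule full[simplified])
    using 1 2 3 c' b t3 cc(2) by (auto simp: algebra_simps)
qed

text \<open>Names starting with an underscore are scratch scalars of compiled expressions, invisible to assertions.\<close>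

definition clean :: "scalars => scalars" where
  "clean s = (\<lambda>x. if temp x then 0 else s x)"

text \<open>Work and depth are counted in units of one parallel loop with at most \<open>Nx\<close> branches, whose bodies are compiled
  expressions of cost at most \<open>G\<close> on integers of at most \<open>B\<close> bits.\<close>

definition Tu where "Tu = G * (Nx + 2) * u"
definition Du where "Du = G * du + depth_cost Nx"

text \<open>A weakest precondition for total correctness, with a budget of \<open>k\<close> units
  for work and for depth alike. It covers all values of the scratch scalars and forgets the read and
  write sets: parallel loops are never nested, so conflicts have to be excluded in
  \<open>wpc_pmap\<close> only.\<close>

definition wpc :: "com => (scalars => (cell => int) => bool) => nat => scalars => (cell => int) => bool" where
  "wpc c Q k s m \<longleftrightarrow> (\<forall>s1. clean s1 = s \<longrightarrow>
     (\<exists>s' m' t d R U. exec w c (s1, m) (s', m') t d R U \<and> Q (clean s') m' \<and> t \<le> k * Tu \<and> d \<le> k * Du))"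

text \<open>The factor 20 leaves room for what surrounds an expression: the final store or move, the
  spawning of branches, tests and counters of loops. It also forces \<open>G\<close> to be at least
  20, so that one unit pays for a bare comparison or increment.\<close>

definition gok :: "expr => bool" where
  "gok e \<longleftrightarrow> evok e \<and> 20 * (ecost e + 1) \<le> G"

lemma agree_clean: "agree s (clean s)"
  by (simp add: agree_def clean_def)

lemma clean_upd [simp]: "\<not> temp x ==> clean (s(x := v)) = (clean s)(x := v)"
  by (auto simp: clean_def)

lemma clean_upd_temp [simp]: "temp x ==> clean (s(x := v)) = clean s"
  by (auto simp: clean_def)

lemma clean_eqI: "(\<And>x. (\<forall>j\<ge>d. x \<noteq> tmp j) ==> s' x = s x) ==> clean s' = clean s"
proof -
  assume a: "\<And>x. (\<forall>j\<ge>d. x \<noteq> tmp j) ==> s' x = s x"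
  have "s' x = s x" if "\<not> temp x" for x by (rule a) (use that in auto)
  then show ?thesis by (auto simp: clean_def)
qed

lemma cmp_exec_clean:
  assumes "evok e" "esafe B e (clean s) m"
  obtains s' t d' R where "exec w (cmp d e) (s, m) (s', m) t d' R {}" "s' (tmp d) = ev e (clean s) m"
     "clean s' = clean s" "t \<le> ecost e * u" "d' \<le> ecost e * du" "R \<subseteq> earr e \<times> UNIV"
proof -
  have "esafe B e s m" "ev e s m = ev e (clean s) m"
    using assms esafe_agree[OF assms(1) agree_clean] ev_agree[OF assms(1) agree_clean] by auto
  with cmp_exec[OF assms(1), of s m d] obtain s' t d' R where
    *: "exec w (cmp d e) (s, m) (s', m) t d' R {}" "s' (tmp d) = ev e (clean s) m"
     "\<forall>x. (\<forall>j\<ge>d. x \<noteq> tmp j) \<longrightarrow> s' x = s x" "t \<le> ecost e * u" "d' \<le> ecost e * du" "R \<subseteq> earr e \<times> UNIV"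
    by auto
  then have "clean s' = clean s" by (intro clean_eqI) blast
  with * that show ?thesis by blast
qed

lemma TuI: "20 * (c + 1) \<le> G ==> t \<le> 20 * (c + 1) * u ==> t \<le> Tu"
proof -
  assume a: "20 * (c + 1) \<le> G" "t \<le> 20 * (c + 1) * u"
  have "20 * (c + 1) * u \<le> G * u" using a(1) by (rule mult_le_mono1)
  also have "\<dots> \<le> G * (Nx + 2) * u" by (intro mult_le_mono1) simp
  finally show ?thesis using a unfolding Tu_def by linarith
qed

lemma DuI: "20 * (c + 1) \<le> G ==> t \<le> 20 * (c + 1) * du + depth_cost Nx ==> t \<le> Du"
proof -
  assume a: "20 * (c + 1) \<le> G" "t \<le> 20 * (c + 1) * du + depth_cost Nx"
  have "20 * (c + 1) * du \<le> G * du" using a(1) by (rule mult_le_mono1)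
  then show ?thesis using a unfolding Du_def by linarith
qed

lemma wpc_mono:
  assumes "wpc c Q k s m" "k \<le> k'" "\<And>s m. Q s m ==> Q' s m"
  shows "wpc c Q' k' s m"
  unfolding wpc_def
proof (intro allI impI)
  fix s1 assume "clean s1 = s"
  with assms(1) obtain s' m' t d R U where
    1: "exec w c (s1, m) (s', m') t d R U" "Q (clean s') m'" "t \<le> k * Tu" "d \<le> k * Du"
    unfolding wpc_def by metis
  have "k * Tu \<le> k' * Tu" "k * Du \<le> k' * Du" using assms(2) by (auto intro: mult_le_mono1)
  then show "\<exists>s' m' t d R U. exec w c (s1, m) (s', m') t d R U \<and> Q' (clean s') m' \<and> t \<le> k' * Tu \<and> d \<le> k' * Du"
    using 1 assms(3) by (intro exI conjI) (assumption, auto intro: order_trans)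
qed

lemma wpc_seq:
  assumes "wpc c1 (\<lambda>s m. wpc c2 Q k2 s m) k1 s m"
  shows "wpc (Seq c1 c2) Q (k1 + k2) s m"
  unfolding wpc_def
proof (intro allI impI)
  fix s1 assume s1: "clean s1 = s"
  from assms s1 obtain s2 m2 t1 d1 R1 U1 where
    1: "exec w c1 (s1, m) (s2, m2) t1 d1 R1 U1" "wpc c2 Q k2 (clean s2) m2" "t1 \<le> k1 * Tu" "d1 \<le> k1 * Du"
    unfolding wpc_def by metis
  then obtain s3 m3 t2 d2 R2 U2 where
    2: "exec w c2 (s2, m2) (s3, m3) t2 d2 R2 U2" "Q (clean s3) m3" "t2 \<le> k2 * Tu" "d2 \<le> k2 * Du"
    unfolding wpc_def by metis
  from exec_Seq[OF 1(1) 2(1)] 1 2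
  show "\<exists>s' m' t d R U. exec w (Seq c1 c2) (s1, m) (s', m') t d R U \<and> Q (clean s') m' \<and>
     t \<le> (k1 + k2) * Tu \<and> d \<le> (k1 + k2) * Du"
    by (intro exI conjI) (assumption, auto simp: algebra_simps)
qed

end

section \<open>Proof rules for assignments, parallel maps and loops\<close>

definition Assign :: "string => expr => com" where
  "Assign x e = Seq (cmp 0 e) (Op x Add (Var (tmp 0)) (Lit 0))"

text \<open>The only form of parallel loop in the program: branch \<open>i\<close> stores one value
  in cell \<open>i\<close> of \<open>A\<close>. As a branch may not read what another branch writes,
  \<open>A\<close> must not occur in \<open>e\<close>; an update of an array in place therefore
  takes two passes through a second array such as \<open>T2\<close>, \<open>X2\<close> or
  \<open>Y2\<close>.\<close>

definition PMap :: "string => expr => expr => com" where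
  "PMap A N e = Seq (cmp 0 N) (ParFor ''i'' (Var (tmp 0)) (Seq (cmp 0 e) (Store A (Var ''i'') (Var (tmp 0)))))"

definition For :: "string => string => com => com" where
  "For x y c = Seq (Op x Add (Lit 0) (Lit 0))
     (WhileLess (Var x) (Var y) (Seq c (Op x Add (Var x) (Lit 1))))"

definition pm :: "string => int => (int => int) => (cell => int) => cell => int" where
  "pm A n f m = (\<lambda>(A', i). if A' = A \<and> 0 \<le> i \<and> i < n then f i else m (A', i))"

lemma pm_same: "0 \<le> i ==> i < n ==> pm A n f m (A, i) = f i"
  by (simp add: pm_def)

lemma pm_other [simp]: "A' \<noteq> A ==> pm A n f m (A', i) = m (A', i)"
  by (simp add: pm_def)

context mach begin

lemma wpc_assign:
  assumes "gok e" "\<not> temp x" "esafe B e s m" "Q (s(x := ev e s m)) m"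
  shows "wpc (Assign x e) Q 1 s m"
  unfolding wpc_def
proof (intro allI impI)
  fix s1 assume s1: "clean s1 = s"
  have evok: "evok e" and g: "20 * (ecost e + 1) \<le> G" using assms by (auto simp: gok_def)
  from cmp_exec_clean[OF evok, of s1 m 0] assms s1 obtain s' t d' R where
    1: "exec w (cmp 0 e) (s1, m) (s', m) t d' R {}" "s' (tmp 0) = ev e s m"
     "clean s' = s" "t \<le> ecost e * u" "d' \<le> ecost e * du" by metis
  let ?v = "ev e s m"
  let ?t = "op_cost w [?v, 0, ?v]"
  have ex: "exec w (Op x Add (Var (tmp 0)) (Lit 0)) (s', m) (s'(x := ?v), m) ?t (depth_cost ?t) {} {}"
    by (rule exec_Op) (auto simp: 1)
  have "num_words w ?v \<le> 2 * esz e * u" "num_words w 0 \<le> 2 * esz e * u"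
    using assms by (auto intro!: nwE nw0)
  note b = op3(1,2)[OF this(1,2,1) esz1]
  have bt: "?t \<le> ecost e * u" "depth_cost ?t \<le> ecost e * du"
    using b ecost_ge[of e] by (meson le_trans mult_le_mono1)+
  have "t + ?t \<le> Tu" using 1 bt u1 by (intro TuI[OF g]) (auto simp: algebra_simps)
  moreover have "d' + depth_cost ?t \<le> Du" using 1 bt by (intro DuI[OF g]) (auto simp: algebra_simps)
  ultimately show "\<exists>s' m' t d R U. exec w (Assign x e) (s1, m) (s', m') t d R U \<and> Q (clean s') m' \<and>
     t \<le> 1 * Tu \<and> d \<le> 1 * Du"
    unfolding Assign_def using exec_Seq[OF 1(1) ex] assms 1 by (intro exI conjI) (assumption, auto)
qed

lemma wpc_pmap:
  assumes N: "gok N" "esafe B N s m" "nat (ev N s m) \<le> Nx"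
    and e: "gok e" "A \<notin> earr e"
    and safe: "\<And>i. 0 \<le> i ==> i < ev N s m ==> esafe B e (s(''i'' := i)) m"
    and Q: "Q s (pm A (ev N s m) (\<lambda>i. ev e (s(''i'' := i)) m) m)"
  shows "wpc (PMap A N e) Q 1 s m"
  unfolding wpc_def
proof (intro allI impI)
  fix s1 assume s1: "clean s1 = s"
  have evok: "evok e" "evok N" and g: "20 * (ecost e + 1) \<le> G" "20 * (ecost N + 1) \<le> G"
    using assms by (auto simp: gok_def)
  have i: "\<not> temp ''i''" by (simp add: temp_def)
  from cmp_exec_clean[OF evok(2), of s1 m 0] assms s1 obtain s2 t0 d0 R0 where
    0: "exec w (cmp 0 N) (s1, m) (s2, m) t0 d0 R0 {}" "s2 (tmp 0) = ev N s m"
     "clean s2 = s" "t0 \<le> ecost N * u" "d0 \<le> ecost N * du" by metis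
  define n where "n = nat (ev N s m)"
  have nB: "n < 2 ^ B" using N(3) Nx unfolding n_def by (rule le_less_trans)
  let ?v = "\<lambda>i. ev e (s(''i'' := int i)) m"
  define Pr where "Pr i = (\<lambda>(s', t, d, R). exec w (cmp 0 e) (s2(''i'' := int i), m) (s', m) t d R {} \<and>
      s' (tmp 0) = ?v i \<and> clean s' = s(''i'' := int i) \<and> t \<le> ecost e * u \<and> d \<le> ecost e * du \<and> R \<subseteq> earr e \<times> UNIV)" for i
  have "\<forall>i. \<exists>x. i < n \<longrightarrow> Pr i x"
  proof
    fix i
    show "\<exists>x. i < n \<longrightarrow> Pr i x"
    proof (cases "i < n")
      case True
      have c: "clean (s2(''i'' := int i)) = s(''i'' := int i)" using 0 i by simp
      have sf: "esafe B e (clean (s2(''i'' := int i))) m" unfolding c using True by (intro safe) (auto simp: n_def)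
      obtain s' t d' R where "exec w (cmp 0 e) (s2(''i'' := int i), m) (s', m) t d' R {}" "s' (tmp 0) = ?v i"
        "clean s' = s(''i'' := int i)" "t \<le> ecost e * u" "d' \<le> ecost e * du" "R \<subseteq> earr e \<times> UNIV"
        by (rule cmp_exec_clean[OF evok(1) sf, of 0]) (unfold c, blast)
      then have "Pr i (s', t, d', R)" by (simp add: Pr_def)
      then show ?thesis by blast
    qed simp
  qed
  from choice[OF this] obtain X where X: "\<And>i. i < n ==> Pr i (X i)" by blast
  define sb tb db Rb where "sb i = fst (X i)" and "tb i = fst (snd (X i))" and "db i = fst (snd (snd (X i)))"
    and "Rb i = snd (snd (snd (X i)))" for i
  have b: "\<And>i. i < n ==> exec w (cmp 0 e) (s2(''i'' := int i), m) (sb i, m) (tb i) (db i) (Rb i) {}"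
    "\<And>i. i < n ==> sb i (tmp 0) = ?v i" "\<And>i. i < n ==> clean (sb i) = s(''i'' := int i)"
    "\<And>i. i < n ==> tb i \<le> ecost e * u" "\<And>i. i < n ==> db i \<le> ecost e * du" "\<And>i. i < n ==> Rb i \<subseteq> earr e \<times> UNIV"
    using X unfolding Pr_def sb_def tb_def db_def Rb_def by (auto simp: split_beta)
  have bi: "sb i ''i'' = int i" if "i < n" for i
  proof -
    have "clean (sb i) ''i'' = int i" using b(3)[OF that] by simp
    then show ?thesis using i by (simp add: clean_def)
  qed
  let ?c = "\<lambda>i. op_cost w [int i, ?v i]"
  have st: "exec w (Store A (Var ''i'') (Var (tmp 0))) (sb i, m) (sb i, m((A, int i) := ?v i)) (?c i) (depth_cost (?c i)) {} {(A, int i)}"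
    if "i < n" for i
    by (rule exec_Store) (use b bi that in auto)
  define m' where "m' = pm A (ev N s m) (\<lambda>i. ev e (s(''i'' := i)) m) m"
  have nwi: "num_words w (int i) \<le> 2 * esz e * u" if "i < n" for i
  proof -
    have "int i < 2 ^ B" using that nB by (metis less_trans of_nat_less_numeral_power_cancel_iff)
    then show ?thesis using nwL[of "int i" 1 "esz e"] by simp
  qed
  have nwi2: "num_words w (int i) \<le> 2 * u" if "i < n" for i
  proof -
    have "int i < 2 ^ B" using that nB by (metis less_trans of_nat_less_numeral_power_cancel_iff)
    then show ?thesis using nwL[of "int i" 1 1] by simp
  qed
  have nwv: "num_words w (?v i) \<le> 2 * esz e * u" if "i < n" for i
    by (rule nwE) (use that safe in \<open>auto simp: n_def\<close>)
  have cst: "?c i \<le> ecost e * u" "depth_cost (?c i) \<le> ecost e * du" if "i < n" for i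
    using op3(3,4)[OF nwi[OF that] nwv[OF that] nwi[OF that] esz1] ecost_ge[of e]
    by (meson le_trans mult_le_mono1)+
  let ?t0 = "op_cost w [ev N s m]"
  let ?tb = "\<lambda>i. tb i + ?c i" and ?db = "\<lambda>i. db i + depth_cost (?c i)"
  let ?T = "?t0 + (\<Sum>i<n. num_words w (int i) + ?tb i)"
  let ?D = "depth_cost ?t0 + depth_cost n + Max (insert 0 (?db ` {..<n}))"
  have par: "exec w (ParFor ''i'' (Var (tmp 0)) (Seq (cmp 0 e) (Store A (Var ''i'') (Var (tmp 0)))))
      (s2, m) (s2, m') ?T ?D (\<Union>i<n. Rb i \<union> {}) (\<Union>i<n. {} \<union> {(A, int i)})"
  proof (rule exec_ParFor[where sb=sb and mb="\<lambda>i. m((A, int i) := ?v i)"])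
    show "\<forall>i<n. exec w (Seq (cmp 0 e) (Store A (Var ''i'') (Var (tmp 0)))) (s2(''i'' := int i), m)
           (sb i, m((A, int i) := ?v i)) (tb i + ?c i) (db i + depth_cost (?c i)) (Rb i \<union> {}) ({} \<union> {(A, int i)})"
      using exec_Seq[OF b(1) st] by blast
    show "\<forall>i<n. \<forall>j<n. i \<noteq> j \<longrightarrow> ({} \<union> {(A, int i)}) \<inter> (Rb j \<union> {} \<union> ({} \<union> {(A, int j)})) = {}"
      using b(6) e(2) by auto
    show "\<forall>k. (\<forall>i<n. k \<in> {} \<union> {(A, int i)} \<longrightarrow> m' k = (m((A, int i) := ?v i)) k) \<and>
        ((\<forall>i<n. k \<notin> {} \<union> {(A, int i)}) \<longrightarrow> m' k = m k)"
    proof (intro allI conjI impI, goal_cases)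
      case (1 k i)
      then show ?case by (auto simp: m'_def pm_def n_def)
    next
      case (2 k)
      show ?case
      proof (cases k)
        case (Pair A' i)
        show ?thesis
        proof (cases "A' = A \<and> 0 \<le> i \<and> i < ev N s m")
          case True
          then have "nat i < n" "k = (A, int (nat i))" using Pair by (auto simp: n_def)
          then show ?thesis using 2 by blast
        qed (auto simp: m'_def pm_def Pair)
      qed
    qed
  qed (use 0 in \<open>auto simp: n_def\<close>)
  have "num_words w (ev N s m) \<le> 2 * esz N * u" using N by (auto intro!: nwE)
  note bN = op3(5,6)[OF this this this esz1]
  have bt: "?t0 \<le> ecost N * u" "depth_cost ?t0 \<le> ecost N * du"
    using bN ecost_ge[of N] by (meson le_trans mult_le_mono1)+
  have nNx: "n \<le> Nx" using N by (simp add: n_def)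
  have "(\<Sum>i<n. num_words w (int i) + ?tb i) \<le> (\<Sum>i<n. (2 * ecost e + 2) * u)"
    using nwi2 b(4) cst(1) by (intro sum_mono) (force simp: algebra_simps)
  also have "\<dots> = n * ((2 * ecost e + 2) * u)" by simp
  also have "\<dots> \<le> Nx * ((2 * ecost e + 2) * u)" using nNx by (rule mult_le_mono1)
  also have "(2 * ecost e + 2) * u \<le> G * u" using g by (intro mult_le_mono1) simp
  finally have sm: "(\<Sum>i<n. num_words w (int i) + ?tb i) \<le> Nx * (G * u)" by simp
  have "2 * ecost N * u \<le> G * u" using g by (intro mult_le_mono1) simp
  moreover have "2 * ecost N * u = ecost N * u + ecost N * u" by simp
  moreover have "Tu = Nx * (G * u) + 2 * (G * u)" by (simp add: Tu_def algebra_simps)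
  ultimately have tot: "t0 + ?T \<le> Tu" using sm 0(4) bt(1) by linarith
  have "Max (insert 0 (?db ` {..<n})) \<le> 2 * ecost e * du"
  proof -
    have "?db i \<le> 2 * ecost e * du" if "i < n" for i
      using add_mono[OF b(5)[OF that] cst(2)[OF that]] by (simp add: algebra_simps)
    then show ?thesis by auto
  qed
  moreover have "depth_cost n \<le> depth_cost Nx" by (rule depth_cost_mono[OF nNx])
  moreover have "2 * ecost N * du + 2 * ecost e * du \<le> G * du"
    unfolding add_mult_distrib[symmetric] using g by (intro mult_le_mono1) simp
  moreover have "2 * ecost N * du = ecost N * du + ecost N * du" by simp
  ultimately have totd: "d0 + ?D \<le> Du" using 0(5) bt(2) unfolding Du_def by linarith
  show "\<exists>s' m' t d R U. exec w (PMap A N e) (s1, m) (s', m') t d R U \<and> Q (clean s') m' \<and>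
     t \<le> 1 * Tu \<and> d \<le> 1 * Du"
    unfolding PMap_def using exec_Seq[OF 0(1) par] Q 0 tot totd
    by (intro exI conjI) (assumption, auto simp: m'_def)
qed

lemma wpc_if:
  assumes "G \<ge> 20" "\<not> temp x" "\<not> temp y" "\<bar>s x\<bar> < 2 ^ B" "\<bar>s y\<bar> < 2 ^ B"
    and "s x < s y ==> wpc c1 Q k s m" "\<not> s x < s y ==> wpc c2 Q k s m"
  shows "wpc (IfLess (Var x) (Var y) c1 c2) Q (k + 1) s m"
  unfolding wpc_def
proof (intro allI impI)
  fix s1 assume s1: "clean s1 = s"
  have v: "s1 x = s x" "s1 y = s y" using s1 assms by (auto simp: clean_def)
  have "wpc (if s1 x < s1 y then c1 else c2) Q k s m" using assms v by auto
  then obtain s2 m2 t1 d1 R1 U1 where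
    1: "exec w (if s1 x < s1 y then c1 else c2) (s1, m) (s2, m2) t1 d1 R1 U1" "Q (clean s2) m2" "t1 \<le> k * Tu" "d1 \<le> k * Du"
    unfolding wpc_def using s1 by metis
  let ?t = "op_cost w [s x, s y]"
  have ex: "exec w (IfLess (Var x) (Var y) c1 c2) (s1, m) (s2, m2) (?t + t1) (depth_cost ?t + d1) R1 U1"
    by (rule exec_IfLess[OF refl refl]) (use 1 v in auto)
  have "num_words w (s x) \<le> 2 * 1 * u" "num_words w (s y) \<le> 2 * 1 * u"
    using assms by (auto intro!: nwL[of _ 1 1, simplified])
  note b = op3(3,4)[OF this this(1)]
  have "?t \<le> Tu" "depth_cost ?t \<le> Du"
    using b assms(1) TuI[of 0 ?t] DuI[of 0 "depth_cost ?t"] by auto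
  then show "\<exists>s' m' t d R U. exec w (IfLess (Var x) (Var y) c1 c2) (s1, m) (s', m') t d R U \<and> Q (clean s') m' \<and>
     t \<le> (k + 1) * Tu \<and> d \<le> (k + 1) * Du"
    using ex 1 by (intro exI conjI) (assumption, auto)
qed

text \<open>Induction on the number \<open>j\<close> of iterations still to come. Each takes
  \<open>k + 2\<close> units: the test, the body and the increment; the last unit is the final
  test.\<close>

lemma wpc_while:
  assumes G: "G \<ge> 20" and xy: "\<not> temp x" "\<not> temp y" and N: "N < 2 ^ B"
    and inv: "\<And>i s m. I i s m ==> s x = int i \<and> s y = int N"
    and body: "\<And>i s m. i < N ==> I i s m ==>
       wpc c (\<lambda>s m. s x = int i \<and> I (Suc i) (s(x := int i + 1)) m) k s m"
    and Q: "\<And>s m. I N s m ==> Q s m"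
  shows "I (N - j) s m ==> j \<le> N ==>
    wpc (WhileLess (Var x) (Var y) (Seq c (Op x Add (Var x) (Lit 1)))) Q (j * (k + 2) + 1) s m"
proof (induction j arbitrary: s m)
  case 0
  show ?case
    unfolding wpc_def
  proof (intro allI impI)
    fix s1 assume s1: "clean s1 = s"
    have v: "s1 x = int N" "s1 y = int N" using s1 xy inv[of N s m] 0 by (auto simp: clean_def)
    let ?t = "op_cost w [int N, int N]"
    have ex: "exec w (WhileLess (Var x) (Var y) (Seq c (Op x Add (Var x) (Lit 1)))) (s1, m) (s1, m) ?t (depth_cost ?t) {} {}"
      by (rule exec_WhileEnd) (use v in auto)
    have "int N < 2 ^ B" using N by (metis of_nat_less_numeral_power_cancel_iff)
    then have "num_words w (int N) \<le> 2 * 1 * u" by (auto intro!: nwL[of _ 1 1, simplified])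
    note b = op3(3,4)[OF this this this]
    have "?t \<le> Tu" "depth_cost ?t \<le> Du"
      using b G TuI[of 0 ?t] DuI[of 0 "depth_cost ?t"] by auto
    then show "\<exists>s' m' t d R U. exec w (WhileLess (Var x) (Var y) (Seq c (Op x Add (Var x) (Lit 1)))) (s1, m) (s', m') t d R U
      \<and> Q (clean s') m' \<and> t \<le> (0 * (k + 2) + 1) * Tu \<and> d \<le> (0 * (k + 2) + 1) * Du"
      using ex s1 Q 0 by (intro exI conjI) (assumption, auto)
  qed
next
  case (Suc j)
  define i where "i = N - Suc j"
  have i: "i < N" "N - j = Suc i" using Suc.prems by (auto simp: i_def)
  show ?case
    unfolding wpc_def
  proof (intro allI impI)
    fix s1 assume s1: "clean s1 = s"
    have v: "s1 x = int i" "s1 y = int N" using s1 xy inv[of i s m] Suc.prems by (auto simp: clean_def i_def)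
    let ?t = "op_cost w [int i, int N]"
    have "wpc c (\<lambda>s m. s x = int i \<and> I (Suc i) (s(x := int i + 1)) m) k s m"
      using body[OF i(1)] Suc.prems by (simp add: i_def)
    with s1 obtain s2 m2 t1 d1 R1 U1 where
      1: "exec w c (s1, m) (s2, m2) t1 d1 R1 U1" "clean s2 x = int i" "I (Suc i) ((clean s2)(x := int i + 1)) m2"
        "t1 \<le> k * Tu" "d1 \<le> k * Du"
      unfolding wpc_def by metis
    have x2: "s2 x = int i" using 1(2) xy by (simp add: clean_def)
    let ?t2 = "op_cost w [int i, 1, int i + 1]"
    have inc: "exec w (Op x Add (Var x) (Lit 1)) (s2, m2) (s2(x := int i + 1), m2) ?t2 (depth_cost ?t2) {} {}"
      by (rule exec_Op) (use x2 in auto)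
    have "wpc (WhileLess (Var x) (Var y) (Seq c (Op x Add (Var x) (Lit 1)))) Q (j * (k + 2) + 1) ((clean s2)(x := int i + 1)) m2"
    proof (rule Suc.IH)
      show "I (N - j) ((clean s2)(x := int i + 1)) m2" using 1(3) i(2) by simp
    qed (use Suc.prems in simp)
    moreover have "clean (s2(x := int i + 1)) = (clean s2)(x := int i + 1)" using xy by simp
    ultimately obtain s3 m3 t3 d3 R3 U3 where
      3: "exec w (WhileLess (Var x) (Var y) (Seq c (Op x Add (Var x) (Lit 1)))) (s2(x := int i + 1), m2) (s3, m3) t3 d3 R3 U3"
        "Q (clean s3) m3" "t3 \<le> (j * (k + 2) + 1) * Tu" "d3 \<le> (j * (k + 2) + 1) * Du"
      unfolding wpc_def by blast
    note ex = exec_WhileStep[OF _ _ refl _ exec_Seq[OF 1(1) inc] 3(1)]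
    have ex': "exec w (WhileLess (Var x) (Var y) (Seq c (Op x Add (Var x) (Lit 1)))) (s1, m) (s3, m3)
       (?t + (t1 + ?t2) + t3) (depth_cost ?t + (d1 + depth_cost ?t2) + d3) (R1 \<union> {} \<union> R3) (U1 \<union> {} \<union> U3)"
      by (rule ex) (use v i in auto)
    have NB: "int N < 2 ^ B" using N by (metis of_nat_less_numeral_power_cancel_iff)
    have "int i + 1 \<le> int N" using i by simp
    then have "int i + 1 < 2 ^ B" using NB by linarith
    then have "num_words w (int N) \<le> 2 * 1 * u" "num_words w (int i) \<le> 2 * 1 * u" "num_words w 1 \<le> 2 * 1 * u"
      "num_words w (int i + 1) \<le> 2 * 1 * u"
      using NB i \<open>int i + 1 < 2 ^ B\<close> B1 by (auto intro!: nwL[of _ 1 1, simplified])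
    note b = op3(3,4)[OF this(2) this(1) this(1)] op3(1,2)[OF this(2,3,4)]
    have "?t \<le> Tu" "depth_cost ?t \<le> Du" "?t2 \<le> Tu" "depth_cost ?t2 \<le> Du"
      using b G TuI[of 0 ?t] DuI[of 0 "depth_cost ?t"] TuI[of 0 ?t2] DuI[of 0 "depth_cost ?t2"] by auto
    then show "\<exists>s' m' t d R U. exec w (WhileLess (Var x) (Var y) (Seq c (Op x Add (Var x) (Lit 1)))) (s1, m) (s', m') t d R U
      \<and> Q (clean s') m' \<and> t \<le> (Suc j * (k + 2) + 1) * Tu \<and> d \<le> (Suc j * (k + 2) + 1) * Du"
      using ex' 1 3 by (intro exI conjI) (assumption, auto simp: algebra_simps)
  qed
qed

lemma wpc_for:
  assumes G: "G \<ge> 20" and xy: "\<not> temp x" "\<not> temp y" and N: "N < 2 ^ B"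
    and I0: "I 0 (s(x := 0)) m"
    and inv: "\<And>i s m. I i s m ==> s x = int i \<and> s y = int N"
    and body: "\<And>i s m. i < N ==> I i s m ==>
       wpc c (\<lambda>s m. s x = int i \<and> I (Suc i) (s(x := int i + 1)) m) k s m"
    and Q: "\<And>s m. I N s m ==> Q s m"
  shows "wpc (For x y c) Q (N * (k + 2) + 2) s m"
proof -
  have a: "wpc (Op x Add (Lit 0) (Lit 0)) (\<lambda>s m. I (N - N) s m) 1 s m"
    unfolding wpc_def
  proof (intro allI impI)
    fix s1 assume s1: "clean s1 = s"
    let ?t = "op_cost w [0, 0, 0]"
    have ex: "exec w (Op x Add (Lit 0) (Lit 0)) (s1, m) (s1(x := 0), m) ?t (depth_cost ?t) {} {}"
      by (rule exec_Op) auto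
    have "num_words w 0 \<le> 2 * 1 * u" by (rule nw0) simp
    note b = op3(1,2)[OF this this this]
    have "?t \<le> Tu" "depth_cost ?t \<le> Du"
      using b G TuI[of 0 ?t] DuI[of 0 "depth_cost ?t"] by auto
    then show "\<exists>s' m' t d R U. exec w (Op x Add (Lit 0) (Lit 0)) (s1, m) (s', m') t d R U
      \<and> I (N - N) (clean s') m' \<and> t \<le> 1 * Tu \<and> d \<le> 1 * Du"
      using ex s1 I0 xy by (intro exI conjI) (assumption, auto)
  qed
  have "wpc (For x y c) Q (1 + (N * (k + 2) + 1)) s m"
    unfolding For_def
    by (rule wpc_seq, rule wpc_mono[OF a le_refl])
       (rule wpc_while[where I=I and N=N and j=N, OF G xy N inv body Q]; simp)
  then show ?thesis by simp
qed

end

section \<open>Approximate distances from a hopset\<close>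

text \<open>Adding a real number can be undone in the extended reals, so \<open>r\<close> moves to
  the left and the infimum is bounded termwise, even over an empty set.\<close>

lemma le_INF_add_real:
  fixes X :: ereal and c :: "'a => real"
  assumes "\<And>p. p \<in> P ==> X \<le> ereal (c p + r)"
  shows "X \<le> (INF p\<in>P. ereal (c p)) + ereal r"
proof -
  have "X - ereal r \<le> (INF p\<in>P. ereal (c p))"
    by (rule INF_greatest) (use assms in \<open>auto simp: ereal_minus_le_iff\<close>)
  then show ?thesis by (simp add: ereal_minus_le_iff)
qed

lemma INF_finite_attained:
  fixes f :: "'a => ereal"
  assumes "finite P" "P \<noteq> {}"
  obtains p where "p \<in> P" "(INF p\<in>P. f p) = f p"
proof -
  have "Inf (f ` P) = Min (f ` P)" using assms by (simp add: Min_Inf)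
  moreover have "Min (f ` P) \<in> f ` P" using assms by (intro Min_in) auto
  ultimately show ?thesis using that by auto
qed

text \<open>The constant belongs to the locale of well-formed digraphs but mentions no graph.
  Instantiating the locale with the empty graph yields its equation unconditionally.\<close>

lemma awalk_cost_eq: "wf_digraph.awalk_cost w p = sum_list (map w p)"
proof -
  have "wf_digraph \<lparr> verts = {}, arcs = {}, tail = undefined, head = undefined \<rparr>"
    by unfold_locales auto
  from wf_digraph.awalk_cost_def[OF this] show ?thesis .
qed

lemma fin_digraph_graph_union:
  assumes "fin_digraph G" "fin_digraph H"
  shows "fin_digraph (graph_union G H)"
proof -
  interpret G: fin_digraph G by fact
  interpret H: fin_digraph H by fact
  show ?thesis by unfold_locales (auto simp: graph_union_def)
qed

locale weighted_digraph = fin_digraph G for G :: "('v, 'e) pre_digraph" +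
  fixes wt :: "'e => real"
  assumes wt_nonneg: "e \<in> arcs G ==> 0 \<le> wt e"
begin

lemma hop_dist_le: "awalk u p v ==> length p \<le> k ==> hop_dist G wt k u v \<le> ereal (sum_list (map wt p))"
  unfolding hop_dist_def awalk_cost_eq by (intro INF_lower2[of p]) auto

lemma walk_cost_nonneg: "awalk u p v ==> 0 \<le> sum_list (map wt p)"
  by (intro sum_list_nonneg) (auto simp: awalk_def intro: wt_nonneg)

lemma hop_dist_nonneg: "0 \<le> hop_dist G wt k u v"
  unfolding hop_dist_def awalk_cost_eq by (rule INF_greatest) (auto intro: walk_cost_nonneg)

lemma hop_dist_mono: "k \<le> l ==> hop_dist G wt l u v \<le> hop_dist G wt k u v"
  unfolding hop_dist_def by (rule INF_superset_mono) auto

lemma finite_hop_walks: "finite {p. awalk u p v \<and> length p \<le> k}"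
  by (rule finite_subset[OF _ finite_lists_length_le[OF finite_arcs, of k]]) (auto simp: awalk_def)

lemma adj_matrix_arc:
  assumes "u \<noteq> v" "adj_matrix G wt u v \<noteq> \<infinity>"
  obtains e where "e \<in> arcs G" "tail G e = u" "head G e = v" "adj_matrix G wt u v = ereal (wt e)"
proof -
  let ?P = "{e \<in> arcs G. tail G e = u \<and> head G e = v}"
  have ne: "?P \<noteq> {}"
  proof
    assume e: "?P = {}"
    have "adj_matrix G wt u v = \<infinity>" using assms(1) unfolding adj_matrix_def e by (simp add: top_ereal_def)
    then show False using assms(2) by simp
  qed
  have "finite ?P" by simp
  from INF_finite_attained[OF this ne, of "\<lambda>e. ereal (wt e)"] obtain e where
    "e \<in> ?P" "(INF e\<in>?P. ereal (wt e)) = ereal (wt e)" .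
  then show ?thesis using that[of e] assms(1) by (auto simp: adj_matrix_def)
qed

lemma adj_matrix_le: "e \<in> arcs G ==> adj_matrix G wt (tail G e) (head G e) \<le> ereal (wt e)"
  unfolding adj_matrix_def by (auto intro: INF_lower2 wt_nonneg)

lemma hop_dist_adj:
  assumes "u \<in> verts G"
  shows "hop_dist G wt (Suc 0) u v \<le> adj_matrix G wt u v"
proof (cases "u = v")
  case True
  then show ?thesis using hop_dist_le[of u "[]" v "Suc 0"] assms by (simp add: adj_matrix_def awalk_Nil_iff zero_ereal_def)
next
  case False
  show ?thesis
  proof (cases "adj_matrix G wt u v = \<infinity>")
    case fin: False
    from adj_matrix_arc[OF False this] obtain e where e: "e \<in> arcs G" "tail G e = u" "head G e = v"
      "adj_matrix G wt u v = ereal (wt e)" .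
    have "awalk u [e] v" using e arc_implies_awalk[of e] by auto
    from hop_dist_le[OF this, of "Suc 0"] show ?thesis using e by simp
  qed simp
qed

text \<open>A finite entry off the diagonal is the weight of an arc, which prolongs a walk by one
  hop; a diagonal entry corresponds to staying in place at no cost.\<close>

lemma hop_dist_step:
  assumes "t \<in> verts G"
  shows "hop_dist G wt (Suc k) u v \<le> hop_dist G wt k u t + adj_matrix G wt t v"
proof (cases "t = v")
  case True
  then show ?thesis using hop_dist_mono[of k "Suc k" u v] by (simp add: adj_matrix_def)
next
  case False
  show ?thesis
  proof (cases "adj_matrix G wt t v = \<infinity>")
    case fin: False
    from adj_matrix_arc[OF False this] obtain e where e: "e \<in> arcs G" "tail G e = t" "head G e = v"
      "adj_matrix G wt t v = ereal (wt e)" .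
    have "hop_dist G wt (Suc k) u v \<le> hop_dist G wt k u t + ereal (wt e)"
      unfolding hop_dist_def[of G wt k] awalk_cost_eq
    proof (rule le_INF_add_real)
      fix p assume p: "p \<in> {p. awalk u p t \<and> length p \<le> k}"
      then have "awalk u (p @ [e]) v" using e arc_implies_awalk[of e] by auto
      from hop_dist_le[OF this, of "Suc k"] p
      show "hop_dist G wt (Suc k) u v \<le> ereal (sum_list (map wt p) + wt e)" by simp
    qed
    then show ?thesis using e by simp
  next
    case True
    have "hop_dist G wt k u t \<noteq> - \<infinity>" using hop_dist_nonneg[of k u t] by auto
    then show ?thesis using True by simp
  qed
qed

text \<open>Only the lower half of the approximation enters, and \<open>A\<close> may exceed the
  true matrix, so the bound survives rounding up and dropping edges. The offset between
  \<open>i\<close> and the number of hops is that of \<open>B 0\<close>, which already accounts for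
  one edge.\<close>

lemma iterated_products_lower:
  assumes it: "iterated_products \<xi> S (verts G) A m B"
    and A: "\<And>x y. x \<in> verts G ==> y \<in> verts G ==> adj_matrix G wt x y \<le> A x y"
    and S: "S \<subseteq> verts G" and u: "u \<in> S"
  shows "i \<le> m ==> v \<in> verts G ==> hop_dist G wt (Suc i) u v \<le> B i u v"
proof (induction i arbitrary: v)
  case 0
  have "hop_dist G wt (Suc 0) u v \<le> adj_matrix G wt u v" using S u by (intro hop_dist_adj) auto
  also have "\<dots> \<le> A u v" using A S u 0 by auto
  also have "\<dots> = B 0 u v" using it u 0 by (auto simp: iterated_products_def)
  finally show ?case .
next
  case (Suc i)
  have "hop_dist G wt (Suc (Suc i)) u v \<le> dist_product (verts G) (B i) A u v"
    unfolding dist_product_def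
  proof (rule INF_greatest)
    fix t assume t: "t \<in> verts G"
    have "hop_dist G wt (Suc (Suc i)) u v \<le> hop_dist G wt (Suc i) u t + adj_matrix G wt t v"
      by (rule hop_dist_step[OF t])
    also have "\<dots> \<le> B i u t + A t v" using Suc t A by (intro add_mono) auto
    finally show "hop_dist G wt (Suc (Suc i)) u v \<le> B i u t + A t v" .
  qed
  also have "\<dots> \<le> B (Suc i) u v" using it Suc u by (auto simp: iterated_products_def approx_dist_product_def)
  finally show ?case .
qed

text \<open>Stated for any walk with substitute weights \<open>w'\<close> that dominate
  \<open>A\<close> along it, so that one induction serves the exact and the rounded matrix. The
  induction splits off the last arc; as \<open>w'\<close> is nonnegative, its weight may be
  multiplied by \<open>(1 + \<xi>) ^ i\<close> as well.\<close>

lemma iterated_products_upper: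
  assumes it: "iterated_products \<xi> S (verts G) A m B"
    and diag: "\<And>x. x \<in> verts G ==> A x x \<le> 0"
    and \<xi>: "0 \<le> \<xi>" and S: "S \<subseteq> verts G" and u: "u \<in> S"
  shows "i \<le> m ==> awalk u p v ==> length p \<le> Suc i ==>
    (\<And>e. e \<in> set p ==> 0 \<le> w' e \<and> A (tail G e) (head G e) \<le> ereal (w' e)) ==>
    B i u v \<le> ereal ((1 + \<xi>) ^ i * sum_list (map w' p))"
proof (induction i arbitrary: p v)
  case 0
  have v: "v \<in> verts G" "u \<in> verts G" using 0(2) by auto
  have B: "B 0 u v = A u v" using it u v by (auto simp: iterated_products_def)
  show ?case
  proof (cases p)
    case Nil
    then have "u = v" using 0 by (auto simp: awalk_Nil_iff)
    then show ?thesis using B diag[of u] v Nil by (simp add: zero_ereal_def)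
  next
    case (Cons e q)
    then have "q = []" using 0 by auto
    then show ?thesis using 0 B Cons by (auto simp: awalk_Cons_iff awalk_Nil_iff)
  qed
next
  case (Suc i)
  have v: "v \<in> verts G" "u \<in> verts G" using Suc.prems(2) by auto
  have nn: "0 \<le> (1 + \<xi>) ^ i" "1 \<le> 1 + \<xi>" using \<xi> by auto
  have le: "B (Suc i) u v \<le> ereal (1 + \<xi>) * (B i u t + A t v)" if "t \<in> verts G" for t
  proof -
    have "B (Suc i) u v \<le> ereal (1 + \<xi>) * dist_product (verts G) (B i) A u v"
      using it Suc.prems u v by (auto simp: iterated_products_def approx_dist_product_def)
    also have "\<dots> \<le> ereal (1 + \<xi>) * (B i u t + A t v)"
      unfolding dist_product_def using \<xi> that by (intro ereal_mult_left_mono INF_lower) auto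
    finally show ?thesis .
  qed
  show ?case
  \<comment> \<open>A walk that does not use up its allowance of hops is prolonged by the diagonal
    entry, which is at most 0.\<close>
  proof (cases "length p \<le> Suc i")
    case True
    have "B i u v \<le> ereal ((1 + \<xi>) ^ i * sum_list (map w' p))"
      using Suc.IH[of p v] Suc.prems True by auto
    then have "B i u v + A v v \<le> ereal ((1 + \<xi>) ^ i * sum_list (map w' p)) + 0"
      using diag v by (intro add_mono) auto
    then have "ereal (1 + \<xi>) * (B i u v + A v v) \<le> ereal (1 + \<xi>) * ereal ((1 + \<xi>) ^ i * sum_list (map w' p))"
      using \<xi> by (intro ereal_mult_left_mono) auto
    with le[OF v(1)] show ?thesis by (auto simp: mult.assoc elim: order_trans)
  next
    case False
    then obtain q e where p: "p = q @ [e]" "length q \<le> Suc i"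
      using Suc.prems(3) by (cases p rule: rev_cases) auto
    have w: "awalk u q (tail G e)" "head G e = v" "e \<in> arcs G"
      using Suc.prems(2) unfolding p by (auto simp: awalk_Cons_iff awalk_Nil_iff)
    have t: "tail G e \<in> verts G" using w by auto
    have 1: "B i u (tail G e) \<le> ereal ((1 + \<xi>) ^ i * sum_list (map w' q))"
      using Suc.IH[OF _ w(1)] Suc.prems p by auto
    have we: "0 \<le> w' e" "A (tail G e) v \<le> ereal (w' e)" using Suc.prems(4)[of e] p w by auto
    have "w' e \<le> (1 + \<xi>) ^ i * w' e"
      using we \<xi> mult_right_mono[of 1 "(1 + \<xi>) ^ i" "w' e"] by simp
    then have "A (tail G e) v \<le> ereal ((1 + \<xi>) ^ i * w' e)" using we(2) by (meson ereal_less_eq(3) order_trans)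
    then have "B i u (tail G e) + A (tail G e) v \<le> ereal ((1 + \<xi>) ^ i * sum_list (map w' q)) + ereal ((1 + \<xi>) ^ i * w' e)"
      by (intro add_mono 1)
    then have "ereal (1 + \<xi>) * (B i u (tail G e) + A (tail G e) v) \<le> ereal (1 + \<xi>) * ereal ((1 + \<xi>) ^ i * sum_list (map w' p))"
      using \<xi> by (intro ereal_mult_left_mono) (auto simp: p algebra_simps)
    with le[OF t] show ?thesis by (auto simp: mult.assoc elim: order_trans)
  qed
qed

lemma \<mu>_nonneg: "0 \<le> \<mu> wt u v"
  unfolding \<mu>_def by (rule INF_greatest) (auto simp: awalk_cost_eq intro: walk_cost_nonneg)

lemma \<mu>_real:
  assumes "u \<rightarrow>\<^sup>*\<^bsub>G\<^esub> v" obtains d where "\<mu> wt u v = ereal d" "0 \<le> d"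
proof -
  obtain p where "awalk u p v" using assms by (auto simp: reachable_awalk)
  from min_cost_le_walk_cost[OF this, of wt] \<mu>_nonneg[of u v] show ?thesis
    using that by (cases "\<mu> wt u v") auto
qed

text \<open>A walk without repeated vertices has fewer arcs than the graph has vertices. This bound
  decides which weights are too large to matter.\<close>

lemma \<mu>_le_card:
  assumes "u \<rightarrow>\<^sup>*\<^bsub>G\<^esub> v" and mx: "\<And>e. e \<in> arcs G ==> wt e \<le> mx" "0 \<le> mx"
  shows "\<mu> wt u v \<le> ereal (real (card (verts G)) * mx)"
proof -
  obtain p where p: "apath u p v" using assms by (auto simp: reachable_apath)
  have "sum_list (map wt p) \<le> sum_list (map (\<lambda>_. mx) p)"
    using p by (intro sum_list_mono mx) (auto simp: apath_def awalk_def)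
  also have "\<dots> = real (length p) * mx" by (simp add: sum_list_triv)
  also have "\<dots> \<le> real (card (verts G)) * mx" using length_apath_less[OF p] mx(2) by (intro mult_right_mono) auto
  finally have "ereal (sum_list (map wt p)) \<le> ereal (real (card (verts G)) * mx)" by simp
  moreover have "\<mu> wt u v \<le> ereal (sum_list (map wt p))"
    using min_cost_le_walk_cost[of u p v wt] p by (simp add: awalk_cost_eq apath_def)
  ultimately show ?thesis by (rule order_trans[rotated])
qed

text \<open>If the distance is not zero, every walk has positive cost and so contains an arc of
  positive weight. Absolute errors that are small against \<open>mn\<close> are thus relatively
  small for every nonzero distance.\<close>

lemma \<mu>_ge_min:
  assumes mn: "\<And>e. e \<in> arcs G ==> 0 < wt e ==> mn \<le> wt e" and "\<mu> wt u v \<noteq> 0"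
  shows "ereal mn \<le> \<mu> wt u v"
  unfolding \<mu>_def awalk_cost_eq
proof (rule INF_greatest)
  fix p assume "p \<in> {p. awalk u p v}"
  then have p: "awalk u p v" by simp
  have pos: "0 \<noteq> sum_list (map wt p)"
    using min_cost_le_walk_cost[OF p, of wt] \<mu>_nonneg[of u v] assms(2) by (auto simp: awalk_cost_eq zero_ereal_def[symmetric])
  have arcs: "set p \<subseteq> arcs G" using p by auto
  then have nn: "\<And>x. x \<in> set (map wt p) ==> 0 \<le> x" using wt_nonneg by auto
  then obtain e where e: "e \<in> set p" "wt e \<noteq> 0" using pos sum_list_nonneg_eq_0_iff[of "map wt p"] by auto
  then have "mn \<le> wt e" using arcs mn wt_nonneg[of e] by force
  also have "\<dots> \<le> sum_list (map wt p)" using e nn by (intro member_le_sum_list) auto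
  finally show "ereal mn \<le> ereal (sum_list (map wt p))" by simp
qed

end

text \<open>This is how unreachable pairs are recognised: if the hopset edges join reachable pairs
  only, the union has no walk for an unreachable pair and the hop distance is infinite.\<close>

lemma graph_union_reachable:
  assumes "fin_digraph G" "fin_digraph H" "verts H = verts G"
    and H: "\<forall>e\<in>arcs H. tail H e \<rightarrow>\<^sup>*\<^bsub>G\<^esub> head H e"
    and "pre_digraph.awalk (graph_union G H) u p v"
  shows "u \<rightarrow>\<^sup>*\<^bsub>G\<^esub> v"
proof -
  interpret G: fin_digraph G by fact
  interpret U: fin_digraph "graph_union G H" by (rule fin_digraph_graph_union) fact+
  show ?thesis using assms(5)
  proof (induction p arbitrary: u)
    case Nil
    then have "u = v" "u \<in> verts (graph_union G H)" unfolding U.awalk_Nil_iff by auto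
    then show ?case using assms(3) by (auto simp: graph_union_def)
  next
    case (Cons e p)
    then have e: "e \<in> arcs (graph_union G H)" "tail (graph_union G H) e = u" "head (graph_union G H) e \<rightarrow>\<^sup>*\<^bsub>G\<^esub> v"
      by (auto simp: U.awalk_Cons_iff)
    have "u \<rightarrow>\<^sup>*\<^bsub>G\<^esub> head (graph_union G H) e"
    proof (cases e)
      case (Inl f)
      then have "f \<in> arcs G" "tail G f = u" using e by (auto simp: graph_union_def)
      then show ?thesis using Inl G.in_arcs_imp_in_arcs_ends[of f] by (auto simp: graph_union_def)
    next
      case (Inr f)
      then show ?thesis using H e by (auto simp: graph_union_def)
    qed
    with e(3) show ?case by (meson G.reachable_trans)
  qed
qed

text \<open>The common frame for the exact and the rounded matrix. The lower bound is the lower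
  bound of the hopset on hop distances. For the upper bound, a cheapest walk with at most
  \<open>\<beta>\<close> edges is revalued by the weights \<open>w'\<close> supplied by the
  hypothesis \<open>walk\<close>; their total is at most \<open>r1\<close> times the distance, and
  the products contribute the factor \<open>(1 + \<xi>) ^ (\<beta> - 1)\<close>.\<close>

lemma hopset_approx_distances:
  assumes G: "weighted_graph G wG" and hs: "hopset \<epsilon> \<beta> G wG H wH" and \<beta>: "1 \<le> \<beta>" and \<epsilon>: "0 \<le> \<epsilon>"
    and S: "S \<subseteq> verts G" and \<xi>: "0 \<le> \<xi>" and r: "0 \<le> r1" "(1 + \<xi>) ^ (\<beta> - 1) * r1 \<le> r" "0 < r"
    and it: "iterated_products \<xi> S (verts G) A (\<beta> - 1) B"
    and ge: "\<And>x y. x \<in> verts G ==> y \<in> verts G ==> adj_matrix (graph_union G H) (case_sum wG wH) x y \<le> A x y"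
    and diag: "\<And>x. x \<in> verts G ==> A x x \<le> 0"
    and walk: "\<And>u v p d. u \<in> S ==> pre_digraph.awalk (graph_union G H) u p v ==> length p \<le> \<beta> ==>
       u \<rightarrow>\<^sup>*\<^bsub>G\<^esub> v ==> wf_digraph.\<mu> G wG u v = ereal d ==> sum_list (map (case_sum wG wH) p) \<le> (1 + \<epsilon>) * d ==>
       \<exists>w'. (\<forall>e\<in>set p. 0 \<le> w' e \<and> A (tail (graph_union G H) e) (head (graph_union G H) e) \<le> ereal (w' e)) \<and>
          sum_list (map w' p) \<le> r1 * d"
  shows "approx_distances r G wG H S (B (\<beta> - 1))"
proof -
  define U where "U = graph_union G H"
  define w where "w = case_sum wG wH"
  have H: "weighted_graph H wH" "verts H = verts G" using hs by (auto simp: hopset_def)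
  interpret G: weighted_digraph G wG
    using G by (auto simp: weighted_graph_def weighted_digraph_def weighted_digraph_axioms_def)
  have fH: "fin_digraph H" using H by (auto simp: weighted_graph_def)
  interpret U: weighted_digraph U w
  proof -
    have "fin_digraph U" unfolding U_def by (intro fin_digraph_graph_union G.fin_digraph_axioms fH)
    then show "weighted_digraph U w"
      using G H(1) by (auto simp: weighted_digraph_def weighted_digraph_axioms_def U_def w_def graph_union_def weighted_graph_def)
  qed
  have VU: "verts U = verts G" using H by (auto simp: U_def graph_union_def)
  show ?thesis unfolding approx_distances_def
  proof (intro ballI impI)
    fix u v
    assume u: "u \<in> S" and v: "v \<in> verts G"
      and c: "u \<rightarrow>\<^sup>*\<^bsub>G\<^esub> v \<or> (\<forall>e\<in>arcs H. tail H e \<rightarrow>\<^sup>*\<^bsub>G\<^esub> head H e)"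
    have low: "hop_dist U w \<beta> u v \<le> B (\<beta> - 1) u v"
      using U.iterated_products_lower[of \<xi> S A "\<beta> - 1" B u "\<beta> - 1" v] it ge S u v \<beta> VU
      unfolding U_def w_def by auto
    show "G.\<mu> wG u v \<le> B (\<beta> - 1) u v \<and> B (\<beta> - 1) u v \<le> ereal r * G.\<mu> wG u v"
    proof (cases "u \<rightarrow>\<^sup>*\<^bsub>G\<^esub> v")
      case True
      then have h: "G.\<mu> wG u v \<le> hop_dist U w \<beta> u v" "hop_dist U w \<beta> u v \<le> ereal (1 + \<epsilon>) * G.\<mu> wG u v"
        using hs by (auto simp: hopset_def U_def w_def)
      from G.\<mu>_real[OF True] obtain d where d: "G.\<mu> wG u v = ereal d" "0 \<le> d" .
      let ?P = "{p. U.awalk u p v \<and> length p \<le> \<beta>}"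
      \<comment> \<open>The upper bound of the hopset is finite for a reachable pair, so a walk with
        at most \<open>\<beta>\<close> edges exists; as there are finitely many, the infimum is
        attained.\<close>
      have ne: "?P \<noteq> {}"
      proof
        assume e: "?P = {}"
        have "hop_dist U w \<beta> u v = \<infinity>" unfolding hop_dist_def e by (simp add: top_ereal_def)
        then show False using h(2) d by simp
      qed
      from INF_finite_attained[OF U.finite_hop_walks ne, of "\<lambda>p. ereal (sum_list (map w p))"] obtain p
        where p: "p \<in> ?P" "(INF p\<in>?P. ereal (sum_list (map w p))) = ereal (sum_list (map w p))" .
      then have "hop_dist U w \<beta> u v = ereal (sum_list (map w p))" unfolding hop_dist_def awalk_cost_eq by simp
      then have cost: "sum_list (map w p) \<le> (1 + \<epsilon>) * d" using h(2) d by simp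
      obtain w' where w': "\<forall>e\<in>set p. 0 \<le> w' e \<and> A (tail U e) (head U e) \<le> ereal (w' e)"
        "sum_list (map w' p) \<le> r1 * d"
        using walk[OF u, of p v d] p True d cost unfolding U_def w_def by auto
      have "B (\<beta> - 1) u v \<le> ereal ((1 + \<xi>) ^ (\<beta> - 1) * sum_list (map w' p))"
        using U.iterated_products_upper[of \<xi> S A "\<beta> - 1" B u "\<beta> - 1" p v w'] it diag S u p w' \<beta> VU \<xi>
        by auto
      also have "(1 + \<xi>) ^ (\<beta> - 1) * sum_list (map w' p) \<le> (1 + \<xi>) ^ (\<beta> - 1) * (r1 * d)"
        using w'(2) \<xi> by (intro mult_left_mono) auto
      also have "\<dots> \<le> r * d" using r d by (simp add: mult.assoc[symmetric] mult_right_mono)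
      finally show ?thesis using h(1) low d by (auto elim: order_trans)
    next
      case False
      then have inf: "G.\<mu> wG u v = \<infinity>" by (rule G.shortest_path_inf)
      have "?thesis \<longleftrightarrow> ?thesis" ..
      have e: "{p. U.awalk u p v \<and> length p \<le> \<beta>} = {}"
        using graph_union_reachable[OF G.fin_digraph_axioms fH H(2)] c False unfolding U_def by blast
      have "hop_dist U w \<beta> u v = \<infinity>" unfolding hop_dist_def e by (simp add: top_ereal_def)
      then show ?thesis using low inf r by simp
    qed
  qed
qed

lemma adj_matrix_union_arc:
  assumes "weighted_graph G wG" "weighted_graph H wH" "e \<in> arcs (graph_union G H)"
  shows "adj_matrix (graph_union G H) (case_sum wG wH) (tail (graph_union G H) e) (head (graph_union G H) e)
     \<le> ereal (case_sum wG wH e)"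
proof -
  have "fin_digraph (graph_union G H)" using assms by (intro fin_digraph_graph_union) (auto simp: weighted_graph_def)
  then interpret U: weighted_digraph "graph_union G H" "case_sum wG wH"
    using assms by (auto simp: weighted_digraph_def weighted_digraph_axioms_def graph_union_def weighted_graph_def)
  show ?thesis using assms by (intro U.adj_matrix_le)
qed

text \<open>Here the walk keeps its own weights: an entry of the adjacency matrix is at most the
  weight of any arc between its two vertices.\<close>

lemma hopset_approx_distances_exact:
  assumes G: "weighted_graph G wG" and hs: "hopset \<epsilon> \<beta> G wG H wH" and \<beta>: "1 \<le> \<beta>" and \<epsilon>: "0 \<le> \<epsilon>"
    and S: "S \<subseteq> verts G" and \<xi>: "0 \<le> \<xi>" and r: "(1 + \<xi>) ^ (\<beta> - 1) * (1 + \<epsilon>) \<le> r" "0 < r"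
    and it: "iterated_products \<xi> S (verts G) (adj_matrix (graph_union G H) (case_sum wG wH)) (\<beta> - 1) B"
  shows "approx_distances r G wG H S (B (\<beta> - 1))"
proof (rule hopset_approx_distances[OF G hs \<beta> \<epsilon> S \<xi> _ r it])
  have H: "weighted_graph H wH" using hs by (auto simp: hopset_def)
  have fU: "fin_digraph (graph_union G H)" using G H by (intro fin_digraph_graph_union) (auto simp: weighted_graph_def)
  then interpret U: weighted_digraph "graph_union G H" "case_sum wG wH"
    using G H by (auto simp: weighted_digraph_def weighted_digraph_axioms_def graph_union_def weighted_graph_def)
  fix u v p d
  assume "pre_digraph.awalk (graph_union G H) u p v" "sum_list (map (case_sum wG wH) p) \<le> (1 + \<epsilon>) * d"
  then show "\<exists>w'. (\<forall>e\<in>set p. 0 \<le> w' e \<and> adj_matrix (graph_union G H) (case_sum wG wH) (tail (graph_union G H) e) (head (graph_union G H) e) \<le> ereal (w' e)) \<and>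
          sum_list (map w' p) \<le> (1 + \<epsilon>) * d"
    using adj_matrix_union_arc[OF G H] U.wt_nonneg
    by (intro exI[of _ "case_sum wG wH"]) (auto simp del: split_paired_All simp: U.awalk_def)
qed (use \<epsilon> in \<open>auto simp: adj_matrix_def\<close>)

text \<open>A matrix whose entries are rounded up by at most \<open>\<eta>\<close>, and which may drop expensive edges, serves as well:
  a pair at distance zero is joined by edges of weight zero, which are not rounded, and for all other
  pairs the rounding errors of \<open>\<beta>\<close> edges are relatively small.\<close>

lemma hopset_approx_distances_rounded:
  assumes G: "weighted_graph G wG" and hs: "hopset \<epsilon> \<beta> G wG H wH" and \<beta>: "1 \<le> \<beta>" and \<epsilon>: "0 \<le> \<epsilon>"
    and S: "S \<subseteq> verts G" and \<xi>: "0 \<le> \<xi>" and r: "(1 + \<xi>) ^ (\<beta> - 1) * (1 + 2 * \<epsilon>) \<le> r" "0 < r"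
    and it: "iterated_products \<xi> S (verts G) A (\<beta> - 1) B"
    and ge: "\<And>x y. x \<in> verts G ==> y \<in> verts G ==> adj_matrix (graph_union G H) (case_sum wG wH) x y \<le> A x y"
    and diag: "\<And>x. x \<in> verts G ==> A x x \<le> 0"
    and mn: "\<And>e. e \<in> arcs G ==> 0 < wG e ==> mn \<le> wG e"
    and mx: "\<And>e. e \<in> arcs G ==> wG e \<le> mx" "0 \<le> mx"
    and zero: "\<And>e. e \<in> arcs (graph_union G H) ==> case_sum wG wH e = 0 ==>
        A (tail (graph_union G H) e) (head (graph_union G H) e) \<le> 0"
    and pos: "\<And>e. e \<in> arcs (graph_union G H) ==> case_sum wG wH e \<le> (1 + \<epsilon>) * (real (card (verts G)) * mx) ==>
        A (tail (graph_union G H) e) (head (graph_union G H) e) \<le> ereal (case_sum wG wH e + \<eta>)"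
    and \<eta>: "0 \<le> \<eta>" "real \<beta> * \<eta> \<le> \<epsilon> * mn"
  shows "approx_distances r G wG H S (B (\<beta> - 1))"
proof (rule hopset_approx_distances[OF G hs \<beta> \<epsilon> S \<xi> _ r it ge diag])
  have H: "weighted_graph H wH" using hs by (auto simp: hopset_def)
  have fU: "fin_digraph (graph_union G H)" using G H by (intro fin_digraph_graph_union) (auto simp: weighted_graph_def)
  then interpret U: weighted_digraph "graph_union G H" "case_sum wG wH"
    using G H by (auto simp: weighted_digraph_def weighted_digraph_axioms_def graph_union_def weighted_graph_def)
  interpret G: weighted_digraph G wG
    using G by (auto simp: weighted_graph_def weighted_digraph_def weighted_digraph_axioms_def)
  let ?w = "case_sum wG wH"
  fix u v p d
  assume p: "U.awalk u p v" "length p \<le> \<beta>" and re: "u \<rightarrow>\<^sup>*\<^bsub>G\<^esub> v" and d: "G.\<mu> wG u v = ereal d"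
    and cost: "sum_list (map ?w p) \<le> (1 + \<epsilon>) * d"
  have arcs: "set p \<subseteq> arcs (graph_union G H)" using p by auto
  have wle: "?w e \<le> sum_list (map ?w p)" "0 \<le> ?w e" if "e \<in> set p" for e
  proof -
    have nn: "0 \<le> ?w e" if "e \<in> set p" for e using that arcs U.wt_nonneg[of e] by blast
    then show "0 \<le> ?w e" using that by blast
    show "?w e \<le> sum_list (map ?w p)" by (rule member_le_sum_list) (use that nn in auto)
  qed
  show "\<exists>w'. (\<forall>e\<in>set p. 0 \<le> w' e \<and> A (tail (graph_union G H) e) (head (graph_union G H) e) \<le> ereal (w' e)) \<and>
          sum_list (map w' p) \<le> (1 + 2 * \<epsilon>) * d"
  proof (cases "d = 0")
    case True
    then have "?w e = 0" if "e \<in> set p" for e using wle[OF that] cost by simp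
    then show ?thesis using arcs zero True
      by (intro exI[of _ "\<lambda>_. 0"]) (auto simp: zero_ereal_def sum_list_triv)
  next
    case False
    then have "ereal mn \<le> ereal d" unfolding d[symmetric] by (intro G.\<mu>_ge_min mn) (auto simp: d)
    then have mnd: "mn \<le> d" by simp
    \<comment> \<open>The walk costs little more than the distance, hence each of its arcs stays
      below the threshold beyond which edges may be dropped.\<close>
    have "d \<le> real (card (verts G)) * mx" using G.\<mu>_le_card[OF re mx] d by simp
    then have "sum_list (map ?w p) \<le> (1 + \<epsilon>) * (real (card (verts G)) * mx)"
      using cost \<epsilon> by (smt (verit) mult_left_mono)
    then have "\<forall>e\<in>set p. 0 \<le> ?w e + \<eta> \<and> A (tail (graph_union G H) e) (head (graph_union G H) e) \<le> ereal (?w e + \<eta>)"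
      using wle \<eta>(1) arcs by (intro ballI conjI pos) (auto intro: order_trans)
    moreover have "sum_list (map (\<lambda>e. ?w e + \<eta>) p) \<le> (1 + 2 * \<epsilon>) * d"
    proof -
      have "sum_list (map (\<lambda>e. ?w e + \<eta>) p) = sum_list (map ?w p) + real (length p) * \<eta>"
        by (simp add: sum_list_addf sum_list_triv)
      also have "real (length p) * \<eta> \<le> real \<beta> * \<eta>" using p \<eta> by (intro mult_right_mono) auto
      also have "\<dots> \<le> \<epsilon> * mn" by (rule \<eta>)
      also have "\<dots> \<le> \<epsilon> * d" using mnd \<epsilon> by (intro mult_left_mono)
      finally show ?thesis using cost by (simp add: algebra_simps)
    qed
    ultimately show ?thesis by (intro exI[of _ "\<lambda>e. ?w e + \<eta>"]) auto
  qed
qed (use \<epsilon> in auto)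

section \<open>Bilinear algorithms from straight-line programs\<close>

text \<open>The same program run on polynomials in one auxiliary variable. The grading by powers of
  this variable separates the bilinear part of an output from everything else that the program
  computes.\<close>

fun slp_pvalue :: "rat poly list => slp_instr => rat poly" where
  "slp_pvalue vs (Const q) = [:q:]"
| "slp_pvalue vs (Plus i j) = vs ! i + vs ! j"
| "slp_pvalue vs (Minus i j) = vs ! i - vs ! j"
| "slp_pvalue vs (Times i j) = vs ! i * vs ! j"

definition slp_prun :: "slp_instr list => rat poly list => rat poly list" where
  "slp_prun is vs = foldl (\<lambda>us c. us @ [slp_pvalue us c]) vs is"

lemma slp_run_Nil [simp]: "slp_run [] vs = vs"
  by (simp add: slp_run_def)

lemma slp_run_snoc: "slp_run (is @ [c]) vs = slp_run is vs @ [slp_value (slp_run is vs) c]"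
  by (simp add: slp_run_def)

lemma slp_prun_Nil [simp]: "slp_prun [] vs = vs"
  by (simp add: slp_prun_def)

lemma slp_prun_snoc: "slp_prun (is @ [c]) vs = slp_prun is vs @ [slp_pvalue (slp_prun is vs) c]"
  by (simp add: slp_prun_def)

lemma length_slp_run [simp]: "length (slp_run is vs) = length vs + length is"
  by (induction "is" rule: rev_induct) (auto simp: slp_run_snoc)

lemma length_slp_prun [simp]: "length (slp_prun is vs) = length vs + length is"
  by (induction "is" rule: rev_induct) (auto simp: slp_prun_snoc)

lemma slp_wf_Nil [simp]: "slp_wf l []"
  by (simp add: slp_wf_def)

lemma slp_wf_snoc: "slp_wf l (is @ [c]) \<longleftrightarrow> slp_wf l is \<and> slp_legal (l + length is) c"
  by (auto simp: slp_wf_def nth_append less_Suc_eq all_conj_distrib)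

lemma slp_run_append_nth:
  "t < length vs + length is ==> slp_run (is @ ext) vs ! t = slp_run is vs ! t"
proof (induction ext rule: rev_induct)
  case (snoc c ext)
  then show ?case by (simp add: slp_run_snoc nth_append flip: append_assoc)
qed simp

lemma slp_run_input: "t < length vs ==> slp_run is vs ! t = vs ! t"
  using slp_run_append_nth[of t vs "[]" "is"] by simp

text \<open>Evaluation at a point is a ring homomorphism and commutes with every instruction;
  well-formedness guarantees that all operands lie within the list.\<close>

lemma poly_slp_prun:
  "slp_wf (length ps) is ==> map (\<lambda>p. poly p z) (slp_prun is ps) = slp_run is (map (\<lambda>p. poly p z) ps)"
proof (induction "is" rule: rev_induct)
  case (snoc c "is")
  then have IH: "map (\<lambda>p. poly p z) (slp_prun is ps) = slp_run is (map (\<lambda>p. poly p z) ps)"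
    and l: "slp_legal (length ps + length is) c" by (auto simp: slp_wf_snoc)
  have "slp_value (map (\<lambda>p. poly p z) (slp_prun is ps)) c = poly (slp_pvalue (slp_prun is ps) c) z"
    using l by (cases c) auto
  then show ?case using IH by (simp add: slp_run_snoc slp_prun_snoc)
qed simp

text \<open>Substituting \<open>z\<^sup>2 x\<close> and \<open>z\<^sup>3 y\<close> for the two groups of inputs turns the part that is bilinear in
  \<open>x\<close> and \<open>y\<close> into the coefficient of \<open>z\<^sup>5\<close>, since 5 = 2 + 3 is the only way to write 5 as a sum of 2s and 3s.\<close>

definition linear_form :: "nat => (nat => 'a) => (nat => 'a) => 'a::comm_ring_1" where
  "linear_form n F x = (\<Sum>i<n. F i * x i)"

lemma linear_form_add: "linear_form n (\<lambda>i. c * F i + d * G i) x = c * linear_form n F x + d * linear_form n G x"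
  by (simp add: linear_form_def distrib_right sum.distrib sum_distrib_left mult.assoc)

lemma linear_form_zero [simp]: "linear_form n (\<lambda>i. 0) x = 0"
  by (simp add: linear_form_def)

text \<open>\<open>L\<close> lists pairs of linear forms, shared by all values of a program, whose
  products span the coefficients of degree 5. Degree 4 is not recorded: in a product it meets degree
  5 only together with degree 1, which is always zero.\<close>

definition bilinear_coeffs ::
  "nat => nat => ((nat => rat) \<times> (nat => rat)) list => ((nat => rat) => (nat => rat) => rat poly) => bool" where
  "bilinear_coeffs a b L P \<longleftrightarrow> (\<exists>\<alpha> F G H. \<forall>x y.
     coeff (P x y) 0 = \<alpha> \<and> coeff (P x y) (Suc 0) = 0 \<and>
     coeff (P x y) 2 = linear_form a F x \<and> coeff (P x y) 3 = linear_form b G y \<and>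
     coeff (P x y) 5 = (\<Sum>\<rho><length L. H \<rho> * (linear_form a (fst (L ! \<rho>)) x * linear_form b (snd (L ! \<rho>)) y)))"

lemma bilinear_coeffsE:
  assumes "bilinear_coeffs a b L P"
  obtains \<alpha> F G H where "\<And>x y. coeff (P x y) 0 = \<alpha>" "\<And>x y. coeff (P x y) (Suc 0) = 0"
     "\<And>x y. coeff (P x y) 2 = linear_form a F x" "\<And>x y. coeff (P x y) 3 = linear_form b G y"
     "\<And>x y. coeff (P x y) 5 = (\<Sum>\<rho><length L. H \<rho> * (linear_form a (fst (L ! \<rho>)) x * linear_form b (snd (L ! \<rho>)) y))"
  using assms unfolding bilinear_coeffs_def by blast

lemma bilinear_coeffsI:
  assumes "\<And>x y. coeff (P x y) 0 = \<alpha>" "\<And>x y. coeff (P x y) (Suc 0) = 0"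
     "\<And>x y. coeff (P x y) 2 = linear_form a F x" "\<And>x y. coeff (P x y) 3 = linear_form b G y"
     "\<And>x y. coeff (P x y) 5 = (\<Sum>\<rho><length L. H \<rho> * (linear_form a (fst (L ! \<rho>)) x * linear_form b (snd (L ! \<rho>)) y))"
  shows "bilinear_coeffs a b L P"
  unfolding bilinear_coeffs_def
  by (rule exI[of _ \<alpha>], rule exI[of _ F], rule exI[of _ G], rule exI[of _ H]) (simp only: assms simp_thms)

lemma bilinear_coeffs_append:
  assumes "bilinear_coeffs a b L P" shows "bilinear_coeffs a b (L @ L') P"
proof -
  from assms show ?thesis
  proof (rule bilinear_coeffsE)
    fix \<alpha> F G H
    assume h: "\<And>x y. coeff (P x y) 0 = \<alpha>" "\<And>x y. coeff (P x y) (Suc 0) = 0"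
     "\<And>x y. coeff (P x y) 2 = linear_form a F x" "\<And>x y. coeff (P x y) 3 = linear_form b G y"
     "\<And>x y. coeff (P x y) 5 = (\<Sum>\<rho><length L. H \<rho> * (linear_form a (fst (L ! \<rho>)) x * linear_form b (snd (L ! \<rho>)) y))"
    show ?thesis
    proof (rule bilinear_coeffsI[where H="\<lambda>\<rho>. if \<rho> < length L then H \<rho> else 0", OF h(1-4)])
      fix x y
      show "coeff (P x y) 5 = (\<Sum>\<rho><length (L @ L'). (if \<rho> < length L then H \<rho> else 0) *
          (linear_form a (fst ((L @ L') ! \<rho>)) x * linear_form b (snd ((L @ L') ! \<rho>)) y))"
        unfolding h by (rule sum.mono_neutral_cong_left) (auto simp: nth_append)
    qed
  qed
qed

lemma bilinear_coeffs_lin: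
  assumes "bilinear_coeffs a b L P" "bilinear_coeffs a b L Q"
  shows "bilinear_coeffs a b L (\<lambda>x y. P x y + smult c (Q x y))"
proof -
  from assms(1) obtain \<alpha> F G H where h: "\<And>x y. coeff (P x y) 0 = \<alpha>" "\<And>x y. coeff (P x y) (Suc 0) = 0"
     "\<And>x y. coeff (P x y) 2 = linear_form a F x" "\<And>x y. coeff (P x y) 3 = linear_form b G y"
     "\<And>x y. coeff (P x y) 5 = (\<Sum>\<rho><length L. H \<rho> * (linear_form a (fst (L ! \<rho>)) x * linear_form b (snd (L ! \<rho>)) y))"
    by (rule bilinear_coeffsE) blast
  from assms(2) obtain \<alpha>' F' G' H' where h': "\<And>x y. coeff (Q x y) 0 = \<alpha>'" "\<And>x y. coeff (Q x y) (Suc 0) = 0"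
     "\<And>x y. coeff (Q x y) 2 = linear_form a F' x" "\<And>x y. coeff (Q x y) 3 = linear_form b G' y"
     "\<And>x y. coeff (Q x y) 5 = (\<Sum>\<rho><length L. H' \<rho> * (linear_form a (fst (L ! \<rho>)) x * linear_form b (snd (L ! \<rho>)) y))"
    by (rule bilinear_coeffsE) blast
  show ?thesis
    by (rule bilinear_coeffsI[where \<alpha>="\<alpha> + c * \<alpha>'" and F="\<lambda>i. 1 * F i + c * F' i" and G="\<lambda>i. 1 * G i + c * G' i"
          and H="\<lambda>i. H i + c * H' i"], unfold linear_form_add)
       (simp_all add: h h' distrib_right sum.distrib sum_distrib_left mult.assoc)
qed

lemma bilinear_coeffs_const: "bilinear_coeffs a b L (\<lambda>x y. [:q:])"
  by (rule bilinear_coeffsI[where \<alpha>=q and F="\<lambda>_. 0" and G="\<lambda>_. 0" and H="\<lambda>_. 0"])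
     (auto simp: numeral_eq_Suc)

lemma coeff_mult_small:
  fixes p q :: "rat poly"
  assumes "coeff p (Suc 0) = 0" "coeff q (Suc 0) = 0"
  shows "coeff (p * q) 0 = coeff p 0 * coeff q 0" "coeff (p * q) (Suc 0) = 0"
    "coeff (p * q) 2 = coeff p 0 * coeff q 2 + coeff q 0 * coeff p 2"
    "coeff (p * q) 3 = coeff p 0 * coeff q 3 + coeff q 0 * coeff p 3"
    "coeff (p * q) 5 = coeff p 0 * coeff q 5 + coeff q 0 * coeff p 5 + coeff p 2 * coeff q 3 + coeff q 2 * coeff p 3"
proof -
  have e: "{..(2::nat)} = {0,1,2}" "{..(3::nat)} = {0,1,2,3}" "{..(5::nat)} = {0,1,2,3,4,5}" "{..Suc 0} = {0,1}" by auto
  show "coeff (p * q) 0 = coeff p 0 * coeff q 0" "coeff (p * q) (Suc 0) = 0"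
    "coeff (p * q) 2 = coeff p 0 * coeff q 2 + coeff q 0 * coeff p 2"
    "coeff (p * q) 3 = coeff p 0 * coeff q 3 + coeff q 0 * coeff p 3"
    "coeff (p * q) 5 = coeff p 0 * coeff q 5 + coeff q 0 * coeff p 5 + coeff p 2 * coeff q 3 + coeff q 2 * coeff p 3"
    unfolding coeff_mult e using assms by (auto simp: mult.commute)
qed

text \<open>By \<open>coeff_mult_small\<close>, the degree 5 part of a product is a combination of
  the degree 5 parts of the factors plus two new products of a form in \<open>x\<close> and a form
  in \<open>y\<close>: the degree 2 part of either factor times the degree 3 part of the
  other.\<close>

lemma bilinear_coeffs_times:
  assumes "bilinear_coeffs a b L P" "bilinear_coeffs a b L Q"
  shows "\<exists>r1 r2. bilinear_coeffs a b (L @ [r1, r2]) (\<lambda>x y. P x y * Q x y)"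
proof -
  from assms(1) obtain \<alpha> F G H where h: "\<And>x y. coeff (P x y) 0 = \<alpha>" "\<And>x y. coeff (P x y) (Suc 0) = 0"
     "\<And>x y. coeff (P x y) 2 = linear_form a F x" "\<And>x y. coeff (P x y) 3 = linear_form b G y"
     "\<And>x y. coeff (P x y) 5 = (\<Sum>\<rho><length L. H \<rho> * (linear_form a (fst (L ! \<rho>)) x * linear_form b (snd (L ! \<rho>)) y))"
    by (rule bilinear_coeffsE) blast
  from assms(2) obtain \<alpha>' F' G' H' where h': "\<And>x y. coeff (Q x y) 0 = \<alpha>'" "\<And>x y. coeff (Q x y) (Suc 0) = 0"
     "\<And>x y. coeff (Q x y) 2 = linear_form a F' x" "\<And>x y. coeff (Q x y) 3 = linear_form b G' y"
     "\<And>x y. coeff (Q x y) 5 = (\<Sum>\<rho><length L. H' \<rho> * (linear_form a (fst (L ! \<rho>)) x * linear_form b (snd (L ! \<rho>)) y))"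
    by (rule bilinear_coeffsE) blast
  let ?L = "L @ [(F, G'), (F', G)]"
  let ?H = "\<lambda>\<rho>. if \<rho> < length L then \<alpha> * H' \<rho> + \<alpha>' * H \<rho> else 1"
  have s: "(\<Sum>\<rho><length ?L. ?H \<rho> * (linear_form a (fst (?L ! \<rho>)) x * linear_form b (snd (?L ! \<rho>)) y))
     = \<alpha> * coeff (Q x y) 5 + \<alpha>' * coeff (P x y) 5 + linear_form a F x * linear_form b G' y + linear_form a F' x * linear_form b G y" for x y
  proof -
    let ?l = "\<lambda>\<rho>. linear_form a (fst (L ! \<rho>)) x * linear_form b (snd (L ! \<rho>)) y"
    have "(\<Sum>\<rho><length L. ?H \<rho> * (linear_form a (fst (?L ! \<rho>)) x * linear_form b (snd (?L ! \<rho>)) y))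
       = (\<Sum>\<rho><length L. \<alpha> * (H' \<rho> * ?l \<rho>) + \<alpha>' * (H \<rho> * ?l \<rho>))"
      by (rule sum.cong) (auto simp: nth_append distrib_right mult.assoc)
    also have "\<dots> = \<alpha> * coeff (Q x y) 5 + \<alpha>' * coeff (P x y) 5"
      unfolding h(5) h'(5) by (simp add: sum.distrib sum_distrib_left)
    finally show ?thesis by (simp add: nth_append)
  qed
  have "bilinear_coeffs a b ?L (\<lambda>x y. P x y * Q x y)"
    by (rule bilinear_coeffsI[where \<alpha>="\<alpha> * \<alpha>'" and F="\<lambda>i. \<alpha> * F' i + \<alpha>' * F i" and G="\<lambda>i. \<alpha> * G' i + \<alpha>' * G i" and H="?H"],
        unfold linear_form_add s)
       (simp_all only: coeff_mult_small[OF h(2) h'(2)], simp_all only: h(1-4) h'(1-4))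
  then show ?thesis by blast
qed

definition slp_pinputs :: "nat => nat => (nat => rat) => (nat => rat) => rat poly list" where
  "slp_pinputs a b x y = map (\<lambda>t. if t < a then monom (x t) 2 else monom (y (t - a)) 3) [0..<a + b]"

lemma sum_single: "linear_form a (\<lambda>i. if i = t then 1 else 0) x = (if t < a then x t else (0::rat))"
proof -
  have "(\<Sum>i<a. (if i = t then 1 else 0) * x i) = (\<Sum>i<a. if i = t then x i else 0)" by (rule sum.cong) auto
  then show ?thesis by (simp add: linear_form_def)
qed

lemma bilinear_coeffs_input:
  assumes "t < a + b" shows "bilinear_coeffs a b L (\<lambda>x y. slp_pinputs a b x y ! t)"
proof (cases "t < a")
  case True
  then show ?thesis using assms unfolding slp_pinputs_def
    by (intro bilinear_coeffsI[where \<alpha>=0 and F="\<lambda>i. if i = t then 1 else 0" and G="\<lambda>_. 0" and H="\<lambda>_. 0"])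
       (auto simp: sum_single)
next
  case False
  then have "t - a < b" using assms by simp
  then show ?thesis using assms False unfolding slp_pinputs_def
    by (intro bilinear_coeffsI[where \<alpha>=0 and G="\<lambda>i. if i = t - a then 1 else 0" and F="\<lambda>_. 0" and H="\<lambda>_. 0"])
       (auto simp: sum_single)
qed

text \<open>Every instruction appends two products, those of \<open>bilinear_coeffs_times\<close> if
  it is a multiplication and two dummies otherwise. This keeps the count a function of the length
  alone.\<close>

lemma slp_bilinear:
  "slp_wf (a + b) is ==> \<exists>L. length L = 2 * length is \<and>
     (\<forall>t<a + b + length is. bilinear_coeffs a b L (\<lambda>x y. slp_prun is (slp_pinputs a b x y) ! t))"
proof (induction "is" rule: rev_induct)
  case Nil
  then show ?case using bilinear_coeffs_input[of _ a b "[]"] by auto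
next
  case (snoc c "is")
  then obtain L where L: "length L = 2 * length is"
    "\<And>t. t < a + b + length is ==> bilinear_coeffs a b L (\<lambda>x y. slp_prun is (slp_pinputs a b x y) ! t)"
    and leg: "slp_legal (a + b + length is) c" by (auto simp: slp_wf_snoc)
  have len: "length (slp_pinputs a b x y) = a + b" for x y by (simp add: slp_pinputs_def)
  have "\<exists>r1 r2. bilinear_coeffs a b (L @ [r1, r2]) (\<lambda>x y. slp_pvalue (slp_prun is (slp_pinputs a b x y)) c)"
  proof (cases c)
    case (Const q)
    then show ?thesis using bilinear_coeffs_const[of a b "L @ [(undefined, undefined), (undefined, undefined)]" q] by (auto intro!: exI)
  next
    case (Plus i j)
    then show ?thesis using leg bilinear_coeffs_lin[OF L(2) L(2), of i j 1]
      by (intro exI) (rule bilinear_coeffs_append, simp)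
  next
    case (Minus i j)
    then show ?thesis using leg bilinear_coeffs_lin[OF L(2) L(2), of i j "-1"]
      by (intro exI) (rule bilinear_coeffs_append, simp)
  next
    case (Times i j)
    then show ?thesis using leg bilinear_coeffs_times[OF L(2) L(2), of i j] by simp
  qed
  then obtain r1 r2 where r: "bilinear_coeffs a b (L @ [r1, r2]) (\<lambda>x y. slp_pvalue (slp_prun is (slp_pinputs a b x y)) c)"
    by blast
  show ?case
  proof (intro exI[of _ "L @ [r1, r2]"] conjI allI impI)
    fix t assume "t < a + b + length (is @ [c])"
    then consider "t < a + b + length is" | "t = a + b + length is" by fastforce
    then show "bilinear_coeffs a b (L @ [r1, r2]) (\<lambda>x y. slp_prun (is @ [c]) (slp_pinputs a b x y) ! t)"
    proof cases
      case 1
      then show ?thesis using bilinear_coeffs_append[OF L(2)[OF 1], of "[r1, r2]"]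
        by (simp add: slp_prun_snoc nth_append len)
    next
      case 2
      then show ?thesis using r by (simp add: slp_prun_snoc nth_append len)
    qed
  qed (use L in simp)
qed

section \<open>Matrix programs as bilinear identities\<close>

definition slp_inputs :: "nat => nat => (nat => rat) => (nat => rat) => rat list" where
  "slp_inputs a b x y = map (\<lambda>t. if t < a then x t else y (t - a)) [0..<a + b]"

lemma concat_rows:
  "concat (map (\<lambda>i. map (X i) [0..<q]) [0..<p]) = map (\<lambda>t. X (t div q) (t mod q)) [0..<p * q]"
proof (induction p)
  case (Suc p)
  have "map (\<lambda>t. X (t div q) (t mod q)) [p * q..<p * q + q] = map (X p) [0..<q]"
    by (rule nth_equalityI) auto
  then show ?case using Suc upt_add_eq_append[of 0 "p * q" q] by (simp add: add.commute)
qed simp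

lemma mm_inputs_eq:
  "mm_inputs p q r X Y = slp_inputs (p * q) (q * r) (\<lambda>t. X (t div q) (t mod q)) (\<lambda>t. Y (t div r) (t mod r))"
proof -
  have "map (\<lambda>t. if t < p * q then X (t div q) (t mod q) else Y ((t - p * q) div r) ((t - p * q) mod r)) [p * q..<p * q + q * r]
     = map (\<lambda>t. Y (t div r) (t mod r)) [0..<q * r]"
    by (rule nth_equalityI) auto
  moreover have "map (\<lambda>t. if t < p * q then X (t div q) (t mod q) else Y ((t - p * q) div r) ((t - p * q) mod r)) [0..<p * q]
     = map (\<lambda>t. X (t div q) (t mod q)) [0..<p * q]" by auto
  ultimately show ?thesis unfolding mm_inputs_def slp_inputs_def concat_rows upt_add_eq_append[of 0 "p * q" "q * r", simplified]
    by simp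
qed

lemma slp_multiplies_flat:
  assumes "slp_multiplies p q r is"
  obtains out where "slp_wf (p * q + q * r) is"
    "\<And>i k. i < p ==> k < r ==> out i k < p * q + q * r + length is"
    "\<And>i k x y. i < p ==> k < r ==>
       slp_run is (slp_inputs (p * q) (q * r) x y) ! out i k = (\<Sum>j<q. x (i * q + j) * y (j * r + k))"
proof -
  from assms obtain out where wf: "slp_wf (p * q + q * r) is" and out: "\<And>i k. i < p ==> k < r ==> out i k < p * q + q * r + length is"
     "\<And>i k X Y. i < p ==> k < r ==> slp_run is (mm_inputs p q r X Y) ! out i k = (\<Sum>j<q. X i j * Y j k)"
    unfolding slp_multiplies_def by blast
  have "slp_run is (slp_inputs (p * q) (q * r) x y) ! out i k = (\<Sum>j<q. x (i * q + j) * y (j * r + k))"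
    if "i < p" "k < r" for i k x y
  proof -
    have "mm_inputs p q r (\<lambda>i j. x (i * q + j)) (\<lambda>j k. y (j * r + k)) = slp_inputs (p * q) (q * r) x y"
      unfolding mm_inputs_eq by (simp add: slp_inputs_def)
    then show ?thesis using out(2)[OF that, of "\<lambda>i j. x (i * q + j)" "\<lambda>j k. y (j * r + k)"] by simp
  qed
  with wf out(1) that show ?thesis by blast
qed

text \<open>The program is correct for all inputs, so scaling the inputs by \<open>z ^ 2\<close> and
  \<open>z ^ 3\<close> multiplies an output by \<open>z ^ 5\<close>. The computed polynomial
  therefore agrees with a monomial at all rational points and equals it; the coefficient of the
  monomial is the entry of the matrix product.\<close>

lemma slp_multiplies_bilinear:
  assumes "slp_multiplies p q r is"
  shows "\<exists>U V W :: nat => nat => rat. \<forall>x y i k. i < p \<longrightarrow> k < r \<longrightarrow>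
      (\<Sum>\<rho><2 * length is. W (i * r + k) \<rho> * (\<Sum>t<p * q. U \<rho> t * x t) * (\<Sum>t<q * r. V \<rho> t * y t)) = (\<Sum>j<q. x (i * q + j) * y (j * r + k))"
proof -
  let ?a = "p * q" and ?b = "q * r"
  obtain out where wf: "slp_wf (?a + ?b) is" and out: "\<And>i k. i < p ==> k < r ==> out i k < ?a + ?b + length is"
    "\<And>i k x y. i < p ==> k < r ==> slp_run is (slp_inputs ?a ?b x y) ! out i k = (\<Sum>j<q. x (i * q + j) * y (j * r + k))"
    by (rule slp_multiplies_flat[OF assms]) blast
  from slp_bilinear[OF wf] obtain L where L: "length L = 2 * length is"
    "\<And>t. t < ?a + ?b + length is ==> bilinear_coeffs ?a ?b L (\<lambda>x y. slp_prun is (slp_pinputs ?a ?b x y) ! t)" by blast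
  have c5: "coeff (slp_prun is (slp_pinputs ?a ?b x y) ! out i k) 5 = (\<Sum>j<q. x (i * q + j) * y (j * r + k))"
    if ik: "i < p" "k < r" for i k x y
  proof -
    let ?P = "slp_prun is (slp_pinputs ?a ?b x y) ! out i k" and ?S = "\<Sum>j<q. x (i * q + j) * y (j * r + k)"
    have "poly ?P z = poly (monom ?S 5) z" for z
    proof -
      have len: "length (slp_pinputs ?a ?b x y) = ?a + ?b" by (simp add: slp_pinputs_def)
      have "poly ?P z = map (\<lambda>p. poly p z) (slp_prun is (slp_pinputs ?a ?b x y)) ! out i k"
        using out(1)[OF ik] len by simp
      also have "\<dots> = slp_run is (map (\<lambda>p. poly p z) (slp_pinputs ?a ?b x y)) ! out i k"
        using poly_slp_prun[of "slp_pinputs ?a ?b x y" "is" z] wf len by simp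
      also have "map (\<lambda>p. poly p z) (slp_pinputs ?a ?b x y) = slp_inputs ?a ?b (\<lambda>t. z\<^sup>2 * x t) (\<lambda>t. z ^ 3 * y t)"
        by (auto simp: slp_pinputs_def slp_inputs_def poly_monom mult.commute)
      also have "slp_run is \<dots> ! out i k = (\<Sum>j<q. (z\<^sup>2 * x (i * q + j)) * (z ^ 3 * y (j * r + k)))"
        by (rule out(2)[OF ik])
      also have "\<dots> = z ^ 5 * ?S" unfolding sum_distrib_left
        by (rule sum.cong) (auto simp: power_numeral_reduce algebra_simps)
      finally show ?thesis by (simp add: poly_monom mult.commute)
    qed
    then have "?P = monom ?S 5" by (simp add: poly_eq_poly_eq_iff[symmetric] fun_eq_iff)
    then show ?thesis by simp
  qed
  have "\<exists>W. \<forall>i<p. \<forall>k<r. \<forall>x y. coeff (slp_prun is (slp_pinputs ?a ?b x y) ! out i k) 5 =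
     (\<Sum>\<rho><length L. W (i * r + k) \<rho> * (linear_form ?a (fst (L ! \<rho>)) x * linear_form ?b (snd (L ! \<rho>)) y))"
  proof -
    have "\<exists>H. \<forall>x y. coeff (slp_prun is (slp_pinputs ?a ?b x y) ! out i k) 5 =
     (\<Sum>\<rho><length L. H \<rho> * (linear_form ?a (fst (L ! \<rho>)) x * linear_form ?b (snd (L ! \<rho>)) y))" if "i < p" "k < r" for i k
      by (insert L(2)[OF out(1)[OF that], unfolded bilinear_coeffs_def], elim exE, intro exI allI, drule spec, drule spec, elim conjE, assumption)
    note ex = this
    define H where "H i k = (SOME H. \<forall>x y. coeff (slp_prun is (slp_pinputs ?a ?b x y) ! out i k) 5 =
     (\<Sum>\<rho><length L. H \<rho> * (linear_form ?a (fst (L ! \<rho>)) x * linear_form ?b (snd (L ! \<rho>)) y)))" for i k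
    have H: "coeff (slp_prun is (slp_pinputs ?a ?b x y) ! out i k) 5 =
     (\<Sum>\<rho><length L. H i k \<rho> * (linear_form ?a (fst (L ! \<rho>)) x * linear_form ?b (snd (L ! \<rho>)) y))"
      if "i < p" "k < r" for i k x y
      using someI_ex[OF ex[OF that]] unfolding H_def by blast
    have dm: "(i * r + k) div r = i" "(i * r + k) mod r = k" if "k < r" for i k using that by auto
    show ?thesis by (rule exI[of _ "\<lambda>t. H (t div r) (t mod r)"]) (use H dm in auto)
  qed
  then obtain W where "\<And>i k x y. i < p ==> k < r ==> coeff (slp_prun is (slp_pinputs ?a ?b x y) ! out i k) 5 =
     (\<Sum>\<rho><length L. W (i * r + k) \<rho> * (linear_form ?a (fst (L ! \<rho>)) x * linear_form ?b (snd (L ! \<rho>)) y))" by blast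
  then show ?thesis using c5 L(1)
    by (intro exI[of _ "\<lambda>\<rho>. fst (L ! \<rho>)"] exI[of _ "\<lambda>\<rho>. snd (L ! \<rho>)"] exI[of _ W])
       (simp add: linear_form_def mult.assoc)
qed

section \<open>Lower and upper bounds on the length of matrix programs\<close>

fun slp_operands :: "slp_instr => nat set" where
  "slp_operands (Const q) = {}"
| "slp_operands (Plus i j) = {i, j}"
| "slp_operands (Minus i j) = {i, j}"
| "slp_operands (Times i j) = {i, j}"

lemma card_slp_operands: "card (\<Union>c\<in>set is. slp_operands c) \<le> 2 * length is"
proof -
  have "card (\<Union>c\<in>set is. slp_operands c) \<le> (\<Sum>c\<in>set is. card (slp_operands c))"
    by (rule card_UN_le) simp
  also have "\<dots> \<le> (\<Sum>c\<in>set is. 2)"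
  proof (rule sum_mono)
    fix c show "card (slp_operands c) \<le> 2" by (cases c) (auto simp: card_insert_if)
  qed
  also have "\<dots> \<le> 2 * length is" by (simp add: card_length)
  finally show ?thesis .
qed

lemma slp_run_unread:
  assumes "length vs = length vs'" "\<And>t. t < length vs ==> t \<noteq> pos ==> vs ! t = vs' ! t"
  shows "slp_wf (length vs) is ==> pos \<notin> (\<Union>c\<in>set is. slp_operands c) ==> pos < length vs ==>
    t < length vs + length is ==> t \<noteq> pos ==> slp_run is vs ! t = slp_run is vs' ! t"
proof (induction "is" arbitrary: t rule: rev_induct)
  case Nil
  then show ?case using assms by simp
next
  case (snoc c "is")
  have IH: "slp_run is vs ! t = slp_run is vs' ! t" if "t < length vs + length is" "t \<noteq> pos" for t
    using snoc that by (auto simp: slp_wf_snoc)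
  have "slp_legal (length vs + length is) c" "pos \<notin> slp_operands c" using snoc by (auto simp: slp_wf_snoc)
  then have "slp_value (slp_run is vs) c = slp_value (slp_run is vs') c"
    by (cases c) (auto intro!: arg_cong2[where f="(+)"] arg_cong2[where f="(-)"] arg_cong2[where f="(*)"] IH)
  then show ?case using IH snoc.prems assms(1) by (auto simp: slp_run_snoc nth_append)
qed

text \<open>Every entry of the right factor must be an operand of some instruction, because an
  output depends on it, and an instruction has at most two operands.\<close>

lemma slp_multiplies_lower_bound:
  assumes "slp_multiplies p q r is" "0 < p"
  shows "q * r \<le> 2 * length is"
proof -
  let ?a = "p * q" and ?b = "q * r"
  obtain out where wf: "slp_wf (?a + ?b) is" and out: "\<And>i k. i < p ==> k < r ==> out i k < ?a + ?b + length is"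
    "\<And>i k x y. i < p ==> k < r ==> slp_run is (slp_inputs ?a ?b x y) ! out i k = (\<Sum>j<q. x (i * q + j) * y (j * r + k))"
    by (rule slp_multiplies_flat[OF assms(1)]) blast
  have "?a + t \<in> (\<Union>c\<in>set is. slp_operands c)" if t: "t < ?b" for t
  proof (rule ccontr)
    assume no: "?a + t \<notin> (\<Union>c\<in>set is. slp_operands c)"
    define j k where "j = t div r" and "k = t mod r"
    have "r > 0" using t by (cases r) auto
    then have jk: "j < q" "k < r" "t = j * r + k" using t by (auto simp: j_def k_def less_mult_imp_div_less)
    define x :: "nat => rat" where "x i = (if i = j then 1 else 0)" for i
    define y :: "nat => rat" where "y i = (if i = t then 1 else 0)" for i
    have "(\<Sum>j'<q. x (0 * q + j') * y (j' * r + k)) = (\<Sum>j'<q. if j' = j then 1 else 0)"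
      by (rule sum.cong) (auto simp: x_def y_def jk)
    then have 1: "slp_run is (slp_inputs ?a ?b x y) ! out 0 k = 1" using out(2)[of 0 k x y] assms(2) jk by simp
    have 0: "slp_run is (slp_inputs ?a ?b x (\<lambda>_. 0)) ! out 0 k = 0" using out(2)[of 0 k x "\<lambda>_. 0"] assms(2) jk by simp
    \<comment> \<open>If the entry is never read, the output can depend on it only by being that
      very input cell. But then the output would be 1 for a zero left factor too.\<close>
    have "out 0 k = ?a + t"
    proof (rule ccontr)
      assume ne: "out 0 k \<noteq> ?a + t"
      have "slp_run is (slp_inputs ?a ?b x y) ! out 0 k = slp_run is (slp_inputs ?a ?b x (\<lambda>_. 0)) ! out 0 k"
        by (rule slp_run_unread[of _ _ "?a + t"])
           (use no ne wf t out(1)[of 0 k] assms(2) jk in \<open>auto simp: slp_inputs_def y_def\<close>)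
      then show False using 0 1 by simp
    qed
    then have "slp_run is (slp_inputs ?a ?b (\<lambda>_. 0) y) ! out 0 k = 1"
      using t by (simp add: slp_run_input slp_inputs_def y_def)
    moreover have "slp_run is (slp_inputs ?a ?b (\<lambda>_. 0) y) ! out 0 k = 0"
      using out(2)[of 0 k "\<lambda>_. 0" y] assms(2) jk by simp
    ultimately show False by simp
  qed
  then have "(\<lambda>t. ?a + t) ` {..<?b} \<subseteq> (\<Union>c\<in>set is. slp_operands c)" by auto
  moreover have "finite (slp_operands c)" for c by (cases c) auto
  ultimately have "card ((\<lambda>t. ?a + t) ` {..<?b}) \<le> card (\<Union>c\<in>set is. slp_operands c)" by (intro card_mono) auto
  also have "\<dots> \<le> 2 * length is" by (rule card_slp_operands)
  finally show ?thesis by (simp add: card_image)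
qed

lemma slp_dot_product:
  assumes "slp_wf l is" "\<And>t. t < q ==> a t < l \<and> b t < l"
  shows "\<exists>ext pos. slp_wf l (is @ ext) \<and> length ext \<le> 2 * q + 1 \<and> pos < l + length (is @ ext) \<and>
     (\<forall>vs. length vs = l \<longrightarrow> slp_run (is @ ext) vs ! pos = (\<Sum>t<q. vs ! a t * vs ! b t))"
  using assms(2)
proof (induction q)
  case 0
  show ?case
    by (rule exI[of _ "[Const 0]"], rule exI[of _ "l + length is"])
       (use assms(1) in \<open>auto simp: slp_wf_snoc slp_run_snoc nth_append\<close>)
next
  case (Suc q)
  from Suc.IH[OF Suc.prems, OF less_SucI] obtain ext pos where e: "slp_wf l (is @ ext)" "length ext \<le> 2 * q + 1" "pos < l + length (is @ ext)"
    "\<And>vs. length vs = l ==> slp_run (is @ ext) vs ! pos = (\<Sum>t<q. vs ! a t * vs ! b t)"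
    by blast
  let ?n = "l + length (is @ ext)"
  let ?i1 = "(is @ ext) @ [Times (a q) (b q)]"
  let ?is = "?i1 @ [Plus pos ?n]"
  have ab: "a q < l" "b q < l" using Suc.prems by auto
  have wf: "slp_wf l ?is" using e(1,3) ab by (auto simp: slp_wf_snoc simp del: append_assoc)
  have "slp_run ?is vs ! (?n + 1) = (\<Sum>t<Suc q. vs ! a t * vs ! b t)" if l: "length vs = l" for vs
  proof -
    have 1: "slp_run ?i1 vs = slp_run (is @ ext) vs @ [vs ! a q * vs ! b q]"
      unfolding slp_run_snoc using ab l by (simp add: slp_run_input)
    have "slp_run ?is vs ! (?n + 1) = slp_run ?i1 vs ! pos + slp_run ?i1 vs ! ?n"
      unfolding slp_run_snoc[of ?i1] using l by (simp add: nth_append)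
    also have "\<dots> = (\<Sum>t<q. vs ! a t * vs ! b t) + vs ! a q * vs ! b q"
      unfolding 1 using e(3) e(4)[OF l] l by (simp add: nth_append)
    finally show ?thesis by simp
  qed
  then show ?case using wf e(2)
    by (intro exI[of _ "ext @ [Times (a q) (b q), Plus pos ?n]"] exI[of _ "?n + 1"]) auto
qed

lemma slp_dot_products:
  assumes "\<And>T t. T < N ==> t < q ==> a T t < l \<and> b T t < l"
  shows "\<exists>is. slp_wf l is \<and> length is \<le> N * (2 * q + 1) \<and>
    (\<forall>T<N. \<exists>pos<l + length is. \<forall>vs. length vs = l \<longrightarrow> slp_run is vs ! pos = (\<Sum>t<q. vs ! a T t * vs ! b T t))"
  using assms
proof (induction N)
  case 0
  show ?case by (rule exI[of _ "[]"]) auto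
next
  case (Suc N)
  from Suc.IH[OF Suc.prems, OF less_SucI] obtain "is" where i: "slp_wf l is" "length is \<le> N * (2 * q + 1)"
    "\<And>T. T<N ==> \<exists>pos<l + length is. \<forall>vs. length vs = l \<longrightarrow> slp_run is vs ! pos = (\<Sum>t<q. vs ! a T t * vs ! b T t)"
    by blast
  from slp_dot_product[OF i(1), of q "a N" "b N"] Suc.prems obtain ext pos where
    e: "slp_wf l (is @ ext)" "length ext \<le> 2 * q + 1" "pos < l + length (is @ ext)"
     "\<forall>vs. length vs = l \<longrightarrow> slp_run (is @ ext) vs ! pos = (\<Sum>t<q. vs ! a N t * vs ! b N t)" by blast
  show ?case
  proof (intro exI[of _ "is @ ext"] conjI allI impI)
    fix T assume "T < Suc N"
    then consider "T < N" | "T = N" by linarith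
    then show "\<exists>pos<l + length (is @ ext). \<forall>vs. length vs = l \<longrightarrow> slp_run (is @ ext) vs ! pos = (\<Sum>t<q. vs ! a T t * vs ! b T t)"
    proof cases
      case 1
      from i(3)[OF 1] obtain pos' where p: "pos' < l + length is"
        "\<forall>vs. length vs = l \<longrightarrow> slp_run is vs ! pos' = (\<Sum>t<q. vs ! a T t * vs ! b T t)" by blast
      show ?thesis by (rule exI[of _ pos']) (use p in \<open>simp add: slp_run_append_nth\<close>)
    qed (use e in blast)
  qed (use i e in auto)
qed

text \<open>Serves to show that the exponent 3 is admissible, so that the infimum in
  \<open>mm_exponent\<close> is taken over a nonempty set.\<close>

lemma slp_multiplies_schoolbook:
  "\<exists>is. slp_multiplies p q r is \<and> length is \<le> p * r * (2 * q + 1)"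
proof -
  let ?l = "p * q + q * r"
  have lt: "(T div r) * q + t < ?l \<and> p * q + (t * r + T mod r) < ?l" if "T < p * r" "t < q" for T t
  proof
    have r: "r > 0" using that by (cases r) auto
    have "T div r < p" using that by (simp add: less_mult_imp_div_less)
    then have "(T div r + 1) * q \<le> p * q" by (intro mult_le_mono1) simp
    then show "(T div r) * q + t < ?l" using that by simp
    have "(t + 1) * r \<le> q * r" using that by (intro mult_le_mono1) simp
    then show "p * q + (t * r + T mod r) < ?l" using mod_less_divisor[OF r, of T] by simp
  qed
  from slp_dot_products[of "p * r" q "\<lambda>T t. (T div r) * q + t" ?l "\<lambda>T t. p * q + (t * r + T mod r)", OF lt]
  obtain "is" where i: "slp_wf ?l is" "length is \<le> p * r * (2 * q + 1)"
    and ex: "\<forall>T<p * r. \<exists>pos<?l + length is. \<forall>vs. length vs = ?l \<longrightarrow>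
       slp_run is vs ! pos = (\<Sum>t<q. vs ! ((T div r) * q + t) * vs ! (p * q + (t * r + T mod r)))" by blast
  define pos where "pos T = (SOME pos. pos < ?l + length is \<and> (\<forall>vs. length vs = ?l \<longrightarrow>
       slp_run is vs ! pos = (\<Sum>t<q. vs ! ((T div r) * q + t) * vs ! (p * q + (t * r + T mod r)))))" for T
  have "pos T < ?l + length is \<and> (\<forall>vs. length vs = ?l \<longrightarrow>
       slp_run is vs ! pos T = (\<Sum>t<q. vs ! ((T div r) * q + t) * vs ! (p * q + (t * r + T mod r))))" if "T < p * r" for T
    using someI_ex[OF ex[rule_format, OF that]] unfolding pos_def .
  then have pos: "\<And>T. T < p * r ==> pos T < ?l + length is"
    "\<And>T vs. T < p * r ==> length vs = ?l ==>
       slp_run is vs ! pos T = (\<Sum>t<q. vs ! ((T div r) * q + t) * vs ! (p * q + (t * r + T mod r)))" by simp_all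
  have "slp_multiplies p q r is"
    unfolding slp_multiplies_def
  proof (intro conjI exI[of _ "\<lambda>i k. pos (i * r + k)"] allI impI i(1))
    fix i k assume ik: "i < p" "k < r"
    have "(i + 1) * r \<le> p * r" using ik by (intro mult_le_mono1) simp
    then have T: "i * r + k < p * r" using ik by simp
    then show "pos (i * r + k) < ?l + length is" by (rule pos)
    fix X Y
    have len: "length (mm_inputs p q r X Y) = ?l" by (simp add: mm_inputs_eq slp_inputs_def)
    have "slp_run is (mm_inputs p q r X Y) ! pos (i * r + k) =
      (\<Sum>t<q. mm_inputs p q r X Y ! (i * q + t) * mm_inputs p q r X Y ! (p * q + (t * r + k)))"
      using pos(2)[OF T len] ik by simp
    also have "\<dots> = (\<Sum>j<q. X i j * Y j k)"
    proof (rule sum.cong)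
      fix t assume "t \<in> {..<q}"
      then have t: "t < q" by simp
      have "i * q + t < p * q" "t * r + k < q * r"
      proof -
        have "(i + 1) * q \<le> p * q" "(t + 1) * r \<le> q * r"
          using mult_le_mono1[of "i + 1" p q] mult_le_mono1[of "t + 1" q r] ik t by simp_all
        then show "i * q + t < p * q" "t * r + k < q * r" using ik t by auto
      qed
      then show "mm_inputs p q r X Y ! (i * q + t) * mm_inputs p q r X Y ! (p * q + (t * r + k)) = X i t * Y t k"
        using t ik by (simp add: mm_inputs_eq slp_inputs_def)
    qed simp
    finally show "slp_run is (mm_inputs p q r X Y) ! pos (i * r + k) = (\<Sum>j<q. X i j * Y j k)" .
  qed
  with i show ?thesis by blast
qed

section \<open>A fixed integer bilinear algorithm close to the exponent\<close>

lemma power_ceil_le: "0 \<le> \<sigma> ==> \<sigma> \<le> 1 ==> 1 \<le> n ==> power_ceil n \<sigma> \<le> n"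
proof -
  assume a: "0 \<le> \<sigma>" "\<sigma> \<le> 1" "1 \<le> n"
  have "real n powr \<sigma> \<le> real n powr 1" using a by (intro powr_mono) auto
  moreover have "real n powr 1 = real n" using a by simp
  ultimately have "real n powr \<sigma> \<le> of_int (int n)" by linarith
  then have "\<lceil>real n powr \<sigma>\<rceil> \<le> int n" by (simp only: ceiling_le_iff)
  then show ?thesis unfolding power_ceil_def by linarith
qed

lemma power_ceil_pos: "1 \<le> n ==> 1 \<le> power_ceil n \<sigma>"
proof -
  assume "1 \<le> n"
  then have "0 < real n powr \<sigma>" by simp
  then have "0 < \<lceil>real n powr \<sigma>\<rceil>" by (simp only: zero_less_ceiling)
  then show ?thesis unfolding power_ceil_def by linarith
qed

lemma common_denominator:
  fixes S :: "rat set"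
  assumes "finite S"
  shows "\<exists>d::int. 0 < d \<and> (\<forall>x\<in>S. \<exists>z. of_int d * x = of_int z)"
  using assms
proof (induction S)
  case empty
  show ?case by (rule exI[of _ 1]) auto
next
  case (insert x S)
  then obtain d where d: "0 < d" "\<forall>x\<in>S. \<exists>z. of_int d * x = of_int z" by auto
  obtain a b where x: "x = of_int a / of_int b" "0 < b" by (metis Fract_of_int_quotient Rat_cases)
  have "\<exists>z. of_int (d * b) * y = (of_int z :: rat)" if y: "y \<in> S" for y
  proof -
    obtain z where "of_int d * y = of_int z" using d y by blast
    then have "of_int (d * b) * y = of_int (z * b)" by (simp add: mult_ac)
    then show ?thesis by blast
  qed
  moreover have "of_int (d * b) * x = (of_int (d * a) :: rat)" using x by simp
  ultimately show ?case using d x by (intro exI[of _ "d * b"]) (auto, metis of_int_mult)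
qed

text \<open>Recursion of depth \<open>k\<close> raises the constant factor of the family of programs
  to the power \<open>k\<close>, which is harmless once that constant is at most
  \<open>q powr \<eta>\<close>. The condition \<open>q ^ (k - 1) < n\<close> is that of the least
  \<open>k\<close> with \<open>n \<le> q ^ k\<close>: all levels but one are paid by
  \<open>n\<close>, and the surplus level by the constant \<open>C\<close>, which is
  \<open>R\<close>.\<close>

lemma mm_algorithm:
  fixes \<sigma> \<delta> :: real
  assumes \<sigma>: "0 \<le> \<sigma>" "\<sigma> \<le> 1" and \<delta>: "0 < \<delta>"
  obtains p q R :: nat and U V W :: "nat => nat => int" and D :: int and C :: real where
    "2 \<le> q" "p = power_ceil q \<sigma>" "1 \<le> D" "q * q \<le> R" "0 < C"
    "\<And>x y i k. i < p ==> k < q ==>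
      (\<Sum>\<rho><R. W (i * q + k) \<rho> * (\<Sum>t<p * q. U \<rho> t * x t) * (\<Sum>t<q * q. V \<rho> t * y t)) = D * (\<Sum>j<q. x (i * q + j) * y (j * q + k))"
    "\<And>n k. 1 \<le> k ==> q ^ (k - 1) < n ==> real (R ^ k) \<le> C * real n powr (mm_exponent \<sigma> + \<delta>)"
proof -
  let ?T = "{\<tau>. \<exists>c. \<forall>n\<ge>1. \<exists>is. slp_multiplies (power_ceil n \<sigma>) n n is \<and> real (length is) \<le> c * real n powr \<tau>}"
  have "3 \<in> ?T"
  proof (intro CollectI exI[of _ 3] allI impI)
    fix n :: nat assume n: "1 \<le> n"
    from slp_multiplies_schoolbook[of "power_ceil n \<sigma>" n n] obtain "is" where
      i: "slp_multiplies (power_ceil n \<sigma>) n n is" "length is \<le> power_ceil n \<sigma> * n * (2 * n + 1)" by blast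
    have "length is \<le> n * n * (3 * n)"
      by (rule order_trans[OF i(2)]) (intro mult_le_mono power_ceil_le \<sigma> n; use n in simp)
    then have "real (length is) \<le> real (3 * n ^ 3)" unfolding of_nat_le_iff by (simp add: power3_eq_cube)
    also have "\<dots> = 3 * real n powr 3" using n by (simp add: powr_numeral)
    finally show "\<exists>is. slp_multiplies (power_ceil n \<sigma>) n n is \<and> real (length is) \<le> 3 * real n powr 3" using i by blast
  qed
  then have ne: "?T \<noteq> {}" by (metis (no_types, lifting) empty_iff)
  have lt: "Inf ?T < mm_exponent \<sigma> + \<delta> / 2" using \<delta> by (simp add: mm_exponent_def)
  obtain \<tau> where \<tau>: "\<tau> \<in> ?T" "\<tau> < mm_exponent \<sigma> + \<delta> / 2"
    using cInf_lessD[OF ne lt] by (elim bexE) (rule that)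
  then obtain c where c: "\<And>n. 1 \<le> n ==> \<exists>is. slp_multiplies (power_ceil n \<sigma>) n n is \<and> real (length is) \<le> c * real n powr \<tau>" by blast
  have lower: "real n ^ 2 \<le> 2 * c * real n powr \<tau>" if "1 \<le> n" for n
  proof -
    from c[OF that] obtain "is" where i: "slp_multiplies (power_ceil n \<sigma>) n n is" "real (length is) \<le> c * real n powr \<tau>" by blast
    from slp_multiplies_lower_bound[OF i(1)] power_ceil_pos[OF that, of \<sigma>] have "n * n \<le> 2 * length is" by simp
    then have "real n ^ 2 \<le> 2 * real (length is)" by (simp add: power2_eq_square flip: of_nat_mult of_nat_le_iff)
    then show ?thesis using i by simp
  qed
  have c1: "1 \<le> 2 * c" using lower[of 1] by simp
  \<comment> \<open>A negative exponent would contradict the quadratic lower bound for large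
    \<open>n\<close>. The sign matters later, when a power of \<open>q ^ (k - 1)\<close> is compared
    with the same power of \<open>n\<close>.\<close>
  have "0 \<le> \<tau>"
  proof (rule ccontr)
    assume "\<not> 0 \<le> \<tau>"
    obtain n :: nat where n: "2 * c < real n" "1 \<le> n" using reals_Archimedean2[of "max 1 (2 * c)"] by fastforce
    have "real n powr \<tau> \<le> real n powr 0" using n \<open>\<not> 0 \<le> \<tau>\<close> by (intro powr_mono) auto
    then have "2 * c * real n powr \<tau> \<le> 2 * c * 1" using c1 n by (intro mult_left_mono) auto
    with lower[OF n(2)] have "real n ^ 2 \<le> 2 * c" by simp
    moreover have "real n * 1 \<le> real n * real n" using n by (intro mult_left_mono) auto
    ultimately show False using n(1) unfolding power2_eq_square by linarith
  qed
  define \<eta> where "\<eta> = \<delta> / 2"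
  have \<eta>: "0 < \<eta>" using \<delta> by (simp add: \<eta>_def)
  \<comment> \<open>This choice makes \<open>2 * c\<close> at most \<open>q powr \<eta>\<close>; the
    2 accounts for the two products per instruction.\<close>
  obtain q0 :: nat where q0: "(2 * c) powr (1 / \<eta>) < real q0" using reals_Archimedean2 by blast
  define q where "q = max 2 q0"
  have q2: "2 \<le> q" by (simp add: q_def)
  have "((2 * c) powr (1 / \<eta>)) powr \<eta> \<le> real q powr \<eta>" using q0 \<eta> by (intro powr_mono2) (auto simp: q_def)
  then have qe: "2 * c \<le> real q powr \<eta>" using c1 \<eta> by (simp add: powr_powr)
  define p where "p = power_ceil q \<sigma>"
  from c[of q] q2 obtain "is" where i: "slp_multiplies p q q is" "real (length is) \<le> c * real q powr \<tau>" by (auto simp: p_def)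
  define R where "R = 2 * length is"
  have p1: "1 \<le> p" using power_ceil_pos[of q \<sigma>] q2 by (simp add: p_def)
  have R: "q * q \<le> R" using slp_multiplies_lower_bound[OF i(1)] p1 by (simp add: R_def)
  from slp_multiplies_bilinear[OF i(1), folded R_def] obtain U V W :: "nat => nat => rat" where
    "\<forall>x y i k. i < p \<longrightarrow> k < q \<longrightarrow>
      (\<Sum>\<rho><R. W (i * q + k) \<rho> * (\<Sum>t<p * q. U \<rho> t * x t) * (\<Sum>t<q * q. V \<rho> t * y t)) = (\<Sum>j<q. x (i * q + j) * y (j * q + k))"
    by (elim exE) (rule that)
  note UVW = this[rule_format]
  let ?S = "(\<lambda>(a, b). U a b) ` ({..<R} \<times> {..<p * q}) \<union> (\<lambda>(a, b). V a b) ` ({..<R} \<times> {..<q * q}) \<union> (\<lambda>(a, b). W a b) ` ({..<p * q} \<times> {..<R})"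
  have "finite ?S" by auto
  from common_denominator[OF this] obtain d where d: "0 < d" "\<And>x. x \<in> ?S ==> \<exists>z. of_int d * x = of_int z" by auto
  define cv where "cv x = \<lfloor>of_int d * x\<rfloor>" for x :: rat
  have cv: "of_int (cv x) = of_int d * x" if "x \<in> ?S" for x using d(2)[OF that] by (auto simp: cv_def)
  have cvU: "of_int (cv (U a b)) = of_int d * U a b" if "a < R" "b < p * q" for a b
    by (rule cv) (use that in auto)
  have cvV: "of_int (cv (V a b)) = of_int d * V a b" if "a < R" "b < q * q" for a b
    by (rule cv) (use that in auto)
  have cvW: "of_int (cv (W a b)) = of_int d * W a b" if "b < R" "a < p * q" for a b
    by (rule cv) (use that in auto)
  \<comment> \<open>Each of the three tables is scaled by \<open>d\<close>, hence the factor
    \<open>d ^ 3\<close>.\<close>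
  have id: "(\<Sum>\<rho><R. cv (W (i * q + k) \<rho>) * (\<Sum>t<p * q. cv (U \<rho> t) * x t) * (\<Sum>t<q * q. cv (V \<rho> t) * y t)) = d ^ 3 * (\<Sum>j<q. x (i * q + j) * y (j * q + k))"
    if ik: "i < p" "k < q" for x y i k
  proof -
    have "(i + 1) * q \<le> p * q" using ik by (intro mult_le_mono1) simp
    then have lt: "i * q + k < p * q" using ik by simp
    have "(of_int (\<Sum>\<rho><R. cv (W (i * q + k) \<rho>) * (\<Sum>t<p * q. cv (U \<rho> t) * x t) * (\<Sum>t<q * q. cv (V \<rho> t) * y t)) :: rat)
      = (\<Sum>\<rho><R. of_int d * W (i * q + k) \<rho> * (\<Sum>t<p * q. of_int d * U \<rho> t * of_int (x t)) * (\<Sum>t<q * q. of_int d * V \<rho> t * of_int (y t)))"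
      using lt by (simp add: cvU cvV cvW)
    also have "\<dots> = of_int d ^ 3 * (\<Sum>\<rho><R. W (i * q + k) \<rho> * (\<Sum>t<p * q. U \<rho> t * of_int (x t)) * (\<Sum>t<q * q. V \<rho> t * of_int (y t)))"
      unfolding sum_distrib_left[of "of_int d ^ 3"]
      by (rule sum.cong) (auto simp: mult.assoc sum_distrib_left[symmetric] power3_eq_cube)
    also have "\<dots> = of_int (d ^ 3 * (\<Sum>j<q. x (i * q + j) * y (j * q + k)))" unfolding UVW[OF ik] by simp
    finally show ?thesis by (simp only: of_int_eq_iff)
  qed
  have Rb: "real R \<le> real q powr (\<tau> + \<eta>)"
  proof -
    have "real R \<le> 2 * c * real q powr \<tau>" using i by (simp add: R_def)
    also have "\<dots> \<le> real q powr \<eta> * real q powr \<tau>" using qe by (intro mult_right_mono) auto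
    also have "\<dots> = real q powr (\<tau> + \<eta>)" by (simp add: powr_add)
    finally show ?thesis .
  qed
  have bound: "real (R ^ k) \<le> real R * real n powr (mm_exponent \<sigma> + \<delta>)" if k: "1 \<le> k" "q ^ (k - 1) < n" for n k
  proof -
    have n1: "1 \<le> n" using k by simp
    have "real (R ^ k) = real R * real R ^ (k - 1)" using k by (cases k) auto
    also have "real R ^ (k - 1) \<le> (real q powr (\<tau> + \<eta>)) ^ (k - 1)" using Rb by (intro power_mono) auto
    also have "\<dots> = (real q ^ (k - 1)) powr (\<tau> + \<eta>)" using q2 by (simp add: powr_powr mult.commute flip: powr_realpow)
    also have "\<dots> \<le> real n powr (\<tau> + \<eta>)" using k \<open>0 \<le> \<tau>\<close> \<eta>
      by (intro powr_mono2) (auto simp flip: of_nat_power)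
    also have "\<dots> \<le> real n powr (mm_exponent \<sigma> + \<delta>)" using \<tau>(2) n1 by (intro powr_mono) (auto simp: \<eta>_def)
    finally show ?thesis by (simp add: mult_left_mono)
  qed
  have "0 < real R" using R q2 by (cases R) auto
  moreover have "1 \<le> d ^ 3" using d(1) by simp
  ultimately show ?thesis
    using that[of q p "d ^ 3" R "real R" "\<lambda>a b. cv (W a b)" "\<lambda>a b. cv (U a b)" "\<lambda>a b. cv (V a b)"] q2 R id bound
    by (simp add: p_def)
qed

section \<open>Recursive matrix products and approximate min-plus products\<close>

text \<open>One level of recursion for a whole batch of matrices. The new batch index has the parent
  as its quotient by \<open>R\<close> and the number of the linear form as its remainder. The low
  digits of row and column, to the bases \<open>p\<close> and \<open>q\<close>, select the entry of
  the small matrix to which the form is applied; the high digits are the position in the smaller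
  matrix that results.\<close>

definition fwd :: "nat => nat => nat => (nat => nat => int) => (nat => nat => nat => int) => nat => nat => nat => int" where
  "fwd p q R U x a i j = (\<Sum>c<p * q. U (a mod R) c * x (a div R) (c div q + p * i) (c mod q + q * j))"

text \<open>The opposite level: the batch shrinks by the factor \<open>R\<close>, and row and column
  regain their low digits.\<close>

definition bwd :: "nat => nat => nat => (nat => nat => int) => (nat => nat => nat => int) => nat => nat => nat => int" where
  "bwd p q R W z a i v = (\<Sum>\<rho><R. W ((i mod p) * q + v mod q) \<rho> * z (a * R + \<rho>) (i div p) (v div q))"

lemma sum_digits:
  fixes f :: "nat => int"
  shows "(\<Sum>j<Q. \<Sum>e<q. f (e + q * j)) = (\<Sum>j<q * Q. f j)"
proof (induction Q)
  case (Suc Q)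
  have "(\<Sum>j<q * Suc Q. f j) = (\<Sum>j<q * Q. f j) + (\<Sum>e<q. f (e + q * Q))"
    using sum.atLeastLessThan_concat[of 0 "q * Q" "q * Q + q" f] sum.shift_bounds_nat_ivl[of f 0 "q * Q" q]
    by (simp add: atLeast0LessThan add.commute)
  then show ?case using Suc by simp
qed simp

text \<open>For fixed rows and columns, the identity is applied once for every high digit
  \<open>j\<close> of the summation index, and \<open>sum_digits\<close> reassembles that index from
  its two digits.\<close>

lemma bilinear_step:
  assumes alg: "\<And>x y i k. i < p ==> k < q ==>
      (\<Sum>\<rho><R. W (i * q + k) \<rho> * (\<Sum>t<p * q. U \<rho> t * x t) * (\<Sum>t<q * q. V \<rho> t * y t)) = D * (\<Sum>j<q. x (i * q + j) * y (j * q + k))"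
    and z: "\<And>\<rho> i v. \<rho> < R ==> i < P ==> v < Q ==>
      z (a * R + \<rho>) i v = E * (\<Sum>j<Q. fwd p q R U x (a * R + \<rho>) i j * fwd q q R V y (a * R + \<rho>) j v)"
    and i: "i < p * P" and v: "v < q * Q"
  shows "bwd p q R W z a i v = D * E * (\<Sum>j<q * Q. x a i j * y a j v)"
proof -
  have pq: "0 < p" "0 < q" using i v by (auto intro: gr0I)
  define i0 i1 v0 v1 where "i0 = i mod p" and "i1 = i div p" and "v0 = v mod q" and "v1 = v div q"
  have iv: "i0 < p" "i1 < P" "v0 < q" "v1 < Q" "i = i0 + p * i1" "v = v0 + q * v1"
    using pq i v by (auto simp: i0_def i1_def v0_def v1_def less_mult_imp_div_less mult.commute)
  define X where "X j c = x a (c div q + p * i1) (c mod q + q * j)" for j c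
  define Y where "Y j c = y a (c div q + q * j) (c mod q + q * v1)" for j c
  have "bwd p q R W z a i v = (\<Sum>\<rho><R. W (i0 * q + v0) \<rho> * (E * (\<Sum>j<Q. (\<Sum>c<p * q. U \<rho> c * X j c) * (\<Sum>c<q * q. V \<rho> c * Y j c))))"
    unfolding bwd_def i0_def[symmetric] v0_def[symmetric] i1_def[symmetric] v1_def[symmetric]
    by (rule sum.cong) (auto simp: z iv fwd_def X_def Y_def)
  also have "\<dots> = E * (\<Sum>\<rho><R. \<Sum>j<Q. W (i0 * q + v0) \<rho> * (\<Sum>c<p * q. U \<rho> c * X j c) * (\<Sum>c<q * q. V \<rho> c * Y j c))"
  proof -
    have "w * (E * (\<Sum>j<Q. f j * g j)) = E * (\<Sum>j<Q. w * f j * g j)" for w and f g :: "nat => int"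
      by (simp add: sum_distrib_left mult_ac)
    then show ?thesis unfolding sum_distrib_left[of E] by simp
  qed
  also have "\<dots> = E * (\<Sum>j<Q. \<Sum>\<rho><R. W (i0 * q + v0) \<rho> * (\<Sum>c<p * q. U \<rho> c * X j c) * (\<Sum>c<q * q. V \<rho> c * Y j c))"
    by (subst sum.swap) simp
  also have "\<dots> = E * (\<Sum>j<Q. D * (\<Sum>e<q. X j (i0 * q + e) * Y j (e * q + v0)))"
    using alg[OF iv(1,3)] by simp
  also have "\<dots> = E * (\<Sum>j<Q. D * (\<Sum>e<q. x a i (e + q * j) * y a (e + q * j) v))"
    using iv by (auto simp: X_def Y_def intro!: sum.cong)
  also have "\<dots> = D * E * (\<Sum>j<Q. \<Sum>e<q. x a i (e + q * j) * y a (e + q * j) v)"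
    by (simp add: sum_distrib_left mult.assoc mult.left_commute)
  also have "\<dots> = D * E * (\<Sum>j<q * Q. x a i j * y a j v)"
    by (subst sum_digits) simp
  finally show ?thesis .
qed

definition fwds :: "nat => nat => nat => (nat => nat => int) => nat => (nat => nat => nat => int) => nat => nat => nat => int" where
  "fwds p q R U l x = (fwd p q R U ^^ l) x"

definition bwds :: "nat => nat => nat => (nat => nat => int) => nat => (nat => nat => nat => int) => nat => nat => nat => int" where
  "bwds p q R W l z = (bwd p q R W ^^ l) z"

lemma fwds_0 [simp]: "fwds p q R U 0 x = x" by (simp add: fwds_def)
lemma fwds_Suc: "fwds p q R U (Suc l) x = fwd p q R U (fwds p q R U l x)" by (simp add: fwds_def)
lemma bwds_0 [simp]: "bwds p q R U 0 x = x" by (simp add: bwds_def)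
lemma bwds_Suc: "bwds p q R U (Suc l) x = bwd p q R U (bwds p q R U l x)" by (simp add: bwds_def)

text \<open>Induction starting at the leaves, where the matrices are single numbers: after
  \<open>l\<close> backward levels the batch consists of the products of the matrices that were
  present after \<open>k - l\<close> forward levels, each with the factor
  \<open>D ^ l\<close>.\<close>

lemma fast_matrix_product:
  fixes x y :: "nat => nat => nat => int" and k :: nat
  assumes alg: "\<And>x y i k. i < p ==> k < q ==>
      (\<Sum>\<rho><R. W (i * q + k) \<rho> * (\<Sum>t<p * q. U \<rho> t * x t) * (\<Sum>t<q * q. V \<rho> t * y t)) = D * (\<Sum>j<q. x (i * q + j) * y (j * q + k))"
  defines "z \<equiv> \<lambda>a i v. fwds p q R U k x a i v * fwds q q R V k y a i v"
  shows "l \<le> k ==> i < p ^ l ==> v < q ^ l ==>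
    bwds p q R W l z a i v = D ^ l * (\<Sum>j<q ^ l. fwds p q R U (k - l) x a i j * fwds q q R V (k - l) y a j v)"
proof (induction l arbitrary: a i v)
  case 0
  then show ?case by (simp add: z_def)
next
  case (Suc l)
  have k: "k - l = Suc (k - Suc l)" using Suc.prems by simp
  have "bwd p q R W (bwds p q R W l z) a i v =
     D * D ^ l * (\<Sum>j<q * q ^ l. fwds p q R U (k - Suc l) x a i j * fwds q q R V (k - Suc l) y a j v)"
  proof (rule bilinear_step[OF alg])
    fix \<rho> i v assume "\<rho> < R" "i < p ^ l" "v < q ^ l"
    then show "bwds p q R W l z (a * R + \<rho>) i v =
      D ^ l * (\<Sum>j<q ^ l. fwd p q R U (fwds p q R U (k - Suc l) x) (a * R + \<rho>) i j *
         fwd q q R V (fwds q q R V (k - Suc l) y) (a * R + \<rho>) j v)"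
      using Suc.IH[of i v "a * R + \<rho>"] Suc.prems unfolding k fwds_Suc by simp
  qed (use Suc.prems in auto)
  then show ?case by (simp add: bwds_Suc)
qed

section \<open>Growth of the entries during the recursion\<close>

lemma fwd_bound:
  assumes "\<And>a b. \<bar>U a b\<bar> \<le> c" "0 \<le> X" "\<And>a i j. \<bar>x a i j\<bar> \<le> X"
  shows "\<bar>fwd p q R U x a i j\<bar> \<le> (int (p * q) * c) * X"
proof -
  have c: "0 \<le> c" using assms(1)[of 0 0] by simp
  have "\<bar>fwd p q R U x a i j\<bar> \<le> (\<Sum>t<p * q. \<bar>U (a mod R) t * x (a div R) (t div q + p * i) (t mod q + q * j)\<bar>)"
    unfolding fwd_def by (rule sum_abs)
  also have "\<dots> \<le> (\<Sum>t<p * q. c * X)"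
    unfolding abs_mult using assms c by (intro sum_mono mult_mono) auto
  finally show ?thesis by (simp add: mult.assoc)
qed

lemma fwds_bound:
  assumes "\<And>a b. \<bar>U a b\<bar> \<le> c" "0 \<le> X" "\<And>a i j. \<bar>x a i j\<bar> \<le> X"
  shows "\<bar>fwds p q R U l x a i j\<bar> \<le> (int (p * q) * c) ^ l * X"
proof (induction l arbitrary: a i j)
  case (Suc l)
  have c: "0 \<le> c" using assms(1)[of 0 0] by simp
  have "\<bar>fwds p q R U (Suc l) x a i j\<bar> \<le> int (p * q) * c * ((int (p * q) * c) ^ l * X)"
    unfolding fwds_Suc by (rule fwd_bound[OF assms(1)]) (use Suc c assms in auto)
  then show ?case by (simp add: mult.assoc)
qed (use assms in simp)

lemma bwd_bound:
  assumes "\<And>a b. \<bar>W a b\<bar> \<le> c" "0 \<le> X" "\<And>a i j. \<bar>x a i j\<bar> \<le> X"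
  shows "\<bar>bwd p q R W x a i j\<bar> \<le> (int R * c) * X"
proof -
  have c: "0 \<le> c" using assms(1)[of 0 0] by simp
  have "\<bar>bwd p q R W x a i j\<bar> \<le> (\<Sum>\<rho><R. \<bar>W ((i mod p) * q + j mod q) \<rho> * x (a * R + \<rho>) (i div p) (j div q)\<bar>)"
    unfolding bwd_def by (rule sum_abs)
  also have "\<dots> \<le> (\<Sum>t<R. c * X)"
    unfolding abs_mult using assms c by (intro sum_mono mult_mono) auto
  finally show ?thesis by (simp add: mult.assoc)
qed

lemma bwds_bound:
  assumes "\<And>a b. \<bar>W a b\<bar> \<le> c" "0 \<le> X" "\<And>a i j. \<bar>x a i j\<bar> \<le> X"
  shows "\<bar>bwds p q R W l x a i j\<bar> \<le> (int R * c) ^ l * X"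
proof (induction l arbitrary: a i j)
  case (Suc l)
  have c: "0 \<le> c" using assms(1)[of 0 0] by simp
  have "\<bar>bwds p q R W (Suc l) x a i j\<bar> \<le> int R * c * ((int R * c) ^ l * X)"
    unfolding bwds_Suc by (rule bwd_bound[OF assms(1)]) (use Suc c assms in auto)
  then show ?case by (simp add: mult.assoc)
qed (use assms in simp)

section \<open>Rounding to a scale and min-plus products by leading digits\<close>

definition cshift :: "int => nat => int" where
  "cshift x j = - ((- x) div 2 ^ j)"

lemma cshift_ge: "x \<le> cshift x j * 2 ^ j"
proof -
  have "((- x) div 2 ^ j) * 2 ^ j \<le> - x"
    by (metis add.commute div_mult_mod_eq le_add_same_cancel1 mult.commute pos_mod_sign zero_less_numeral zero_less_power)
  then show ?thesis unfolding cshift_def by simp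
qed

lemma cshift_less: "cshift x j * 2 ^ j < x + 2 ^ j"
proof -
  have "(- x) div 2 ^ j * 2 ^ j + (- x) mod 2 ^ j = - x" by (rule div_mult_mod_eq)
  moreover have "(- x) mod 2 ^ j < 2 ^ j" by simp
  ultimately have "- x < ((- x) div 2 ^ j) * 2 ^ j + 2 ^ j" by linarith
  then show ?thesis unfolding cshift_def by simp
qed

lemma cshift_nonneg: "0 \<le> x ==> 0 \<le> cshift x j"
proof (rule ccontr)
  assume "0 \<le> x" "\<not> 0 \<le> cshift x j"
  then have "cshift x j * 2 ^ j < 0" by (intro mult_neg_pos) auto
  then show False using cshift_ge[of x j] \<open>0 \<le> x\<close> by simp
qed

lemma cshift_0 [simp]: "cshift x 0 = x"
  by (simp add: cshift_def)

lemma cshift_le: "x \<le> M * 2 ^ j ==> cshift x j \<le> M"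
proof -
  assume "x \<le> M * 2 ^ j"
  then have "cshift x j * 2 ^ j < (M + 1) * 2 ^ j" using cshift_less[of x j] by (simp add: distrib_right)
  then show ?thesis by simp
qed

lemma bit_length_bounds:
  assumes "2 ^ a \<le> v" "v < 2 ^ b" shows "a < bit_length v" "bit_length v \<le> b"
proof -
  have v: "0 < v" using assms(1) by (smt (verit) zero_less_power)
  show "bit_length v \<le> b" unfolding bit_length_def using assms(2) v
    by (subst floorlog_le_iff) (auto simp: nat_less_iff)
  have "\<not> bit_length v \<le> a" unfolding bit_length_def using assms(1) v
    by (subst floorlog_le_iff) (auto simp: nat_less_iff)
  then show "a < bit_length v" by simp
qed

lemma bit_length_pow: "\<bar>v\<bar> < 2 ^ bit_length v"
  unfolding bit_length_def using floorlog_le_iff[of 2 "nat \<bar>v\<bar>" "floorlog 2 (nat \<bar>v\<bar>)"] by (simp add: nat_less_iff)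

lemma bit_length_pow_le: "0 < v ==> 2 ^ (bit_length v - 1) \<le> v"
proof -
  assume v: "0 < v"
  have "bit_length v \<noteq> 0" using v bit_length_pow[of v] by (auto intro: ccontr)
  then have "\<not> floorlog 2 (nat \<bar>v\<bar>) \<le> bit_length v - 1" by (simp add: bit_length_def)
  then show ?thesis using v by (subst (asm) floorlog_le_iff) (auto simp: nat_less_iff not_less le_nat_iff)
qed

text \<open>Ties merely enlarge the leading digit and cannot carry, because fewer than
  \<open>2 ^ L\<close> powers are added and none exceeds the largest.\<close>

lemma leading_digit_sum:
  fixes e :: "nat => nat"
  assumes fin: "finite T" and t0: "t0 \<in> T" and mx: "\<And>t. t \<in> T ==> e t \<le> e t0"
    and card: "int (card T) < 2 ^ L" and L: "0 < L"
  shows "(bit_length (\<Sum>t\<in>T. 2 ^ (L * e t)) - 1) div L = e t0"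
proof -
  let ?S = "\<Sum>t\<in>T. 2 ^ (L * e t) :: int"
  have lo: "2 ^ (L * e t0) \<le> ?S" using fin t0 by (intro member_le_sum) auto
  have "?S \<le> (\<Sum>t\<in>T. 2 ^ (L * e t0))" using mx by (intro sum_mono power_increasing) auto
  also have "\<dots> = int (card T) * 2 ^ (L * e t0)" by simp
  also have "\<dots> < 2 ^ L * 2 ^ (L * e t0)" using card by simp
  also have "\<dots> = 2 ^ (L * (e t0 + 1))" by (simp add: power_add)
  finally have hi: "?S < 2 ^ (L * (e t0 + 1))" .
  from bit_length_bounds[OF lo hi] have "L * e t0 \<le> bit_length ?S - 1" "bit_length ?S - 1 < L * (e t0 + 1)"
    by auto
  then show ?thesis by (metis Suc_eq_plus1 div_nat_eqI mult.commute)
qed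

text \<open>The leading digit of a sum of products of encodings in base \<open>2 ^ L\<close> is at the position of the least sum,
  as there are fewer than \<open>2 ^ L\<close> summands.\<close>

definition enc :: "nat => int => nat => int => int" where
  "enc L M j x = (if M < cshift x j then 0 else 2 ^ (L * nat (M - cshift x j)))"

text \<open>A product of encodings of \<open>x\<close> and \<open>y\<close> has the exponent
  \<open>L * (2 * M - (x + y))\<close>, so the sum is \<open>2 * M\<close> minus the position of the
  digit. A vanishing \<open>S\<close> means that no index has both entries below the cutoff.\<close>

definition dec :: "nat => int => int => nat => int => int" where
  "dec L M I j S = (if 0 < S then (2 * M - int ((bit_length S - 1) div L)) * 2 ^ j else I)"

text \<open>Entries above the cutoff are encoded as 0 and drop out of the sum. The remaining indices
  form \<open>T\<close>, and \<open>leading_digit_sum\<close> finds the largest exponent over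
  \<open>T\<close>, which belongs to the least rounded sum.\<close>

lemma dec_enc_sum:
  fixes b a :: "nat => int" and M I :: int and j :: nat
  assumes nn: "\<And>t. t < n ==> 0 \<le> b t" "\<And>t. t < n ==> 0 \<le> a t" and n: "int n < 2 ^ L" and L: "0 < L"
  defines "r \<equiv> dec L M I j (\<Sum>t<n. enc L M j (b t) * enc L M j (a t))"
  shows "r = I \<and> (\<forall>t<n. cshift (b t) j \<le> M \<longrightarrow> \<not> cshift (a t) j \<le> M) \<or>
    (\<exists>t<n. cshift (b t) j \<le> M \<and> cshift (a t) j \<le> M \<and> r = (cshift (b t) j + cshift (a t) j) * 2 ^ j) \<and>
    (\<forall>t<n. cshift (b t) j \<le> M \<longrightarrow> cshift (a t) j \<le> M \<longrightarrow> r \<le> (cshift (b t) j + cshift (a t) j) * 2 ^ j)"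
proof -
  define T where "T = {t. t < n \<and> cshift (b t) j \<le> M \<and> cshift (a t) j \<le> M}"
  define e where "e t = nat (2 * M - (cshift (b t) j + cshift (a t) j))" for t
  have S: "(\<Sum>t<n. enc L M j (b t) * enc L M j (a t)) = (\<Sum>t\<in>T. 2 ^ (L * e t))"
  proof (rule sum.mono_neutral_cong_right)
    show "\<forall>i\<in>{..<n} - T. enc L M j (b i) * enc L M j (a i) = 0" by (auto simp: T_def enc_def)
    fix t assume t: "t \<in> T"
    then have "nat (M - cshift (b t) j) + nat (M - cshift (a t) j) = e t" by (auto simp: T_def e_def)
    then have "L * nat (M - cshift (b t) j) + L * nat (M - cshift (a t) j) = L * e t"
      by (metis distrib_left)
    then show "enc L M j (b t) * enc L M j (a t) = 2 ^ (L * e t)" using t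
      by (simp add: T_def enc_def flip: power_add)
  qed (auto simp: T_def)
  have fin: "finite T" and Tn: "T \<subseteq> {..<n}" by (auto simp: T_def)
  show ?thesis
  proof (cases "T = {}")
    case True
    then have "r = I" by (simp add: r_def S dec_def)
    then show ?thesis using True by (auto simp: T_def)
  next
    case False
    then have "Max (e ` T) \<in> e ` T" using fin by (intro Max_in) auto
    then obtain t0 where t0: "t0 \<in> T" "e t0 = Max (e ` T)" by auto
    then have mx: "\<And>t. t \<in> T ==> e t \<le> e t0" using fin by simp
    have "card T \<le> n" using card_mono[OF _ Tn] by simp
    then have c: "int (card T) < 2 ^ L" using n by linarith
    have pos: "0 < (\<Sum>t\<in>T. 2 ^ (L * e t) :: int)" using fin False by (intro sum_pos) auto
    have ei: "int (e t) = 2 * M - (cshift (b t) j + cshift (a t) j)" if "t \<in> T" for t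
      using that by (auto simp: e_def T_def)
    have r: "r = (cshift (b t0) j + cshift (a t0) j) * 2 ^ j"
      unfolding r_def S dec_def using pos leading_digit_sum[where e=e, OF fin t0(1) mx c L] ei[OF t0(1)] by simp
    have "cshift (b t0) j + cshift (a t0) j \<le> cshift (b t) j + cshift (a t) j" if "t \<in> T" for t
      using mx[OF that] ei[OF that] ei[OF t0(1)] by linarith
    then have "r \<le> (cshift (b t) j + cshift (a t) j) * 2 ^ j" if "t \<in> T" for t
      unfolding r using that by (intro mult_right_mono) auto
    then show ?thesis using r t0 unfolding T_def by auto
  qed
qed

text \<open>\<open>r\<close> is an admissible value for an entry of the min-plus product of the row \<open>b\<close> and the column \<open>a\<close>,
  where \<open>I\<close> stands for infinity and the upper bound is only required of sums up to \<open>I / 2\<close>.\<close>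

definition minplus_entry :: "int => int => nat => (nat => int) => (nat => int) => int => bool" where
  "minplus_entry M I n b a r \<longleftrightarrow> 0 \<le> r \<and> r \<le> I \<and>
     (r = I \<or> (\<exists>t<n. b t < I \<and> a t < I \<and> b t + a t \<le> r)) \<and>
     (\<forall>t<n. b t < I \<longrightarrow> a t < I \<longrightarrow> 2 * (b t + a t) \<le> I \<longrightarrow> r * M \<le> (b t + a t) * (M + 4))"

text \<open>The exact minimum satisfies the relaxed conditions all the more. The range is padded to
  \<open>N\<close> because the program takes minima over a power of two of candidates.\<close>

lemma minplus_entry_exact:
  fixes b a :: "nat => int"
  assumes nn: "\<And>t. t < n ==> 0 \<le> b t" "\<And>t. t < n ==> 0 \<le> a t" and I: "0 < I" and M: "0 \<le> M"
    and N: "n \<le> N" "0 < N"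
  shows "minplus_entry M I n b a (Min ((\<lambda>t. if t < n then min (b t + a t) I else I) ` {..<N}))"
proof -
  let ?f = "\<lambda>t. if t < n then min (b t + a t) I else I"
  let ?r = "Min (?f ` {..<N})"
  have "?r \<in> ?f ` {..<N}" using N by (intro Min_in) auto
  then obtain t0 where t0: "t0 < N" "?r = ?f t0" by auto
  have le: "?r \<le> ?f t" if "t < N" for t using that by (intro Min_le) auto
  have "0 \<le> ?r" unfolding t0 using nn I by (auto simp: min_def)
  moreover have "?r \<le> I" unfolding t0 by auto
  moreover have "?r = I \<or> (\<exists>t<n. b t < I \<and> a t < I \<and> b t + a t \<le> ?r)"
  proof (cases "?r = I")
    case False
    then have t: "t0 < n" "?r = b t0 + a t0" "b t0 + a t0 < I" using t0 by (auto split: if_splits simp: min_def)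
    then show ?thesis using nn[of t0] by (intro disjI2 exI[of _ t0]) auto
  qed simp
  moreover have "?r * M \<le> (b t + a t) * (M + 4)" if "t < n" for t
  proof -
    have "?r \<le> b t + a t" using le[of t] that N by auto
    then have "?r * M \<le> (b t + a t) * M" using M by (intro mult_right_mono)
    also have "\<dots> \<le> (b t + a t) * (M + 4)" using nn[OF that] by (intro mult_left_mono) auto
    finally show ?thesis .
  qed
  ultimately show ?thesis unfolding minplus_entry_def by blast
qed

text \<open>At scale \<open>j\<close> each of two summands is raised by less than
  \<open>2 ^ j\<close>. For a sum \<open>C\<close>, consider the least scale with
  \<open>C \<le> M * 2 ^ j\<close>: at \<open>j = 0\<close> nothing is rounded, and otherwise
  \<open>C\<close> exceeds \<open>M * 2 ^ (j - 1)\<close>, so that the error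
  \<open>2 * 2 ^ j\<close> is at most \<open>4 * C / M\<close>. No scale underestimates, hence the
  minimum over all scales is sound.\<close>

lemma minplus_entry_scaled:
  fixes b a :: "nat => int" and m T J :: nat
  assumes nn: "\<And>t. t < n ==> 0 \<le> b t" "\<And>t. t < n ==> 0 \<le> a t" and n: "int n < 2 ^ L" and L: "0 < L"
    and J: "J = T - m" "m < T" and N: "J \<le> N"
  shows "minplus_entry (2 ^ m) (2 ^ T) n b a
    (Min ((\<lambda>j. if j < J then dec L (2 ^ m) (2 ^ T) j (\<Sum>t<n. enc L (2 ^ m) j (b t) * enc L (2 ^ m) j (a t)) else 2 ^ T) ` {..<N}))"
proof -
  define M I :: int where "M = 2 ^ m" and "I = 2 ^ T"
  define d where "d j = dec L M I j (\<Sum>t<n. enc L M j (b t) * enc L M j (a t))" for j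
  let ?f = "\<lambda>j. if j < J then d j else I"
  let ?r = "Min (?f ` {..<N})"
  have J0: "0 < J" using J by simp
  have MI: "M * 2 ^ J = I" using J by (simp add: M_def I_def flip: power_add)
  have M0: "0 < M" "0 < I" by (auto simp: M_def I_def)
  have Mj: "2 * (M * 2 ^ j) \<le> I" if "j < J" for j
  proof -
    have "2 * (M * 2 ^ j) = M * 2 ^ (Suc j)" by simp
    also have "\<dots> \<le> M * 2 ^ J" using that M0 by (intro mult_left_mono power_increasing) auto
    finally show ?thesis using MI by simp
  qed
  have D: "d j = I \<and> (\<forall>t<n. cshift (b t) j \<le> M \<longrightarrow> \<not> cshift (a t) j \<le> M) \<or>
    (\<exists>t<n. cshift (b t) j \<le> M \<and> cshift (a t) j \<le> M \<and> d j = (cshift (b t) j + cshift (a t) j) * 2 ^ j) \<and>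
    (\<forall>t<n. cshift (b t) j \<le> M \<longrightarrow> cshift (a t) j \<le> M \<longrightarrow> d j \<le> (cshift (b t) j + cshift (a t) j) * 2 ^ j)" for j
    using dec_enc_sum[where b=b and a=a and M=M and I=I and j=j, OF _ _ n L, folded d_def] nn by blast
  have "?f ` {..<N} \<noteq> {}" unfolding image_is_empty using N J0 by (metis empty_iff lessThan_iff less_le_trans)
  then have "?r \<in> ?f ` {..<N}" by (intro Min_in) auto
  then obtain j0 where j0: "j0 < N" "?r = ?f j0" by auto
  have le: "?r \<le> ?f j" if "j < N" for j using that by (intro Min_le) auto
  \<comment> \<open>An entry \<open>I\<close> lies above the cutoff at every scale and is never
    mistaken for a finite value.\<close>
  have lt: "x < I" if "cshift x j \<le> M" "j < J" for x j
  proof -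
    have "x \<le> cshift x j * 2 ^ j" by (rule cshift_ge)
    also have "\<dots> \<le> M * 2 ^ j" using that by (intro mult_right_mono) auto
    also have "\<dots> < 2 * (M * 2 ^ j)" using M0 by simp
    finally show ?thesis using Mj[OF that(2)] by simp
  qed
  have P: "?f j = I \<or> (0 \<le> ?f j \<and> ?f j \<le> I \<and> (\<exists>t<n. b t < I \<and> a t < I \<and> b t + a t \<le> ?f j))" for j
  proof (cases "j < J")
    case True
    show ?thesis using D[where j=j]
    proof (elim disjE conjE exE)
      fix t assume t: "t < n" "cshift (b t) j \<le> M" "cshift (a t) j \<le> M" "d j = (cshift (b t) j + cshift (a t) j) * 2 ^ j"
      have "b t + a t \<le> d j" using cshift_ge[of "b t" j] cshift_ge[of "a t" j] t by (simp add: distrib_right)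
      moreover have "d j \<le> (2 * M) * 2 ^ j" unfolding t(4) using t by (intro mult_right_mono) auto
      moreover have "0 \<le> b t + a t" using nn t by simp
      moreover have "(2 * M) * 2 ^ j \<le> I" using Mj[OF True] by simp
      ultimately have "0 \<le> d j" "d j \<le> I" "b t + a t \<le> d j" by linarith+
      then show ?thesis using t(1) lt[OF t(2) True] lt[OF t(3) True] True by auto
    qed (use True in auto)
  qed simp
  have "0 \<le> ?r" "?r \<le> I" "?r = I \<or> (\<exists>t<n. b t < I \<and> a t < I \<and> b t + a t \<le> ?r)"
    using P[of j0] M0 unfolding j0(2) by auto
  moreover have "?r * M \<le> (b t + a t) * (M + 4)" if t: "t < n" and C: "2 * (b t + a t) \<le> I" for t
  proof -
    let ?C = "b t + a t"
    have nnt: "0 \<le> b t" "0 \<le> a t" using nn t by auto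
    \<comment> \<open>As \<open>M * 2 ^ J = I\<close>, the coarsest scale reaches exactly up to
      \<open>I / 2\<close>; this explains the restriction to such sums in
      \<open>minplus_entry\<close>.\<close>
    have "2 * ?C \<le> 2 * (M * 2 ^ (J - 1))" using C MI J0 by (cases J) auto
    then have ex: "?C \<le> M * 2 ^ (J - 1)" by simp
    define j where "j = (LEAST j. ?C \<le> M * 2 ^ j)"
    have Cj: "?C \<le> M * 2 ^ j" unfolding j_def by (rule LeastI[of _ "J - 1"]) (rule ex)
    have "j \<le> J - 1" unfolding j_def by (rule Least_le) (rule ex)
    then have jJ: "j < J" using J0 by simp
    have c: "cshift (b t) j \<le> M" "cshift (a t) j \<le> M" using nnt Cj by (auto intro!: cshift_le)
    have "?r \<le> d j" using le[of j] jJ N by auto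
    also have "d j \<le> (cshift (b t) j + cshift (a t) j) * 2 ^ j" using D[where j=j] t c by blast
    finally have r: "?r \<le> (cshift (b t) j + cshift (a t) j) * 2 ^ j" .
    show ?thesis
    proof (cases j)
      case 0
      then have "?r * M \<le> ?C * M" using r M0 by (intro mult_right_mono) auto
      also have "\<dots> \<le> ?C * (M + 4)" using nnt by (intro mult_left_mono) auto
      finally show ?thesis .
    next
      case (Suc i)
      have "\<not> ?C \<le> M * 2 ^ i" using not_less_Least[of i "\<lambda>j. ?C \<le> M * 2 ^ j"] Suc by (simp add: j_def)
      then have i: "M * 2 ^ i \<le> ?C" by simp
      have "?r \<le> ?C + 2 * 2 ^ j" using r cshift_less[of "b t" j] cshift_less[of "a t" j] by (simp add: distrib_right)
      then have "?r * M \<le> (?C + 4 * 2 ^ i) * M" using M0 Suc by (intro mult_right_mono) auto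
      also have "\<dots> = ?C * M + 4 * (M * 2 ^ i)" by (simp add: algebra_simps)
      also have "\<dots> \<le> ?C * M + 4 * ?C" using i by simp
      finally show ?thesis by (simp add: algebra_simps)
    qed
  qed
  ultimately show ?thesis unfolding minplus_entry_def M_def I_def d_def by blast
qed

section \<open>From integer entries to approximate distance products\<close>

definition scaled :: "int => real => int => ereal" where
  "scaled I c x = (if x < I then ereal (real_of_int x * c) else \<infinity>)"

text \<open>Adding two entries doubles the bound, and the factor \<open>1 + 4 / M\<close> at most
  doubles it again. This growth per product determines how far \<open>I\<close> has to lie above the
  largest finite entry.\<close>

lemma minplus_entry_bound:
  assumes "minplus_entry M I n b a r" "4 \<le> M" "r < I"
    and "\<And>t. t < n ==> b t < I ==> b t \<le> X" "\<And>t. t < n ==> a t < I ==> a t \<le> X" "4 * X \<le> I"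
  shows "r \<le> 4 * X"
proof -
  obtain t where t: "t < n" "b t < I" "a t < I" "b t + a t \<le> r" using assms by (auto simp: minplus_entry_def)
  have C: "b t + a t \<le> 2 * X" using assms(4,5)[OF t(1)] t by simp
  have "r * M \<le> (b t + a t) * (M + 4)" using assms(1,6) t C by (auto simp: minplus_entry_def)
  also have "\<dots> \<le> (2 * X) * (M + 4)" using C assms(2) by (intro mult_right_mono) auto
  also have "\<dots> \<le> (2 * X) * (2 * M)"
  proof (rule mult_left_mono)
    have "0 \<le> r" using assms(1) by (simp add: minplus_entry_def)
    have "0 \<le> r * M" using \<open>0 \<le> r\<close> assms(2) by simp
    then have "0 \<le> (2 * X) * (M + 4)" using \<open>r * M \<le> _\<close> \<open>(b t + a t) * (M + 4) \<le> _\<close> by linarith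
    then show "0 \<le> 2 * X" using assms(2) by (simp add: zero_le_mult_iff)
  qed (use assms in simp)
  finally have "r * M \<le> (4 * X) * M" by simp
  then show ?thesis using assms(2) by simp
qed

text \<open>\<open>4 * X \<le> I\<close> places all finite sums in the range up to
  \<open>I / 2\<close>, where \<open>minplus_entry\<close> supplies its upper bound; the unit
  \<open>c\<close> merely scales both sides.\<close>

lemma dist_product_scaled:
  fixes B A :: "nat => nat => int"
  assumes r: "minplus_entry M I n (B u) (\<lambda>t. A t v) r" and M: "4 < M" and I: "0 < I" and c: "0 \<le> c"
    and nn: "\<And>t. t < n ==> 0 \<le> B u t" "\<And>t. t < n ==> 0 \<le> A t v"
    and X: "\<And>t. t < n ==> B u t < I ==> B u t \<le> X" "\<And>t. t < n ==> A t v < I ==> A t v \<le> X" "4 * X \<le> I"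
  defines "Bh \<equiv> \<lambda>u t. scaled I c (B u t)" and "Ah \<equiv> \<lambda>t v. scaled I c (A t v)"
  shows "dist_product {..<n} Bh Ah u v \<le> scaled I c r"
    and "scaled I c r \<le> ereal (1 + 4 / real_of_int M) * dist_product {..<n} Bh Ah u v"
proof -
  show "dist_product {..<n} Bh Ah u v \<le> scaled I c r"
  proof (cases "r < I")
    case True
    then obtain t where t: "t < n" "B u t < I" "A t v < I" "B u t + A t v \<le> r" using r by (auto simp: minplus_entry_def)
    have "dist_product {..<n} Bh Ah u v \<le> Bh u t + Ah t v" unfolding dist_product_def using t by (intro INF_lower) auto
    also have "\<dots> = ereal (real_of_int (B u t + A t v) * c)" using t by (simp add: Bh_def Ah_def scaled_def distrib_right)
    also have "\<dots> \<le> ereal (real_of_int r * c)" using t(4) c by (simp add: mult_right_mono del: of_int_add)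
    finally show ?thesis using True by (simp add: scaled_def)
  qed (simp add: scaled_def)
  let ?k = "1 + 4 / real_of_int M"
  have k: "0 < ?k" using M by (simp add: add_pos_pos)
  have one: "scaled I c r \<le> ereal ?k * (Bh u t + Ah t v)" if t: "t < n" for t
  proof (cases "B u t < I \<and> A t v < I")
    case True
    then have C: "2 * (B u t + A t v) \<le> I" using X t by force
    then have h: "r * M \<le> (B u t + A t v) * (M + 4)" using r t True by (auto simp: minplus_entry_def)
    have "real_of_int r * M \<le> real_of_int (B u t + A t v) * (M + 4)"
      using h by (metis of_int_le_iff of_int_mult of_int_add of_int_numeral)
    then have le: "real_of_int r \<le> ?k * real_of_int (B u t + A t v)" using M by (simp add: field_simps)
    show ?thesis
    proof (cases "r < I")
      case True': True
      have "real_of_int r * c \<le> ?k * real_of_int (B u t + A t v) * c" using le c by (rule mult_right_mono)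
      then show ?thesis using True True' by (simp add: scaled_def Bh_def Ah_def distrib_right mult.assoc distrib_left)
    next
      \<comment> \<open>A value \<open>I\<close> in spite of a finite sum would force
        \<open>M \<le> 4\<close>.\<close>
      case False
      then have "r = I" using r by (auto simp: minplus_entry_def)
      moreover have "2 * (B u t + A t v) * (M + 4) \<le> I * (M + 4)" using C M by (intro mult_right_mono) auto
      moreover have "2 * (B u t + A t v) * (M + 4) = 2 * ((B u t + A t v) * (M + 4))" by (rule mult.assoc)
      moreover have "I * (M + 4) = I * M + I * 4" by (rule distrib_left)
      moreover have "I * M \<le> (B u t + A t v) * (M + 4)" using h \<open>r = I\<close> by simp
      ultimately have "I * M \<le> I * 4" by linarith
      then show ?thesis using M I by simp
    qed
  next
    case False
    then have "Bh u t + Ah t v = \<infinity>" by (auto simp: Bh_def Ah_def scaled_def)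
    then show ?thesis unfolding \<open>Bh u t + Ah t v = \<infinity>\<close> using k by simp
  qed
  show "scaled I c r \<le> ereal ?k * dist_product {..<n} Bh Ah u v"
  proof (cases "n = 0")
    case True
    then show ?thesis using k by (simp add: dist_product_def top_ereal_def)
  next
    case False
    have "finite {..<n}" "{..<n} \<noteq> {}" using False by auto
    from INF_finite_attained[OF this, of "\<lambda>t. Bh u t + Ah t v"] obtain t where
      "t \<in> {..<n}" "(INF t\<in>{..<n}. Bh u t + Ah t v) = Bh u t + Ah t v" .
    then show ?thesis using one[of t] by (simp add: dist_product_def)
  qed
qed

section \<open>The program\<close>

abbreviation eadd (infixl "[+]" 65) where "a [+] b \<equiv> EBin Add a b"
abbreviation esub (infixl "[-]" 65) where "a [-] b \<equiv> EBin Sub a b"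
abbreviation emul (infixl "[*]" 70) where "a [*] b \<equiv> EBin Mul a b"
abbreviation equot (infixl "[div]" 70) where "a [div] b \<equiv> EBin Quot a b"
abbreviation eshl (infixl "[<<]" 60) where "a [<<] b \<equiv> EBin Shift a b"

definition emod (infixl "[mod]" 70) where "a [mod] b = a [-] (a [div] b) [*] b"
definition eshr (infixl "[>>]" 60) where "a [>>] b = a [<<] (ELit 0 [-] b)"

lemma emod_simps [simp]:
  "ev (a [mod] b) s m = ev a s m mod ev b s m"
  "esafe B (a [mod] b) s m \<longleftrightarrow> esafe B a s m \<and> esafe B b s m"
  "evok (a [mod] b) \<longleftrightarrow> evok a \<and> evok b"
  "earr (a [mod] b) = earr a \<union> earr b"
  by (auto simp: emod_def minus_div_mult_eq_mod)

lemma eshr_simps [simp]: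
  "0 \<le> ev b s m ==> ev (a [>>] b) s m = ev a s m div 2 ^ nat (ev b s m)"
  "0 \<le> ev b s m ==> esafe B (a [>>] b) s m \<longleftrightarrow> esafe B a s m \<and> esafe B b s m"
  "evok (a [>>] b) \<longleftrightarrow> evok a \<and> evok b"
  "earr (a [>>] b) = earr a \<union> earr b"
  by (auto simp: eshr_def)

text \<open>The coefficient tables of the bilinear algorithm are part of the program text, and a
  lookup is a chain of comparisons. Its cost is a constant, because the algorithm is fixed.
  \<open>k\<close> is the index of the head of the remaining list.\<close>

fun etab :: "int list => nat => expr => expr" where
  "etab [] k e = ELit 0"
| "etab (c # cs) k e = EIf e (ELit (int (Suc k))) (ELit c) (etab cs (Suc k) e)"

lemma ev_etab: "ev e s m = int (k + j) ==> j < length cs ==> ev (etab cs k e) s m = cs ! j"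
proof (induction cs arbitrary: k j)
  case (Cons c cs)
  show ?case
  proof (cases j)
    case (Suc j')
    then show ?thesis using Cons.IH[of "Suc k" j'] Cons.prems by simp
  qed (use Cons.prems in auto)
qed simp

lemma esafe_etab:
  "esafe B e s m ==> \<forall>c\<in>set cs. \<bar>c\<bar> < 2 ^ B ==> k + length cs < 2 ^ B ==> esafe B (etab cs k e) s m"
proof (induction cs arbitrary: k)
  case (Cons c cs)
  have "int (k + length (c # cs)) < 2 ^ B" using Cons.prems(3) by (metis of_nat_less_numeral_power_cancel_iff)
  then show ?case using Cons by auto
qed simp

lemma evok_etab [simp]: "evok e ==> evok (etab cs k e)"
  by (induction cs arbitrary: k) auto

lemma earr_etab: "earr (etab cs k e) \<subseteq> earr e"
  by (induction cs arbitrary: k) auto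

fun esum :: "expr list => expr" where
  "esum [] = ELit 0"
| "esum (e # es) = e [+] esum es"

lemma ev_esum: "ev (esum es) s m = (\<Sum>e\<leftarrow>es. ev e s m)"
  by (induction es) auto

lemma esafe_esum: "\<forall>e\<in>set es. esafe B e s m ==> esafe B (esum es) s m"
  by (induction es) auto

lemma evok_esum: "\<forall>e\<in>set es. evok e ==> evok (esum es)"
  by (induction es) auto

lemma earr_esum: "earr (esum es) = (\<Union>e\<in>set es. earr e)"
  by (induction es) auto

lemma ev_esum_upt: "ev (esum (map f [0..<n])) s m = (\<Sum>c<n. ev (f c) s m)"
  by (simp add: ev_esum interv_sum_list_conv_sum_set_nat comp_def atLeast0LessThan)

definition arr :: "(cell => int) => string => nat => (nat => int) => bool" where
  "arr m A N f \<longleftrightarrow> (\<forall>i<N. m (A, int i) = f i)"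

lemma arrD: "arr m A N f ==> i < N ==> m (A, int i) = f i"
  by (simp add: arr_def)

definition frame :: "string set => (cell => int) => (cell => int) => bool" where
  "frame S m m' \<longleftrightarrow> (\<forall>A i. A \<notin> S \<longrightarrow> m' (A, i) = m (A, i))"

lemma frame_arr: "frame S m m' ==> A \<notin> S ==> arr m A N f ==> arr m' A N f"
  by (simp add: frame_def arr_def)

lemma frame_trans: "frame S m m' ==> frame S' m' m'' ==> S \<subseteq> S'' ==> S' \<subseteq> S'' ==> frame S'' m m''"
  by (fastforce simp: frame_def)

lemma frame_refl: "frame S m m"
  by (simp add: frame_def)

context mach begin

lemma gok_G: "gok e ==> 20 \<le> G"
  by (simp add: gok_def)

lemma wpc_seq_le:
  assumes "k1 \<le> k" "wpc c1 (\<lambda>s m. wpc c2 Q (k - k1) s m) k1 s m"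
  shows "wpc (Seq c1 c2) Q k s m"
  using wpc_seq[OF assms(2)] assms(1) by simp

lemma wpc_assign_seq:
  assumes "0 < k" "gok e" "\<not> temp x" "esafe B e s m" "wpc c Q (k - 1) (s(x := ev e s m)) m"
  shows "wpc (Seq (Assign x e) c) Q k s m"
  using assms by (intro wpc_seq_le[of 1] wpc_assign) auto

lemma wpc_pmap_arr:
  assumes N: "gok eN" "esafe B eN s m" "ev eN s m = int N" "N \<le> Nx"
    and e: "gok e" "A \<notin> earr e"
    and f: "\<And>i. i < N ==> esafe B e (s(''i'' := int i)) m \<and> ev e (s(''i'' := int i)) m = f i"
    and Q: "\<And>m'. arr m' A N f ==> frame {A} m m' ==> Q s m'"
  shows "wpc (PMap A eN e) Q 1 s m"
proof (rule wpc_pmap)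
  fix i assume i: "0 \<le> i" "i < ev eN s m"
  then have "nat i < N" using N by simp
  from f[OF this] i show "esafe B e (s(''i'' := i)) m" by simp
next
  show "Q s (pm A (ev eN s m) (\<lambda>i. ev e (s(''i'' := i)) m) m)"
  proof (rule Q)
    show "arr (pm A (ev eN s m) (\<lambda>i. ev e (s(''i'' := i)) m) m) A N f"
      unfolding arr_def using f N by (simp add: pm_same)
  qed (simp add: frame_def)
qed (use assms in auto)

lemma wpc_pmap_seq:
  assumes "0 < k" "gok eN" "esafe B eN s m" "ev eN s m = int N" "N \<le> Nx" "gok e" "A \<notin> earr e"
    and "\<And>i. i < N ==> esafe B e (s(''i'' := int i)) m \<and> ev e (s(''i'' := int i)) m = f i"
    and "\<And>m'. arr m' A N f ==> frame {A} m m' ==> wpc c Q (k - 1) s m'"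
  shows "wpc (Seq (PMap A eN e) c) Q k s m"
  using assms(1) by (intro wpc_seq_le[of 1] wpc_pmap_arr[OF assms(2-7), where f=f]) (use assms in auto)

end

section \<open>Block minima by a tournament\<close>

definition e_half where "e_half = EVar ''cnt'' [div] ELit 2"
definition e_cnt where "e_cnt = EVar ''cnt''"
definition e_min where
  "e_min = EIf (ELoad ''Z'' (ELit 2 [*] EVar ''i'')) (ELoad ''Z'' (ELit 2 [*] EVar ''i'' [+] ELit 1))
     (ELoad ''Z'' (ELit 2 [*] EVar ''i'')) (ELoad ''Z'' (ELit 2 [*] EVar ''i'' [+] ELit 1))"
definition e_ldT where "e_ldT = ELoad ''T2'' (EVar ''i'')"

definition reduce_body :: com where
  "reduce_body = Seq (Assign ''cnt'' e_half) (Seq (PMap ''T2'' e_cnt e_min) (PMap ''Z'' e_cnt e_ldT))"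

definition reduce :: com where
  "reduce = For ''l'' ''h'' reduce_body"

definition reduce_exprs where "reduce_exprs = [e_half, e_cnt, e_min, e_ldT]"

lemma Min_halves:
  fixes f :: "nat => int"
  shows "min (Min (f ` {2 * b * 2 ^ l..<(2 * b + 1) * 2 ^ l})) (Min (f ` {(2 * b + 1) * 2 ^ l..<(2 * b + 2) * 2 ^ l}))
    = Min (f ` {b * 2 ^ Suc l..<(b + 1) * 2 ^ Suc l})"
proof -
  have "{b * 2 ^ Suc l..<(b + 1) * 2 ^ Suc l} = {2 * b * 2 ^ l..<(2 * b + 1) * 2 ^ l} \<union> {(2 * b + 1) * 2 ^ l..<(2 * b + 2) * 2 ^ l}"
    using ivl_disj_un_two(3)[of "2 * b * 2 ^ l" "(2 * b + 1) * 2 ^ l" "(2 * b + 2) * 2 ^ l"] by (auto simp: algebra_simps)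
  then show ?thesis by (simp only: image_Un) (subst Min_Un, auto)
qed

lemma temp_simps [simp]: "\<not> temp []" "temp (c # cs) \<longleftrightarrow> c = CHR ''_''"
  by (simp_all add: temp_def)

lemma (in mach) lit_less: "2 \<le> B ==> (2::int) < 2 ^ B" "2 \<le> B ==> (3::int) < 2 ^ B"
  using power_increasing[of 2 B "2::int"] by auto

text \<open>After \<open>l\<close> rounds, cell \<open>b\<close> holds the minimum of the block
  \<open>b\<close> of length \<open>2 ^ l\<close>. A round merges neighbouring blocks and takes 5
  units: an assignment, two maps and the loop overhead.\<close>

lemma (in mach) wpc_reduce:
  assumes ex: "\<forall>e\<in>set reduce_exprs. gok e" and B2: "2 \<le> B"
    and h: "s ''h'' = int h" "h < 2 ^ B" and cnt: "s ''cnt'' = int (c * 2 ^ h)" "c * 2 ^ h \<le> Nx"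
    and Z: "arr m ''Z'' (c * 2 ^ h) f" and f: "\<And>i. i < c * 2 ^ h ==> \<bar>f i\<bar> < 2 ^ B"
    and Q: "\<And>m'. arr m' ''Z'' c (\<lambda>b. Min (f ` {b * 2 ^ h..<(b + 1) * 2 ^ h})) ==> frame {''Z'', ''T2''} m m' ==>
      Q (s(''cnt'' := int c, ''l'' := int h)) m'"
  shows "wpc reduce Q (h * 5 + 2) s m"
proof -
  have gok: "gok e_half" "gok e_cnt" "gok e_min" "gok e_ldT"
    using ex by (auto simp: reduce_exprs_def)
  have G20: "20 \<le> G" using gok(1) by (rule gok_G)
  have NB: "x < 2 ^ B" if "x \<le> Nx" for x using Nx that by linarith
  have NBi: "int x < 2 ^ B" if "x \<le> Nx" for x using NB[OF that] by (metis of_nat_less_numeral_power_cancel_iff)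
  define I where "I l s' m' \<longleftrightarrow> s' = s(''cnt'' := int (c * 2 ^ (h - l)), ''l'' := int l) \<and> l \<le> h \<and>
    arr m' ''Z'' (c * 2 ^ (h - l)) (\<lambda>b. Min (f ` {b * 2 ^ l..<(b + 1) * 2 ^ l})) \<and> frame {''Z'', ''T2''} m m'" for l s' m'
  have Mb: "\<bar>Min (f ` {b * 2 ^ l..<(b + 1) * 2 ^ l})\<bar> < 2 ^ B" if "l \<le> h" "b < c * 2 ^ (h - l)" for b l
  proof -
    have "Min (f ` {b * 2 ^ l..<(b + 1) * 2 ^ l}) \<in> f ` {b * 2 ^ l..<(b + 1) * 2 ^ l}" by (intro Min_in) auto
    then obtain i where i: "Min (f ` {b * 2 ^ l..<(b + 1) * 2 ^ l}) = f i" "i < (b + 1) * 2 ^ l"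
      by (rule imageE) (rule that, auto)
    have "(b + 1) * 2 ^ l \<le> (c * 2 ^ (h - l)) * 2 ^ l" using that by (intro mult_le_mono1) simp
    also have "\<dots> = c * 2 ^ h" using that by (simp add: mult.assoc flip: power_add)
    finally show ?thesis using i f[of i] by simp
  qed
  have "wpc (For ''l'' ''h'' reduce_body) Q (h * (3 + 2) + 2) s m"
  proof (rule wpc_for[where I=I])
    show "I 0 (s(''l'' := 0)) m" using cnt Z by (auto simp: I_def frame_refl fun_upd_idem)
    show "\<And>i s m. I i s m ==> s ''l'' = int i \<and> s ''h'' = int h" using h by (simp add: I_def)
    show "Q s' m'" if "I h s' m'" for s' m' using that Q[of m'] by (simp add: I_def)
    fix l s' m' assume l: "l < h" and "I l s' m'"
    then have s': "s' = s(''cnt'' := int (c * 2 ^ (h - l)), ''l'' := int l)"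
      and Z': "arr m' ''Z'' (c * 2 ^ (h - l)) (\<lambda>b. Min (f ` {b * 2 ^ l..<(b + 1) * 2 ^ l}))" and fr: "frame {''Z'', ''T2''} m m'"
      by (auto simp: I_def)
    define c' where "c' = c * 2 ^ (h - Suc l)"
    have c2: "c * 2 ^ (h - l) = 2 * c'" using l by (simp add: c'_def Suc_diff_Suc[symmetric] del: Suc_diff_Suc)
    have "2 * c' \<le> c * 2 ^ h" unfolding c2[symmetric] by (simp add: power_increasing)
    then have cN: "2 * c' \<le> Nx" using cnt by simp
    note cB = NBi[OF cN]
    have cB': "c' < 2 ^ B" using NB[of c'] cN by simp
    show "wpc reduce_body (\<lambda>s m. s ''l'' = int l \<and> I (Suc l) (s(''l'' := int l + 1)) m) 3 s' m'"
      unfolding reduce_body_def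
    proof (rule wpc_assign_seq[OF _ gok(1)])
      show "esafe B e_half s' m'" using cB lit_less[OF B2] by (simp add: e_half_def s' c2)
      let ?s = "s'(''cnt'' := ev e_half s' m')"
      have s: "?s = s(''cnt'' := int c', ''l'' := int l)" by (auto simp: s' e_half_def c2)
      show "wpc (Seq (PMap ''T2'' e_cnt e_min) (PMap ''Z'' e_cnt e_ldT))
         (\<lambda>s m. s ''l'' = int l \<and> I (Suc l) (s(''l'' := int l + 1)) m) (3 - 1) ?s m'"
        unfolding s
      proof (rule wpc_pmap_seq[OF _ gok(2) _ _ _ gok(3), where N=c' and f="\<lambda>b. Min (f ` {b * 2 ^ Suc l..<(b + 1) * 2 ^ Suc l})"])
        fix i assume i: "i < c'"
        have e: "2 * int i = int (2 * i)" "2 * int i + 1 = int (2 * i + 1)" by auto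
        have ld: "m' (''Z'', 2 * int i) = Min (f ` {2 * i * 2 ^ l..<(2 * i + 1) * 2 ^ l})"
          "m' (''Z'', 2 * int i + 1) = Min (f ` {(2 * i + 1) * 2 ^ l..<(2 * i + 2) * 2 ^ l})"
          unfolding e using arrD[OF Z', of "2 * i"] arrD[OF Z', of "2 * i + 1"] i c2 by (simp_all add: add.commute)
        have bd0: "\<bar>m' (''Z'', int j)\<bar> < 2 ^ B" if "j < 2 * c'" for j
          using arrD[OF Z', of j] Mb[of l j] that c2 l by simp
        have bd: "\<bar>m' (''Z'', 2 * int i)\<bar> < 2 ^ B" "\<bar>m' (''Z'', 2 * int i + 1)\<bar> < 2 ^ B"
          using bd0[of "2 * i"] bd0[of "2 * i + 1"] i by (simp_all add: add.commute)
        have "int i < 2 ^ B" using NBi[of i] i cN by simp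
        then have "esafe B e_min (s(''cnt'' := int c', ''l'' := int l, ''i'' := int i)) m'"
          using bd lit_less[OF B2] B1 by (auto simp: e_min_def)
        moreover have "ev e_min (s(''cnt'' := int c', ''l'' := int l, ''i'' := int i)) m' = Min (f ` {i * 2 ^ Suc l..<(i + 1) * 2 ^ Suc l})"
          unfolding Min_halves[symmetric] ld[symmetric] by (simp add: e_min_def min_def)
        ultimately show "esafe B e_min (s(''cnt'' := int c', ''l'' := int l, ''i'' := int i)) m' \<and>
          ev e_min (s(''cnt'' := int c', ''l'' := int l, ''i'' := int i)) m' = Min (f ` {i * 2 ^ Suc l..<(i + 1) * 2 ^ Suc l})" by blast
      next
        fix m1 assume T: "arr m1 ''T2'' c' (\<lambda>b. Min (f ` {b * 2 ^ Suc l..<(b + 1) * 2 ^ Suc l}))" and fr1: "frame {''T2''} m' m1"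
        show "wpc (PMap ''Z'' e_cnt e_ldT) (\<lambda>s m. s ''l'' = int l \<and> I (Suc l) (s(''l'' := int l + 1)) m) (3 - 1 - 1)
          (s(''cnt'' := int c', ''l'' := int l)) m1"
          unfolding numeral_eq_Suc diff_Suc_1 pred_numeral_simps Suc_1 One_nat_def[symmetric]
        proof (rule wpc_mono[OF wpc_pmap_arr[OF gok(2) _ _ _ gok(4), where N=c' and f="\<lambda>b. Min (f ` {b * 2 ^ Suc l..<(b + 1) * 2 ^ Suc l})"
              and Q = "\<lambda>s m. s ''l'' = int l \<and> I (Suc l) (s(''l'' := int l + 1)) m"]])
          fix i assume i: "i < c'"
          have "int i < 2 ^ B" using NBi[of i] i cN by simp
          then show "esafe B e_ldT (s(''cnt'' := int c', ''l'' := int l, ''i'' := int i)) m1 \<and>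
            ev e_ldT (s(''cnt'' := int c', ''l'' := int l, ''i'' := int i)) m1 = Min (f ` {i * 2 ^ Suc l..<(i + 1) * 2 ^ Suc l})"
            using arrD[OF T i] Mb[of "Suc l" i] i l by (auto simp: e_ldT_def c'_def)
        next
          fix m2 assume "arr m2 ''Z'' c' (\<lambda>b. Min (f ` {b * 2 ^ Suc l..<(b + 1) * 2 ^ Suc l}))" "frame {''Z''} m1 m2"
          moreover have "frame {''Z'', ''T2''} m m2"
            using fr fr1 \<open>frame {''Z''} m1 m2\<close> by (simp add: frame_def)
          ultimately show "(s(''cnt'' := int c', ''l'' := int l)) ''l'' = int l \<and>
             I (Suc l) ((s(''cnt'' := int c', ''l'' := int l))(''l'' := int l + 1)) m2"
            using l by (auto simp: I_def c'_def)
        qed (use cB' cN in \<open>auto simp: e_cnt_def e_ldT_def\<close>)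
      qed (use cB' cN in \<open>auto simp: e_cnt_def e_min_def\<close>)
    qed auto
  qed (use G20 h in auto)
  then show ?thesis by (simp add: reduce_def mult.commute)
qed

section \<open>Scalars of the program, and the range of the positive weights\<close>

abbreviation "vn \<equiv> EVar ''n''"
abbreviation "vs \<equiv> EVar ''s''"
abbreviation "vi \<equiv> EVar ''i''"
abbreviation "vhops \<equiv> EVar ''hops''"
abbreviation "vlb \<equiv> EVar ''lb''"
abbreviation "vm \<equiv> EVar ''m''"
abbreviation "vM \<equiv> EVar ''M''"
abbreviation "vt \<equiv> EVar ''t''"
abbreviation "vbb \<equiv> EVar ''bb''"
abbreviation "vc \<equiv> EVar ''c''"
abbreviation "vlo \<equiv> EVar ''lo''"
abbreviation "vhi \<equiv> EVar ''hi''"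
abbreviation "vsh \<equiv> EVar ''sh''"
abbreviation "vtn \<equiv> EVar ''tn''"
abbreviation "vT \<equiv> EVar ''T''"
abbreviation "vI \<equiv> EVar ''I''"
abbreviation "vJ \<equiv> EVar ''J''"
abbreviation "vP \<equiv> EVar ''P''"
abbreviation "vQ \<equiv> EVar ''Q''"
abbreviation "vk \<equiv> EVar ''k''"
abbreviation "vE \<equiv> EVar ''E''"
abbreviation "vsn \<equiv> EVar ''sn''"
abbreviation "vh \<equiv> EVar ''h''"
abbreviation "va \<equiv> EVar ''a''"
abbreviation "vP' \<equiv> EVar ''p''"
abbreviation "vQ' \<equiv> EVar ''q''"
abbreviation "Gn \<equiv> ELoad ''G_num'' vi"
abbreviation "Gd \<equiv> ELoad ''G_den'' vi"
abbreviation "Hn \<equiv> ELoad ''H_num'' vi"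
abbreviation "Hd \<equiv> ELoad ''H_den'' vi"

definition "e_lb = EBits vn"
definition "e_m \<kappa> = EBits (ELit (int \<kappa>) [*] EVar ''accuracy'' [*] vlb)"
definition "e_M = ELit 1 [<<] vm"
definition "e_t a = ELit (int a) [*] vlb [+] (vm [+] ELit 1)"
definition "e_2lb = vlb [+] vlb"
definition "e_c = ELit 1 [<<] vh"
definition "e_vc = vc"
definition "e_z1 = EIf vi (vn [*] vn) (ELit 0 [-] (EBits Gn [+] EBits Gd)) (ELit 0)"
definition "e_z2 = EIf vi (vn [*] vn) (EIf (ELit 0) Gn (EIf (ELit 0) Gd (EBits Gn [-] EBits Gd) vbb) vbb) vbb"
definition "e_z3 = EIf vi (vn [*] vn) (EIf (ELit 0) Gn (EIf (ELit 0) Gd (EBits Gd [-] EBits Gn) vbb) vbb) vbb"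
definition "e_Z0 = ELoad ''Z'' (ELit 0)"
definition "e_nZ0 = ELit 0 [-] ELoad ''Z'' (ELit 0)"
definition "e_bb = ELit 1 [-] ELoad ''Z'' (ELit 0)"
definition "e_x = EIf vhi vlo (ELit 0) vlo"
definition "e_hi = EIf vhi vlo (ELit 0) vhi"
definition "e_xv = EVar ''x''"

text \<open>Three tournaments over the cells of \<open>G\<close>. The first yields a number
  \<open>bb\<close> above the absolute value of every exponent, a neutral value for cells without
  positive weight. The other two find the least exponent and, through negation, the largest. Without
  any positive weight they leave \<open>lo = bb\<close> above \<open>hi = - bb\<close>; the last
  assignments detect this and set both to 0.\<close>

definition ph_range :: com where
  "ph_range = Seq (Assign ''h'' e_2lb) (Seq (Assign ''c'' e_c)
     (Seq (PMap ''Z'' e_vc e_z1) (Seq (Assign ''cnt'' e_vc) (Seq reduce (Seq (Assign ''bb'' e_bb)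
     (Seq (PMap ''Z'' e_vc e_z2) (Seq (Assign ''cnt'' e_vc) (Seq reduce (Seq (Assign ''lo'' e_Z0)
     (Seq (PMap ''Z'' e_vc e_z3) (Seq (Assign ''cnt'' e_vc) (Seq reduce (Seq (Assign ''hi'' e_nZ0)
     (Seq (Assign ''x'' e_x) (Seq (Assign ''hi'' e_hi) (Assign ''lo'' e_xv))))))))))))))))"

definition "range_exprs = [e_2lb, e_c, e_vc, e_z1, e_bb, e_z2, e_Z0, e_z3, e_nZ0, e_x, e_hi, e_xv] @ reduce_exprs"

locale prun = mach w B G Nx for w B G Nx :: nat +
  fixes n lb :: nat and m0 :: "cell => int"
  assumes n2: "2 \<le> n"
    and lb_eq: "lb = bit_length (int n)"
    and gin: "\<And>k. k < n * n ==> 0 \<le> m0 (''G_num'', int k) \<and> m0 (''G_num'', int k) < 2 ^ w"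
      "\<And>k. k < n * n ==> 0 \<le> m0 (''G_den'', int k) \<and> m0 (''G_den'', int k) < 2 ^ w"
    and Nx1: "2 ^ (2 * lb) \<le> Nx"
    and Bw: "4 * w + 4 * lb + 10 \<le> B"
begin

lemma n_lb: "n < 2 ^ lb"
  using bit_length_pow[of "int n"] unfolding lb_eq by (simp add: nat_less_iff)

lemma lb2: "2 \<le> lb"
proof (rule ccontr)
  assume "\<not> 2 \<le> lb"
  then have "(2::nat) ^ lb \<le> 2 ^ 1" by (intro power_increasing) auto
  then show False using n_lb n2 by simp
qed

lemma lessB: "x < B ==> x < 2 ^ B"
  using less_exp[of B] by linarith

lemma lessB': "x \<le> Nx ==> x < 2 ^ B"
  using Nx by linarith

lemma B10: "10 \<le> B"
  using Bw by simp

lemma int_lessB: "int x < 2 ^ B \<longleftrightarrow> x < 2 ^ B"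
  by (metis of_nat_less_numeral_power_cancel_iff)

lemma small_lits: "(1::int) < 2 ^ B" "(2::int) < 2 ^ B" "(0::int) < 2 ^ B"
  using lit_less B10 by auto

lemma pow_less_B: "x < 2 ^ k ==> k \<le> B ==> x < (2::int) ^ B"
  by (rule pow_bound_mono)

definition "gn k = m0 (''G_num'', int k)"
definition "gd k = m0 (''G_den'', int k)"

text \<open>The weight stored in cell \<open>k\<close> lies between \<open>2 powr (ek k - 1)\<close> and \<open>2 powr (ek k + 1)\<close>.\<close>

definition "Epos = {k. k < n * n \<and> 0 < gn k \<and> 0 < gd k}"
definition "ek k = int (bit_length (gn k)) - int (bit_length (gd k))"
definition "lo = (if Epos = {} then 0 else Min (ek ` Epos))"
definition "hi = (if Epos = {} then 0 else Max (ek ` Epos))"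

lemma g_bits: "k < n * n ==> bit_length (gn k) \<le> w" "k < n * n ==> bit_length (gd k) \<le> w"
  unfolding gn_def gd_def using gin by (auto intro!: bit_length_le)

lemma ek_bound: "k < n * n ==> \<bar>ek k\<bar> \<le> int w"
  using g_bits[of k] by (auto simp: ek_def)

lemma finite_Epos: "finite Epos"
  by (simp add: Epos_def)

lemma lo_le: "k \<in> Epos ==> lo \<le> ek k" and hi_ge: "k \<in> Epos ==> ek k \<le> hi"
  using finite_Epos by (auto simp: lo_def hi_def)

lemma lo_in: "Epos \<noteq> {} ==> lo \<in> ek ` Epos" and hi_in: "Epos \<noteq> {} ==> hi \<in> ek ` Epos"
  using finite_Epos by (auto simp: lo_def hi_def)

lemma lo_bound: "\<bar>lo\<bar> \<le> int w"
proof (cases "Epos = {}")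
  case False
  then show ?thesis using lo_in[OF False] ek_bound by (auto simp: Epos_def)
qed (simp add: lo_def)

lemma hi_bound: "\<bar>hi\<bar> \<le> int w"
proof (cases "Epos = {}")
  case False
  then show ?thesis using hi_in[OF False] ek_bound by (auto simp: Epos_def)
qed (simp add: hi_def)

lemma lo_hi: "lo \<le> hi"
proof (cases "Epos = {}")
  case False
  then obtain k where "k \<in> Epos" by auto
  then show ?thesis using lo_le hi_ge by fastforce
qed (simp add: lo_def hi_def)

abbreviation N2 :: nat where "N2 \<equiv> 2 ^ (2 * lb)"

lemma nn_N2: "n * n \<le> N2"
proof -
  have "n * n \<le> 2 ^ lb * 2 ^ lb" using n_lb by (intro mult_le_mono) auto
  then show ?thesis by (simp add: mult_2 power_add)
qed

text \<open>The padding value is neutral, being at least every \<open>g k\<close>, and shows only if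
  \<open>E\<close> is empty.\<close>

lemma Min_default:
  fixes g :: "nat => int" and b :: int
  assumes "E \<subseteq> {..<N}" "0 < N" "\<And>k. k \<in> E ==> g k \<le> b"
  shows "Min ((\<lambda>k. if k \<in> E then g k else b) ` {..<N}) = (if E = {} then b else Min (g ` E))"
proof (cases "E = {}")
  case True
  then show ?thesis using assms by (auto simp: image_constant_conv)
next
  case False
  have finE: "finite E" using assms(1) finite_subset by blast
  have "Min (g ` E) \<in> g ` E" using False finE by (intro Min_in) auto
  then obtain k0 where k0: "k0 \<in> E" "Min (g ` E) = g k0" by auto
  have "Min ((\<lambda>k. if k \<in> E then g k else b) ` {..<N}) = g k0"
  proof (rule Min_eqI)
    fix y assume "y \<in> (\<lambda>k. if k \<in> E then g k else b) ` {..<N}"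
    then obtain k where "y = (if k \<in> E then g k else b)" by (rule imageE) (rule that)
    then show "g k0 \<le> y" using k0 finE assms(3)[OF k0(1)] by (auto simp flip: k0(2))
  next
    show "g k0 \<in> (\<lambda>k. if k \<in> E then g k else b) ` {..<N}" using k0 assms(1) by (auto intro!: image_eqI[of _ _ k0])
  qed simp
  then show ?thesis using False k0 by simp
qed

definition inp_arrays :: "string set" where
  "inp_arrays = {''G_num'', ''G_den'', ''H_num'', ''H_den'', ''source''}"

definition inp :: "(cell => int) => bool" where
  "inp m \<longleftrightarrow> (\<forall>A i. A \<in> inp_arrays \<longrightarrow> m (A, i) = m0 (A, i))"

lemma inp_frame: "inp m ==> frame S m m' ==> S \<inter> inp_arrays = {} ==> inp m'"
  by (auto simp: inp_def frame_def)

lemma inp_g: "inp m ==> m (''G_num'', int k) = gn k" "inp m ==> m (''G_den'', int k) = gd k"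
  by (auto simp: inp_def inp_arrays_def gn_def gd_def)

lemma g_bnd: "k < n * n ==> \<bar>gn k\<bar> < 2 ^ B" "k < n * n ==> \<bar>gd k\<bar> < 2 ^ B"
  using gin[of k] Bw unfolding gn_def gd_def by (auto intro: pow_less_B[of _ w])

lemma N2_B: "N2 < 2 ^ B"
  using Nx1 lessB' by auto

lemma lb_B: "lb < 2 ^ B" "2 * lb < 2 ^ B" "2 * lb \<le> B"
  using Bw by (auto intro!: lessB)

lemma n_B: "n < 2 ^ B"
  using n_lb less_le_trans[OF n_lb, of "2 ^ B"] Bw by (simp add: power_increasing)

lemma nn_B: "n * n < 2 ^ B"
  using nn_N2 N2_B by linarith

text \<open>The budget consists of one map, one assignment and a tournament of \<open>2 * lb\<close>
  rounds at 5 units each plus 2. The tournament changes \<open>cnt\<close> and \<open>l\<close>, so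
  the continuation has to cope with any values of these.\<close>

lemma wpc_leafmin:
  assumes gk: "gok e_vc" "gok z" "\<forall>e\<in>set reduce_exprs. gok e" "''Z'' \<notin> earr z"
    and s: "s ''c'' = int N2" "s ''h'' = int (2 * lb)" and k: "10 * lb + 4 \<le> k"
    and z: "\<And>i. i < N2 ==> esafe B z (s(''i'' := int i)) m \<and> ev z (s(''i'' := int i)) m = f i"
    and f: "\<And>i. i < N2 ==> \<bar>f i\<bar> < 2 ^ B"
    and Q: "\<And>m' cnt l. frame {''Z'', ''T2''} m m' ==> m' (''Z'', 0) = Min (f ` {..<N2}) ==>
       wpc c Q (k - (10 * lb + 4)) (s(''cnt'' := cnt, ''l'' := l)) m'"
  shows "wpc (Seq (PMap ''Z'' e_vc z) (Seq (Assign ''cnt'' e_vc) (Seq reduce c))) Q k s m"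
proof (rule wpc_pmap_seq[OF _ gk(1) _ _ Nx1 gk(2,4) z])
  show "0 < k" using k by simp
  show "esafe B e_vc s m" "ev e_vc s m = int N2" using s N2_B by (auto simp: e_vc_def)
  fix m1 assume m1: "arr m1 ''Z'' N2 f" "frame {''Z''} m m1"
  show "wpc (Seq (Assign ''cnt'' e_vc) (Seq reduce c)) Q (k - 1) s m1"
  proof (rule wpc_assign_seq[OF _ gk(1)])
    show "0 < k - 1" using k by simp
    show "esafe B e_vc s m1" using s N2_B by (auto simp: e_vc_def)
    have v: "ev e_vc s m1 = int N2" using s by (simp add: e_vc_def)
    show "wpc (Seq reduce c) Q (k - 1 - 1) (s(''cnt'' := ev e_vc s m1)) m1"
      unfolding v
    proof (rule wpc_seq_le[of "2 * lb * 5 + 2"])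
      show "2 * lb * 5 + 2 \<le> k - 1 - 1" using k by simp
      show "wpc reduce (\<lambda>s m. wpc c Q (k - 1 - 1 - (2 * lb * 5 + 2)) s m) (2 * lb * 5 + 2) (s(''cnt'' := int N2)) m1"
      proof (rule wpc_reduce[OF gk(3) _ _ _ _ _ _ f, where c=1])
        fix m2 assume m2: "arr m2 ''Z'' 1 (\<lambda>b. Min (f ` {b * 2 ^ (2 * lb)..<(b + 1) * 2 ^ (2 * lb)}))" "frame {''Z'', ''T2''} m1 m2"
        have "wpc c Q (k - (10 * lb + 4)) (s(''cnt'' := int 1, ''l'' := int (2 * lb))) m2"
        proof (rule Q)
          show "frame {''Z'', ''T2''} m m2" using m1(2) m2(2) by (rule frame_trans) auto
          show "m2 (''Z'', 0) = Min (f ` {..<N2})" using arrD[OF m2(1), of 0] by (simp add: atLeast0LessThan)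
        qed
        moreover have "k - 1 - 1 - (2 * lb * 5 + 2) = k - (10 * lb + 4)" by simp
        ultimately show "wpc c Q (k - 1 - 1 - (2 * lb * 5 + 2)) (s(''cnt'' := int N2, ''cnt'' := int 1, ''l'' := int (2 * lb))) m2"
          unfolding fun_upd_upd by metis
      qed (use s lb_B B10 Nx1 m1 in auto)
    qed
  qed simp
qed

lemma wpc_range:
  assumes gk: "\<forall>e\<in>set range_exprs. gok e"
    and s: "s ''n'' = int n" "s ''lb'' = int lb" and m: "inp m"
    and k: "45 + 30 * lb \<le> k"
    and Q: "\<And>m' c bb x cnt l. inp m' ==> Q (s(''h'' := int (2 * lb), ''c'' := c, ''cnt'' := cnt, ''l'' := l,
       ''bb'' := bb, ''x'' := x, ''hi'' := hi, ''lo'' := lo)) m'"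
  shows "wpc ph_range Q k s m"
proof -
  note gok = gk[unfolded range_exprs_def, simplified]
  have rex: "\<forall>e\<in>set reduce_exprs. gok e" using gok by simp
  note lits = small_lits
  have N2i: "(2::int) ^ (2 * lb) < 2 ^ B" using Bw by (intro power_strict_increasing) auto
  define f1 where "f1 i = (if i < n * n then - int (bit_length (gn i) + bit_length (gd i)) else 0)" for i
  define bb where "bb = 1 - Min (f1 ` {..<N2})"
  have f1w: "- int (2 * w) \<le> f1 i" "f1 i \<le> 0" for i using g_bits[of i] by (auto simp: f1_def)
  have wB: "int (2 * w) + 1 < 2 ^ B"
  proof -
    have "int (2 * w + 1) < 2 ^ B" unfolding int_lessB using Bw by (intro lessB) simp
    then show ?thesis by simp
  qed
  have ne: "{..<N2} \<noteq> {}" by (simp add: lessThan_empty_iff)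
  have "Min (f1 ` {..<N2}) \<in> f1 ` {..<N2}" using ne by (intro Min_in) auto
  then obtain i0 where "Min (f1 ` {..<N2}) = f1 i0" by (rule imageE) (rule that)
  then have bb1: "1 \<le> bb" "bb \<le> int (2 * w) + 1" unfolding bb_def using f1w[of i0] by linarith+
  have bbg: "int (bit_length (gn i) + bit_length (gd i)) < bb" if "i < n * n" for i
  proof -
    have "Min (f1 ` {..<N2}) \<le> f1 i" using that nn_N2 by (intro Min_le) auto
    then show ?thesis using that by (simp add: bb_def f1_def)
  qed
  have bbB: "\<bar>bb\<bar> < 2 ^ B" using bb1 wB by linarith
  have ekB: "\<bar>ek i\<bar> < 2 ^ B" if "i \<in> Epos" for i using ek_bound[of i] that wB by (auto simp: Epos_def)
  define f2 where "f2 i = (if i \<in> Epos then ek i else bb)" for i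
  define f3 where "f3 i = (if i \<in> Epos then - ek i else bb)" for i
  have EN: "Epos \<subseteq> {..<N2}" using nn_N2 by (auto simp: Epos_def)
  have M2: "Min (f2 ` {..<N2}) = (if Epos = {} then bb else lo)"
    unfolding f2_def using bbg by (subst Min_default[OF EN]) (force simp: lo_def ek_def Epos_def)+
  have M3: "- Min (f3 ` {..<N2}) = (if Epos = {} then - bb else hi)"
  proof -
    have e: "Min (f3 ` {..<N2}) = (if Epos = {} then bb else Min ((\<lambda>i. - ek i) ` Epos))"
      unfolding f3_def using bbg by (subst Min_default[OF EN]) (force simp: ek_def Epos_def)+
    have "Min ((\<lambda>i. - ek i) ` Epos) = - hi" if "Epos \<noteq> {}"
    proof (rule Min_eqI)
      show "- hi \<le> y" if "y \<in> (\<lambda>i. - ek i) ` Epos" for y using that hi_ge by auto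
      from hi_in[OF that] obtain i where "i \<in> Epos" "hi = ek i" by auto
      then show "- hi \<in> (\<lambda>i. - ek i) ` Epos" by auto
    qed (simp add: finite_Epos)
    then show ?thesis using e by simp
  qed
  have iB: "i < 2 ^ B" if "i < N2" for i using that N2_B by linarith
  have hilo: "(if Epos = {} then - bb else hi) < (if Epos = {} then bb else lo) \<longleftrightarrow> Epos = {}"
    using bb1 lo_hi by auto
  have hlB: "\<bar>lo\<bar> < 2 ^ B" "\<bar>hi\<bar> < 2 ^ B" using lo_bound hi_bound wB by linarith+
  let ?s0 = "s(''h'' := int (2 * lb), ''c'' := int N2)"
  show ?thesis unfolding ph_range_def
  proof (rule wpc_assign_seq)
    show "esafe B e_2lb s m" using s lb_B by (simp add: e_2lb_def)
    have v: "ev e_2lb s m = int (2 * lb)" using s by (simp add: e_2lb_def)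
    show "wpc (Seq (Assign ''c'' e_c)
     (Seq (PMap ''Z'' e_vc e_z1) (Seq (Assign ''cnt'' e_vc) (Seq reduce (Seq (Assign ''bb'' e_bb)
     (Seq (PMap ''Z'' e_vc e_z2) (Seq (Assign ''cnt'' e_vc) (Seq reduce (Seq (Assign ''lo'' e_Z0)
     (Seq (PMap ''Z'' e_vc e_z3) (Seq (Assign ''cnt'' e_vc) (Seq reduce (Seq (Assign ''hi'' e_nZ0)
     (Seq (Assign ''x'' e_x) (Seq (Assign ''hi'' e_hi) (Assign ''lo'' e_xv))))))))))))))))
        Q (k - 1) (s(''h'' := ev e_2lb s m)) m" unfolding v
    proof (rule wpc_assign_seq)
      have "2 * int lb < 2 ^ B" using lb_B(2) int_lessB[of "2 * lb"] by simp
      then show "esafe B e_c (s(''h'' := int (2 * lb))) m" using lb_B lits by (simp add: e_c_def)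
      have v: "ev e_c (s(''h'' := int (2 * lb))) m = int N2" by (simp add: e_c_def nat_mult_distrib)
      show "wpc (Seq (PMap ''Z'' e_vc e_z1) (Seq (Assign ''cnt'' e_vc) (Seq reduce (Seq (Assign ''bb'' e_bb)
     (Seq (PMap ''Z'' e_vc e_z2) (Seq (Assign ''cnt'' e_vc) (Seq reduce (Seq (Assign ''lo'' e_Z0)
     (Seq (PMap ''Z'' e_vc e_z3) (Seq (Assign ''cnt'' e_vc) (Seq reduce (Seq (Assign ''hi'' e_nZ0)
     (Seq (Assign ''x'' e_x) (Seq (Assign ''hi'' e_hi) (Assign ''lo'' e_xv)))))))))))))))
        Q (k - 1 - 1) (s(''h'' := int (2 * lb), ''c'' := ev e_c (s(''h'' := int (2 * lb))) m)) m" unfolding v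
      proof (rule wpc_leafmin[where f=f1])
        show "esafe B e_z1 (?s0(''i'' := int i)) m \<and> ev e_z1 (?s0(''i'' := int i)) m = f1 i" if "i < N2" for i
          using that s iB[OF that] n_B inp_g[OF m, of i] g_bnd[of i] lits
          by (auto simp: e_z1_def f1_def simp flip: of_nat_mult)
        show "\<bar>f1 i\<bar> < 2 ^ B" for i using f1w[of i] wB by linarith
        fix m1 cnt1 l1 assume f1: "frame {''Z'', ''T2''} m m1" and Z1: "m1 (''Z'', 0) = Min (f1 ` {..<N2})"
        have m1: "inp m1" using m f1 by (rule inp_frame) (auto simp: inp_arrays_def)
        let ?s1 = "?s0(''cnt'' := cnt1, ''l'' := l1)"
        show "wpc (Seq (Assign ''bb'' e_bb)
     (Seq (PMap ''Z'' e_vc e_z2) (Seq (Assign ''cnt'' e_vc) (Seq reduce (Seq (Assign ''lo'' e_Z0)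
     (Seq (PMap ''Z'' e_vc e_z3) (Seq (Assign ''cnt'' e_vc) (Seq reduce (Seq (Assign ''hi'' e_nZ0)
     (Seq (Assign ''x'' e_x) (Seq (Assign ''hi'' e_hi) (Assign ''lo'' e_xv))))))))))))
          Q (k - 1 - 1 - (10 * lb + 4)) ?s1 m1"
        proof (rule wpc_assign_seq)
          have ZB: "\<bar>Min (f1 ` {..<N2})\<bar> < 2 ^ B" using bb1 wB unfolding bb_def by linarith
          show "esafe B e_bb ?s1 m1" using Z1 ZB lits by (simp add: e_bb_def)
          have v: "ev e_bb ?s1 m1 = bb" using Z1 by (simp add: e_bb_def bb_def)
          let ?s2 = "?s1(''bb'' := bb)"
          show "wpc (Seq (PMap ''Z'' e_vc e_z2) (Seq (Assign ''cnt'' e_vc) (Seq reduce (Seq (Assign ''lo'' e_Z0)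
     (Seq (PMap ''Z'' e_vc e_z3) (Seq (Assign ''cnt'' e_vc) (Seq reduce (Seq (Assign ''hi'' e_nZ0)
     (Seq (Assign ''x'' e_x) (Seq (Assign ''hi'' e_hi) (Assign ''lo'' e_xv)))))))))))
          Q (k - 1 - 1 - (10 * lb + 4) - 1) (?s1(''bb'' := ev e_bb ?s1 m1)) m1" unfolding v
          proof (rule wpc_leafmin[where f=f2])
            show "esafe B e_z2 (?s2(''i'' := int i)) m1 \<and> ev e_z2 (?s2(''i'' := int i)) m1 = f2 i" if "i < N2" for i
              using that s iB[OF that] n_B inp_g[OF m1, of i] g_bnd[of i] lits bbB
              by (auto simp: e_z2_def f2_def Epos_def ek_def simp flip: of_nat_mult)
            show "\<bar>f2 i\<bar> < 2 ^ B" for i using bbB ekB by (simp add: f2_def)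
            fix m2 cnt2 l2 assume f2: "frame {''Z'', ''T2''} m1 m2" and Z2: "m2 (''Z'', 0) = Min (f2 ` {..<N2})"
            have m2: "inp m2" using m1 f2 by (rule inp_frame) (auto simp: inp_arrays_def)
            let ?s3 = "?s2(''cnt'' := cnt2, ''l'' := l2)" and ?lo = "if Epos = {} then bb else lo"
            have loB: "\<bar>?lo\<bar> < 2 ^ B" using bbB hlB by simp
            show "wpc (Seq (Assign ''lo'' e_Z0)
              (Seq (PMap ''Z'' e_vc e_z3) (Seq (Assign ''cnt'' e_vc) (Seq reduce (Seq (Assign ''hi'' e_nZ0)
              (Seq (Assign ''x'' e_x) (Seq (Assign ''hi'' e_hi) (Assign ''lo'' e_xv))))))))
              Q (k - 1 - 1 - (10 * lb + 4) - 1 - (10 * lb + 4)) ?s3 m2"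
            proof (rule wpc_assign_seq)
              show "esafe B e_Z0 ?s3 m2" using Z2 M2 loB lits by (simp add: e_Z0_def)
              have v: "ev e_Z0 ?s3 m2 = ?lo" using Z2 M2 by (simp add: e_Z0_def)
              let ?s4 = "?s3(''lo'' := ?lo)"
              show "wpc (Seq (PMap ''Z'' e_vc e_z3) (Seq (Assign ''cnt'' e_vc) (Seq reduce (Seq (Assign ''hi'' e_nZ0)
                (Seq (Assign ''x'' e_x) (Seq (Assign ''hi'' e_hi) (Assign ''lo'' e_xv)))))))
                Q (k - 1 - 1 - (10 * lb + 4) - 1 - (10 * lb + 4) - 1) (?s3(''lo'' := ev e_Z0 ?s3 m2)) m2" unfolding v
              proof (rule wpc_leafmin[where f=f3])
                show "esafe B e_z3 (?s4(''i'' := int i)) m2 \<and> ev e_z3 (?s4(''i'' := int i)) m2 = f3 i" if "i < N2" for i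
                  using that s iB[OF that] n_B inp_g[OF m2, of i] g_bnd[of i] lits bbB
                  by (auto simp: e_z3_def f3_def Epos_def ek_def simp flip: of_nat_mult)
                show "\<bar>f3 i\<bar> < 2 ^ B" for i using bbB ekB by (simp add: f3_def)
                fix m3 cnt3 l3 assume f3: "frame {''Z'', ''T2''} m2 m3" and Z3: "m3 (''Z'', 0) = Min (f3 ` {..<N2})"
                have m3: "inp m3" using m2 f3 by (rule inp_frame) (auto simp: inp_arrays_def)
                let ?s5 = "?s4(''cnt'' := cnt3, ''l'' := l3)" and ?hi = "if Epos = {} then - bb else hi"
                have hiB: "\<bar>?hi\<bar> < 2 ^ B" using bbB hlB by simp
                show "wpc (Seq (Assign ''hi'' e_nZ0) (Seq (Assign ''x'' e_x) (Seq (Assign ''hi'' e_hi) (Assign ''lo'' e_xv))))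
                   Q (k - 1 - 1 - (10 * lb + 4) - 1 - (10 * lb + 4) - 1 - (10 * lb + 4)) ?s5 m3"
                proof (rule wpc_assign_seq)
                  have v: "ev e_nZ0 ?s5 m3 = ?hi" using Z3 M3 by (simp add: e_nZ0_def)
                  have "\<bar>- Min (f3 ` {..<N2})\<bar> < 2 ^ B" unfolding M3 by (rule hiB)
                  then have "\<bar>Min (f3 ` {..<N2})\<bar> < 2 ^ B" by simp
                  then show "esafe B e_nZ0 ?s5 m3" using Z3 lits by (simp add: e_nZ0_def)
                  let ?s6 = "?s5(''hi'' := ?hi)"
                  show "wpc (Seq (Assign ''x'' e_x) (Seq (Assign ''hi'' e_hi) (Assign ''lo'' e_xv)))
                   Q (k - 1 - 1 - (10 * lb + 4) - 1 - (10 * lb + 4) - 1 - (10 * lb + 4) - 1) (?s5(''hi'' := ev e_nZ0 ?s5 m3)) m3"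
                    unfolding v
                  proof (rule wpc_assign_seq)
                    show "esafe B e_x ?s6 m3" using loB hiB lits by (simp add: e_x_def)
                    have v: "ev e_x ?s6 m3 = lo" using hilo by (simp add: e_x_def lo_def)
                    show "wpc (Seq (Assign ''hi'' e_hi) (Assign ''lo'' e_xv))
                     Q (k - 1 - 1 - (10 * lb + 4) - 1 - (10 * lb + 4) - 1 - (10 * lb + 4) - 1 - 1) (?s6(''x'' := ev e_x ?s6 m3)) m3"
                      unfolding v
                    proof (rule wpc_assign_seq)
                      show "esafe B e_hi (?s6(''x'' := lo)) m3" using loB hiB lits by (simp add: e_hi_def)
                      have v: "ev e_hi (?s6(''x'' := lo)) m3 = hi" using hilo by (simp add: e_hi_def hi_def)
                      let ?s7 = "?s6(''x'' := lo, ''hi'' := hi)"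
                      have "wpc (Assign ''lo'' e_xv) Q 1 ?s7 m3"
                      proof (rule wpc_assign)
                        show "esafe B e_xv ?s7 m3" using hlB by (simp add: e_xv_def)
                        have "?s7(''lo'' := ev e_xv ?s7 m3) = s(''h'' := int (2 * lb), ''c'' := int N2, ''cnt'' := cnt3, ''l'' := l3,
                          ''bb'' := bb, ''x'' := lo, ''hi'' := hi, ''lo'' := lo)"
                          by (auto simp: e_xv_def fun_eq_iff)
                        then show "Q (?s7(''lo'' := ev e_xv ?s7 m3)) m3" using Q[OF m3] by metis
                      qed (use gok in auto)
                      then show "wpc (Assign ''lo'' e_xv) Q
                        (k - 1 - 1 - (10 * lb + 4) - 1 - (10 * lb + 4) - 1 - (10 * lb + 4) - 1 - 1 - 1)
                        (?s6(''x'' := lo, ''hi'' := ev e_hi (?s6(''x'' := lo)) m3)) m3"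
                        unfolding v by (rule wpc_mono) (use k in auto)
                    qed (use gok k in auto)
                  qed (use gok k in auto)
                qed (use gok k in auto)
              qed (use gok rex k in \<open>auto simp: e_z3_def\<close>)
            qed (use gok k in auto)
          qed (use gok rex k in \<open>auto simp: e_z2_def\<close>)
        qed (use gok k in auto)
      qed (use gok rex k in \<open>auto simp: e_z1_def\<close>)
    qed (use gok k in auto)
  qed (use gok k in auto)
qed

end

section \<open>Thresholds, rounded weights and powers of the recursion constants\<close>

definition "e_sh = vt [-] vlo"
definition "e_tn a f = (ELit (int f) [+] ELit (int (a + 1)) [*] vlb) [+] ((vhi [-] vlo) [+] vt) [+] ELit 2"
definition "e_T = vtn [+] (vhops [+] vhops) [+] ELit 2"
definition "e_I = ELit 1 [<<] vT"
definition "e_cap = ELit 1 [<<] vtn"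
definition "e_J = vT [-] vm"
definition "e_nn = vn [*] vn"
definition "e_sn = vs [*] vn"
definition "e_one = ELit 1"
definition "e_zero = ELit 0"
definition "e_m1 = vhops [-] ELit 1"
text \<open>The ceiling of a weight in units of \<open>2 powr - sh\<close>, written as a negated
  floor. For negative \<open>sh\<close> the denominator is scaled instead of the numerator, so that
  the ceiling is that of the exact quotient. A zero denominator, which stands for infinity, becomes
  \<open>I\<close>.\<close>

definition e_rnd :: "expr => expr => expr" where
  "e_rnd nu de = EIf (ELit 0) de
     (ELit 0 [-] (ELit 0 [-] EIf vsh (ELit 0) nu (nu [<<] vsh)) [div] EIf vsh (ELit 0) (de [<<] (ELit 0 [-] vsh)) de) vI"
definition "e_rG = e_rnd Gn Gd"
definition "e_rH = e_rnd Hn Hd"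
definition "e_y = EIf (ELoad ''RG'' vi) (ELoad ''RH'' vi) (ELoad ''RG'' vi) (ELoad ''RH'' vi)"
definition "e_ycap = EIf (EVar ''cap'') e_y vI e_y"
text \<open>The only test is a strict comparison, so the case of different row and column takes two
  of them, and the diagonal is what remains.\<close>

definition "e_A = EIf (vi [div] vn) (vi [mod] vn) e_ycap (EIf (vi [mod] vn) (vi [div] vn) e_ycap (ELit 0))"
definition "e_B = ELoad ''A'' (ELoad ''source'' (vi [div] vn) [*] vn [+] vi [mod] vn)"
definition "e_vnn = EVar ''nn''"
definition "e_vsn = vsn"

definition ph_scale :: "nat => nat => com" where
  "ph_scale \<kappa> a = Seq (Assign ''lb'' e_lb) (Seq (Assign ''m'' (e_m \<kappa>)) (Seq (Assign ''M'' e_M) (Assign ''t'' (e_t a))))"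

definition ph_mat :: "nat => nat => com" where
  "ph_mat a f = Seq (Assign ''sh'' e_sh) (Seq (Assign ''tn'' (e_tn a f)) (Seq (Assign ''T'' e_T) (Seq (Assign ''I'' e_I)
     (Seq (Assign ''cap'' e_cap) (Seq (Assign ''J'' e_J) (Seq (Assign ''nn'' e_nn) (Seq (Assign ''sn'' e_sn)
     (Seq (Assign ''one'' e_one) (Seq (Assign ''m1'' e_m1)
     (Seq (PMap ''RG'' e_vnn e_rG) (Seq (PMap ''RH'' e_vnn e_rH) (Seq (PMap ''A'' e_vnn e_A) (PMap ''B'' e_vsn e_B)))))))))))))"

definition "e_E D = EIf vQ vn (vE [*] ELit D) vE"
definition "e_P p = EIf vQ vn (vP [*] ELit (int p)) vP"
definition "e_k = EIf vQ vn (vk [+] ELit 1) vk"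
definition "e_Q q = EIf vQ vn (vQ [*] ELit (int q)) vQ"

text \<open>The number of rounds is always \<open>lb\<close>; once \<open>Q\<close> has reached
  \<open>n\<close>, a round changes nothing. \<open>Q\<close> is updated last because the other
  updates test it.\<close>

definition ph_pow_body :: "nat => nat => int => com" where
  "ph_pow_body p q D = Seq (Assign ''E'' (e_E D)) (Seq (Assign ''P'' (e_P p)) (Seq (Assign ''k'' e_k) (Assign ''Q'' (e_Q q))))"

definition ph_pow :: "nat => nat => int => com" where
  "ph_pow p q D = Seq (Assign ''E'' e_one) (Seq (Assign ''P'' e_one) (Seq (Assign ''k'' e_zero) (Seq (Assign ''Q'' e_one)
     (For ''x'' ''lb'' (ph_pow_body p q D)))))"

definition setup_exprs where
  "setup_exprs p q D \<kappa> a f = [e_lb, e_m \<kappa>, e_M, e_t a, e_sh, e_tn a f, e_T, e_I, e_cap, e_J, e_nn, e_sn, e_one, e_zero, e_m1,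
     e_rG, e_rH, e_A, e_B, e_vnn, e_vsn, e_E D, e_P p, e_k, e_Q q]"

text \<open>\<open>2 ^ ce\<close> bounds the growth of entries in one level of the recursion.
  \<open>BK\<close> reserves bits for the rounded weights and the thresholds, \<open>BM\<close> for
  the encoded matrices: \<open>lb * 2 ^ mm\<close> bits for either factor, and
  \<open>ce * lb\<close> bits each for the forward levels of the two factors and for the backward
  levels.\<close>

locale prun2 = prun w B G Nx n lb m0 for w B G Nx n lb :: nat and m0 :: "cell => int" +
  fixes p q R :: nat and U V W :: "nat => nat => int" and D cu :: int and \<kappa> a f s hops acc ce mm tt :: nat
  assumes hin: "\<And>k. k < n * n ==> 0 \<le> m0 (''H_num'', int k) \<and> m0 (''H_num'', int k) < 2 ^ w"
      "\<And>k. k < n * n ==> 0 \<le> m0 (''H_den'', int k) \<and> m0 (''H_den'', int k) < 2 ^ w"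
    and src: "\<And>i. i < s ==> 0 \<le> m0 (''source'', int i) \<and> m0 (''source'', int i) < int n"
    and sn: "s \<le> n" and hops1: "1 \<le> hops" and acc1: "1 \<le> acc" and \<kappa>2: "2 \<le> \<kappa>"
    and pq: "1 \<le> p" "p \<le> q" "2 \<le> q" "q * q \<le> R" and D1: "1 \<le> D"
    and alg: "\<And>x y i k. i < p ==> k < q ==>
      (\<Sum>\<rho><R. W (i * q + k) \<rho> * (\<Sum>t<p * q. U \<rho> t * x t) * (\<Sum>t<q * q. V \<rho> t * y t)) = D * (\<Sum>j<q. x (i * q + j) * y (j * q + k))"
    and UVW: "\<And>i j. \<bar>U i j\<bar> \<le> cu" "\<And>i j. \<bar>V i j\<bar> \<le> cu" "\<And>i j. \<bar>W i j\<bar> \<le> cu"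
    and ce: "int (R * R) * (cu + 1) < 2 ^ ce" "D < 2 ^ ce"
    and mm_eq: "mm = bit_length (int (\<kappa> * acc * lb))"
    and tt_eq: "tt = a * lb + (mm + 1)"
    and BK: "4 * w + 4 * lb + 2 * (f + (a + 1) * lb + tt + 2 * hops + 10) + \<kappa> + acc + ce \<le> B"
    and BM: "3 * ce * lb + 2 * lb * 2 ^ mm + 10 \<le> B"
begin

text \<open>Weights are rounded up to multiples of \<open>2 powr - sh\<close>, and multiples exceeding \<open>2 ^ tn\<close> are dropped. The value \<open>I\<close>
  stands for infinity; finite entries at most quadruple in each product and so stay below it. There are \<open>J\<close> scales.\<close>

definition sh :: int where "sh = int tt - lo"
definition tn :: nat where "tn = f + (a + 1) * lb + nat (hi - lo) + tt + 2"
definition T :: nat where "T = tn + 2 * hops + 2"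
definition I :: int where "I = 2 ^ T"
definition J :: nat where "J = T - mm"
definition kk :: nat where "kk = (LEAST k. n \<le> q ^ k)"
abbreviation M :: int where "M \<equiv> 2 ^ mm"

lemma mm_T: "mm < T" unfolding T_def tn_def using tt_eq by simp

lemma n_le: "n \<le> q ^ kk" and kk_le: "kk \<le> lb"
proof -
  have "2 ^ lb \<le> q ^ lb" using pq by (intro power_mono) auto
  then have l: "n \<le> q ^ lb" using n_lb by linarith
  then show "n \<le> q ^ kk" unfolding kk_def by (rule LeastI)
  show "kk \<le> lb" unfolding kk_def using l by (rule Least_le)
qed

lemma less_kk: "j < kk ==> q ^ j < n"
  unfolding kk_def using not_less_Least by (meson not_le)

lemma kk1: "1 \<le> kk"
proof (rule ccontr)
  assume "\<not> 1 \<le> kk"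
  then have "kk = 0" by simp
  then show False using n_le n2 by simp
qed

lemma powq_le: "j \<le> kk ==> q ^ j \<le> q * n"
proof -
  assume j: "j \<le> kk"
  have "q ^ j \<le> q ^ kk" using j pq by (intro power_increasing) auto
  also have "\<dots> = q * q ^ (kk - 1)" using kk1 by (cases kk) auto
  also have "\<dots> \<le> q * n" using less_kk[of "kk - 1"] kk1 by simp
  finally show ?thesis .
qed

lemma powp_le: "p ^ j \<le> q ^ j"
  using pq by (intro power_mono) auto

lemma cu0: "0 \<le> cu" using UVW(1)[of 0 0] by linarith

lemma R4: "4 \<le> R"
proof -
  have "2 * 2 \<le> q * q" using pq by (intro mult_le_mono) auto
  then show ?thesis using pq by simp
qed

lemma RR_ce: "R * R < 2 ^ ce" "cu < 2 ^ ce" "R < 2 ^ ce" "q < 2 ^ ce" "p < 2 ^ ce"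
proof -
  have "int (R * R) * 1 \<le> int (R * R) * (cu + 1)" using cu0 by (intro mult_left_mono) auto
  then have "int (R * R) < 2 ^ ce" using ce(1) by linarith
  then show 1: "R * R < 2 ^ ce" by (metis of_nat_less_numeral_power_cancel_iff)
  have "1 \<le> R * R" using R4 by (simp add: Suc_le_eq)
  then have "1 \<le> int (R * R)" by linarith
  then have "1 * (cu + 1) \<le> int (R * R) * (cu + 1)" using cu0 by (intro mult_right_mono) auto
  from le_less_trans[OF this ce(1)] show "cu < 2 ^ ce" by simp
  have "R \<le> R * R" by simp
  then show R: "R < 2 ^ ce" using 1 by linarith
  have "q \<le> q * q" by simp
  then show "q < 2 ^ ce" using pq R by linarith
  then show "p < 2 ^ ce" using pq by linarith
qed

lemma ce_B: "x < 2 ^ ce ==> x < (2::nat) ^ B" "y < 2 ^ ce ==> y < (2::int) ^ B"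
  using BK by (auto elim!: less_le_trans intro!: power_increasing)

lemma qn_B: "q * n < 2 ^ B"
proof -
  have "q * n < 2 ^ ce * 2 ^ lb" using RR_ce n_lb by (intro mult_strict_mono) auto
  also have "\<dots> \<le> 2 ^ B" unfolding power_add[symmetric] using BK by (intro power_increasing) auto
  finally show ?thesis .
qed

lemma D_pow_B: "j \<le> lb ==> \<bar>D ^ j\<bar> < 2 ^ B"
proof -
  assume j: "j \<le> lb"
  have "D ^ j \<le> (2 ^ ce) ^ j" using ce(2) D1 by (intro power_mono) auto
  also have "\<dots> = 2 ^ (ce * j)" by (simp add: power_mult)
  also have "\<dots> < 2 ^ B"
  proof (rule power_strict_increasing)
    have "ce * j \<le> ce * lb" using j by simp
    moreover have "3 * ce * lb = ce * lb + ce * lb + ce * lb" by simp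
    ultimately show "ce * j < B" using BM by linarith
  qed simp
  finally show ?thesis using D1 by simp
qed

lemma hl_nat: "int (nat (hi - lo)) = hi - lo" "nat (hi - lo) \<le> 2 * w"
  using lo_hi lo_bound hi_bound by auto

lemma T_B: "T + 3 + 2 * w \<le> B" "T < B" "tn < B" "tt < B" "mm < B" "T \<le> B" "J < B" "tn \<le> B" "mm \<le> B" "hops < B"
  "f < B" "Suc a < B" "acc < B" "\<kappa> < B"
proof -
  have "mm \<le> tt" unfolding tt_eq by simp
  have "Suc a \<le> (a + 1) * lb" using lb2 by (cases lb) auto
  have gen: "4 * w + 4 * l + 2 * (f + x + t + 2 * h + 10) + k1 + k2 + k3 \<le> B ==> d \<le> 2 * w ==>
      f + x + d + t + 2 + 2 * h + 2 + 3 + 2 * w \<le> B" for l x t h k1 k2 k3 d :: nat by arith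
  have "T + 3 + 2 * w \<le> B" unfolding T_def tn_def by (rule gen[OF BK hl_nat(2)])
  then show "T + 3 + 2 * w \<le> B" "T < B" "T \<le> B" "J < B" by (simp_all add: J_def)
  then show "tn < B" "tn \<le> B" by (simp_all add: T_def)
  show "tt < B" "mm < B" "mm \<le> B" "hops < B" "f < B" "acc < B" "\<kappa> < B" using BK \<open>mm \<le> tt\<close> by simp_all
  have gen2: "4 * w + 4 * l + 2 * (f + x + t + 2 * h + 10) + k1 + k2 + k3 \<le> B ==> a' \<le> x ==> a' < B"
    for l x t h k1 k2 k3 a' :: nat by arith
  show "Suc a < B" by (rule gen2[OF BK \<open>Suc a \<le> (a + 1) * lb\<close>])
qed

lemma sh_B: "\<bar>sh\<bar> \<le> int B" "\<bar>sh\<bar> < 2 ^ B"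
proof -
  have "\<bar>sh\<bar> \<le> int (tt + w)" using lo_bound by (auto simp: sh_def)
  moreover have "tt + w < B" using BK by simp
  ultimately have 1: "\<bar>sh\<bar> < int B" by linarith
  then show "\<bar>sh\<bar> \<le> int B" by simp
  have "int B < 2 ^ B" using less_exp[of B] by (simp add: int_lessB)
  then show "\<bar>sh\<bar> < 2 ^ B" using 1 by linarith
qed

lemma I_B: "I < 2 ^ B" "0 < I" "\<bar>I\<bar> < 2 ^ B"
  using T_B by (auto simp: I_def)

lemma mM_B: "M < 2 ^ B" "\<bar>M\<bar> < (2::int) ^ B" using T_B by auto

definition "hnu k = m0 (''H_num'', int k)"
definition "hde k = m0 (''H_den'', int k)"

lemma inp_h: "inp m ==> m (''H_num'', int k) = hnu k" "inp m ==> m (''H_den'', int k) = hde k"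
  by (auto simp: inp_def inp_arrays_def hnu_def hde_def)

definition rnd :: "int => int => int" where
  "rnd nu de = (if 0 < de then - ((- (if sh < 0 then nu else nu * 2 ^ nat sh)) div (if sh < 0 then de * 2 ^ nat (- sh) else de)) else I)"

definition "yv k = min (rnd (gn k) (gd k)) (rnd (hnu k) (hde k))"
definition A :: "nat => nat => int" where
  "A ua v = (if ua = v then 0 else if 2 ^ tn < yv (ua * n + v) then I else yv (ua * n + v))"

definition sc :: "nat => nat" where "sc i = nat (m0 (''source'', int i))"

lemma sc_less: "i < s ==> sc i < n" and sc_int: "i < s ==> m0 (''source'', int i) = int (sc i)"
  using src[of i] by (auto simp: sc_def)

lemma rnd_nonneg: "0 \<le> nu ==> 0 \<le> rnd nu de"
proof -
  assume nu: "0 \<le> nu"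
  have "(- (if sh < 0 then nu else nu * 2 ^ nat sh)) div (if sh < 0 then de * 2 ^ nat (- sh) else de) \<le> 0" if "0 < de"
    using that nu by (intro div_nonpos_pos_le0) auto
  then show ?thesis using I_B by (auto simp: rnd_def)
qed

lemma nn_idx: "ua < n ==> v < n ==> ua * n + v < n * n"
proof -
  assume uv: "ua < n" "v < n"
  have "ua * n + v < (ua + 1) * n" using uv by simp
  also have "\<dots> \<le> n * n" using uv by (intro mult_le_mono1) simp
  finally show ?thesis .
qed

lemma g0: "k < n * n ==> 0 \<le> gn k" "k < n * n ==> 0 \<le> gd k" "k < n * n ==> 0 \<le> hnu k" "k < n * n ==> 0 \<le> hde k"
  using gin hin by (auto simp: gn_def gd_def hnu_def hde_def)

lemma gw: "k < n * n ==> gn k < 2 ^ w" "k < n * n ==> gd k < 2 ^ w" "k < n * n ==> hnu k < 2 ^ w" "k < n * n ==> hde k < 2 ^ w"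
  using gin hin by (auto simp: gn_def gd_def hnu_def hde_def)

lemma h_bnd: "k < n * n ==> \<bar>hnu k\<bar> < 2 ^ B" "k < n * n ==> \<bar>hde k\<bar> < 2 ^ B"
  using g0(3,4)[of k] gw(3,4)[of k] Bw by (auto intro: pow_less_B[of _ w])

lemma tn_T: "(2::int) ^ tn < I"
  unfolding I_def T_def by (intro power_strict_increasing) auto

lemma A_bounds: "ua < n ==> v < n ==> 0 \<le> A ua v" "A ua v \<le> I" "A ua v < I ==> A ua v \<le> 2 ^ tn"
proof -
  show "ua < n ==> v < n ==> 0 \<le> A ua v"
    using g0[OF nn_idx[of ua v]] rnd_nonneg I_B by (auto simp: A_def yv_def)
  show "A ua v \<le> I" using tn_T I_B by (auto simp: A_def)
  show "A ua v < I ==> A ua v \<le> 2 ^ tn" by (auto simp: A_def split: if_splits)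
qed

lemma rnd_bound: "0 \<le> nu ==> nu < 2 ^ w ==> \<bar>rnd nu de\<bar> < 2 ^ B"
proof -
  assume nu: "0 \<le> nu" "nu < 2 ^ w"
  let ?N = "if sh < 0 then nu else nu * 2 ^ nat sh" and ?d = "if sh < 0 then de * 2 ^ nat (- sh) else de"
  have "\<bar>?N\<bar> < 2 ^ B"
  proof (cases "sh < 0")
    case True
    then show ?thesis using nu Bw by (auto intro: pow_less_B[of _ w])
  next
    case False
    then have "nat sh \<le> tt + w" using lo_bound by (auto simp: sh_def)
    have "nu * 2 ^ nat sh < 2 ^ w * 2 ^ nat sh" using nu by (intro mult_strict_right_mono) auto
    also have "\<dots> \<le> 2 ^ B" unfolding power_add[symmetric] using \<open>nat sh \<le> tt + w\<close> BK by (intro power_increasing) auto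
    finally show ?thesis using nu False by simp
  qed
  then have "\<bar>(- ?N) div ?d\<bar> < 2 ^ B" using abs_div_le[of "- ?N" ?d] by linarith
  then show ?thesis using I_B by (simp add: rnd_def)
qed

lemma e_rnd_sem:
  assumes "s' ''sh'' = sh" "s' ''I'' = I" "ev nu s' m = nu'" "ev de s' m = de'"
    "esafe B nu s' m" "esafe B de s' m"
  shows "esafe B (e_rnd nu de) s' m \<and> ev (e_rnd nu de) s' m = rnd nu' de'"
  using assms sh_B I_B small_lits by (auto simp: e_rnd_def rnd_def)

definition env :: "scalars => bool" where
  "env s' \<longleftrightarrow> s' ''n'' = int n \<and> s' ''s'' = int s \<and> s' ''hops'' = int hops \<and> s' ''lb'' = int lb \<and> s' ''M'' = M \<and>
    s' ''sh'' = sh \<and> s' ''I'' = I \<and> s' ''J'' = int J \<and> s' ''sn'' = int (s * n) \<and> s' ''one'' = 1 \<and>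
    s' ''m1'' = int (hops - 1) \<and> s' ''P'' = int (p ^ kk) \<and> s' ''Q'' = int (q ^ kk) \<and> s' ''k'' = int kk \<and> s' ''E'' = D ^ kk"

definition memA :: "(cell => int) => bool" where
  "memA m \<longleftrightarrow> inp m \<and> arr m ''A'' (n * n) (\<lambda>k. A (k div n) (k mod n))"

lemma memA_D: "memA m ==> ua < n ==> v < n ==> m (''A'', int (ua * n + v)) = A ua v"
  using arrD[of m "''A''" "n * n" _ "ua * n + v"] nn_idx[of ua v] by (auto simp: memA_def)

lemma memA_frame: "memA m ==> frame S m m' ==> S \<inter> inp_arrays = {} ==> ''A'' \<notin> S ==> memA m'"
  unfolding memA_def by (auto intro: inp_frame frame_arr)

lemma sn_Nx: "s * n \<le> Nx" "n * n \<le> Nx"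
proof -
  have "s * n \<le> n * n" using sn by (intro mult_le_mono1)
  then show "s * n \<le> Nx" "n * n \<le> Nx" using nn_N2 Nx1 by linarith+
qed

lemma sn_B: "s * n < 2 ^ B" "n * n < 2 ^ B"
  using sn_Nx Nx by linarith+

lemma s_B: "s < 2 ^ B"
  using sn n_B by linarith

lemma eA_sem:
  assumes s: "s' ''n'' = int n" "s' ''I'' = I" "s' ''cap'' = 2 ^ tn" "s' ''i'' = int i" and i: "i < n * n"
    and m: "m (''RG'', int i) = rnd (gn i) (gd i)" "m (''RH'', int i) = rnd (hnu i) (hde i)"
  shows "esafe B e_A s' m \<and> ev e_A s' m = A (i div n) (i mod n)"
proof -
  have ub: "i < 2 ^ B" using i nn_B by linarith
  have b: "\<bar>rnd (gn i) (gd i)\<bar> < 2 ^ B" "\<bar>rnd (hnu i) (hde i)\<bar> < 2 ^ B"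
    using rnd_bound g0 gw i by auto
  have y: "esafe B e_ycap s' m" "ev e_ycap s' m = (if 2 ^ tn < yv i then I else yv i)"
    using s m b ub I_B T_B by (auto simp: e_ycap_def e_y_def yv_def min_def)
  have dm: "(i div n) * n + i mod n = i" by simp
  show ?thesis using s y ub n_B small_lits
    by (auto simp: e_A_def A_def dm of_nat_div[symmetric] of_nat_mod[symmetric] simp del: of_nat_div of_nat_mod)
qed

lemma eB_sem:
  assumes s: "s' ''n'' = int n" "s' ''i'' = int i" and i: "i < s * n" and m: "memA m"
  shows "esafe B e_B s' m \<and> ev e_B s' m = A (sc (i div n)) (i mod n)"
proof -
  have ub: "i < 2 ^ B" using i sn_B by linarith
  have ua: "i div n < s" using i by (simp add: less_mult_imp_div_less)
  have v: "i mod n < n" using n2 by simp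
  have sm: "m (''source'', int (i div n)) = int (sc (i div n))"
    using m sc_int[OF ua] by (auto simp: memA_def inp_def inp_arrays_def)
  have "sc (i div n) < 2 ^ B" using sc_less[OF ua] n_B by linarith
  moreover have "m (''A'', int (sc (i div n) * n + i mod n)) = A (sc (i div n)) (i mod n)"
    using memA_D[OF m sc_less[OF ua] v] .
  moreover have "\<bar>A (sc (i div n)) (i mod n)\<bar> < 2 ^ B"
    using A_bounds(1)[OF sc_less[OF ua] v] A_bounds(2)[of "sc (i div n)" "i mod n"] I_B by linarith
  ultimately show ?thesis using s ub n_B sm
    by (simp add: e_B_def of_nat_div[symmetric] of_nat_mod[symmetric] of_nat_mult[symmetric] of_nat_add[symmetric]
      del: of_nat_div of_nat_mod of_nat_mult of_nat_add)
qed

lemma wpc_scale: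
  assumes gk: "\<forall>e\<in>set (setup_exprs p q D \<kappa> a f). gok e"
    and s: "s' ''n'' = int n" "s' ''accuracy'' = int acc" and k: "4 \<le> k"
    and Q: "Q (s'(''lb'' := int lb, ''m'' := int mm, ''M'' := M, ''t'' := int tt)) m"
  shows "wpc (ph_scale \<kappa> a) Q k s' m"
proof -
  note gok = gk[unfolded setup_exprs_def, simplified]
  note [simp] = int_lessB
  have B': "acc < 2 ^ B" "\<kappa> < 2 ^ B" "lb < 2 ^ B" "a < 2 ^ B" "mm < 2 ^ B" using T_B lb_B by (auto intro: lessB)
  show ?thesis unfolding ph_scale_def
  proof (rule wpc_assign_seq)
    have v: "ev e_lb s' m = int lb" using s by (simp add: e_lb_def lb_eq)
    show "esafe B e_lb s' m" using s n_B by (simp add: e_lb_def)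
    let ?s = "s'(''lb'' := int lb)"
    show "wpc (Seq (Assign ''m'' (e_m \<kappa>)) (Seq (Assign ''M'' e_M) (Assign ''t'' (e_t a)))) Q (k - 1) (s'(''lb'' := ev e_lb s' m)) m"
      unfolding v
    proof (rule wpc_assign_seq)
      have v: "ev (e_m \<kappa>) ?s m = int mm" using s by (simp add: e_m_def mm_eq)
      show "esafe B (e_m \<kappa>) ?s m" using s B' by (simp add: e_m_def)
      let ?s = "s'(''lb'' := int lb, ''m'' := int mm)"
      show "wpc (Seq (Assign ''M'' e_M) (Assign ''t'' (e_t a))) Q (k - 1 - 1) (s'(''lb'' := int lb, ''m'' := ev (e_m \<kappa>) (s'(''lb'' := int lb)) m)) m"
        unfolding v
      proof (rule wpc_assign_seq)
        have v: "ev e_M ?s m = M" by (simp add: e_M_def)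
        show "esafe B e_M ?s m" using B' T_B small_lits by (simp add: e_M_def)
        have "wpc (Assign ''t'' (e_t a)) Q 1 (?s(''M'' := M)) m"
        proof (rule wpc_assign)
          show "esafe B (e_t a) (?s(''M'' := M)) m" using B' small_lits by (simp add: e_t_def)
          have "ev (e_t a) (?s(''M'' := M)) m = int tt" by (simp add: e_t_def tt_eq)
          then show "Q (?s(''M'' := M, ''t'' := ev (e_t a) (?s(''M'' := M)) m)) m" using Q by simp
        qed (use gok in auto)
        then show "wpc (Assign ''t'' (e_t a)) Q (k - 1 - 1 - 1) (s'(''lb'' := int lb, ''m'' := int mm, ''M'' := ev e_M ?s m)) m"
          unfolding v by (rule wpc_mono) (use k in auto)
      qed (use gok k in auto)
    qed (use gok k in auto)
  qed (use gok k in auto)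
qed

lemma wpc_mat:
  assumes gk: "\<forall>e\<in>set (setup_exprs p q D \<kappa> a f). gok e"
    and s: "s' ''n'' = int n" "s' ''s'' = int s" "s' ''hops'' = int hops" "s' ''lb'' = int lb" "s' ''m'' = int mm"
      "s' ''t'' = int tt" "s' ''lo'' = lo" "s' ''hi'' = hi" and m: "inp m" and k: "14 \<le> k"
    and Q: "\<And>m'. memA m' ==> arr m' ''B'' (s * n) (\<lambda>i. A (sc (i div n)) (i mod n)) ==>
      Q (s'(''sh'' := sh, ''tn'' := int tn, ''T'' := int T, ''I'' := I, ''cap'' := 2 ^ tn, ''J'' := int J,
         ''nn'' := int (n * n), ''sn'' := int (s * n), ''one'' := 1, ''m1'' := int (hops - 1))) m'"
  shows "wpc (ph_mat a f) Q k s' m"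
proof -
  note gok = gk[unfolded setup_exprs_def, simplified]
  note [simp] = int_lessB
  have B': "lb < 2 ^ B" "tt < 2 ^ B" "mm < 2 ^ B" "T < 2 ^ B" "tn < 2 ^ B" "hops < 2 ^ B" "f < 2 ^ B" "Suc a < 2 ^ B"
    using T_B lb_B by (auto intro: lessB)
  have aB: "1 + int a < 2 ^ B" using B'(8) int_lessB[of "Suc a"] by simp
  have hlB: "\<bar>lo\<bar> < 2 ^ B" "\<bar>hi\<bar> < 2 ^ B"
  proof -
    have "w < B" using Bw by simp
    then have "int w < 2 ^ B" using lessB by simp
    then show "\<bar>lo\<bar> < 2 ^ B" "\<bar>hi\<bar> < 2 ^ B" using lo_bound hi_bound by linarith+
  qed
  let ?s1 = "s'(''sh'' := sh)"
  let ?s2 = "?s1(''tn'' := int tn)"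
  let ?s3 = "?s2(''T'' := int T)"
  let ?s4 = "?s3(''I'' := I)"
  let ?s5 = "?s4(''cap'' := 2 ^ tn)"
  let ?s6 = "?s5(''J'' := int J)"
  let ?s7 = "?s6(''nn'' := int (n * n))"
  let ?s8 = "?s7(''sn'' := int (s * n))"
  let ?s9 = "?s8(''one'' := 1)"
  let ?s10 = "?s9(''m1'' := int (hops - 1))"
  have v1: "ev e_sh s' m = sh" "esafe B e_sh s' m" using s B' hlB by (auto simp: e_sh_def sh_def)
  have v2: "ev (e_tn a f) ?s1 m = int tn" "esafe B (e_tn a f) ?s1 m"
    using s B' hlB hl_nat small_lits aB by (auto simp: e_tn_def tn_def algebra_simps)
  have v3: "ev e_T ?s2 m = int T" "esafe B e_T ?s2 m" using s B' small_lits by (auto simp: e_T_def T_def)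
  have v4: "ev e_I ?s3 m = I" "esafe B e_I ?s3 m" using B' small_lits T_B by (auto simp: e_I_def I_def)
  have v5: "ev e_cap ?s4 m = 2 ^ tn" "esafe B e_cap ?s4 m" using B' small_lits T_B by (auto simp: e_cap_def)
  have v6: "ev e_J ?s5 m = int J" "esafe B e_J ?s5 m" using s B' mm_T by (auto simp: e_J_def J_def)
  have v7: "ev e_nn ?s6 m = int (n * n)" "esafe B e_nn ?s6 m" using s n_B by (auto simp: e_nn_def)
  have v8: "ev e_sn ?s7 m = int (s * n)" "esafe B e_sn ?s7 m" using s n_B s_B by (auto simp: e_sn_def)
  have v9: "ev e_one ?s8 m = 1" "esafe B e_one ?s8 m" using small_lits by (auto simp: e_one_def)
  have v10: "ev e_m1 ?s9 m = int (hops - 1)" "esafe B e_m1 ?s9 m" using s B' small_lits hops1 by (auto simp: e_m1_def)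
  have n: "ev e_vnn ?s10 x = int (n * n)" "esafe B e_vnn ?s10 x" for x using sn_B by (auto simp: e_vnn_def simp del: of_nat_mult)
  have snv: "ev e_vsn ?s10 x = int (s * n)" "esafe B e_vsn ?s10 x" for x using sn_B by (auto simp: e_vsn_def simp del: of_nat_mult)
  have iB: "i < 2 ^ B" if "i < n * n" for i using that sn_B by linarith
  have rG: "esafe B e_rG (?s10(''i'' := int i)) x \<and> ev e_rG (?s10(''i'' := int i)) x = rnd (gn i) (gd i)" if "i < n * n" "inp x" for i x
    unfolding e_rG_def using that inp_g[OF that(2), of i] g_bnd[of i] iB by (intro e_rnd_sem) auto
  have rH: "esafe B e_rH (?s10(''i'' := int i)) x \<and> ev e_rH (?s10(''i'' := int i)) x = rnd (hnu i) (hde i)" if "i < n * n" "inp x" for i x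
    unfolding e_rH_def using that inp_h[OF that(2), of i] h_bnd[of i] iB by (intro e_rnd_sem) auto
  have fin: "wpc (Seq (PMap ''RG'' e_vnn e_rG) (Seq (PMap ''RH'' e_vnn e_rH) (Seq (PMap ''A'' e_vnn e_A) (PMap ''B'' e_vsn e_B))))
     Q (k - 1 - 1 - 1 - 1 - 1 - 1 - 1 - 1 - 1 - 1) ?s10 m"
  proof (rule wpc_pmap_seq[OF _ _ n(2) n(1) sn_Nx(2) _ _ rG[OF _ m]])
    fix m1 assume m1: "arr m1 ''RG'' (n * n) (\<lambda>i. rnd (gn i) (gd i))" "frame {''RG''} m m1"
    have i1: "inp m1" by (rule inp_frame[OF m m1(2)]) (simp add: inp_arrays_def)
    show "wpc (Seq (PMap ''RH'' e_vnn e_rH) (Seq (PMap ''A'' e_vnn e_A) (PMap ''B'' e_vsn e_B)))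
     Q (k - 1 - 1 - 1 - 1 - 1 - 1 - 1 - 1 - 1 - 1 - 1) ?s10 m1"
    proof (rule wpc_pmap_seq[OF _ _ n(2) n(1) sn_Nx(2) _ _ rH[OF _ i1]])
      fix m2 assume m2: "arr m2 ''RH'' (n * n) (\<lambda>i. rnd (hnu i) (hde i))" "frame {''RH''} m1 m2"
      have i2: "inp m2" by (rule inp_frame[OF i1 m2(2)]) (simp add: inp_arrays_def)
      have RG: "arr m2 ''RG'' (n * n) (\<lambda>i. rnd (gn i) (gd i))" by (rule frame_arr[OF m2(2) _ m1(1)]) simp
      have eA: "esafe B e_A (?s10(''i'' := int i)) m2 \<and> ev e_A (?s10(''i'' := int i)) m2 = A (i div n) (i mod n)" if "i < n * n" for i
        using s arrD[OF RG that] arrD[OF m2(1) that] that by (intro eA_sem) auto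
      show "wpc (Seq (PMap ''A'' e_vnn e_A) (PMap ''B'' e_vsn e_B))
       Q (k - 1 - 1 - 1 - 1 - 1 - 1 - 1 - 1 - 1 - 1 - 1 - 1) ?s10 m2"
      proof (rule wpc_pmap_seq[OF _ _ n(2) n(1) sn_Nx(2) _ _ eA])
        fix m3 assume m3: "arr m3 ''A'' (n * n) (\<lambda>i. A (i div n) (i mod n))" "frame {''A''} m2 m3"
        have "inp m3" by (rule inp_frame[OF i2 m3(2)]) (simp add: inp_arrays_def)
        then have mA: "memA m3" using m3 by (simp add: memA_def)
        have eB: "esafe B e_B (?s10(''i'' := int i)) m3 \<and> ev e_B (?s10(''i'' := int i)) m3 = A (sc (i div n)) (i mod n)" if "i < s * n" for i
          using s that mA by (intro eB_sem) auto
        have "wpc (PMap ''B'' e_vsn e_B) Q 1 ?s10 m3"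
        proof (rule wpc_pmap_arr[OF _ snv(2) snv(1) sn_Nx(1) _ _ eB])
          fix m4 assume m4: "arr m4 ''B'' (s * n) (\<lambda>i. A (sc (i div n)) (i mod n))" "frame {''B''} m3 m4"
          have "memA m4" by (rule memA_frame[OF mA m4(2)]) (auto simp: inp_arrays_def)
          then show "Q ?s10 m4" using Q m4 by blast
        qed (use gok in \<open>auto simp: e_B_def\<close>)
        then show "wpc (PMap ''B'' e_vsn e_B) Q (k - 1 - 1 - 1 - 1 - 1 - 1 - 1 - 1 - 1 - 1 - 1 - 1 - 1) ?s10 m3"
          by (rule wpc_mono) (use k in auto)
      qed (use gok k in \<open>auto simp: e_A_def e_ycap_def e_y_def\<close>)
    qed (use gok k in \<open>auto simp: e_rH_def e_rnd_def\<close>)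
  qed (use gok k in \<open>auto simp: e_rG_def e_rnd_def\<close>)
  show ?thesis unfolding ph_mat_def
    apply (rule wpc_assign_seq[OF _ _ _ v1(2)], use k in simp, use gok in simp, simp, unfold v1(1))
    apply (rule wpc_assign_seq[OF _ _ _ v2(2)], use k in simp, use gok in simp, simp, unfold v2(1))
    apply (rule wpc_assign_seq[OF _ _ _ v3(2)], use k in simp, use gok in simp, simp, unfold v3(1))
    apply (rule wpc_assign_seq[OF _ _ _ v4(2)], use k in simp, use gok in simp, simp, unfold v4(1))
    apply (rule wpc_assign_seq[OF _ _ _ v5(2)], use k in simp, use gok in simp, simp, unfold v5(1))
    apply (rule wpc_assign_seq[OF _ _ _ v6(2)], use k in simp, use gok in simp, simp, unfold v6(1))
    apply (rule wpc_assign_seq[OF _ _ _ v7(2)], use k in simp, use gok in simp, simp, unfold v7(1))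
    apply (rule wpc_assign_seq[OF _ _ _ v8(2)], use k in simp, use gok in simp, simp, unfold v8(1))
    apply (rule wpc_assign_seq[OF _ _ _ v9(2)], use k in simp, use gok in simp, simp, unfold v9(1))
    apply (rule wpc_assign_seq[OF _ _ _ v10(2)], use k in simp, use gok in simp, simp, unfold v10(1))
    by (rule fin)
qed

lemma wpc_pow:
  assumes gk: "\<forall>e\<in>set (setup_exprs p q D \<kappa> a f). gok e"
    and s: "s' ''n'' = int n" "s' ''lb'' = int lb" and k: "6 * lb + 6 \<le> k"
    and Q: "Q (s'(''E'' := D ^ kk, ''P'' := int (p ^ kk), ''k'' := int kk, ''Q'' := int (q ^ kk), ''x'' := int lb)) m"
  shows "wpc (ph_pow p q D) Q k s' m"
proof -
  note gok = gk[unfolded setup_exprs_def, simplified]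
  have G20: "20 \<le> G" using gok by (auto intro: gok_G)
  note [simp] = int_lessB
  define S where "S j = s'(''E'' := D ^ j, ''P'' := int (p ^ j), ''k'' := int j, ''Q'' := int (q ^ j))" for j
  have B': "\<bar>D ^ j\<bar> < 2 ^ B" "p ^ j < 2 ^ B" "q ^ j < 2 ^ B" "j < 2 ^ B" if "j \<le> kk" for j
  proof -
    show "\<bar>D ^ j\<bar> < 2 ^ B" using D_pow_B[of j] that kk_le by simp
    show q: "q ^ j < 2 ^ B" using powq_le[OF that] qn_B by linarith
    show "p ^ j < 2 ^ B" using powp_le[of j] q by linarith
    have "j \<le> lb" using that kk_le by simp
    then show "j < 2 ^ B" using lb_B by linarith
  qed
  have Bi: "int p ^ j < 2 ^ B" "int q ^ j < 2 ^ B" if "j \<le> kk" for j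
    using B'[OF that] int_lessB[of "p ^ j"] int_lessB[of "q ^ j"] by auto
  \<comment> \<open>The powers stand still from round \<open>kk\<close> on, hence the
    minimum.\<close>
  define Iv where "Iv j s2 m2 \<longleftrightarrow> m2 = m \<and> s2 = (S (min j kk))(''x'' := int j)" for j s2 m2
  have loop: "wpc (For ''x'' ''lb'' (ph_pow_body p q D)) Q (lb * (4 + 2) + 2) (S 0) m"
  proof (rule wpc_for[where I=Iv, OF G20])
    show "Iv 0 ((S 0)(''x'' := 0)) m" by (simp add: Iv_def)
    show "\<And>i s m. Iv i s m ==> s ''x'' = int i \<and> s ''lb'' = int lb" using s by (auto simp: Iv_def S_def)
    show "Q s2 m2" if "Iv lb s2 m2" for s2 m2 using that Q kk_le by (simp add: Iv_def S_def min_absorb2)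
    fix i s2 m2 assume i: "i < lb" and "Iv i s2 m2"
    then have s2: "m2 = m" "s2 = (S (min i kk))(''x'' := int i)" by (auto simp: Iv_def)
    define j j' where "j = min i kk" and "j' = (if i < kk then Suc j else j)"
    have jk: "j \<le> kk" and j': "min (Suc i) kk = j'" by (auto simp: j_def j'_def)
    have c: "q ^ j < n \<longleftrightarrow> i < kk"
    proof
      assume "q ^ j < n" then show "i < kk" using n_le by (cases "i < kk") (auto simp: j_def min_def split: if_splits)
    qed (use less_kk[of i] in \<open>simp add: j_def min_def\<close>)
    let ?t1 = "s2(''E'' := D ^ j')"
    let ?t2 = "?t1(''P'' := int p ^ j')"
    let ?t3 = "?t2(''k'' := int j')"
    have n0: "s2 ''n'' = int n" "s2 ''Q'' = int q ^ j" "s2 ''E'' = D ^ j" "s2 ''P'' = int p ^ j" "s2 ''k'' = int j"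
      using s by (simp_all add: s2 S_def j_def)
    have lits: "\<bar>D\<bar> < 2 ^ B" "p < 2 ^ B" "q < 2 ^ B" using ce_B RR_ce ce(2) D1 by auto
    have dj: "D ^ j' = (if i < kk then D ^ j * D else D ^ j)" "int p ^ j' = (if i < kk then int p ^ j * int p else int p ^ j)"
      "int q ^ j' = (if i < kk then int q ^ j * int q else int q ^ j)" "int j' = (if i < kk then int j + 1 else int j)"
      by (simp_all add: j'_def mult.commute)
    note bb = B'[OF jk] Bi[OF jk]
    have v1: "ev (e_E D) s2 m = D ^ j'" "esafe B (e_E D) s2 m"
      using bb lits n_B unfolding dj by (simp_all add: e_E_def n0 c)
    have v2: "ev (e_P p) ?t1 m = int p ^ j'" "esafe B (e_P p) ?t1 m"
      using bb lits n_B unfolding dj by (simp_all add: e_P_def n0 c)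
    have v3: "ev e_k ?t2 m = int j'" "esafe B e_k ?t2 m"
      using bb lits n_B small_lits unfolding dj by (simp_all add: e_k_def n0 c)
    have v4: "ev (e_Q q) ?t3 m = int q ^ j'" "esafe B (e_Q q) ?t3 m"
      using bb lits n_B unfolding dj by (simp_all add: e_Q_def n0 c)
    have fin: "(?t3(''Q'' := int q ^ j')) ''x'' = int i \<and> Iv (Suc i) ((?t3(''Q'' := int q ^ j'))(''x'' := int i + 1)) m"
      unfolding Iv_def j' s2 by (auto simp: S_def fun_eq_iff)
    show "wpc (ph_pow_body p q D) (\<lambda>s m. s ''x'' = int i \<and> Iv (Suc i) (s(''x'' := int i + 1)) m) 4 s2 m2"
      unfolding ph_pow_body_def s2(1)
      apply (rule wpc_assign_seq[OF _ _ _ v1(2)], simp, use gok in simp, simp, unfold v1(1))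
      apply (rule wpc_assign_seq[OF _ _ _ v2(2)], simp, use gok in simp, simp, unfold v2(1))
      apply (rule wpc_assign_seq[OF _ _ _ v3(2)], simp, use gok in simp, simp, unfold v3(1))
      apply (rule wpc_mono[where k=1])
        apply (rule wpc_assign[OF _ _ v4(2)], use gok in simp, simp, unfold v4(1), rule fin)
       apply simp
      by assumption
  qed (use lb_B in auto)
  have v: "ev e_one s2 m = 1" "esafe B e_one s2 m" "ev e_zero s2 m = 0" "esafe B e_zero s2 m" for s2
    using small_lits by (auto simp: e_one_def e_zero_def)
  have S0: "s'(''E'' := 1, ''P'' := 1, ''k'' := 0, ''Q'' := 1) = S 0" by (simp add: S_def)
  show ?thesis unfolding ph_pow_def
    apply (rule wpc_assign_seq[OF _ _ _ v(2)], use k in simp, use gok in simp, simp, unfold v)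
    apply (rule wpc_assign_seq[OF _ _ _ v(2)], use k in simp, use gok in simp, simp, unfold v)
    apply (rule wpc_assign_seq[OF _ _ _ v(4)], use k in simp, use gok in simp, simp, unfold v)
    apply (rule wpc_assign_seq[OF _ _ _ v(2)], use k in simp, use gok in simp, simp, unfold v)
    unfolding S0
    by (rule wpc_mono[OF loop]) (use k in auto)
qed

end

section \<open>The recursive matrix product on flat arrays\<close>

definition "x_j vq = vi [mod] vq"
definition "x_i vp vq = (vi [div] vq) [mod] vp"
definition "x_a vp vq = (vi [div] vq) [div] vp"
definition "e_flat a p i q j = (a [*] p [+] i) [*] q [+] j"

text \<open>The sum over the block positions is unrolled into the expression, whose cost thus
  depends on the fixed algorithm only. The low digit of the batch index selects the coefficient in
  the table.\<close>

definition e_fwd :: "string => expr => nat => expr => nat => nat => (nat => nat => int) => expr" where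
  "e_fwd An vp p vq q R U = esum (map (\<lambda>c. etab (map (\<lambda>\<rho>. U \<rho> c) [0..<R]) 0 (x_a vp vq [mod] ELit (int R)) [*]
     ELoad An (e_flat (x_a vp vq [div] ELit (int R)) (vp [*] ELit (int p)) (ELit (int (c div q)) [+] ELit (int p) [*] x_i vp vq)
       (vq [*] ELit (int q)) (ELit (int (c mod q)) [+] ELit (int q) [*] x_j vq))) [0..<p * q])"

definition e_bwd :: "nat => nat => nat => (nat => nat => int) => expr" where
  "e_bwd p q R W = esum (map (\<lambda>\<rho>. etab (map (\<lambda>t. W t \<rho>) [0..<p * q]) 0
       (x_i vP' vQ' [mod] ELit (int p) [*] ELit (int q) [+] x_j vQ' [mod] ELit (int q)) [*]
     ELoad ''X'' (e_flat (x_a vP' vQ' [*] ELit (int R) [+] ELit (int \<rho>)) (vP' [div] ELit (int p)) (x_i vP' vQ' [div] ELit (int p))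
       (vQ' [div] ELit (int q)) (x_j vQ' [div] ELit (int q)))) [0..<R])"

definition "e_cs x j = ELit 0 [-] ((ELit 0 [-] x) [>>] j)"
definition "e_enc x j = EIf vM (e_cs x j) (ELit 0) (ELit 1 [<<] (vlb [*] (vM [-] e_cs x j)))"
text \<open>The powers of \<open>p\<close> and \<open>q\<close> may exceed the true sizes; rows and
  columns beyond these are filled with zeros.\<close>

definition "e_encX = EIf (x_i vP' vQ') vs (EIf (x_j vQ') vn (e_enc (ELoad ''B'' (x_i vP' vQ' [*] vn [+] x_j vQ')) (x_a vP' vQ')) (ELit 0)) (ELit 0)"
definition "e_encY = EIf (x_i vQ' vQ') vn (EIf (x_j vQ') vn (e_enc (ELoad ''A'' (x_i vQ' vQ' [*] vn [+] x_j vQ')) (x_a vQ' vQ')) (ELit 0)) (ELit 0)"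

definition "e_cX = va [*] vP' [*] vQ'"
definition "e_cY = va [*] vQ' [*] vQ'"
definition "e_ldX2 = ELoad ''X2'' vi"
definition "e_ldY2 = ELoad ''Y2'' vi"
definition "e_mul = ELoad ''X'' vi [*] ELoad ''Y'' vi"
definition "e_vP = vP"
definition "e_vQ = vQ"
definition "e_vJ = vJ"
definition "e_aR R = va [*] ELit (int R)"
definition "e_pd p = vP' [div] ELit (int p)"
definition "e_qd q = vQ' [div] ELit (int q)"
definition "e_ad R = va [div] ELit (int R)"
definition "e_pm p = vP' [*] ELit (int p)"
definition "e_qm q = vQ' [*] ELit (int q)"
definition "e_va = va"

definition fbody where
  "fbody p q R U V = Seq (Assign ''a'' (e_aR R)) (Seq (Assign ''p'' (e_pd p)) (Seq (Assign ''q'' (e_qd q))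
     (Seq (PMap ''X2'' e_cX (e_fwd ''X'' vP' p vQ' q R U)) (Seq (PMap ''X'' e_cX e_ldX2)
     (Seq (PMap ''Y2'' e_cY (e_fwd ''Y'' vQ' q vQ' q R V)) (PMap ''Y'' e_cY e_ldY2))))))"

definition bbody where
  "bbody p q R W = Seq (Assign ''a'' (e_ad R)) (Seq (Assign ''p'' (e_pm p)) (Seq (Assign ''q'' (e_qm q))
     (Seq (PMap ''X2'' e_cX (e_bwd p q R W)) (PMap ''X'' e_cX e_ldX2))))"

text \<open>All scales pass through the recursion in one batch. The forward levels turn
  \<open>J\<close> pairs of matrices into \<open>J * R ^ kk\<close> pairs of numbers, which are
  multiplied cell by cell; the backward levels assemble the products. \<open>a\<close> counts the
  matrices of the batch, \<open>p\<close> and \<open>q\<close> are their current sizes.\<close>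

definition fmm where
  "fmm p q R U V W = Seq (Assign ''p'' e_vP) (Seq (Assign ''q'' e_vQ) (Seq (Assign ''a'' e_vJ)
     (Seq (PMap ''X'' e_cX e_encX) (Seq (PMap ''Y'' e_cY e_encY) (Seq (For ''l'' ''k'' (fbody p q R U V))
     (Seq (PMap ''X2'' e_va e_mul) (Seq (PMap ''X'' e_va e_ldX2) (For ''l'' ''k'' (bbody p q R W)))))))))"

definition fmm_exprs where
  "fmm_exprs p q R U V W = [e_aR R, e_pd p, e_qd q, e_cX, e_fwd ''X'' vP' p vQ' q R U, e_ldX2, e_cY, e_fwd ''Y'' vQ' q vQ' q R V, e_ldY2,
     e_ad R, e_pm p, e_qm q, e_bwd p q R W, e_vP, e_vQ, e_vJ, e_encX, e_encY, e_va, e_mul]"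

definition flat :: "nat => nat => (nat => nat => nat => int) => nat => int" where
  "flat P Q x k = x ((k div Q) div P) ((k div Q) mod P) (k mod Q)"

lemma flat_index:
  assumes "a < N" "i < P" "j < Q"
  shows "(a * P + i) * Q + j < N * P * Q" "flat P Q x ((a * P + i) * Q + j) = x a i j"
proof -
  have "a * P + i < (a + 1) * P" using assms by simp
  also have "\<dots> \<le> N * P" using assms by (intro mult_le_mono1) simp
  finally have 1: "a * P + i < N * P" .
  have "(a * P + i) * Q + j < (a * P + i + 1) * Q" using assms by simp
  also have "\<dots> \<le> N * P * Q" using 1 by (intro mult_le_mono1) simp
  finally show "(a * P + i) * Q + j < N * P * Q" .
  show "flat P Q x ((a * P + i) * Q + j) = x a i j" using assms by (simp add: flat_def)
qed

lemma arr_flatD: "arr m A (N * P * Q) (flat P Q x) ==> a < N ==> i < P ==> j < Q ==> m (A, int ((a * P + i) * Q + j)) = x a i j"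
  using flat_index(1)[of a N i P j Q] flat_index(2)[of a N i P j Q x] by (simp add: arr_def del: of_nat_add of_nat_mult)

lemma unflat_bounds:
  assumes "k < N * P * Q"
  shows "k mod Q < Q" "(k div Q) mod P < P" "(k div Q) div P < (N::nat)" "0 < P" "0 < Q"
proof -
  show Q: "0 < Q" "0 < P" using assms by (auto intro: gr0I)
  show "k mod Q < Q" "(k div Q) mod P < P" using Q by auto
  have "k div Q < N * P" using assms by (simp add: less_mult_imp_div_less)
  then show "(k div Q) div P < N" by (simp add: less_mult_imp_div_less)
qed

context prun2
begin

lemma lits_B: "int p < 2 ^ B" "int q < 2 ^ B" "int R < 2 ^ B" "c \<le> R * R ==> int c < 2 ^ B"
proof -
  have *: "c \<le> R * R ==> int c < 2 ^ B" for c
    using RR_ce(1) ce_B(1)[of "R * R"] int_lessB[of c] by linarith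
  show "int p < 2 ^ B" "int q < 2 ^ B" "int R < 2 ^ B" "c \<le> R * R ==> int c < 2 ^ B"
    using RR_ce(3-5) ce_B(1) * by (auto simp: int_lessB)
qed

lemma pq_RR: "p * q \<le> R * R" "q * q \<le> R * R" "p * q \<le> R" "R \<le> R * R"
proof -
  have 1: "p * q \<le> q * q" using pq by (intro mult_le_mono1)
  show 2: "R \<le> R * R" by simp
  show "p * q \<le> R * R" "q * q \<le> R * R" "p * q \<le> R" using 1 2 pq by linarith+
qed

lemma tab_B: "\<bar>U i j\<bar> < 2 ^ B" "\<bar>V i j\<bar> < 2 ^ B" "\<bar>W i j\<bar> < 2 ^ B"
  using UVW[of i j] ce_B(2)[OF RR_ce(2)] by linarith+

lemma etab_sem:
  assumes "ev e s' m = int j" "j < N" "esafe B e s' m" "\<And>t. \<bar>g t\<bar> < 2 ^ B" "N \<le> R * R"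
  shows "ev (etab (map g [0..<N]) 0 e) s' m = g j" "esafe B (etab (map g [0..<N]) 0 e) s' m"
proof -
  show "ev (etab (map g [0..<N]) 0 e) s' m = g j" using ev_etab[of e s' m 0 j "map g [0..<N]"] assms by simp
  have "N < 2 ^ B" using lits_B(4)[OF assms(5)] by (simp add: int_lessB)
  then show "esafe B (etab (map g [0..<N]) 0 e) s' m" using assms by (intro esafe_etab) auto
qed

text \<open>One lemma for both factors: blocks have \<open>p\<close> rows in the left one and
  \<open>q\<close> rows in the right one, whence the parameter \<open>p'\<close>.\<close>

lemma e_fwd_sem:
  assumes vp: "ev vp s' m = int P" "esafe B vp s' m" and vq: "ev vq s' m = int Q" "esafe B vq s' m"
    and i: "s' ''i'' = int k" "k < N * R * P * Q" "k < 2 ^ B"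
    and x: "arr m An (N * (P * p') * (Q * q)) (flat (P * p') (Q * q) x)" and xB: "\<And>a i j. \<bar>x a i j\<bar> < 2 ^ B"
    and t: "\<And>i j. \<bar>Ut i j\<bar> < 2 ^ B" and p': "p' \<le> q"
  shows "esafe B (e_fwd An vp p' vq q R Ut) s' m \<and> ev (e_fwd An vp p' vq q R Ut) s' m = flat P Q (fwd p' q R Ut x) k"
proof -
  define j ii aa where "j = k mod Q" and "ii = (k div Q) mod P" and "aa = (k div Q) div P"
  have b: "j < Q" "ii < P" "aa < N * R" using unflat_bounds[of k "N * R" P Q] i by (auto simp: j_def ii_def aa_def)
  have R0: "0 < R" using R4 by simp
  have ee: "ev (x_j vq) s' m = int j" "ev (x_i vp vq) s' m = int ii" "ev (x_a vp vq) s' m = int aa"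
    "esafe B (x_j vq) s' m" "esafe B (x_i vp vq) s' m" "esafe B (x_a vp vq) s' m"
    using vp vq i by (auto simp: x_j_def x_i_def x_a_def j_def ii_def aa_def of_nat_div of_nat_mod int_lessB)
  let ?t = "\<lambda>c. etab (map (\<lambda>\<rho>. Ut \<rho> c) [0..<R]) 0 (x_a vp vq [mod] ELit (int R))"
  let ?l = "\<lambda>c. e_flat (x_a vp vq [div] ELit (int R)) (vp [*] ELit (int p')) (ELit (int (c div q)) [+] ELit (int p') [*] x_i vp vq)
       (vq [*] ELit (int q)) (ELit (int (c mod q)) [+] ELit (int q) [*] x_j vq)"
  have T: "ev (?t c) s' m = Ut (aa mod R) c \<and> esafe B (?t c) s' m" for c
    using etab_sem[of "x_a vp vq [mod] ELit (int R)" s' m "aa mod R" R "\<lambda>\<rho>. Ut \<rho> c"] ee R0 lits_B(3) t pq_RR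
    by (auto simp: of_nat_mod)
  have Lq: "ev (?l c) s' m = int (((aa div R) * (P * p') + (c div q + p' * ii)) * (Q * q) + (c mod q + q * j))" for c
    using ee vp vq by (simp add: e_flat_def of_nat_div of_nat_mod)
  have Lx: "m (An, ev (?l c) s' m) = x (aa div R) (c div q + p' * ii) (c mod q + q * j)" if c: "c < p' * q" for c
    unfolding Lq
  proof (rule arr_flatD[OF x])
    show "aa div R < N" using b by (simp add: less_mult_imp_div_less)
    have "c div q < p'" using c by (simp add: less_mult_imp_div_less)
    then have "c div q + p' * ii < p' * (ii + 1)" by simp
    also have "\<dots> \<le> p' * P" using b by (intro mult_le_mono2) simp
    finally show "c div q + p' * ii < P * p'" by (simp add: mult.commute)
    have "c mod q < q" using pq by simp
    then have "c mod q + q * j < q * (j + 1)" by simp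
    also have "\<dots> \<le> q * Q" using b by (intro mult_le_mono2) simp
    finally show "c mod q + q * j < Q * q" by (simp add: mult.commute)
  qed
  have litB: "int (c div q) < 2 ^ B" "int (c mod q) < 2 ^ B" "int p' < 2 ^ B" if c: "c < p' * q" for c
  proof -
    have "p' * q \<le> q * q" using p' by (intro mult_le_mono1)
    moreover have "q \<le> q * q" by simp
    ultimately have "c \<le> R * R" "p' \<le> R * R" using c pq_RR(2) p' by linarith+
    moreover have "c div q \<le> c" "c mod q \<le> c" by auto
    ultimately have le: "c div q \<le> R * R" "c mod q \<le> R * R" "p' \<le> R * R" by linarith+
    show "int (c div q) < 2 ^ B" "int (c mod q) < 2 ^ B" "int p' < 2 ^ B"
      by (fact lits_B(4)[OF le(1)] lits_B(4)[OF le(2)] lits_B(4)[OF le(3)])+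
  qed
  have Ls: "esafe B (?l c) s' m" if c: "c < p' * q" for c
    using ee vp vq litB[OF c] lits_B by (simp add: e_flat_def del: of_nat_div of_nat_mod)
  have "esafe B (e_fwd An vp p' vq q R Ut) s' m"
    unfolding e_fwd_def by (rule esafe_esum) (use T Ls Lx xB in auto)
  moreover have "ev (e_fwd An vp p' vq q R Ut) s' m = (\<Sum>c<p' * q. Ut (aa mod R) c * x (aa div R) (c div q + p' * ii) (c mod q + q * j))"
    unfolding e_fwd_def ev_esum_upt using T Lx by (intro sum.cong) auto
  ultimately show ?thesis by (simp add: flat_def fwd_def j_def ii_def aa_def)
qed

lemma e_bwd_sem:
  assumes s: "s' ''p'' = int (P * p)" "s' ''q'' = int (Q * q)" "P * p < 2 ^ B" "Q * q < 2 ^ B"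
    and i: "s' ''i'' = int k" "k < N * (P * p) * (Q * q)" "k < 2 ^ B"
    and x: "arr m ''X'' (N * R * P * Q) (flat P Q x)" and xB: "\<And>a i j. \<bar>x a i j\<bar> < 2 ^ B"
  shows "esafe B (e_bwd p q R W) s' m \<and> ev (e_bwd p q R W) s' m = flat (P * p) (Q * q) (bwd p q R W x) k"
proof -
  define j ii aa where "j = k mod (Q * q)" and "ii = (k div (Q * q)) mod (P * p)" and "aa = (k div (Q * q)) div (P * p)"
  have b: "j < Q * q" "ii < P * p" "aa < N" using unflat_bounds[of k N "P * p" "Q * q"] i by (auto simp: j_def ii_def aa_def)
  have PQB: "int (P * p) < 2 ^ B" "int (Q * q) < 2 ^ B" using s(3,4) by (simp_all only: int_lessB)
  then have pB: "\<bar>s' ''p''\<bar> < 2 ^ B" "\<bar>s' ''q''\<bar> < 2 ^ B" unfolding s(1,2) by (simp_all del: of_nat_mult)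
  from PQB have ee: "ev (x_j vQ') s' m = int j" "ev (x_i vP' vQ') s' m = int ii" "ev (x_a vP' vQ') s' m = int aa"
    "esafe B (x_j vQ') s' m" "esafe B (x_i vP' vQ') s' m" "esafe B (x_a vP' vQ') s' m"
    using pB s i by (simp_all add: x_j_def x_i_def x_a_def j_def ii_def aa_def of_nat_div of_nat_mod int_lessB)
  let ?e = "x_i vP' vQ' [mod] ELit (int p) [*] ELit (int q) [+] x_j vQ' [mod] ELit (int q)"
  let ?t = "\<lambda>\<rho>. etab (map (\<lambda>t. W t \<rho>) [0..<p * q]) 0 ?e"
  let ?l = "\<lambda>\<rho>. e_flat (x_a vP' vQ' [*] ELit (int R) [+] ELit (int \<rho>)) (vP' [div] ELit (int p)) (x_i vP' vQ' [div] ELit (int p))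
       (vQ' [div] ELit (int q)) (x_j vQ' [div] ELit (int q))"
  have lt: "(ii mod p) * q + j mod q < p * q"
  proof -
    have "(ii mod p) * q + j mod q < (ii mod p + 1) * q" using pq by simp
    also have "\<dots> \<le> p * q" using pq by (intro mult_le_mono1) (simp add: Suc_le_eq)
    finally show ?thesis .
  qed
  have T: "ev (?t \<rho>) s' m = W ((ii mod p) * q + j mod q) \<rho> \<and> esafe B (?t \<rho>) s' m" for \<rho>
    using etab_sem[of ?e s' m "(ii mod p) * q + j mod q" "p * q" "\<lambda>t. W t \<rho>"] ee lt lits_B tab_B pq_RR
    by (auto simp: of_nat_mod)
  have Lq: "ev (?l \<rho>) s' m = int (((aa * R + \<rho>) * P + ii div p) * Q + j div q)" for \<rho>
  proof -
    have "int P = int (P * p) div int p" "int Q = int (Q * q) div int q" using pq by simp_all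
    then show ?thesis using ee s by (simp add: e_flat_def of_nat_div)
  qed
  have Lx: "m (''X'', ev (?l \<rho>) s' m) = x (aa * R + \<rho>) (ii div p) (j div q)" if "\<rho> < R" for \<rho>
    unfolding Lq
  proof (rule arr_flatD[OF x])
    have "aa * R + \<rho> < (aa + 1) * R" using that by simp
    also have "\<dots> \<le> N * R" using b by (intro mult_le_mono1) simp
    finally show "aa * R + \<rho> < N * R" .
    show "ii div p < P" "j div q < Q" using b by (simp_all add: less_mult_imp_div_less)
  qed
  have Ls: "esafe B (?l \<rho>) s' m" if "\<rho> < R" for \<rho>
  proof -
    have "int \<rho> < 2 ^ B" using that lits_B(3) by linarith
    then show ?thesis using ee pB lits_B by (simp add: e_flat_def)
  qed
  have "esafe B (e_bwd p q R W) s' m"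
    unfolding e_bwd_def by (rule esafe_esum) (use T Ls Lx xB in auto)
  moreover have "ev (e_bwd p q R W) s' m = (\<Sum>\<rho><R. W ((ii mod p) * q + j mod q) \<rho> * x (aa * R + \<rho>) (ii div p) (j div q))"
    unfolding e_bwd_def ev_esum_upt using T Lx by (intro sum.cong) auto
  ultimately show ?thesis by (simp add: flat_def bwd_def j_def ii_def aa_def)
qed

lemma e_enc_sem:
  assumes x: "ev x s' m = xv" "0 \<le> xv" "esafe B x s' m" and j: "ev j s' m = int jv" "esafe B j s' m"
    and s: "s' ''M'' = M" "s' ''lb'' = int lb"
  shows "esafe B (e_enc x j) s' m \<and> ev (e_enc x j) s' m = enc lb M jv xv"
proof -
  have cs: "ev (e_cs x j) s' m = cshift xv jv" "esafe B (e_cs x j) s' m"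
    using x j small_lits by (auto simp: e_cs_def cshift_def)
  have c0: "0 \<le> cshift xv jv" by (rule cshift_nonneg[OF x(2)])
  \<comment> \<open>A left shift is safe by at most \<open>B\<close> positions; \<open>BM\<close>
    provides for the largest exponent \<open>lb * M\<close>.\<close>
  have "int lb * (M - cshift xv jv) \<le> int lb * M" using c0 by (intro mult_left_mono) auto
  also have "\<dots> = int (lb * 2 ^ mm)" by simp
  also have "\<dots> \<le> int B" using BM by (intro of_nat_mono) linarith
  finally have "int lb * (M - cshift xv jv) \<le> int B" .
  then show ?thesis using cs s mM_B small_lits lb_B(1)
    by (auto simp: e_enc_def enc_def nat_mult_distrib int_lessB not_less)
qed

definition xenc :: "(nat => nat => int) => nat => nat => nat => int" where
  "xenc Bf j i t = (if i < s \<and> t < n then enc lb M j (Bf i t) else 0)"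

definition yenc :: "nat => nat => nat => int" where
  "yenc j t v = (if t < n \<and> v < n then enc lb M j (A t v) else 0)"

lemma enc_bound: "0 \<le> x ==> \<bar>enc lb M j x\<bar> \<le> 2 ^ (lb * 2 ^ mm)"
proof -
  assume "0 \<le> x"
  then have "nat (M - cshift x j) \<le> nat M" using cshift_nonneg[of x j] by (intro nat_mono) simp
  then have "nat (M - cshift x j) \<le> 2 ^ mm" by (simp add: nat_power_eq)
  then show ?thesis by (auto simp: enc_def intro!: power_increasing)
qed

lemma yenc_bound: "\<bar>yenc j t v\<bar> \<le> 2 ^ (lb * 2 ^ mm)"
  using enc_bound A_bounds(1) by (auto simp: yenc_def)

lemma xenc_bound: "(\<And>i t. i < s ==> t < n ==> 0 \<le> Bf i t) ==> \<bar>xenc Bf j i t\<bar> \<le> 2 ^ (lb * 2 ^ mm)"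
  using enc_bound by (auto simp: xenc_def)

lemma cu_ce: "int (p * q) * cu \<le> 2 ^ ce" "int (q * q) * cu \<le> 2 ^ ce" "int R * cu \<le> 2 ^ ce"
proof -
  have *: "int c * cu \<le> 2 ^ ce" if "c \<le> R * R" for c
  proof -
    have "int c \<le> int (R * R)" using that by (simp only: of_nat_le_iff)
    then have "int c * cu \<le> int (R * R) * (cu + 1)" using cu0 by (intro mult_mono) auto
    then show ?thesis using ce(1) by linarith
  qed
  show "int (p * q) * cu \<le> 2 ^ ce" "int (q * q) * cu \<le> 2 ^ ce" "int R * cu \<le> 2 ^ ce"
    using *[OF pq_RR(1)] *[OF pq_RR(2)] *[OF pq_RR(4)] by auto
qed

text \<open>There are at most \<open>lb\<close> levels, and each adds at most \<open>ce\<close>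
  bits.\<close>

lemma pow_bound:
  assumes "0 \<le> c" "c \<le> (2::int) ^ ce" "X \<le> 2 ^ b" "0 \<le> X" "l \<le> kk" shows "c ^ l * X \<le> 2 ^ (ce * lb + b)"
proof -
  have "c ^ l \<le> (2 ^ ce) ^ l" using assms by (intro power_mono) auto
  also have "\<dots> = 2 ^ (ce * l)" by (simp add: power_mult)
  also have "\<dots> \<le> 2 ^ (ce * lb)" using assms(5) kk_le by (intro power_increasing mult_le_mono2) auto
  finally show ?thesis unfolding power_add using assms by (intro mult_mono) auto
qed

lemma fwds_B:
  assumes "\<And>a i j. \<bar>x a i j\<bar> \<le> 2 ^ (lb * 2 ^ mm)" "l \<le> kk" "\<And>i j. \<bar>Ut i j\<bar> \<le> cu" "int (p' * q) * cu \<le> 2 ^ ce"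
  shows "\<bar>fwds p' q R Ut l x a0 i j\<bar> \<le> 2 ^ (ce * lb + lb * 2 ^ mm)"
proof -
  have "\<bar>fwds p' q R Ut l x a0 i j\<bar> \<le> (int (p' * q) * cu) ^ l * 2 ^ (lb * 2 ^ mm)"
    by (rule fwds_bound) (use assms in auto)
  also have "\<dots> \<le> 2 ^ (ce * lb + lb * 2 ^ mm)" by (rule pow_bound) (use assms cu0 in auto)
  finally show ?thesis .
qed

lemma pow_strict_B: "e \<le> 3 * ce * lb + 2 * lb * 2 ^ mm ==> (x::int) \<le> 2 ^ e ==> x < 2 ^ B"
proof -
  assume "e \<le> 3 * ce * lb + 2 * lb * 2 ^ mm" "x \<le> 2 ^ e"
  moreover have "(2::int) ^ e < 2 ^ B" using BM \<open>e \<le> _\<close> by (intro power_strict_increasing) auto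
  ultimately show ?thesis by linarith
qed

lemma fwds_B':
  assumes "\<And>a i j. \<bar>x a i j\<bar> \<le> 2 ^ (lb * 2 ^ mm)" "l \<le> kk" "\<And>i j. \<bar>Ut i j\<bar> \<le> cu" "int (p' * q) * cu \<le> 2 ^ ce"
  shows "\<bar>fwds p' q R Ut l x a0 i j\<bar> < 2 ^ B"
  by (rule pow_strict_B[OF _ fwds_B[OF assms]]) auto

lemma bwds_B:
  assumes "\<And>a i j. \<bar>x a i j\<bar> \<le> 2 ^ (ce * lb + lb * 2 ^ mm)" "\<And>a i j. \<bar>y a i j\<bar> \<le> 2 ^ (ce * lb + lb * 2 ^ mm)" "l \<le> kk"
  shows "\<bar>bwds p q R W l (\<lambda>a i j. x a i j * y a i j) a0 i j\<bar> < 2 ^ B"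
proof -
  let ?e = "ce * lb + lb * 2 ^ mm"
  have xy: "\<bar>x a i j * y a i j\<bar> \<le> 2 ^ (?e + ?e)" for a i j
    unfolding abs_mult power_add[of _ ?e ?e] using assms by (intro mult_mono) auto
  have "\<bar>bwds p q R W l (\<lambda>a i j. x a i j * y a i j) a0 i j\<bar> \<le> (int R * cu) ^ l * 2 ^ (?e + ?e)"
    by (rule bwds_bound) (use UVW xy in auto)
  also have "\<dots> \<le> 2 ^ (ce * lb + (?e + ?e))" by (rule pow_bound) (use assms cu0 cu_ce in auto)
  finally show ?thesis by (rule pow_strict_B[rotated]) (simp add: algebra_simps)
qed

end

text \<open>The loop bound has to accommodate either kind of product: \<open>2 ^ lb\<close>
  candidates per entry for the naive one, and for the fast one the numbers at the bottom of the
  recursion as well as one candidate per scale. \<open>sp\<close> makes the rows of all sources fit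
  into the recursive product.\<close>

locale prun3 = prun2 +
  assumes naive_N: "n < J ==> s * n * 2 ^ lb \<le> Nx"
    and fast_N: "J \<le> n ==> J * R ^ kk \<le> Nx" "J \<le> n ==> s * n * 2 ^ bit_length (int J) \<le> Nx"
    and sp: "s \<le> p ^ kk"
begin

lemma wpc_fbody:
  assumes gk: "\<forall>e\<in>set (fmm_exprs p q R U V W). gok e"
    and s: "s' ''a'' = int N" "s' ''p'' = int (P * p)" "s' ''q'' = int (Q * q)"
    and P0: "0 < P" "0 < Q"
    and sz: "N * R * P * Q \<le> Nx" "N * R * Q * Q \<le> Nx" "P * p < 2 ^ B" "Q * q < 2 ^ B" "N * R < 2 ^ B"
    and x: "arr m ''X'' (N * (P * p) * (Q * q)) (flat (P * p) (Q * q) x)" and xB: "\<And>a i j. \<bar>x a i j\<bar> < 2 ^ B"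
    and y: "arr m ''Y'' (N * (Q * q) * (Q * q)) (flat (Q * q) (Q * q) y)" and yB: "\<And>a i j. \<bar>y a i j\<bar> < 2 ^ B"
    and fB: "\<And>a i j. \<bar>fwd p q R U x a i j\<bar> < 2 ^ B" "\<And>a i j. \<bar>fwd q q R V y a i j\<bar> < 2 ^ B"
    and Qq: "\<And>m'. frame {''X'', ''X2'', ''Y'', ''Y2''} m m' ==> arr m' ''X'' (N * R * P * Q) (flat P Q (fwd p q R U x)) ==>
      arr m' ''Y'' (N * R * Q * Q) (flat Q Q (fwd q q R V y)) ==> Qr (s'(''a'' := int (N * R), ''p'' := int P, ''q'' := int Q)) m'"
  shows "wpc (fbody p q R U V) Qr 7 s' m"
proof -
  note gok = gk[unfolded fmm_exprs_def, simplified]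
  have le: "P \<le> P * p" "Q \<le> Q * q" "N \<le> N * R" using pq R4 by simp_all
  have B': "int N < 2 ^ B" "int (P * p) < 2 ^ B" "int (Q * q) < 2 ^ B" "int P < 2 ^ B" "int Q < 2 ^ B" "int (N * R) < 2 ^ B"
    using le sz by (auto simp only: int_lessB intro: le_less_trans)
  let ?t1 = "s'(''a'' := int (N * R))"
  let ?t2 = "?t1(''p'' := int P)"
  let ?t3 = "?t2(''q'' := int Q)"
  have v1: "ev (e_aR R) s' m = int (N * R)" "esafe B (e_aR R) s' m" using s B' lits_B by (auto simp: e_aR_def)
  have v2: "ev (e_pd p) ?t1 m = int P" "esafe B (e_pd p) ?t1 m" using s B'(2) lits_B pq by (simp_all add: e_pd_def)
  have v3: "ev (e_qd q) ?t2 m = int Q" "esafe B (e_qd q) ?t2 m" using s B'(3) lits_B pq by (simp_all add: e_qd_def)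
  have cX: "ev e_cX ?t3 m = int (N * R * P * Q)" "esafe B e_cX ?t3 m" for m using B'(4-6) by (simp_all add: e_cX_def del: of_nat_mult add: of_nat_mult[symmetric])
  have cY: "ev e_cY ?t3 m = int (N * R * Q * Q)" "esafe B e_cY ?t3 m" for m using B'(4-6) by (simp_all add: e_cY_def del: of_nat_mult add: of_nat_mult[symmetric])
  have kB: "k < 2 ^ B" if "k < z" "z \<le> Nx" for k z using that Nx by linarith
  have vpq: "ev vP' (?t3(''i'' := int k)) m = int P" "esafe B vP' (?t3(''i'' := int k)) m"
     "ev vQ' (?t3(''i'' := int k)) m = int Q" "esafe B vQ' (?t3(''i'' := int k)) m" for k m using B' by simp_all
  have fX: "esafe B (e_fwd ''X'' vP' p vQ' q R U) (?t3(''i'' := int k)) m \<and>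
     ev (e_fwd ''X'' vP' p vQ' q R U) (?t3(''i'' := int k)) m = flat P Q (fwd p q R U x) k" if "k < N * R * P * Q" for k
    by (rule e_fwd_sem[OF vpq _ that kB[OF that sz(1)] x xB tab_B(1) pq(2)]) simp
  have fin: "wpc (Seq (PMap ''X2'' e_cX (e_fwd ''X'' vP' p vQ' q R U)) (Seq (PMap ''X'' e_cX e_ldX2)
     (Seq (PMap ''Y2'' e_cY (e_fwd ''Y'' vQ' q vQ' q R V)) (PMap ''Y'' e_cY e_ldY2)))) Qr (7 - 1 - 1 - 1) ?t3 m"
  proof (rule wpc_pmap_seq[OF _ _ cX(2) cX(1) sz(1) _ _ fX])
    fix m1 assume m1: "arr m1 ''X2'' (N * R * P * Q) (flat P Q (fwd p q R U x))" "frame {''X2''} m m1"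
    have ld: "esafe B e_ldX2 (?t3(''i'' := int k)) m1 \<and> ev e_ldX2 (?t3(''i'' := int k)) m1 = flat P Q (fwd p q R U x) k" if "k < N * R * P * Q" for k
      using arrD[OF m1(1) that] kB[OF that sz(1)] fB(1) by (simp add: e_ldX2_def int_lessB flat_def)
    show "wpc (Seq (PMap ''X'' e_cX e_ldX2) (Seq (PMap ''Y2'' e_cY (e_fwd ''Y'' vQ' q vQ' q R V)) (PMap ''Y'' e_cY e_ldY2)))
       Qr (7 - 1 - 1 - 1 - 1) ?t3 m1"
    proof (rule wpc_pmap_seq[OF _ _ cX(2) cX(1) sz(1) _ _ ld])
      fix m2 assume m2: "arr m2 ''X'' (N * R * P * Q) (flat P Q (fwd p q R U x))" "frame {''X''} m1 m2"
      have y2: "arr m2 ''Y'' (N * (Q * q) * (Q * q)) (flat (Q * q) (Q * q) y)"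
        by (rule frame_arr[OF m2(2) _ frame_arr[OF m1(2) _ y]]) auto
      have fY: "esafe B (e_fwd ''Y'' vQ' q vQ' q R V) (?t3(''i'' := int k)) m2 \<and>
         ev (e_fwd ''Y'' vQ' q vQ' q R V) (?t3(''i'' := int k)) m2 = flat Q Q (fwd q q R V y) k" if "k < N * R * Q * Q" for k
        by (rule e_fwd_sem[OF vpq(3,4,3,4) _ that kB[OF that sz(2)] y2 yB tab_B(2) le_refl]) simp
      show "wpc (Seq (PMap ''Y2'' e_cY (e_fwd ''Y'' vQ' q vQ' q R V)) (PMap ''Y'' e_cY e_ldY2)) Qr (7 - 1 - 1 - 1 - 1 - 1) ?t3 m2"
      proof (rule wpc_pmap_seq[OF _ _ cY(2) cY(1) sz(2) _ _ fY])
        fix m3 assume m3: "arr m3 ''Y2'' (N * R * Q * Q) (flat Q Q (fwd q q R V y))" "frame {''Y2''} m2 m3"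
        have ld: "esafe B e_ldY2 (?t3(''i'' := int k)) m3 \<and> ev e_ldY2 (?t3(''i'' := int k)) m3 = flat Q Q (fwd q q R V y) k" if "k < N * R * Q * Q" for k
          using arrD[OF m3(1) that] kB[OF that sz(2)] fB(2) by (simp add: e_ldY2_def int_lessB flat_def)
        have "wpc (PMap ''Y'' e_cY e_ldY2) Qr 1 ?t3 m3"
        proof (rule wpc_pmap_arr[OF _ cY(2) cY(1) sz(2) _ _ ld])
          fix m4 assume m4: "arr m4 ''Y'' (N * R * Q * Q) (flat Q Q (fwd q q R V y))" "frame {''Y''} m3 m4"
          show "Qr ?t3 m4"
          proof (rule Qq[OF _ _ m4(1)])
            show "frame {''X'', ''X2'', ''Y'', ''Y2''} m m4" using m1(2) m2(2) m3(2) m4(2) by (simp add: frame_def)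
            show "arr m4 ''X'' (N * R * P * Q) (flat P Q (fwd p q R U x))"
              by (rule frame_arr[OF m4(2) _ frame_arr[OF m3(2) _ m2(1)]]) auto
          qed
        qed (use gok in \<open>auto simp: e_ldY2_def\<close>)
        then show "wpc (PMap ''Y'' e_cY e_ldY2) Qr (7 - 1 - 1 - 1 - 1 - 1 - 1) ?t3 m3" by simp
      next
        show "''Y2'' \<notin> earr (e_fwd ''Y'' vQ' q vQ' q R V)"
          by (auto simp: e_fwd_def earr_esum e_flat_def x_a_def x_i_def x_j_def dest!: earr_etab[THEN subsetD])
      qed (use gok in auto)
    qed (use gok in \<open>auto simp: e_ldX2_def\<close>)
  next
    show "''X2'' \<notin> earr (e_fwd ''X'' vP' p vQ' q R U)"
      by (auto simp: e_fwd_def earr_esum e_flat_def x_a_def x_i_def x_j_def dest!: earr_etab[THEN subsetD])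
  qed (use gok in auto)
  show ?thesis unfolding fbody_def
    apply (rule wpc_assign_seq[OF _ _ _ v1(2)], simp, use gok in simp, simp, unfold v1(1))
    apply (rule wpc_assign_seq[OF _ _ _ v2(2)], simp, use gok in simp, simp, unfold v2(1))
    apply (rule wpc_assign_seq[OF _ _ _ v3(2)], simp, use gok in simp, simp, unfold v3(1))
    by (rule fin)
qed

lemma wpc_bbody:
  assumes gk: "\<forall>e\<in>set (fmm_exprs p q R U V W). gok e"
    and s: "s' ''a'' = int (N * R)" "s' ''p'' = int P" "s' ''q'' = int Q"
    and sz: "N * (P * p) * (Q * q) \<le> Nx" "P * p < 2 ^ B" "Q * q < 2 ^ B" "N * R < 2 ^ B"
    and x: "arr m ''X'' (N * R * P * Q) (flat P Q x)" and xB: "\<And>a i j. \<bar>x a i j\<bar> < 2 ^ B"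
    and fB: "\<And>a i j. \<bar>bwd p q R W x a i j\<bar> < 2 ^ B"
    and Qq: "\<And>m'. frame {''X'', ''X2'', ''Y'', ''Y2''} m m' ==> arr m' ''X'' (N * (P * p) * (Q * q)) (flat (P * p) (Q * q) (bwd p q R W x)) ==>
      Qr (s'(''a'' := int N, ''p'' := int (P * p), ''q'' := int (Q * q))) m'"
  shows "wpc (bbody p q R W) Qr 5 s' m"
proof -
  note gok = gk[unfolded fmm_exprs_def, simplified]
  have le: "P \<le> P * p" "Q \<le> Q * q" "N \<le> N * R" using pq R4 by simp_all
  have B': "int N < 2 ^ B" "int (P * p) < 2 ^ B" "int (Q * q) < 2 ^ B" "int P < 2 ^ B" "int Q < 2 ^ B" "int (N * R) < 2 ^ B"
    using le sz by (auto simp only: int_lessB intro: le_less_trans)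
  let ?t1 = "s'(''a'' := int N)"
  let ?t2 = "?t1(''p'' := int (P * p))"
  let ?t3 = "?t2(''q'' := int (Q * q))"
  have v1: "ev (e_ad R) s' m = int N" "esafe B (e_ad R) s' m" using s B'(6) lits_B R4 by (simp_all add: e_ad_def)
  have v2: "ev (e_pm p) ?t1 m = int (P * p)" "esafe B (e_pm p) ?t1 m" using s B'(4) lits_B by (simp_all add: e_pm_def)
  have v3: "ev (e_qm q) ?t2 m = int (Q * q)" "esafe B (e_qm q) ?t2 m" using s B'(5) lits_B by (simp_all add: e_qm_def)
  have cX: "ev e_cX ?t3 m = int (N * (P * p) * (Q * q))" "esafe B e_cX ?t3 m" for m
    using B'(1-3) by (simp_all add: e_cX_def del: of_nat_mult add: of_nat_mult[symmetric])
  have kB: "k < 2 ^ B" if "k < z" "z \<le> Nx" for k z using that Nx by linarith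
  have fX: "esafe B (e_bwd p q R W) (?t3(''i'' := int k)) m \<and>
     ev (e_bwd p q R W) (?t3(''i'' := int k)) m = flat (P * p) (Q * q) (bwd p q R W x) k" if "k < N * (P * p) * (Q * q)" for k
    by (rule e_bwd_sem[OF _ _ sz(2,3) _ that kB[OF that sz(1)] x xB]) simp_all
  have fin: "wpc (Seq (PMap ''X2'' e_cX (e_bwd p q R W)) (PMap ''X'' e_cX e_ldX2)) Qr (5 - 1 - 1 - 1) ?t3 m"
  proof (rule wpc_pmap_seq[OF _ _ cX(2) cX(1) sz(1) _ _ fX])
    fix m1 assume m1: "arr m1 ''X2'' (N * (P * p) * (Q * q)) (flat (P * p) (Q * q) (bwd p q R W x))" "frame {''X2''} m m1"
    have ld: "esafe B e_ldX2 (?t3(''i'' := int k)) m1 \<and> ev e_ldX2 (?t3(''i'' := int k)) m1 = flat (P * p) (Q * q) (bwd p q R W x) k" if "k < N * (P * p) * (Q * q)" for k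
      using arrD[OF m1(1) that] kB[OF that sz(1)] fB by (simp add: e_ldX2_def int_lessB flat_def)
    have "wpc (PMap ''X'' e_cX e_ldX2) Qr 1 ?t3 m1"
    proof (rule wpc_pmap_arr[OF _ cX(2) cX(1) sz(1) _ _ ld])
      fix m2 assume m2: "arr m2 ''X'' (N * (P * p) * (Q * q)) (flat (P * p) (Q * q) (bwd p q R W x))" "frame {''X''} m1 m2"
      show "Qr ?t3 m2" by (rule Qq[OF _ m2(1)]) (use m1(2) m2(2) in \<open>simp add: frame_def\<close>)
    qed (use gok in \<open>auto simp: e_ldX2_def\<close>)
    then show "wpc (PMap ''X'' e_cX e_ldX2) Qr (5 - 1 - 1 - 1 - 1) ?t3 m1" by simp
  next
    show "''X2'' \<notin> earr (e_bwd p q R W)"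
      by (auto simp: e_bwd_def earr_esum e_flat_def x_a_def x_i_def x_j_def dest!: earr_etab[THEN subsetD])
  qed (use gok in auto)
  show ?thesis unfolding bbody_def
    apply (rule wpc_assign_seq[OF _ _ _ v1(2)], simp, use gok in simp, simp, unfold v1(1))
    apply (rule wpc_assign_seq[OF _ _ _ v2(2)], simp, use gok in simp, simp, unfold v2(1))
    apply (rule wpc_assign_seq[OF _ _ _ v3(2)], simp, use gok in simp, simp, unfold v3(1))
    by (rule fin)
qed

end

section \<open>One approximate min-plus product\<close>

definition "e_bJ = EBits vJ"
definition "e_vlb = vlb"
definition "e_sc = vsn [*] vc"
definition "xt = vi [mod] vc"
definition "xr = vi [div] vc"
definition "e_sum = ELoad ''B'' ((xr [div] vn) [*] vn [+] xt) [+] ELoad ''A'' (xt [*] vn [+] xr [mod] vn)"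
definition "e_nv = EIf xt vn (EIf e_sum vI e_sum vI) vI"
text \<open>\<open>E\<close> holds \<open>D ^ kk\<close>, the factor that the integer form of the
  bilinear identity leaves on every entry; the division is exact.\<close>

definition "e_S = ELoad ''X'' (e_flat xt vP (xr [div] vn) vQ (xr [mod] vn)) [div] vE"
definition "e_dec = EIf (ELit 0) e_S ((ELit 2 [*] vM [-] (EBits e_S [-] ELit 1) [div] vlb) [<<] xt) vI"
definition "e_fv = EIf xt vJ e_dec vI"
definition "e_ldZ = ELoad ''Z'' vi"

text \<open>With more than \<open>n\<close> scales the naive min-plus product is within the work bound, and thanks to it the number of
  branches, hence the depth, does not depend on the aspect ratio.\<close>

definition naive where
  "naive = Seq (Assign ''h'' e_vlb) (Seq (Assign ''c'' e_c) (Seq (Assign ''cnt'' e_sc) (PMap ''Z'' e_cnt e_nv)))"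

definition fast where
  "fast p q R U V W = Seq (Assign ''h'' e_bJ) (Seq (Assign ''c'' e_c) (Seq (Assign ''cnt'' e_sc)
     (Seq (fmm p q R U V W) (PMap ''Z'' e_cnt e_fv))))"

text \<open>Both kinds of product end with one block of \<open>2 ^ h\<close> candidates per output
  entry, indexed by the summation index in the naive case and by the scale in the fast case, so the
  same tournament completes either.\<close>

definition step where
  "step p q R U V W = Seq (IfLess (Var ''n'') (Var ''J'') naive (fast p q R U V W)) (Seq reduce (PMap ''B'' e_vsn e_ldZ))"

definition main_loop where
  "main_loop p q R U V W = For ''y'' ''m1'' (step p q R U V W)"

definition "step_exprs = [e_bJ, e_vlb, e_sc, e_nv, e_fv, e_ldZ, e_c, e_cnt, e_vsn] @ reduce_exprs"

lemma Min_block: "Min (f ` {b * N..<(b + 1) * N}) = Min ((\<lambda>j. f (b * N + j)) ` {..<N::nat})"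
proof -
  have "{b * N..<(b + 1) * N} = (\<lambda>j. b * N + j) ` {..<N}"
    using image_add_atLeastLessThan[of "b * N" 0 N] by (simp add: atLeast0LessThan algebra_simps)
  then show ?thesis by (simp only: image_image)
qed

context prun3
begin

lemma powpq: "(p ^ l) * (q ^ l) \<le> R ^ l" "(q ^ l) * (q ^ l) \<le> R ^ l"
  unfolding power_mult_distrib[symmetric] using pq_RR pq by (auto intro!: power_mono)

text \<open>As \<open>p * q\<close> and \<open>q * q\<close> are at most \<open>R\<close>, the
  arrays do not shrink from one forward level to the next, and \<open>J * R ^ kk\<close> at the
  bottom bounds all of them. This is where the quadratic lower bound on the number of products is
  needed.\<close>

lemma size_le:
  assumes "J \<le> n" "l \<le> kk"
  shows "J * R ^ l * p ^ (kk - l) * q ^ (kk - l) \<le> Nx" "J * R ^ l * q ^ (kk - l) * q ^ (kk - l) \<le> Nx" "J * R ^ l \<le> Nx"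
proof -
  have e: "J * R ^ l * R ^ (kk - l) = J * R ^ kk" using assms(2) by (simp add: mult.assoc flip: power_add)
  have "J * R ^ l * (p ^ (kk - l) * q ^ (kk - l)) \<le> J * R ^ l * R ^ (kk - l)" by (intro mult_le_mono2 powpq)
  then show "J * R ^ l * p ^ (kk - l) * q ^ (kk - l) \<le> Nx" using e fast_N(1)[OF assms(1)] unfolding mult.assoc by linarith
  have "J * R ^ l * (q ^ (kk - l) * q ^ (kk - l)) \<le> J * R ^ l * R ^ (kk - l)" by (intro mult_le_mono2 powpq)
  then show "J * R ^ l * q ^ (kk - l) * q ^ (kk - l) \<le> Nx" using e fast_N(1)[OF assms(1)] unfolding mult.assoc by linarith
  have "J * R ^ l * 1 \<le> J * R ^ l * R ^ (kk - l)" using R4 by (intro mult_le_mono2) simp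
  then show "J * R ^ l \<le> Nx" using e fast_N(1)[OF assms(1)] by linarith
qed

lemma pw_B: "l \<le> kk ==> p ^ l < 2 ^ B" "l \<le> kk ==> q ^ l < 2 ^ B"
  using powq_le[of l] powp_le[of l] qn_B by linarith+

lemma JB: "J < 2 ^ B" "int J < 2 ^ B"
  using T_B(7) lessB int_lessB by auto

text \<open>A forward level takes 9 units and a backward level 7, two of which are loop overhead in
  either case; together they give \<open>16 * kk\<close>.\<close>

lemma wpc_fmm:
  assumes gk: "\<forall>e\<in>set (fmm_exprs p q R U V W). gok e"
    and ev: "env s'" and J: "J \<le> n" and m: "memA m"
    and Bm: "arr m ''B'' (s * n) (\<lambda>k. Bf (k div n) (k mod n))" and Bf: "\<And>i t. i < s ==> t < n ==> 0 \<le> Bf i t \<and> Bf i t \<le> I"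
    and Q: "\<And>m' z. frame {''X'', ''X2'', ''Y'', ''Y2''} m m' ==> arr m' ''X'' (J * p ^ kk * q ^ kk) (flat (p ^ kk) (q ^ kk) z) ==>
       (\<And>a i v. \<bar>z a i v\<bar> < 2 ^ B) ==>
       (\<And>a i v. i < s ==> v < n ==> z a i v = D ^ kk * (\<Sum>t<n. enc lb M a (Bf i t) * enc lb M a (A t v))) ==>
       Qr (s'(''p'' := int (p ^ kk), ''q'' := int (q ^ kk), ''a'' := int J, ''l'' := int kk)) m'"
  shows "wpc (fmm p q R U V W) Qr (16 * kk + 11) s' m"
proof -
  note gok = gk[unfolded fmm_exprs_def, simplified]
  have G20: "20 \<le> G" using gok by (auto intro: gok_G)
  note E = ev[unfolded env_def]
  define x where "x = xenc Bf"
  define y where "y = yenc"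
  have xb: "\<bar>x a i t\<bar> \<le> 2 ^ (lb * 2 ^ mm)" for a i t unfolding x_def using Bf by (intro xenc_bound) auto
  have yb: "\<bar>y a i t\<bar> \<le> 2 ^ (lb * 2 ^ mm)" for a i t unfolding y_def by (rule yenc_bound)
  have xl: "\<bar>fwds p q R U l x a i j\<bar> < 2 ^ B" if "l \<le> kk" for l a i j
    by (rule fwds_B'[where x=x and Ut=U and p'=p]) (use xb that UVW cu_ce in auto)
  have yl: "\<bar>fwds q q R V l y a i j\<bar> < 2 ^ B" if "l \<le> kk" for l a i j
    by (rule fwds_B'[where x=y and Ut=V and p'=q]) (use yb that UVW cu_ce in auto)
  define z0 where "z0 = (\<lambda>a i v. fwds p q R U kk x a i v * fwds q q R V kk y a i v)"
  have xk: "\<bar>fwds p q R U kk x a i j\<bar> \<le> 2 ^ (ce * lb + lb * 2 ^ mm)" for a i j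
    by (rule fwds_B[where x=x and Ut=U and p'=p]) (use xb UVW cu_ce in auto)
  have yk: "\<bar>fwds q q R V kk y a i j\<bar> \<le> 2 ^ (ce * lb + lb * 2 ^ mm)" for a i j
    by (rule fwds_B[where x=y and Ut=V and p'=q]) (use yb UVW cu_ce in auto)
  have zl: "\<bar>bwds p q R W l z0 a i j\<bar> < 2 ^ B" if "l \<le> kk" for l a i j
    unfolding z0_def by (rule bwds_B) (use xk yk that in auto)
  have kB: "k < 2 ^ B" if "k < N" "N \<le> Nx" for k N using that Nx by linarith
  have pB: "int p ^ kk < 2 ^ B" "int q ^ kk < 2 ^ B" "p ^ kk < 2 ^ B" "q ^ kk < 2 ^ B"
    using pw_B[of kk] int_lessB[of "p ^ kk"] int_lessB[of "q ^ kk"] by auto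
  let ?P = "p ^ kk" and ?Q = "q ^ kk"
  let ?S = "\<lambda>l. s'(''p'' := int (p ^ (kk - l)), ''q'' := int (q ^ (kk - l)), ''a'' := int (J * R ^ l))"
  let ?T = "\<lambda>l. s'(''p'' := int (p ^ l), ''q'' := int (q ^ l), ''a'' := int (J * R ^ (kk - l)))"
  let ?F = "{''X'', ''X2'', ''Y'', ''Y2''}"
  have cX: "ev e_cX (?S 0) m2 = int (J * ?P * ?Q)" "esafe B e_cX (?S 0) m2" for m2
    using pB JB by (simp_all add: e_cX_def int_lessB)
  have cY: "ev e_cY (?S 0) m2 = int (J * ?Q * ?Q)" "esafe B e_cY (?S 0) m2" for m2
    using pB JB by (simp_all add: e_cY_def int_lessB)
  have szX: "J * ?P * ?Q \<le> Nx" and szY: "J * ?Q * ?Q \<le> Nx" using size_le[OF J, of 0] by simp_all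
  have encX: "esafe B e_encX ((?S 0)(''i'' := int k)) m \<and> ev e_encX ((?S 0)(''i'' := int k)) m = flat ?P ?Q x k" if k: "k < J * ?P * ?Q" for k
  proof -
    let ?s = "(?S 0)(''i'' := int k)"
    define j i a where "j = k mod ?Q" and "i = (k div ?Q) mod ?P" and "a = (k div ?Q) div ?P"
    have ee: "ev (x_j vQ') ?s m = int j" "ev (x_i vP' vQ') ?s m = int i" "ev (x_a vP' vQ') ?s m = int a"
      "esafe B (x_j vQ') ?s m" "esafe B (x_i vP' vQ') ?s m" "esafe B (x_a vP' vQ') ?s m"
      using pB kB[OF k szX] by (simp_all add: x_j_def x_i_def x_a_def j_def i_def a_def of_nat_div of_nat_mod int_lessB)
    let ?L = "ELoad ''B'' (x_i vP' vQ' [*] vn [+] x_j vQ')"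
    have ld: "ev ?L ?s m = Bf i j \<and> esafe B ?L ?s m" if ij: "i < s" "j < n"
    proof -
      have "i * n + j < (i + 1) * n" using ij by simp
      also have "\<dots> \<le> s * n" using ij by (intro mult_le_mono1) simp
      finally have "i * n + j < s * n" .
      from arrD[OF Bm this] have "m (''B'', int (i * n + j)) = Bf i j" using ij by simp
      moreover have "\<bar>Bf i j\<bar> < 2 ^ B" using Bf[OF ij] I_B by linarith
      ultimately show ?thesis using ee E n_B by (simp add: int_lessB)
    qed
    have en: "esafe B (e_enc ?L (x_a vP' vQ')) ?s m \<and> ev (e_enc ?L (x_a vP' vQ')) ?s m = enc lb M a (Bf i j)" if ij: "i < s" "j < n"
      by (rule e_enc_sem) (use ld[OF ij] Bf[OF ij] ee E in auto)
    show ?thesis unfolding e_encX_def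
      using ee E n_B s_B small_lits en by (auto simp: int_lessB flat_def x_def xenc_def j_def i_def a_def)
  qed
  have encY: "esafe B e_encY ((?S 0)(''i'' := int k)) m2 \<and> ev e_encY ((?S 0)(''i'' := int k)) m2 = flat ?Q ?Q y k"
    if k: "k < J * ?Q * ?Q" and m2: "memA m2" for k m2
  proof -
    let ?s = "(?S 0)(''i'' := int k)"
    define j i a where "j = k mod ?Q" and "i = (k div ?Q) mod ?Q" and "a = (k div ?Q) div ?Q"
    have ee: "ev (x_j vQ') ?s m2 = int j" "ev (x_i vQ' vQ') ?s m2 = int i" "ev (x_a vQ' vQ') ?s m2 = int a"
      "esafe B (x_j vQ') ?s m2" "esafe B (x_i vQ' vQ') ?s m2" "esafe B (x_a vQ' vQ') ?s m2"
      using pB kB[OF k szY] by (simp_all add: x_j_def x_i_def x_a_def j_def i_def a_def of_nat_div of_nat_mod int_lessB)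
    let ?L = "ELoad ''A'' (x_i vQ' vQ' [*] vn [+] x_j vQ')"
    have ld: "ev ?L ?s m2 = A i j \<and> esafe B ?L ?s m2" if ij: "i < n" "j < n"
    proof -
      have "m2 (''A'', int (i * n + j)) = A i j" by (rule memA_D[OF m2 ij])
      moreover have "\<bar>A i j\<bar> < 2 ^ B" using A_bounds(1)[OF ij] A_bounds(2)[of i j] I_B by linarith
      ultimately show ?thesis using ee E n_B by (simp add: int_lessB)
    qed
    have en: "esafe B (e_enc ?L (x_a vQ' vQ')) ?s m2 \<and> ev (e_enc ?L (x_a vQ' vQ')) ?s m2 = enc lb M a (A i j)" if ij: "i < n" "j < n"
      by (rule e_enc_sem) (use ld[OF ij] A_bounds(1)[OF ij] ee E in auto)
    show ?thesis unfolding e_encY_def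
      using ee E n_B s_B small_lits en by (auto simp: int_lessB flat_def y_def yenc_def j_def i_def a_def)
  qed
  define I1 where "I1 l s2 m2 \<longleftrightarrow> l \<le> kk \<and> s2 = (?S l)(''l'' := int l) \<and> frame ?F m m2 \<and>
    arr m2 ''X'' (J * R ^ l * p ^ (kk - l) * q ^ (kk - l)) (flat (p ^ (kk - l)) (q ^ (kk - l)) (fwds p q R U l x)) \<and>
    arr m2 ''Y'' (J * R ^ l * q ^ (kk - l) * q ^ (kk - l)) (flat (q ^ (kk - l)) (q ^ (kk - l)) (fwds q q R V l y))" for l s2 m2
  define I2 where "I2 l s2 m2 \<longleftrightarrow> l \<le> kk \<and> s2 = (?T l)(''l'' := int l) \<and> frame ?F m m2 \<and>
    arr m2 ''X'' (J * R ^ (kk - l) * p ^ l * q ^ l) (flat (p ^ l) (q ^ l) (bwds p q R W l z0))" for l s2 m2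
  have loop2: "wpc (For ''l'' ''k'' (bbody p q R W)) Qr (kk * (5 + 2) + 2) s2 m2"
    if I20: "I2 0 (s2(''l'' := 0)) m2" for s2 m2
  proof (rule wpc_for[where I=I2, OF G20])
    show "\<And>l s m. I2 l s m ==> s ''l'' = int l \<and> s ''k'' = int kk" using E by (auto simp: I2_def)
    show "I2 0 (s2(''l'' := 0)) m2" by (rule I20)
    show "Qr s3 m3" if "I2 kk s3 m3" for s3 m3
    proof -
      have s3: "s3 = s'(''p'' := int (p ^ kk), ''q'' := int (q ^ kk), ''a'' := int J, ''l'' := int kk)"
        and m3: "frame ?F m m3" "arr m3 ''X'' (J * p ^ kk * q ^ kk) (flat (p ^ kk) (q ^ kk) (bwds p q R W kk z0))"
        using that by (auto simp: I2_def)
      show ?thesis unfolding s3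
      proof (rule Q[OF m3])
        show "\<bar>bwds p q R W kk z0 a i v\<bar> < 2 ^ B" for a i v by (rule zl) simp
        fix a i v assume iv: "i < s" "v < n"
        have "bwds p q R W kk z0 a i v = D ^ kk * (\<Sum>j<q ^ kk. fwds p q R U (kk - kk) x a i j * fwds q q R V (kk - kk) y a j v)"
          unfolding z0_def by (rule fast_matrix_product[OF alg]) (use iv sp n_le in auto)
        \<comment> \<open>Encodings beyond the index \<open>n\<close> are zero, so the padded range
          shrinks to the true one.\<close>
        also have "(\<Sum>j<q ^ kk. fwds p q R U (kk - kk) x a i j * fwds q q R V (kk - kk) y a j v) =
           (\<Sum>t<n. enc lb M a (Bf i t) * enc lb M a (A t v))"
          by (rule sum.mono_neutral_cong_right) (use iv n_le in \<open>auto simp: x_def y_def xenc_def yenc_def\<close>)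
        finally show "bwds p q R W kk z0 a i v = D ^ kk * (\<Sum>t<n. enc lb M a (Bf i t) * enc lb M a (A t v))" .
      qed
    qed
    fix l s3 m3 assume l: "l < kk" and "I2 l s3 m3"
    then have s3: "s3 = (?T l)(''l'' := int l)" and fr: "frame ?F m m3"
      and X: "arr m3 ''X'' (J * R ^ (kk - l) * p ^ l * q ^ l) (flat (p ^ l) (q ^ l) (bwds p q R W l z0))" by (auto simp: I2_def)
    let ?N = "J * R ^ (kk - Suc l)"
    have NR: "J * R ^ (kk - l) = ?N * R" using l by (simp add: Suc_diff_Suc[symmetric] del: Suc_diff_Suc)
    have sz: "?N * (p ^ l * p) * (q ^ l * q) \<le> Nx" using size_le(1)[OF J, of "kk - Suc l"] l by (simp add: mult_ac)
    have szN: "?N * R < 2 ^ B" using size_le(3)[OF J, of "kk - l"] Nx unfolding NR by simp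
    have pl: "p ^ l * p < 2 ^ B" "q ^ l * q < 2 ^ B" using pw_B[of "Suc l"] l by (simp_all add: mult.commute)
    show "wpc (bbody p q R W) (\<lambda>s m. s ''l'' = int l \<and> I2 (Suc l) (s(''l'' := int l + 1)) m) 5 s3 m3"
    proof (rule wpc_bbody[OF gk, where N="?N" and P="p ^ l" and Q="q ^ l", OF _ _ _ sz pl szN X[unfolded NR]])
      show "s3 ''a'' = int (?N * R)" "s3 ''p'' = int (p ^ l)" "s3 ''q'' = int (q ^ l)" by (simp_all add: s3 NR)
      show "\<bar>bwds p q R W l z0 a i j\<bar> < 2 ^ B" for a i j by (rule zl) (use l in simp)
      show "\<bar>bwd p q R W (bwds p q R W l z0) a i j\<bar> < 2 ^ B" for a i j
        using zl[of "Suc l" a i j] l by (simp add: bwds_Suc)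
      fix m4 assume m4: "frame ?F m3 m4"
        "arr m4 ''X'' (?N * (p ^ l * p) * (q ^ l * q)) (flat (p ^ l * p) (q ^ l * q) (bwd p q R W (bwds p q R W l z0)))"
      have "frame ?F m m4" by (rule frame_trans[OF fr m4(1)]) auto
      then show "(s3(''a'' := int ?N, ''p'' := int (p ^ l * p), ''q'' := int (q ^ l * q))) ''l'' = int l \<and>
         I2 (Suc l) ((s3(''a'' := int ?N, ''p'' := int (p ^ l * p), ''q'' := int (q ^ l * q)))(''l'' := int l + 1)) m4"
        using m4(2) l unfolding I2_def s3 by (auto simp: fun_eq_iff mult.commute bwds_Suc)
    qed
  qed (use kk_le lb_B in auto)
  have loop1: "wpc (For ''l'' ''k'' (fbody p q R U V)) (\<lambda>s2 m2. I1 kk s2 m2) (kk * (7 + 2) + 2) s2 m2"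
    if I10: "I1 0 (s2(''l'' := 0)) m2" for s2 m2
  proof (rule wpc_for[where I=I1, OF G20])
    show "\<And>l s m. I1 l s m ==> s ''l'' = int l \<and> s ''k'' = int kk" using E by (auto simp: I1_def)
    show "I1 0 (s2(''l'' := 0)) m2" by (rule I10)
    fix l s3 m3 assume l: "l < kk" and "I1 l s3 m3"
    then have s3: "s3 = (?S l)(''l'' := int l)" and fr: "frame ?F m m3"
      and X: "arr m3 ''X'' (J * R ^ l * p ^ (kk - l) * q ^ (kk - l)) (flat (p ^ (kk - l)) (q ^ (kk - l)) (fwds p q R U l x))"
      and Y: "arr m3 ''Y'' (J * R ^ l * q ^ (kk - l) * q ^ (kk - l)) (flat (q ^ (kk - l)) (q ^ (kk - l)) (fwds q q R V l y))"
      by (auto simp: I1_def)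
    let ?N = "J * R ^ l" and ?p = "p ^ (kk - Suc l)" and ?q = "q ^ (kk - Suc l)"
    have PP: "p ^ (kk - l) = ?p * p" "q ^ (kk - l) = ?q * q" using l by (simp_all add: Suc_diff_Suc[symmetric] del: Suc_diff_Suc)
    have N': "J * R ^ Suc l = ?N * R" by simp
    have sz: "?N * R * ?p * ?q \<le> Nx" "?N * R * ?q * ?q \<le> Nx" "?N * R < 2 ^ B"
      using size_le[OF J, of "Suc l"] l Nx unfolding N' by auto
    have pl: "?p * p < 2 ^ B" "?q * q < 2 ^ B" using pw_B[of "kk - l"] unfolding PP by simp_all
    have pos: "0 < ?p" "0 < ?q" using pq by simp_all
    show "wpc (fbody p q R U V) (\<lambda>s m. s ''l'' = int l \<and> I1 (Suc l) (s(''l'' := int l + 1)) m) 7 s3 m3"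
    proof (rule wpc_fbody[OF gk, where N="?N" and P="?p" and Q="?q", OF _ _ _ pos sz(1,2) pl sz(3) _ _ Y[unfolded PP]])
      show "s3 ''a'' = int ?N" "s3 ''p'' = int (?p * p)" "s3 ''q'' = int (?q * q)" unfolding PP[symmetric] by (simp_all add: s3)
      show "arr m3 ''X'' (?N * (?p * p) * (?q * q)) (flat (?p * p) (?q * q) (fwds p q R U l x))" using X unfolding PP .
      show "\<bar>fwds p q R U l x a i j\<bar> < 2 ^ B" "\<bar>fwds q q R V l y a i j\<bar> < 2 ^ B" for a i j
        using xl yl l by (simp_all add: less_imp_le)
      show "\<bar>fwd p q R U (fwds p q R U l x) a i j\<bar> < 2 ^ B" "\<bar>fwd q q R V (fwds q q R V l y) a i j\<bar> < 2 ^ B" for a i j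
        using xl[of "Suc l" a i j] yl[of "Suc l" a i j] l by (simp_all add: fwds_Suc)
      fix m4 assume m4: "frame ?F m3 m4" "arr m4 ''X'' (?N * R * ?p * ?q) (flat ?p ?q (fwd p q R U (fwds p q R U l x)))"
        "arr m4 ''Y'' (?N * R * ?q * ?q) (flat ?q ?q (fwd q q R V (fwds q q R V l y)))"
      have "frame ?F m m4" by (rule frame_trans[OF fr m4(1)]) auto
      then show "(s3(''a'' := int (?N * R), ''p'' := int ?p, ''q'' := int ?q)) ''l'' = int l \<and>
         I1 (Suc l) ((s3(''a'' := int (?N * R), ''p'' := int ?p, ''q'' := int ?q))(''l'' := int l + 1)) m4"
        using m4(2,3) l unfolding I1_def s3 N' by (auto simp: fun_eq_iff fwds_Suc)
    qed
  qed (use kk_le lb_B in auto)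
  have vP: "ev e_vP s' m = int ?P" "esafe B e_vP s' m" using E pB by (simp_all add: e_vP_def)
  have vQ: "ev e_vQ t m = int ?Q" "esafe B e_vQ t m" if "t = s'(''p'' := int ?P)" for t using E pB by (simp_all add: e_vQ_def that)
  have vJ: "ev e_vJ t m = int J" "esafe B e_vJ t m" if "t = s'(''p'' := int ?P, ''q'' := int ?Q)" for t using E JB by (simp_all add: e_vJ_def that)
  have fin: "wpc (Seq (PMap ''X'' e_cX e_encX) (Seq (PMap ''Y'' e_cY e_encY) (Seq (For ''l'' ''k'' (fbody p q R U V))
     (Seq (PMap ''X2'' e_va e_mul) (Seq (PMap ''X'' e_va e_ldX2) (For ''l'' ''k'' (bbody p q R W)))))))
     Qr (16 * kk + 11 - 1 - 1 - 1) (?S 0) m"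
  proof (rule wpc_pmap_seq[OF _ _ cX(2) cX(1) szX _ _ encX])
    fix m1 assume m1: "arr m1 ''X'' (J * ?P * ?Q) (flat ?P ?Q x)" "frame {''X''} m m1"
    have mA1: "memA m1" by (rule memA_frame[OF m m1(2)]) (auto simp: inp_arrays_def)
    show "wpc (Seq (PMap ''Y'' e_cY e_encY) (Seq (For ''l'' ''k'' (fbody p q R U V))
     (Seq (PMap ''X2'' e_va e_mul) (Seq (PMap ''X'' e_va e_ldX2) (For ''l'' ''k'' (bbody p q R W))))))
     Qr (16 * kk + 11 - 1 - 1 - 1 - 1) (?S 0) m1"
    proof (rule wpc_pmap_seq[OF _ _ cY(2) cY(1) szY _ _ encY[OF _ mA1]])
      fix m2 assume m2: "arr m2 ''Y'' (J * ?Q * ?Q) (flat ?Q ?Q y)" "frame {''Y''} m1 m2"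
      have X2: "arr m2 ''X'' (J * ?P * ?Q) (flat ?P ?Q x)" by (rule frame_arr[OF m2(2) _ m1(1)]) simp
      have f2: "frame ?F m m2" using m1(2) m2(2) by (simp add: frame_def)
      show "wpc (Seq (For ''l'' ''k'' (fbody p q R U V)) (Seq (PMap ''X2'' e_va e_mul) (Seq (PMap ''X'' e_va e_ldX2) (For ''l'' ''k'' (bbody p q R W)))))
       Qr (16 * kk + 11 - 1 - 1 - 1 - 1 - 1) (?S 0) m2"
      proof (rule wpc_seq_le[of "kk * (7 + 2) + 2"], simp, rule wpc_mono[OF loop1 le_refl])
        show "I1 0 ((?S 0)(''l'' := 0)) m2" using X2 m2(1) f2 by (simp add: I1_def)
        fix s3 m3 assume "I1 kk s3 m3"
        then have s3: "s3 = (?S kk)(''l'' := int kk)" and f3: "frame ?F m m3"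
          and X3: "arr m3 ''X'' (J * R ^ kk) (flat 1 1 (fwds p q R U kk x))" and Y3: "arr m3 ''Y'' (J * R ^ kk) (flat 1 1 (fwds q q R V kk y))"
          by (auto simp: I1_def)
        have NB: "J * R ^ kk \<le> Nx" by (rule fast_N(1)[OF J])
        have va: "ev e_va s3 m4 = int (J * R ^ kk)" "esafe B e_va s3 m4" for m4
          using lessB'[OF NB] int_lessB[of "J * R ^ kk"] by (simp_all add: e_va_def s3)
        have mul: "esafe B e_mul (s3(''i'' := int k)) m3 \<and> ev e_mul (s3(''i'' := int k)) m3 = flat 1 1 z0 k" if k: "k < J * R ^ kk" for k
          using arrD[OF X3 k] arrD[OF Y3 k] xl[of kk] yl[of kk] kB[OF k NB] by (simp add: e_mul_def flat_def z0_def int_lessB)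
        show "wpc (Seq (PMap ''X2'' e_va e_mul) (Seq (PMap ''X'' e_va e_ldX2) (For ''l'' ''k'' (bbody p q R W))))
           Qr (16 * kk + 11 - 1 - 1 - 1 - 1 - 1 - (kk * (7 + 2) + 2)) s3 m3"
        proof (rule wpc_pmap_seq[OF _ _ va(2) va(1) NB _ _ mul])
          fix m4 assume m4: "arr m4 ''X2'' (J * R ^ kk) (flat 1 1 z0)" "frame {''X2''} m3 m4"
          have ld: "esafe B e_ldX2 (s3(''i'' := int k)) m4 \<and> ev e_ldX2 (s3(''i'' := int k)) m4 = flat 1 1 z0 k" if k: "k < J * R ^ kk" for k
            using arrD[OF m4(1) k] zl[of 0] kB[OF k NB] by (simp add: e_ldX2_def flat_def int_lessB)
          show "wpc (Seq (PMap ''X'' e_va e_ldX2) (For ''l'' ''k'' (bbody p q R W)))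
             Qr (16 * kk + 11 - 1 - 1 - 1 - 1 - 1 - (kk * (7 + 2) + 2) - 1) s3 m4"
          proof (rule wpc_pmap_seq[OF _ _ va(2) va(1) NB _ _ ld])
            fix m5 assume m5: "arr m5 ''X'' (J * R ^ kk) (flat 1 1 z0)" "frame {''X''} m4 m5"
            have f5: "frame ?F m m5" using f3 m4(2) m5(2) by (simp add: frame_def)
            have "I2 0 (s3(''l'' := 0)) m5" using f5 m5(1) by (auto simp: I2_def s3 fun_eq_iff)
            then have "wpc (For ''l'' ''k'' (bbody p q R W)) Qr (kk * (5 + 2) + 2) s3 m5" by (rule loop2)
            then show "wpc (For ''l'' ''k'' (bbody p q R W)) Qr (16 * kk + 11 - 1 - 1 - 1 - 1 - 1 - (kk * (7 + 2) + 2) - 1 - 1) s3 m5"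
              by (rule wpc_mono) simp
          qed (use gok in \<open>auto simp: e_ldX2_def\<close>)
        qed (use gok in \<open>auto simp: e_mul_def\<close>)
      qed
    qed (use gok in \<open>auto simp: e_encY_def e_enc_def e_cs_def x_j_def x_i_def x_a_def\<close>)
  qed (use gok in \<open>auto simp: e_encX_def e_enc_def e_cs_def x_j_def x_i_def x_a_def\<close>)
  have S0: "s'(''p'' := int ?P, ''q'' := int ?Q, ''a'' := int J) = ?S 0" by simp
  show ?thesis unfolding fmm_def
    apply (rule wpc_assign_seq[OF _ _ _ vP(2)], simp, use gok in simp, simp, unfold vP(1))
    apply (rule wpc_assign_seq[OF _ _ _ vQ(2)[OF refl]], simp, use gok in simp, simp, unfold vQ(1)[OF refl])
    apply (rule wpc_assign_seq[OF _ _ _ vJ(2)[OF refl]], simp, use gok in simp, simp, unfold vJ(1)[OF refl])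
    unfolding S0 by (rule fin)
qed

definition loc_vars :: "string set" where
  "loc_vars = {''h'', ''c'', ''cnt'', ''a'', ''p'', ''q'', ''l''}"

text \<open>The common interface of the two kinds of product: \<open>g\<close> lists the candidates
  and \<open>h\<close> is the number of rounds of the tournament to follow.\<close>

definition leaves :: "(nat => nat => int) => nat => (nat => int) => bool" where
  "leaves Bf h g \<longleftrightarrow> h \<le> lb \<and> s * n * 2 ^ h \<le> Nx \<and> (\<forall>i<s * n * 2 ^ h. \<bar>g i\<bar> < 2 ^ B) \<and>
     (\<forall>r<s * n. minplus_entry M I n (Bf (r div n)) (\<lambda>t. A t (r mod n)) (Min ((\<lambda>j. g (r * 2 ^ h + j)) ` {..<2 ^ h})))"

lemma env_upd: "env s' ==> (\<And>x. x \<notin> loc_vars ==> s2 x = s' x) ==> env s2"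
  by (simp add: env_def loc_vars_def)

lemma block_index: "j < 2 ^ h ==> (r * 2 ^ h + j) div 2 ^ h = r \<and> (r * 2 ^ h + j) mod 2 ^ h = (j::nat)"
  by simp

lemma row_index: "r < s * n ==> r div n < s" "r mod n < n"
  using n2 by (auto simp: less_mult_imp_div_less)

lemma B_load:
  assumes "arr m ''B'' (s * n) (\<lambda>k. Bf (k div n) (k mod n))" "i < s" "t < n"
  shows "m (''B'', int (i * n + t)) = Bf i t"
proof -
  have "i * n + t < (i + 1) * n" using assms by simp
  also have "\<dots> \<le> s * n" using assms by (intro mult_le_mono1) simp
  finally have "i * n + t < s * n" .
  from arrD[OF assms(1) this] assms(3) show ?thesis by simp
qed

lemma xt_xr:
  assumes "s' ''c'' = int c" "s' ''i'' = int k" "c < 2 ^ B" "k < 2 ^ B"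
  shows "ev xt s' m = int (k mod c)" "ev xr s' m = int (k div c)" "esafe B xt s' m" "esafe B xr s' m"
  using assms by (simp_all add: xt_def xr_def of_nat_div of_nat_mod int_lessB)

lemma A_B: "ua < n ==> v < n ==> \<bar>A ua v\<bar> < 2 ^ B"
  using A_bounds(1)[of ua v] A_bounds(2)[of ua v] I_B by linarith

lemma wpc_naive:
  assumes gk: "\<forall>e\<in>set step_exprs. gok e"
    and ev: "env s'" and J: "n < J" and m: "memA m"
    and Bm: "arr m ''B'' (s * n) (\<lambda>k. Bf (k div n) (k mod n))" and Bf: "\<And>i t. i < s ==> t < n ==> 0 \<le> Bf i t \<and> Bf i t \<le> I"
    and Q: "\<And>m' h g s2. frame {''X'', ''X2'', ''Y'', ''Y2'', ''Z''} m m' ==> leaves Bf h g ==> arr m' ''Z'' (s * n * 2 ^ h) g ==>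
       s2 ''h'' = int h ==> s2 ''cnt'' = int (s * n * 2 ^ h) ==> (\<And>x. x \<notin> loc_vars ==> s2 x = s' x) ==> Qr s2 m'"
  shows "wpc naive Qr 4 s' m"
proof -
  note gok = gk[unfolded step_exprs_def, simplified]
  note E = ev[unfolded env_def]
  have Nn: "s * n * 2 ^ lb \<le> Nx" by (rule naive_N[OF J])
  have lbp: "lb < B" using Bw by simp
  \<comment> \<open>Leaf \<open>k\<close> is the summation index \<open>t\<close> for the output
    entry \<open>r\<close>; indices from \<open>n\<close> up to \<open>2 ^ lb\<close> are padded
    with infinity.\<close>
  define g where "g k = (let t = k mod 2 ^ lb; r = k div 2 ^ lb in if t < n then min (Bf (r div n) t + A t (r mod n)) I else I)" for k
  have kB: "k < 2 ^ B" if "k < s * n * 2 ^ lb" for k using that Nn Nx by linarith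
  let ?s1 = "s'(''h'' := int lb)"
  let ?s2 = "?s1(''c'' := 2 ^ lb)"
  let ?s3 = "?s2(''cnt'' := int (s * n * 2 ^ lb))"
  have v1: "ev e_vlb s' m = int lb" "esafe B e_vlb s' m" using E lb_B by (simp_all add: e_vlb_def int_lessB)
  have v2: "ev e_c ?s1 m = 2 ^ lb" "esafe B e_c ?s1 m" using lb_B lbp small_lits by (simp_all add: e_c_def int_lessB)
  have sni: "int s * int n < 2 ^ B" using sn_B(1) int_lessB[of "s * n"] by simp
  have v3: "ev e_sc ?s2 m = int (s * n * 2 ^ lb)" "esafe B e_sc ?s2 m" using E sni lbp by (simp_all add: e_sc_def)
  have v4: "ev e_cnt ?s3 m = int (s * n * 2 ^ lb)" "esafe B e_cnt ?s3 m"
    using lessB'[OF Nn] int_lessB[of "s * n * 2 ^ lb"] by (simp_all add: e_cnt_def)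
  have leaf: "esafe B e_nv (?s3(''i'' := int k)) m \<and> ev e_nv (?s3(''i'' := int k)) m = g k \<and> \<bar>g k\<bar> < 2 ^ B" if k: "k < s * n * 2 ^ lb" for k
  proof -
    let ?s = "?s3(''i'' := int k)"
    define t r where "t = k mod 2 ^ lb" and "r = k div 2 ^ lb"
    have "ev xt ?s m = int t \<and> ev xr ?s m = int r \<and> esafe B xt ?s m \<and> esafe B xr ?s m"
      unfolding t_def r_def using kB[OF k] lbp by (intro conjI xt_xr[where c="2 ^ lb"]) auto
    note tr = this[THEN conjunct1] this[THEN conjunct2, THEN conjunct1] this[THEN conjunct2, THEN conjunct2, THEN conjunct1]
      this[THEN conjunct2, THEN conjunct2, THEN conjunct2]
    have r: "r < s * n" using k by (simp add: r_def less_mult_imp_div_less)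
    note ri = row_index(1)[OF r] row_index(2)[of r]
    have sum: "esafe B e_sum ?s m \<and> ev e_sum ?s m = Bf (r div n) t + A t (r mod n)" if t: "t < n"
    proof -
      have ix: "(int r div int n) * int n + int t = int ((r div n) * n + t)" "int t * int n + int r mod int n = int (t * n + r mod n)"
        by (simp_all add: of_nat_div of_nat_mod)
      have "m (''B'', (int r div int n) * int n + int t) = Bf (r div n) t" "m (''A'', int t * int n + int r mod int n) = A t (r mod n)"
        unfolding ix by (rule B_load[OF Bm ri(1) t]) (rule memA_D[OF m t ri(2)])
      moreover have "\<bar>Bf (r div n) t\<bar> < 2 ^ B" using Bf[OF ri(1) t] I_B by linarith
      ultimately show ?thesis using tr E n_B A_B[OF t ri(2)] by (simp add: e_sum_def int_lessB)
    qed
    have gB: "\<bar>g k\<bar> < 2 ^ B"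
    proof (cases "t < n")
      case True
      then have "0 \<le> Bf (r div n) t + A t (r mod n)" using Bf[OF ri(1)] A_bounds(1)[OF _ ri(2)] by simp
      then show ?thesis using I_B by (auto simp: g_def Let_def t_def[symmetric] r_def[symmetric] min_def)
    qed (use I_B in \<open>auto simp: g_def Let_def t_def[symmetric] r_def[symmetric]\<close>)
    show ?thesis using tr E n_B sum I_B gB
      by (auto simp: e_nv_def int_lessB g_def Let_def t_def[symmetric] r_def[symmetric] min_def)
  qed
  have lv: "leaves Bf lb g" unfolding leaves_def
  proof (intro conjI allI impI)
    fix r assume r: "r < s * n"
    note ri = row_index(1)[OF r] row_index(2)[of r]
    have "(\<lambda>j. g (r * 2 ^ lb + j)) ` {..<2 ^ lb} = (\<lambda>t. if t < n then min (Bf (r div n) t + A t (r mod n)) I else I) ` {..<2 ^ lb}"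
      using block_index[of _ lb r] by (intro image_cong) (auto simp: g_def Let_def)
    then show "minplus_entry M I n (Bf (r div n)) (\<lambda>t. A t (r mod n)) (Min ((\<lambda>j. g (r * 2 ^ lb + j)) ` {..<2 ^ lb}))"
      using Bf[OF ri(1)] A_bounds(1)[OF _ ri(2)] I_B n_lb by (simp only:) (intro minplus_entry_exact, auto)
  qed (use Nn leaf in auto)
  show ?thesis unfolding naive_def
    apply (rule wpc_assign_seq[OF _ _ _ v1(2)], simp, use gok in simp, simp, unfold v1(1))
    apply (rule wpc_assign_seq[OF _ _ _ v2(2)], simp, use gok in simp, simp, unfold v2(1))
    apply (rule wpc_assign_seq[OF _ _ _ v3(2)], simp, use gok in simp, simp, unfold v3(1))
    apply (rule wpc_mono[where k=1 and Q=Qr])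
      apply (rule wpc_pmap_arr[OF _ v4(2) v4(1) Nn, where f=g])
          apply (use gok in simp)
         apply (use gok in simp)
        apply (simp add: e_nv_def e_sum_def xt_def xr_def)
       apply (use leaf in blast)
      apply (rule Q[OF _ lv], simp add: frame_def, assumption)
    by (auto simp: loc_vars_def)
qed

lemma bl_pos: "0 < v ==> 1 \<le> bit_length v"
  using bit_length_pow[of v] by (cases "bit_length v") auto

lemma wpc_fast:
  assumes gk: "\<forall>e\<in>set step_exprs. gok e" "\<forall>e\<in>set (fmm_exprs p q R U V W). gok e"
    and ev: "env s'" and J: "J \<le> n" and m: "memA m"
    and Bm: "arr m ''B'' (s * n) (\<lambda>k. Bf (k div n) (k mod n))" and Bf: "\<And>i t. i < s ==> t < n ==> 0 \<le> Bf i t \<and> Bf i t \<le> I"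
    and Q: "\<And>m' h g s2. frame {''X'', ''X2'', ''Y'', ''Y2'', ''Z''} m m' ==> leaves Bf h g ==> arr m' ''Z'' (s * n * 2 ^ h) g ==>
       s2 ''h'' = int h ==> s2 ''cnt'' = int (s * n * 2 ^ h) ==> (\<And>x. x \<notin> loc_vars ==> s2 x = s' x) ==> Qr s2 m'"
  shows "wpc (fast p q R U V W) Qr (16 * kk + 15) s' m"
proof -
  note gok = gk(1)[unfolded step_exprs_def, simplified]
  note E = ev[unfolded env_def]
  define h where "h = bit_length (int J)"
  have Nn: "s * n * 2 ^ h \<le> Nx" unfolding h_def by (rule fast_N(2)[OF J])
  have "bit_length (int J) \<le> bit_length (int n)" unfolding bit_length_def using J by (simp add: floorlog_mono)
  then have hlb: "h \<le> lb" unfolding h_def lb_eq[symmetric] .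
  have Jh: "J \<le> 2 ^ h" using bit_length_pow[of "int J"] by (simp add: h_def nat_less_iff)
  have lbp: "lb < B" "h < B" using Bw hlb by simp_all
  have hB: "h < 2 ^ B" using lbp(2) by (rule lessB)
  define Sm where "Sm j i v = (\<Sum>t<n. enc lb M j (Bf i t) * enc lb M j (A t v))" for j i v
  define g where "g k = (let j = k mod 2 ^ h; r = k div 2 ^ h in if j < J then dec lb M I j (Sm j (r div n) (r mod n)) else I)" for k
  have kB: "k < 2 ^ B" if "k < s * n * 2 ^ h" for k using that Nn Nx by linarith
  let ?s1 = "s'(''h'' := int h)"
  let ?s2 = "?s1(''c'' := 2 ^ h)"
  let ?s3 = "?s2(''cnt'' := int (s * n * 2 ^ h))"
  let ?s4 = "?s3(''p'' := int (p ^ kk), ''q'' := int (q ^ kk), ''a'' := int J, ''l'' := int kk)"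
  have v1: "ev e_bJ s' m = int h" "esafe B e_bJ s' m" using E JB by (simp_all add: e_bJ_def h_def)
  have v2: "ev e_c ?s1 m = 2 ^ h" "esafe B e_c ?s1 m" using hB lbp small_lits by (simp_all add: e_c_def int_lessB)
  have sni: "int s * int n < 2 ^ B" using sn_B(1) int_lessB[of "s * n"] by simp
  have v3: "ev e_sc ?s2 m = int (s * n * 2 ^ h)" "esafe B e_sc ?s2 m" using E sni lbp by (simp_all add: e_sc_def)
  have v4: "ev e_cnt ?s4 m2 = int (s * n * 2 ^ h)" "esafe B e_cnt ?s4 m2" for m2
    using lessB'[OF Nn] int_lessB[of "s * n * 2 ^ h"] by (simp_all add: e_cnt_def)
  have pB: "int p ^ kk < 2 ^ B" "int q ^ kk < 2 ^ B"
    using pw_B[of kk] int_lessB[of "p ^ kk"] int_lessB[of "q ^ kk"] by auto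
  have DB: "\<bar>D ^ kk\<bar> < 2 ^ B" by (rule D_pow_B[OF kk_le])
  have D0: "0 < D ^ kk" using D1 by simp
  have lv: "leaves Bf h g" unfolding leaves_def
  proof (intro conjI allI impI)
    fix r assume r: "r < s * n"
    note ri = row_index(1)[OF r] row_index(2)[of r]
    have im: "(\<lambda>j. g (r * 2 ^ h + j)) ` {..<2 ^ h} = (\<lambda>j. if j < J then dec lb M I j (Sm j (r div n) (r mod n)) else I) ` {..<2 ^ h}"
      using block_index[of _ h r] by (intro image_cong) (auto simp: g_def Let_def)
    have nl: "int n < 2 ^ lb" using n_lb by (metis of_nat_less_numeral_power_cancel_iff)
    show "minplus_entry M I n (Bf (r div n)) (\<lambda>t. A t (r mod n)) (Min ((\<lambda>j. g (r * 2 ^ h + j)) ` {..<2 ^ h}))"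
      unfolding im Sm_def I_def
      by (rule minplus_entry_scaled[where J=J]) (use Bf[OF ri(1)] A_bounds(1)[OF _ ri(2)] nl lb2 Jh mm_T in \<open>auto simp: J_def\<close>)
  next
    fix k assume k: "k < s * n * 2 ^ h"
    define r where "r = k div 2 ^ h"
    have r: "r < s * n" using k by (simp add: r_def less_mult_imp_div_less)
    note ri = row_index(1)[OF r] row_index(2)[of r]
    have "\<bar>dec lb M I j (Sm j (r div n) (r mod n))\<bar> < 2 ^ B" if j: "j < J" for j
    proof -
      have nl: "int n < 2 ^ lb" using n_lb by (metis of_nat_less_numeral_power_cancel_iff)
      have D: "dec lb M I j (Sm j (r div n) (r mod n)) = I \<or> (\<exists>t<n. cshift (Bf (r div n) t) j \<le> M \<and> cshift (A t (r mod n)) j \<le> M \<and>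
         dec lb M I j (Sm j (r div n) (r mod n)) = (cshift (Bf (r div n) t) j + cshift (A t (r mod n)) j) * 2 ^ j)"
        unfolding Sm_def using dec_enc_sum[where b="Bf (r div n)" and a="\<lambda>t. A t (r mod n)" and M=M and I=I and j=j and n=n and L=lb, OF _ _ nl]
          Bf[OF ri(1)] A_bounds(1)[OF _ ri(2)] lb2 by auto
      then show ?thesis
      proof
        assume "\<exists>t<n. cshift (Bf (r div n) t) j \<le> M \<and> cshift (A t (r mod n)) j \<le> M \<and>
         dec lb M I j (Sm j (r div n) (r mod n)) = (cshift (Bf (r div n) t) j + cshift (A t (r mod n)) j) * 2 ^ j"
        then obtain t where t: "t < n" "cshift (Bf (r div n) t) j \<le> M" "cshift (A t (r mod n)) j \<le> M"
          and d: "dec lb M I j (Sm j (r div n) (r mod n)) = (cshift (Bf (r div n) t) j + cshift (A t (r mod n)) j) * 2 ^ j" by blast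
        have nn: "0 \<le> cshift (Bf (r div n) t) j" "0 \<le> cshift (A t (r mod n)) j"
          using cshift_nonneg Bf[OF ri(1) t(1)] A_bounds(1)[OF t(1) ri(2)] by auto
        have "(cshift (Bf (r div n) t) j + cshift (A t (r mod n)) j) * 2 ^ j \<le> (2 * M) * 2 ^ j" using t by (intro mult_right_mono) auto
        also have "\<dots> = 2 ^ (Suc (mm + j))" by (simp add: power_add)
        also have "\<dots> < 2 ^ B" using j T_B mm_T by (intro power_strict_increasing) (auto simp: J_def)
        finally show ?thesis unfolding d using nn by simp
      qed (use I_B in simp)
    qed
    then show "\<bar>g k\<bar> < 2 ^ B" using I_B by (simp add: g_def Let_def r_def[symmetric])
  qed (use Nn hlb in auto)
  have fin: "wpc (Seq (fmm p q R U V W) (PMap ''Z'' e_cnt e_fv)) Qr (16 * kk + 15 - 1 - 1 - 1) ?s3 m"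
  proof (rule wpc_seq_le[of "16 * kk + 11"], simp, rule wpc_fmm[OF gk(2) _ J m Bm Bf])
    show "env ?s3" by (rule env_upd[OF ev]) (simp add: loc_vars_def)
    fix m1 z assume f1: "frame {''X'', ''X2'', ''Y'', ''Y2''} m m1" and X: "arr m1 ''X'' (J * p ^ kk * q ^ kk) (flat (p ^ kk) (q ^ kk) z)"
      and zB: "\<And>a i v. \<bar>z a i v\<bar> < 2 ^ B" and z: "\<And>a i v. i < s ==> v < n ==> z a i v = D ^ kk * (\<Sum>t<n. enc lb M a (Bf i t) * enc lb M a (A t v))"
    have leaf: "esafe B e_fv (?s4(''i'' := int k)) m1 \<and> ev e_fv (?s4(''i'' := int k)) m1 = g k" if k: "k < s * n * 2 ^ h" for k
    proof -
      let ?s = "?s4(''i'' := int k)"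
      define t r where "t = k mod 2 ^ h" and "r = k div 2 ^ h"
      have "ev xt ?s m1 = int t \<and> ev xr ?s m1 = int r \<and> esafe B xt ?s m1 \<and> esafe B xr ?s m1"
        unfolding t_def r_def using kB[OF k] lbp by (intro conjI xt_xr[where c="2 ^ h"]) auto
      note tr = this[THEN conjunct1] this[THEN conjunct2, THEN conjunct1] this[THEN conjunct2, THEN conjunct2, THEN conjunct1]
        this[THEN conjunct2, THEN conjunct2, THEN conjunct2]
      have r: "r < s * n" using k by (simp add: r_def less_mult_imp_div_less)
      note ri = row_index(1)[OF r] row_index(2)[of r]
      let ?S = "Sm t (r div n) (r mod n)"
      have S: "ev e_S ?s m1 = ?S \<and> esafe B e_S ?s m1" if t: "t < J"
      proof -
        have ix: "(int t * int p ^ kk + int r div int n) * int q ^ kk + int r mod int n = int ((t * p ^ kk + r div n) * q ^ kk + r mod n)"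
          by (simp add: of_nat_div of_nat_mod)
        have "m1 (''X'', (int t * int p ^ kk + int r div int n) * int q ^ kk + int r mod int n) = z t (r div n) (r mod n)"
          unfolding ix by (rule arr_flatD[OF X t]) (use ri sp n_le in auto)
        moreover have "z t (r div n) (r mod n) div D ^ kk = ?S" using z[OF ri] D1 by (auto simp: Sm_def)
        ultimately show ?thesis using tr E n_B pB DB zB by (simp add: e_S_def e_flat_def int_lessB)
      qed
      have tB: "t < J ==> t \<le> B" using T_B(7) by simp
      have d: "ev e_dec ?s m1 = dec lb M I t ?S \<and> esafe B e_dec ?s m1" if t: "t < J"
      proof -
        have "(int (bit_length ?S) - 1) div int lb = int ((bit_length ?S - 1) div lb)" if "0 < ?S"
          using bl_pos[OF that] by (simp add: of_nat_diff of_nat_div)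
        then show ?thesis using S[OF t] tr E I_B mM_B lb_B small_lits tB[OF t]
          by (auto simp: e_dec_def dec_def int_lessB)
      qed
      show ?thesis using tr E JB I_B d by (auto simp: e_fv_def g_def Let_def t_def[symmetric] r_def[symmetric])
    qed
    show "wpc (PMap ''Z'' e_cnt e_fv) Qr (16 * kk + 15 - 1 - 1 - 1 - (16 * kk + 11)) ?s4 m1"
      apply (rule wpc_mono[where k=1 and Q=Qr])
        apply (rule wpc_pmap_arr[OF _ v4(2) v4(1) Nn, where f=g])
            apply (use gok in simp)
           apply (use gok in simp)
          apply (simp add: e_fv_def e_dec_def e_S_def e_flat_def xt_def xr_def)
         apply (use leaf in blast)
        apply (rule Q[OF _ lv], use f1 in \<open>simp add: frame_def\<close>, assumption)
      by (auto simp: loc_vars_def)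
  qed
  show ?thesis unfolding fast_def
    apply (rule wpc_assign_seq[OF _ _ _ v1(2)], simp, use gok in simp, simp, unfold v1(1))
    apply (rule wpc_assign_seq[OF _ _ _ v2(2)], simp, use gok in simp, simp, unfold v2(1))
    apply (rule wpc_assign_seq[OF _ _ _ v3(2)], simp, use gok in simp, simp, unfold v3(1))
    by (rule fin)
qed

lemma wpc_step:
  assumes gk: "\<forall>e\<in>set step_exprs. gok e" "\<forall>e\<in>set (fmm_exprs p q R U V W). gok e"
    and ev: "env s'" and m: "memA m"
    and Bm: "arr m ''B'' (s * n) (\<lambda>k. Bf (k div n) (k mod n))" and Bf: "\<And>i t. i < s ==> t < n ==> 0 \<le> Bf i t \<and> Bf i t \<le> I"
    and Q: "\<And>m' Bf' s2. memA m' ==> arr m' ''B'' (s * n) (\<lambda>k. Bf' (k div n) (k mod n)) ==>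
       (\<And>i v. i < s ==> v < n ==> minplus_entry M I n (Bf i) (\<lambda>t. A t v) (Bf' i v)) ==>
       (\<And>x. x \<notin> loc_vars ==> s2 x = s' x) ==> Qr s2 m'"
  shows "wpc (step p q R U V W) Qr (21 * lb + 19) s' m"
proof -
  note gok = gk(1)[unfolded step_exprs_def, simplified]
  have G20: "20 \<le> G" using gok by (auto intro: gok_G)
  note E = ev[unfolded env_def]
  have rest: "wpc (Seq reduce (PMap ''B'' e_vsn e_ldZ)) Qr (5 * lb + 3) s2 m1"
    if f1: "frame {''X'', ''X2'', ''Y'', ''Y2'', ''Z''} m m1" and lv: "leaves Bf h g" and Z: "arr m1 ''Z'' (s * n * 2 ^ h) g"
      and s2: "s2 ''h'' = int h" "s2 ''cnt'' = int (s * n * 2 ^ h)" "\<And>x. x \<notin> loc_vars ==> s2 x = s' x" for m1 h g s2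
  proof (rule wpc_seq_le[of "h * 5 + 2"])
    have hlb: "h \<le> lb" and Nn: "s * n * 2 ^ h \<le> Nx" and gB: "\<And>i. i < s * n * 2 ^ h ==> \<bar>g i\<bar> < 2 ^ B"
      and mp: "\<And>r. r < s * n ==> minplus_entry M I n (Bf (r div n)) (\<lambda>t. A t (r mod n)) (Min ((\<lambda>j. g (r * 2 ^ h + j)) ` {..<2 ^ h}))"
      using lv by (auto simp: leaves_def)
    show "h * 5 + 2 \<le> 5 * lb + 3" using hlb by simp
    have rex: "\<forall>e\<in>set reduce_exprs. gok e" using gok by simp
    show "wpc reduce (\<lambda>s m. wpc (PMap ''B'' e_vsn e_ldZ) Qr (5 * lb + 3 - (h * 5 + 2)) s m) (h * 5 + 2) s2 m1"
    proof (rule wpc_reduce[OF rex _ s2(1) _ s2(2) Nn Z gB])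
      show "2 \<le> B" using B10 by simp
      show "h < 2 ^ B" using hlb lb_B by linarith
      fix m2 assume Z2: "arr m2 ''Z'' (s * n) (\<lambda>b. Min (g ` {b * 2 ^ h..<(b + 1) * 2 ^ h}))" and f2: "frame {''Z'', ''T2''} m1 m2"
      define b where "b r = Min ((\<lambda>j. g (r * 2 ^ h + j)) ` {..<2 ^ h})" for r
      define Bf' where "Bf' i v = b (i * n + v)" for i v
      have ri: "Bf' (r div n) (r mod n) = b r" for r by (simp add: Bf'_def)
      let ?s3 = "s2(''cnt'' := int (s * n), ''l'' := int h)"
      have vsn: "ev e_vsn ?s3 m2 = int (s * n)" "esafe B e_vsn ?s3 m2"
        using E s2(3)[of "''sn''"] sn_B(1) int_lessB[of "s * n"] by (simp_all add: e_vsn_def loc_vars_def)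
      have ld: "esafe B e_ldZ (?s3(''i'' := int r)) m2 \<and> ev e_ldZ (?s3(''i'' := int r)) m2 = Bf' (r div n) (r mod n)" if r: "r < s * n" for r
      proof -
        have bz: "m2 (''Z'', int r) = b r" using arrD[OF Z2 r] unfolding b_def Min_block .
        have "0 \<le> b r" "b r \<le> I" using mp[OF r] by (auto simp: b_def minplus_entry_def)
        then have "\<bar>b r\<bar> < 2 ^ B" using I_B by linarith
        moreover have "r < 2 ^ B" using r sn_B(1) by linarith
        ultimately show ?thesis using bz ri by (simp add: e_ldZ_def int_lessB)
      qed
      show "wpc (PMap ''B'' e_vsn e_ldZ) Qr (5 * lb + 3 - (h * 5 + 2)) ?s3 m2"
      proof (rule wpc_mono[where k=1])
        show "wpc (PMap ''B'' e_vsn e_ldZ) Qr 1 ?s3 m2"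
        proof (rule wpc_pmap_arr[OF _ vsn(2) vsn(1) sn_Nx(1) _ _ ld])
          fix m3 assume m3: "arr m3 ''B'' (s * n) (\<lambda>r. Bf' (r div n) (r mod n))" "frame {''B''} m2 m3"
          show "Qr ?s3 m3"
          proof (rule Q[OF _ m3(1)])
            have "frame {''X'', ''X2'', ''Y'', ''Y2'', ''Z'', ''T2'', ''B''} m m3" using f1 f2 m3(2) by (simp add: frame_def)
            then show "memA m3" by (rule memA_frame[OF m]) (auto simp: inp_arrays_def)
            show "?s3 x = s' x" if "x \<notin> loc_vars" for x using s2(3)[OF that] that by (auto simp: loc_vars_def)
            fix i v assume iv: "i < s" "v < n"
            have "i * n + v < (i + 1) * n" using iv by simp
            also have "\<dots> \<le> s * n" using iv by (intro mult_le_mono1) simp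
            finally have "i * n + v < s * n" .
            from mp[OF this] iv show "minplus_entry M I n (Bf i) (\<lambda>t. A t v) (Bf' i v)" by (simp add: Bf'_def b_def)
          qed
        qed (use gok in \<open>auto simp: e_ldZ_def\<close>)
      qed (use hlb in auto)
    qed
  qed
  have br: "wpc (IfLess (Var ''n'') (Var ''J'') naive (fast p q R U V W)) (\<lambda>s m. wpc (Seq reduce (PMap ''B'' e_vsn e_ldZ)) Qr (5 * lb + 3) s m)
     (16 * lb + 15 + 1) s' m"
  proof (rule wpc_if[OF G20])
    assume "s' ''n'' < s' ''J''"
    then have J: "n < J" using E by simp
    show "wpc naive (\<lambda>s m. wpc (Seq reduce (PMap ''B'' e_vsn e_ldZ)) Qr (5 * lb + 3) s m) (16 * lb + 15) s' m"
      by (rule wpc_mono[OF wpc_naive[OF gk(1) ev J m Bm Bf rest]]) auto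
  next
    assume "\<not> s' ''n'' < s' ''J''"
    then have J: "J \<le> n" using E by simp
    show "wpc (fast p q R U V W) (\<lambda>s m. wpc (Seq reduce (PMap ''B'' e_vsn e_ldZ)) Qr (5 * lb + 3) s m) (16 * lb + 15) s' m"
      by (rule wpc_mono[OF wpc_fast[OF gk ev J m Bm Bf rest]]) (use kk_le in auto)
  qed (use E n_B JB in \<open>auto simp: int_lessB\<close>)
  show ?thesis unfolding step_def
    by (rule wpc_seq_le[of "16 * lb + 15 + 1"], simp, rule wpc_mono[OF br le_refl], rule wpc_mono, assumption) auto
qed

text \<open>The memory holds only the current matrix, whereas correctness speaks about the whole
  sequence. The invariant therefore asserts that a history \<open>Bs\<close> exists which ends in
  the present contents of the array.\<close>

lemma wpc_main_loop:
  assumes gk: "\<forall>e\<in>set step_exprs. gok e" "\<forall>e\<in>set (fmm_exprs p q R U V W). gok e"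
    and ev: "env s'" and m: "memA m"
    and Bm: "arr m ''B'' (s * n) (\<lambda>k. A (sc (k div n)) (k mod n))"
    and Q: "\<And>m' Bs s2. memA m' ==> env s2 ==> arr m' ''B'' (s * n) (\<lambda>k. Bs (hops - 1) (k div n) (k mod n)) ==>
       (\<And>i v. i < s ==> v < n ==> Bs 0 i v = A (sc i) v) ==>
       (\<And>y i v. y < hops - 1 ==> i < s ==> v < n ==> minplus_entry M I n (Bs y i) (\<lambda>t. A t v) (Bs (Suc y) i v)) ==> Qr s2 m'"
  shows "wpc (main_loop p q R U V W) Qr (hops * (21 * lb + 21) + 2) s' m"
proof -
  note gok = gk(1)[unfolded step_exprs_def, simplified]
  have G20: "20 \<le> G" using gok by (auto intro: gok_G)
  define Iv where "Iv y s2 m2 \<longleftrightarrow> s2 ''y'' = int y \<and> env s2 \<and> memA m2 \<and> (\<exists>Bs. arr m2 ''B'' (s * n) (\<lambda>k. Bs y (k div n) (k mod n)) \<and>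
     (\<forall>i<s. \<forall>v<n. Bs 0 i v = A (sc i) v) \<and>
     (\<forall>z<y. \<forall>i<s. \<forall>v<n. minplus_entry M I n (Bs z i) (\<lambda>t. A t v) (Bs (Suc z) i v)))" for y s2 m2
  have "wpc (For ''y'' ''m1'' (step p q R U V W)) Qr ((hops - 1) * ((21 * lb + 19) + 2) + 2) s' m"
  proof (rule wpc_for[where I=Iv, OF G20])
    show "hops - 1 < 2 ^ B" using lessB[OF T_B(10)] by simp
    have "env (s'(''y'' := 0))" using ev by (simp add: env_def)
    then show "Iv 0 (s'(''y'' := 0)) m" using m Bm unfolding Iv_def by (auto intro!: exI[of _ "\<lambda>y i v. A (sc i) v"])
    show "\<And>y s m. Iv y s m ==> s ''y'' = int y \<and> s ''m1'' = int (hops - 1)" by (auto simp: Iv_def env_def)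
    show "Qr s2 m2" if "Iv (hops - 1) s2 m2" for s2 m2 using that Q unfolding Iv_def by blast
    fix y s2 m2 assume "y < hops - 1" and I: "Iv y s2 m2"
    then obtain Bs where y: "s2 ''y'' = int y" and e2: "env s2" and mA: "memA m2"
      and B2: "arr m2 ''B'' (s * n) (\<lambda>k. Bs y (k div n) (k mod n))" and B0: "\<And>i v. i < s ==> v < n ==> Bs 0 i v = A (sc i) v"
      and st: "\<And>z i v. z < y ==> i < s ==> v < n ==> minplus_entry M I n (Bs z i) (\<lambda>t. A t v) (Bs (Suc z) i v)"
      unfolding Iv_def by blast
    have bnd: "0 \<le> Bs y i t \<and> Bs y i t \<le> I" if "i < s" "t < n" for i t
    proof (cases y)
      case 0
      then show ?thesis using B0[OF that] A_bounds(1)[OF sc_less[OF that(1)] that(2)] A_bounds(2)[of "sc i" t] by simp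
    next
      case (Suc z)
      then show ?thesis using st[OF _ that, of z] by (simp add: minplus_entry_def)
    qed
    show "wpc (step p q R U V W) (\<lambda>s m. s ''y'' = int y \<and> Iv (Suc y) (s(''y'' := int y + 1)) m) (21 * lb + 19) s2 m2"
    proof (rule wpc_step[OF gk e2 mA B2 bnd])
      fix m3 Bf' s3 assume m3: "memA m3" "arr m3 ''B'' (s * n) (\<lambda>k. Bf' (k div n) (k mod n))"
        and mp: "\<And>i v. i < s ==> v < n ==> minplus_entry M I n (Bs y i) (\<lambda>t. A t v) (Bf' i v)"
        and s3: "\<And>x. x \<notin> loc_vars ==> s3 x = s2 x"
      have e3: "env s3" by (rule env_upd[OF e2 s3])
      then have e4: "env (s3(''y'' := int y + 1))" by (simp add: env_def)
      have y3: "s3 ''y'' = int y" using s3[of "''y''"] y by (simp add: loc_vars_def)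
      have "\<exists>Bs'. arr m3 ''B'' (s * n) (\<lambda>k. Bs' (Suc y) (k div n) (k mod n)) \<and> (\<forall>i<s. \<forall>v<n. Bs' 0 i v = A (sc i) v) \<and>
        (\<forall>z<Suc y. \<forall>i<s. \<forall>v<n. minplus_entry M I n (Bs' z i) (\<lambda>t. A t v) (Bs' (Suc z) i v))"
        by (rule exI[of _ "Bs(Suc y := Bf')"]) (use m3 mp B0 st in \<open>auto simp: less_Suc_eq\<close>)
      then show "s3 ''y'' = int y \<and> Iv (Suc y) (s3(''y'' := int y + 1)) m3"
        using y3 e4 m3(1) unfolding Iv_def by simp
    qed
  qed auto
  then show ?thesis unfolding main_loop_def
    by (rule wpc_mono) (auto intro!: mult_le_mono)
qed

end

section \<open>Output, and the program as a whole\<close>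

definition "o_B = ELoad ''B'' vi"
text \<open>The unit \<open>2 powr - sh\<close> goes into the numerator or into the denominator,
  according to the sign of \<open>sh\<close>.\<close>

definition "e_on = EIf o_B vI (EIf vsh (ELit 0) (o_B [<<] (ELit 0 [-] vsh)) o_B) (ELit 0)"
definition "e_od = EIf o_B vI (EIf vsh (ELit 0) (ELit 1) (ELit 1 [<<] vsh)) (ELit 0)"
definition "o_u = ELoad ''source'' (vi [div] vn)"
definition "o_v = vi [mod] vn"
definition "o_ld An = ELoad An (o_u [*] vn [+] o_v)"
text \<open>Selects between the fractions stored for \<open>G\<close> and \<open>H\<close> by
  cross-multiplication; a zero denominator counts as infinity and loses.\<close>

definition "o_sel gx hx = EIf (ELit 0) (o_ld ''G_den'') (EIf (ELit 0) (o_ld ''H_den'')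
   (EIf (o_ld ''G_num'' [*] o_ld ''H_den'') (o_ld ''H_num'' [*] o_ld ''G_den'') (o_ld gx) (o_ld hx)) (o_ld gx)) (o_ld hx)"
definition "e_xn = EIf o_u o_v (o_sel ''G_num'' ''H_num'') (EIf o_v o_u (o_sel ''G_num'' ''H_num'') (ELit 0))"
definition "e_xd = EIf o_u o_v (o_sel ''G_den'' ''H_den'') (EIf o_v o_u (o_sel ''G_den'' ''H_den'') (ELit 1))"

text \<open>The second alternative is the case of a single hop, in which the entries must not be
  rounded.\<close>

definition ph_out :: com where
  "ph_out = IfLess (Var ''one'') (Var ''hops'')
     (Seq (PMap ''D_num'' e_vsn e_on) (PMap ''D_den'' e_vsn e_od))
     (Seq (PMap ''D_num'' e_vsn e_xn) (PMap ''D_den'' e_vsn e_xd))"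

definition "out_exprs = [e_vsn, e_on, e_od, e_xn, e_xd]"

definition prog where
  "prog p q R U V W D \<kappa> a f = Seq (ph_scale \<kappa> a) (Seq ph_range (Seq (ph_mat a f) (Seq (ph_pow p q D)
     (Seq (main_loop p q R U V W) ph_out))))"

definition all_exprs where
  "all_exprs p q R U V W D \<kappa> a f = setup_exprs p q D \<kappa> a f @ range_exprs @ step_exprs @ fmm_exprs p q R U V W @ out_exprs"

lemma evok_all: "e \<in> set (all_exprs p q R U V W D \<kappa> a f) ==> evok e"
  unfolding all_exprs_def setup_exprs_def range_exprs_def step_exprs_def fmm_exprs_def out_exprs_def reduce_exprs_def
  by (auto simp: e_lb_def e_m_def e_M_def e_t_def e_sh_def e_tn_def e_T_def e_I_def e_cap_def e_J_def e_nn_def e_sn_def e_one_def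
    e_zero_def e_m1_def e_rG_def e_rH_def e_rnd_def e_A_def e_ycap_def e_y_def e_B_def e_vnn_def e_vsn_def e_E_def e_P_def e_k_def e_Q_def
    e_2lb_def e_c_def e_vc_def e_z1_def e_bb_def e_z2_def e_Z0_def e_z3_def e_nZ0_def e_x_def e_hi_def e_xv_def
    e_half_def e_cnt_def e_min_def e_ldT_def e_bJ_def e_vlb_def e_sc_def e_nv_def e_sum_def e_fv_def e_dec_def e_S_def e_flat_def
    xt_def xr_def e_ldZ_def e_aR_def e_pd_def e_qd_def e_cX_def e_cY_def e_fwd_def e_bwd_def e_ldX2_def e_ldY2_def e_ad_def e_pm_def e_qm_def
    e_vP_def e_vQ_def e_vJ_def e_encX_def e_encY_def e_enc_def e_cs_def e_va_def e_mul_def x_a_def x_i_def x_j_def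
    e_on_def e_od_def o_B_def e_xn_def e_xd_def o_u_def o_v_def o_sel_def o_ld_def intro!: evok_esum)

lemma cell_min:
  fixes a b c d :: int
  assumes "0 \<le> a" "0 \<le> b" "0 \<le> c" "0 \<le> d"
  defines "x \<equiv> if 0 < b then if 0 < d then if a * d < c * b then a else c else a else c"
    and "y \<equiv> if 0 < b then if 0 < d then if a * d < c * b then b else d else b else d"
  shows "(if y = 0 then \<infinity> else ereal (real_of_int x / real_of_int y)) =
    min (if b = 0 then \<infinity> else ereal (real_of_int a / real_of_int b)) (if d = 0 then \<infinity> else ereal (real_of_int c / real_of_int d))"
proof (cases "0 < b \<and> 0 < d")
  case True
  then have "real_of_int a / real_of_int b < real_of_int c / real_of_int d \<longleftrightarrow> real_of_int (a * d) < real_of_int (c * b)"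
    by (simp add: divide_less_eq less_divide_eq field_simps)
  then have "real_of_int a / real_of_int b < real_of_int c / real_of_int d \<longleftrightarrow> a * d < c * b" by (simp only: of_int_less_iff)
  then show ?thesis using True by (auto simp: x_def y_def min_def)
next
  case False
  then have "b = 0 \<or> d = 0" using assms by auto
  then show ?thesis using assms(1-4) by (auto simp: x_def y_def)
qed

context prun3
begin

definition uc :: real where "uc = 2 powr (- real_of_int sh)"

definition AX :: "nat => nat => ereal" where
  "AX x v = (if x = v then 0 else min (cell_value m0 ''G_num'' ''G_den'' (int (x * n + v))) (cell_value m0 ''H_num'' ''H_den'' (int (x * n + v))))"

definition outB :: "(cell => int) => (nat => nat => int) => bool" where
  "outB m Bf \<longleftrightarrow> (\<forall>i<s. \<forall>v<n. cell_value m ''D_num'' ''D_den'' (int (i * n + v)) = scaled I uc (Bf i v))"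

definition outA :: "(cell => int) => bool" where
  "outA m \<longleftrightarrow> (\<forall>i<s. \<forall>v<n. cell_value m ''D_num'' ''D_den'' (int (i * n + v)) = AX (sc i) v)"

lemma sn_idx: "i < s ==> v < n ==> i * n + v < s * n"
proof -
  assume iv: "i < s" "v < n"
  have "i * n + v < (i + 1) * n" using iv by simp
  also have "\<dots> \<le> s * n" using iv by (intro mult_le_mono1) simp
  finally show "i * n + v < s * n" .
qed

lemma inp_D: "inp m ==> A' \<in> inp_arrays ==> m (A', k) = m0 (A', k)"
  by (simp add: inp_def)

lemma wpc_out:
  assumes gk: "\<forall>e\<in>set out_exprs. gok e"
    and ev: "env s'" and m: "memA m" and Bm: "arr m ''B'' (s * n) (\<lambda>k. Bf (k div n) (k mod n))"
    and Bf: "\<And>i t. i < s ==> t < n ==> 0 \<le> Bf i t \<and> Bf i t \<le> I"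
    and Q: "\<And>m' . (if 1 < hops then outB m' Bf else outA m') ==> Qr s' m'"
  shows "wpc ph_out Qr 3 s' m"
proof -
  note gok = gk[unfolded out_exprs_def, simplified]
  have G20: "20 \<le> G" using gok by (auto intro: gok_G)
  note E = ev[unfolded env_def]
  have im: "inp m" using m by (simp add: memA_def)
  have snN: "s * n \<le> Nx" by (rule sn_Nx)
  have vsn: "ev e_vsn s' m2 = int (s * n)" "esafe B e_vsn s' m2" for m2
    using E sn_B(1) int_lessB[of "s * n"] by (simp_all add: e_vsn_def)
  have kB: "k < 2 ^ B" if "k < s * n" for k using that sn_B by linarith
  have oB: "esafe B o_B (s'(''i'' := int k)) m2 \<and> ev o_B (s'(''i'' := int k)) m2 = Bf (k div n) (k mod n)"
    if k: "k < s * n" and m2: "arr m2 ''B'' (s * n) (\<lambda>k. Bf (k div n) (k mod n))" for k m2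
    using arrD[OF m2 k] Bf[OF row_index(1)[OF k] row_index(2)[of k]] I_B kB[OF k] by (auto simp add: o_B_def int_lessB)
  have shB': "0 \<le> sh ==> sh \<le> int B" "sh < 0 ==> - sh \<le> int B" using sh_B by auto
  define num :: "int => int" where "num x = (if x < I then (if sh < 0 then x * 2 ^ nat (- sh) else x) else 0)" for x
  define den :: "int => int" where "den x = (if x < I then (if sh < 0 then 1 else 2 ^ nat sh) else 0)" for x
  have on: "esafe B e_on (s'(''i'' := int k)) m \<and> ev e_on (s'(''i'' := int k)) m = num (Bf (k div n) (k mod n))" if k: "k < s * n" for k
    using oB[OF k Bm] E I_B sh_B shB' small_lits by (auto simp: e_on_def num_def)
  have od: "esafe B e_od (s'(''i'' := int k)) m2 \<and> ev e_od (s'(''i'' := int k)) m2 = den (Bf (k div n) (k mod n))"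
    if k: "k < s * n" and m2: "arr m2 ''B'' (s * n) (\<lambda>k. Bf (k div n) (k mod n))" for k m2
    using oB[OF k m2] E I_B sh_B shB' small_lits by (auto simp: e_od_def den_def)
  have nd: "(if den x = 0 then \<infinity> else ereal (real_of_int (num x) / real_of_int (den x))) = scaled I uc x" for x
  proof (cases "sh < 0")
    case True
    then have "(2::real) ^ nat (- sh) = 2 powr (- real_of_int sh)" by (simp add: powr_realpow[symmetric])
    then show ?thesis using True by (simp add: num_def den_def scaled_def uc_def)
  next
    case False
    then have "(2::real) ^ nat sh = 2 powr (real_of_int sh)" by (simp add: powr_realpow[symmetric])
    then show ?thesis using False by (simp add: num_def den_def scaled_def uc_def powr_minus divide_inverse)
  qed
  define xn :: "nat => int" where "xn k = (let x = sc (k div n); v = k mod n; i = int (x * n + v); a = m0 (''G_num'', i); b = m0 (''G_den'', i); c = m0 (''H_num'', i); d = m0 (''H_den'', i)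
     in if x = v then 0 else if 0 < b then if 0 < d then if a * d < c * b then a else c else a else c)" for k
  define xd :: "nat => int" where "xd k = (let x = sc (k div n); v = k mod n; i = int (x * n + v); a = m0 (''G_num'', i); b = m0 (''G_den'', i); c = m0 (''H_num'', i); d = m0 (''H_den'', i)
     in if x = v then 1 else if 0 < b then if 0 < d then if a * d < c * b then b else d else b else d)" for k
  have ox: "(esafe B e_xn (s'(''i'' := int k)) m2 \<and> ev e_xn (s'(''i'' := int k)) m2 = xn k) \<and>
     (esafe B e_xd (s'(''i'' := int k)) m2 \<and> ev e_xd (s'(''i'' := int k)) m2 = xd k)"
    if k: "k < s * n" and m2: "inp m2" for k m2
  proof -
    let ?s = "s'(''i'' := int k)"
    note ri = row_index(1)[OF k] row_index(2)[of k]
    define x v where "x = sc (k div n)" and "v = k mod n"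
    have xn': "x < n" "v < n" using sc_less[OF ri(1)] ri by (auto simp: x_def v_def)
    have src: "m2 (''source'', int k div int n) = int x"
      using inp_D[OF m2, of "''source''" "int (k div n)"] sc_int[OF ri(1)] by (simp add: inp_arrays_def x_def of_nat_div)
    have u: "ev o_u ?s m2 = int x \<and> esafe B o_u ?s m2" "ev o_v ?s m2 = int v \<and> esafe B o_v ?s m2"
      using src E kB[OF k] n_B xn' by (auto simp: o_u_def o_v_def v_def of_nat_mod int_lessB)
    have idx: "x * n + v < n * n" by (rule nn_idx[OF xn'])
    have ld: "ev (o_ld An) ?s m2 = m0 (An, int (x * n + v)) \<and> esafe B (o_ld An) ?s m2"
      if "An \<in> {''G_num'', ''G_den'', ''H_num'', ''H_den''}" for An
    proof -
      have "m2 (An, int x * int n + int v) = m0 (An, int x * int n + int v)" using that by (intro inp_D[OF m2]) (auto simp: inp_arrays_def)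
      moreover have "\<bar>m0 (An, int (x * n + v))\<bar> < 2 ^ B"
        using that g_bnd[OF idx] h_bnd[OF idx] unfolding gn_def gd_def hnu_def hde_def by auto
      ultimately show ?thesis using u E n_B by (simp add: o_ld_def int_lessB)
    qed
    show ?thesis using u ld small_lits
      by (auto simp: e_xn_def e_xd_def o_sel_def xn_def xd_def Let_def x_def[symmetric] v_def[symmetric])
  qed
  have xnd: "(if xd k = 0 then \<infinity> else ereal (real_of_int (xn k) / real_of_int (xd k))) = AX (sc (k div n)) (k mod n)" if k: "k < s * n" for k
  proof (cases "sc (k div n) = k mod n")
    case True
    then show ?thesis by (simp add: xn_def xd_def AX_def Let_def zero_ereal_def)
  next
    case False
    note ri = row_index(1)[OF k] row_index(2)[of k]
    have idx: "sc (k div n) * n + k mod n < n * n" by (rule nn_idx[OF sc_less[OF ri(1)] ri(2)])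
    show ?thesis
      unfolding xn_def xd_def AX_def Let_def cell_value_def if_not_P[OF False]
      by (rule cell_min[OF g0(1)[OF idx, unfolded gn_def] g0(2)[OF idx, unfolded gd_def] g0(3)[OF idx, unfolded hnu_def] g0(4)[OF idx, unfolded hde_def]])
  qed
  have cv: "cell_value m2 ''D_num'' ''D_den'' (int k) = (if y k = 0 then \<infinity> else ereal (real_of_int (x k) / real_of_int (y k)))"
    if "arr m2 ''D_num'' (s * n) x" "arr m2 ''D_den'' (s * n) y" "k < s * n" for m2 x y k
    using that by (simp add: cell_value_def arr_def)
  show ?thesis unfolding ph_out_def
  proof (rule wpc_mono[OF wpc_if[OF G20, where k=2 and Q=Qr]])
    assume "s' ''one'' < s' ''hops''"
    then have h: "1 < hops" using E by simp
    show "wpc (Seq (PMap ''D_num'' e_vsn e_on) (PMap ''D_den'' e_vsn e_od)) Qr 2 s' m"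
    proof (rule wpc_pmap_seq[OF _ _ vsn(2) vsn(1) snN _ _ on])
      fix m1 assume m1: "arr m1 ''D_num'' (s * n) (\<lambda>k. num (Bf (k div n) (k mod n)))" "frame {''D_num''} m m1"
      have B1: "arr m1 ''B'' (s * n) (\<lambda>k. Bf (k div n) (k mod n))" by (rule frame_arr[OF m1(2) _ Bm]) simp
      have "wpc (PMap ''D_den'' e_vsn e_od) Qr 1 s' m1"
      proof (rule wpc_pmap_arr[OF _ vsn(2) vsn(1) snN _ _ od[OF _ B1]])
        fix m2 assume m2: "arr m2 ''D_den'' (s * n) (\<lambda>k. den (Bf (k div n) (k mod n)))" "frame {''D_den''} m1 m2"
        have n2': "arr m2 ''D_num'' (s * n) (\<lambda>k. num (Bf (k div n) (k mod n)))" by (rule frame_arr[OF m2(2) _ m1(1)]) simp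
        have "outB m2 Bf" unfolding outB_def
        proof (intro allI impI)
          fix i v assume iv: "i < s" "v < n"
          show "cell_value m2 ''D_num'' ''D_den'' (int (i * n + v)) = scaled I uc (Bf i v)"
            unfolding cv[OF n2' m2(1) sn_idx[OF iv]] nd using iv by simp
        qed
        then show "Qr s' m2" using Q h by simp
      qed (use gok in \<open>auto simp: e_od_def o_B_def\<close>)
      then show "wpc (PMap ''D_den'' e_vsn e_od) Qr (2 - 1) s' m1" by simp
    qed (use gok in \<open>auto simp: e_on_def o_B_def\<close>)
  next
    assume "\<not> s' ''one'' < s' ''hops''"
    then have h: "\<not> 1 < hops" using E by simp
    show "wpc (Seq (PMap ''D_num'' e_vsn e_xn) (PMap ''D_den'' e_vsn e_xd)) Qr 2 s' m"
    proof (rule wpc_pmap_seq[OF _ _ vsn(2) vsn(1) snN _ _ ox[OF _ im, THEN conjunct1]])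
      fix m1 assume m1: "arr m1 ''D_num'' (s * n) xn" "frame {''D_num''} m m1"
      have i1: "inp m1" by (rule inp_frame[OF im m1(2)]) (simp add: inp_arrays_def)
      have "wpc (PMap ''D_den'' e_vsn e_xd) Qr 1 s' m1"
      proof (rule wpc_pmap_arr[OF _ vsn(2) vsn(1) snN _ _ ox[OF _ i1, THEN conjunct2]])
        fix m2 assume m2: "arr m2 ''D_den'' (s * n) xd" "frame {''D_den''} m1 m2"
        have n2': "arr m2 ''D_num'' (s * n) xn" by (rule frame_arr[OF m2(2) _ m1(1)]) simp
        have "outA m2" unfolding outA_def
        proof (intro allI impI)
          fix i v assume iv: "i < s" "v < n"
          show "cell_value m2 ''D_num'' ''D_den'' (int (i * n + v)) = AX (sc i) v"
            unfolding cv[OF n2' m2(1) sn_idx[OF iv]] xnd[OF sn_idx[OF iv]] using iv by simp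
        qed
        then show "Qr s' m2" using Q h by simp
      qed (use gok in \<open>auto simp: e_xd_def o_sel_def o_ld_def o_u_def o_v_def\<close>)
      then show "wpc (PMap ''D_den'' e_vsn e_xd) Qr (2 - 1) s' m1" by simp
    qed (use gok in \<open>auto simp: e_xn_def o_sel_def o_ld_def o_u_def o_v_def\<close>)
  qed (use E small_lits lessB[OF T_B(10)] in \<open>auto simp: int_lessB\<close>)
qed

lemma minplus_chain_bounds:
  assumes B0: "\<And>i v. i < s ==> v < n ==> Bs 0 i v = A (sc i) v"
    and st: "\<And>y i v. y < hops - 1 ==> i < s ==> v < n ==> minplus_entry M I n (Bs y i) (\<lambda>t. A t v) (Bs (Suc y) i v)"
    and y: "y \<le> hops - 1" and iv: "i < s" "v < n"
  shows "0 \<le> Bs y i v \<and> Bs y i v \<le> I"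
proof (cases y)
  case 0
  then show ?thesis using B0[OF iv] A_bounds(1)[OF sc_less[OF iv(1)] iv(2)] A_bounds(2)[of "sc i" v] by simp
next
  case (Suc z)
  then show ?thesis using st[OF _ iv, of z] y by (simp add: minplus_entry_def)
qed

text \<open>Up to constants, a product takes \<open>16 * lb\<close> units for the recursion and
  \<open>5 * lb\<close> for the tournament.\<close>

definition steps :: nat where "steps = 100 + 40 * lb + hops * (21 * lb + 21)"

definition result :: "(cell => int) => (nat => nat => nat => int) => bool" where
  "result m Bs \<longleftrightarrow> (\<forall>i<s. \<forall>v<n. Bs 0 i v = A (sc i) v) \<and>
     (\<forall>y<hops - 1. \<forall>i<s. \<forall>v<n. minplus_entry M I n (Bs y i) (\<lambda>t. A t v) (Bs (Suc y) i v)) \<and>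
     (if 1 < hops then outB m (Bs (hops - 1)) else outA m)"

lemma wpc_prog:
  assumes gk: "\<forall>e\<in>set (all_exprs p q R U V W D \<kappa> a f). gok e"
    and s: "s' ''n'' = int n" "s' ''s'' = int s" "s' ''hops'' = int hops" "s' ''accuracy'' = int acc"
  shows "wpc (prog p q R U V W D \<kappa> a f) (\<lambda>_ m. \<exists>Bs. result m Bs) steps s' m0"
proof -
  have gs: "\<forall>e\<in>set (setup_exprs p q D \<kappa> a f). gok e" "\<forall>e\<in>set range_exprs. gok e" "\<forall>e\<in>set step_exprs. gok e"
    "\<forall>e\<in>set (fmm_exprs p q R U V W). gok e" "\<forall>e\<in>set out_exprs. gok e"
    using gk by (auto simp: all_exprs_def)
  have i0: "inp m0" by (simp add: inp_def)
  let ?Q = "\<lambda>(_::scalars) m. \<exists>Bs. result m Bs"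
  show ?thesis unfolding prog_def
  proof (rule wpc_seq_le[of 4], simp add: steps_def, rule wpc_scale[OF gs(1)])
    let ?s1 = "s'(''lb'' := int lb, ''m'' := int mm, ''M'' := M, ''t'' := int tt)"
    show "wpc (Seq ph_range (Seq (ph_mat a f) (Seq (ph_pow p q D) (Seq (main_loop p q R U V W) ph_out)))) ?Q (steps - 4) ?s1 m0"
    proof (rule wpc_seq_le[of "45 + 30 * lb"], simp add: steps_def, rule wpc_range[OF gs(2)])
      fix m1 c bb x cnt l assume m1: "inp m1"
      let ?s2 = "?s1(''h'' := int (2 * lb), ''c'' := c, ''cnt'' := cnt, ''l'' := l, ''bb'' := bb, ''x'' := x, ''hi'' := hi, ''lo'' := lo)"
      show "wpc (Seq (ph_mat a f) (Seq (ph_pow p q D) (Seq (main_loop p q R U V W) ph_out))) ?Q (steps - 4 - (45 + 30 * lb)) ?s2 m1"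
      proof (rule wpc_seq_le[of 14], simp add: steps_def, rule wpc_mat[OF gs(1) _ _ _ _ _ _ _ _ m1])
        fix m2 assume m2: "memA m2" "arr m2 ''B'' (s * n) (\<lambda>i. A (sc (i div n)) (i mod n))"
        let ?s3 = "?s2(''sh'' := sh, ''tn'' := int tn, ''T'' := int T, ''I'' := I, ''cap'' := 2 ^ tn, ''J'' := int J,
           ''nn'' := int (n * n), ''sn'' := int (s * n), ''one'' := 1, ''m1'' := int (hops - 1))"
        show "wpc (Seq (ph_pow p q D) (Seq (main_loop p q R U V W) ph_out)) ?Q (steps - 4 - (45 + 30 * lb) - 14) ?s3 m2"
        proof (rule wpc_seq_le[of "6 * lb + 6"], simp add: steps_def, rule wpc_pow[OF gs(1)])
          let ?s4 = "?s3(''E'' := D ^ kk, ''P'' := int (p ^ kk), ''k'' := int kk, ''Q'' := int (q ^ kk), ''x'' := int lb)"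
          have e4: "env ?s4" unfolding env_def using s by simp
          show "wpc (Seq (main_loop p q R U V W) ph_out) ?Q (steps - 4 - (45 + 30 * lb) - 14 - (6 * lb + 6)) ?s4 m2"
          proof (rule wpc_seq_le[of "hops * (21 * lb + 21) + 2"], simp add: steps_def, rule wpc_main_loop[OF gs(3,4) e4 m2])
            fix m3 Bs s5 assume m3: "memA m3" "env s5" "arr m3 ''B'' (s * n) (\<lambda>k. Bs (hops - 1) (k div n) (k mod n))"
              and B0: "\<And>i v. i < s ==> v < n ==> Bs 0 i v = A (sc i) v"
              and st: "\<And>y i v. y < hops - 1 ==> i < s ==> v < n ==> minplus_entry M I n (Bs y i) (\<lambda>t. A t v) (Bs (Suc y) i v)"
            show "wpc ph_out ?Q (steps - 4 - (45 + 30 * lb) - 14 - (6 * lb + 6) - (hops * (21 * lb + 21) + 2)) s5 m3"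
            proof (rule wpc_mono[where k=3 and Q="?Q"])
              show "wpc ph_out ?Q 3 s5 m3"
              proof (rule wpc_out[OF gs(5) m3(2,1,3)])
                show "0 \<le> Bs (hops - 1) i t \<and> Bs (hops - 1) i t \<le> I" if "i < s" "t < n" for i t
                  by (rule minplus_chain_bounds[OF B0 st le_refl that])
                show "\<exists>Bs. result m' Bs" if "if 1 < hops then outB m' (Bs (hops - 1)) else outA m'" for m'
                  using that B0 st unfolding result_def by blast
              qed
            qed (simp add: steps_def)
          qed
        qed (use s in auto)
      qed (use s in auto)
    qed (use s i0 in auto)
  qed (use s in auto)
qed

end

section \<open>Rounded weights\<close>

locale hopset_run = prun3 +
  fixes EG EH :: "nat rel" and wE wH :: "(nat \<times> nat) weight_fun" and Ss :: "nat set" and eps xi :: real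
  assumes wgE: "weighted_graph (vgraph n EG) wE"
    and hs: "hopset eps hops (vgraph n EG) wE (vgraph n EH) wH"
    and stG: "stores_graph w m0 ''G_num'' ''G_den'' n EG wE"
    and stH: "stores_graph w m0 ''H_num'' ''H_den'' n EH wH"
    and Ssub: "Ss \<subseteq> {..<n}" and cardS: "card Ss = s"
    and bij: "bij_betw (\<lambda>i. m0 (''source'', int i)) {..<s} (int ` Ss)"
    and eps0: "0 < eps" and eps_f: "1 + eps \<le> 2 ^ f"
    and acc_eps: "1 / eps \<le> real acc"
    and hops_\<kappa>: "hops \<le> \<kappa> * lb"
    and xi9: "9 / 2 ^ mm \<le> xi" and \<kappa>16: "16 \<le> \<kappa>"
begin

abbreviation "GG \<equiv> vgraph n EG"
abbreviation "HH \<equiv> vgraph n EH"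
abbreviation "UU \<equiv> graph_union GG HH"
abbreviation "ww \<equiv> case_sum wE wH"

lemma vgraph_simps [simp]: "verts (vgraph n X) = {..<n}" "arcs (vgraph n X) = X" "tail (vgraph n X) = fst" "head (vgraph n X) = snd"
  by (auto simp: vgraph_def with_proj_def)

lemma weighted_vgraph: "weighted_graph (vgraph n X) wt ==> e \<in> X ==> fst e < n \<and> snd e < n \<and> 0 \<le> wt e"
proof -
  assume X: "weighted_graph (vgraph n X) wt" "e \<in> X"
  then interpret fin_digraph "vgraph n X" by (simp add: weighted_graph_def)
  show ?thesis using X tail_in_verts[of e] head_in_verts[of e] by (auto simp: weighted_graph_def)
qed

lemma wgH: "weighted_graph HH wH"
  using hs by (simp add: hopset_def)

lemma stores_cell:
  assumes "stores_graph w m0 num den n X wt" "x < n" "y < n"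
  shows "cell_value m0 num den (int (x * n + y)) = (if (x, y) \<in> X then ereal (wt (x, y)) else \<infinity>)"
  using assms unfolding stores_graph_def Let_def by blast

lemma stores_arc:
  assumes "stores_graph w m0 num den n X wt" "x < n" "y < n" "(x, y) \<in> X"
  shows "0 < m0 (den, int (x * n + y))" "wt (x, y) = real_of_int (m0 (num, int (x * n + y))) / real_of_int (m0 (den, int (x * n + y)))"
proof -
  have c: "cell_value m0 num den (int (x * n + y)) = ereal (wt (x, y))" using stores_cell[OF assms(1-3)] assms(4) by simp
  then have "m0 (den, int (x * n + y)) \<noteq> 0" by (auto simp: cell_value_def split: if_splits)
  moreover have "0 \<le> m0 (den, int (x * n + y))" using assms unfolding stores_graph_def Let_def by blast
  ultimately show "0 < m0 (den, int (x * n + y))" by simp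
  then show "wt (x, y) = real_of_int (m0 (num, int (x * n + y))) / real_of_int (m0 (den, int (x * n + y)))"
    using c by (simp add: cell_value_def)
qed

lemma stores_nonarc:
  assumes "stores_graph w m0 num den n X wt" "x < n" "y < n" "(x, y) \<notin> X"
  shows "m0 (den, int (x * n + y)) = 0"
  using stores_cell[OF assms(1-3)] assms(4) by (auto simp: cell_value_def split: if_splits)

lemma adj_AX: assumes "x < n" "y < n" shows "adj_matrix UU ww x y = AX x y"
proof (cases "x = y")
  case False
  have "{e \<in> arcs UU. tail UU e = x \<and> head UU e = y} =
    (if (x, y) \<in> EG then {Inl (x, y)} else {}) \<union> (if (x, y) \<in> EH then {Inr (x, y)} else {})"
    by (auto simp: graph_union_def)
  then show ?thesis
    using False stores_cell[OF stG assms] stores_cell[OF stH assms]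
    by (auto simp: adj_matrix_def AX_def inf_min min_def top_ereal_def)
qed (simp add: adj_matrix_def AX_def)

lemma uc_pos: "0 < uc" by (simp add: uc_def)

lemma rnd_ceil: "0 < de ==> rnd nu de = \<lceil>(real_of_int nu / real_of_int de) / uc\<rceil>"
proof -
  assume de: "0 < de"
  show ?thesis
  proof (cases "sh < 0")
    case True
    then have p: "2 powr real_of_int sh = 1 / 2 ^ nat (- sh)"
      by (simp add: powr_realpow[symmetric] powr_minus divide_inverse)
    have "rnd nu de = \<lceil>real_of_int nu / real_of_int (de * 2 ^ nat (- sh))\<rceil>"
      using True de unfolding ceiling_divide_eq_div by (simp add: rnd_def)
    then show ?thesis using p by (simp add: uc_def powr_minus divide_inverse mult_ac)
  next
    case False
    then have p: "2 powr real_of_int sh = 2 ^ nat sh" by (simp add: powr_realpow[symmetric])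
    have "rnd nu de = \<lceil>real_of_int (nu * 2 ^ nat sh) / real_of_int de\<rceil>"
      using False de unfolding ceiling_divide_eq_div by (simp add: rnd_def)
    then show ?thesis using p by (simp add: uc_def powr_minus divide_inverse mult_ac)
  qed
qed

lemma rnd_ge: "0 < de ==> real_of_int nu / real_of_int de \<le> rnd nu de * uc"
  using le_of_int_ceiling[of "(real_of_int nu / real_of_int de) / uc"] unfolding pos_divide_le_eq[OF uc_pos] by (simp only: rnd_ceil)

lemma rnd_less: "0 < de ==> rnd nu de * uc < real_of_int nu / real_of_int de + uc"
proof -
  assume de: "0 < de"
  have "real_of_int (rnd nu de) < (real_of_int nu / real_of_int de) / uc + 1" unfolding rnd_ceil[OF de] by linarith
  then have "rnd nu de * uc < ((real_of_int nu / real_of_int de) / uc + 1) * uc" using uc_pos by (rule mult_strict_right_mono)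
  then show ?thesis using uc_pos by (simp add: distrib_right)
qed

lemma rnd_cap: "0 < de ==> real_of_int nu / real_of_int de \<le> 2 ^ tn * uc ==> rnd nu de \<le> 2 ^ tn"
  unfolding pos_divide_le_eq[OF uc_pos, symmetric] by (simp only: rnd_ceil ceiling_le_iff of_int_power of_int_numeral)

lemma rnd_zero: "0 < de ==> rnd 0 de = 0"
  by (simp add: rnd_ceil)

definition Ah :: "nat => nat => ereal" where "Ah x y = scaled I uc (A x y)"

lemma I0: "0 < I" by (simp add: I_def)

lemma Ah_nonneg: "x < n ==> y < n ==> 0 \<le> Ah x y"
  using A_bounds(1)[of x y] uc_pos by (simp add: Ah_def scaled_def)

lemma Ah_diag: "Ah x x = 0"
  using I0 by (simp add: Ah_def scaled_def A_def zero_ereal_def)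

lemma AX_le_cell: "x \<noteq> y ==> AX x y \<le> cell_value m0 ''G_num'' ''G_den'' (int (x * n + y))"
  "x \<noteq> y ==> AX x y \<le> cell_value m0 ''H_num'' ''H_den'' (int (x * n + y))"
  by (auto simp: AX_def)

text \<open>Rounding goes up and a dropped weight becomes infinite, so entries only increase, as the
  lower bound on distances requires.\<close>

lemma AX_le_Ah: assumes "x < n" "y < n" shows "AX x y \<le> Ah x y"
proof (cases "x = y \<or> \<not> A x y < I")
  case True
  then show ?thesis using Ah_nonneg[OF assms] by (auto simp: AX_def Ah_def scaled_def)
next
  case False
  let ?k = "x * n + y"
  have ne: "x \<noteq> y" and AI: "A x y < I" "A x y = yv ?k" using False by (auto simp: A_def split: if_splits)
  have yI: "yv ?k < I" using AI by simp
  have "AX x y \<le> ereal (real_of_int (yv ?k) * uc)"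
  proof (cases "rnd (gn ?k) (gd ?k) \<le> rnd (hnu ?k) (hde ?k)")
    case True
    then have y: "yv ?k = rnd (gn ?k) (gd ?k)" by (simp add: yv_def)
    then have d: "0 < gd ?k" using yI by (auto simp: rnd_def split: if_splits)
    show ?thesis unfolding y
      by (rule order_trans[OF AX_le_cell(1)[OF ne]]) (use rnd_ge[OF d, of "gn ?k"] d in \<open>simp add: cell_value_def gn_def gd_def\<close>)
  next
    case False
    then have y: "yv ?k = rnd (hnu ?k) (hde ?k)" by (simp add: yv_def)
    then have d: "0 < hde ?k" using yI by (auto simp: rnd_def split: if_splits)
    show ?thesis unfolding y
      by (rule order_trans[OF AX_le_cell(2)[OF ne]]) (use rnd_ge[OF d, of "hnu ?k"] d in \<open>simp add: cell_value_def hnu_def hde_def\<close>)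
  qed
  then show ?thesis using AI by (simp add: Ah_def scaled_def)
qed

lemma arc_cell:
  assumes "e \<in> arcs UU"
  obtains x y nu de where "x < n" "y < n" "tail UU e = x" "head UU e = y" "0 \<le> nu" "0 < de"
    "ww e = real_of_int nu / real_of_int de" "yv (x * n + y) \<le> rnd nu de" "0 \<le> yv (x * n + y)"
proof -
  have yv0: "0 \<le> yv (x * n + y)" if "x < n" "y < n" for x y
    using g0[OF nn_idx[OF that]] rnd_nonneg by (simp add: yv_def)
  consider (g) x y where "e = Inl (x, y)" "(x, y) \<in> EG" | (h) x y where "e = Inr (x, y)" "(x, y) \<in> EH"
    using assms by (auto simp: graph_union_def)
  then show thesis
  proof cases
    case g
    have xy: "x < n" "y < n" using weighted_vgraph[OF wgE g(2)] by auto
    show thesis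
      by (rule that[OF xy, of "gn (x * n + y)" "gd (x * n + y)"])
        (use g xy yv0[OF xy] stores_arc[OF stG xy g(2)] g0(1)[OF nn_idx[OF xy]] in \<open>auto simp: graph_union_def yv_def gn_def gd_def\<close>)
  next
    case h
    have xy: "x < n" "y < n" using weighted_vgraph[OF wgH h(2)] by auto
    show thesis
      by (rule that[OF xy, of "hnu (x * n + y)" "hde (x * n + y)"])
        (use h xy yv0[OF xy] stores_arc[OF stH xy h(2)] g0(3)[OF nn_idx[OF xy]] in \<open>auto simp: graph_union_def yv_def hnu_def hde_def\<close>)
  qed
qed

lemma Ah_le_yv: "yv (x * n + y) \<le> r ==> 0 \<le> r ==> r \<le> 2 ^ tn ==> Ah x y \<le> ereal (real_of_int r * uc)"
  using tn_T uc_pos I0 by (auto simp: Ah_def scaled_def A_def intro: mult_right_mono)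

text \<open>Weight 0 is a separate claim because it is represented exactly: an additive error could
  not be charged to a distance 0.\<close>

lemma Ah_arc:
  assumes e: "e \<in> arcs UU" and le: "ww e \<le> 2 ^ tn * uc"
  shows "Ah (tail UU e) (head UU e) \<le> ereal (ww e + uc)" "ww e = 0 ==> Ah (tail UU e) (head UU e) \<le> 0"
proof -
  obtain x y nu de where xy: "tail UU e = x" "head UU e = y" "0 \<le> nu" "0 < de"
    "ww e = real_of_int nu / real_of_int de" "yv (x * n + y) \<le> rnd nu de" "0 \<le> yv (x * n + y)"
    using arc_cell[OF e] by metis
  have c: "rnd nu de \<le> 2 ^ tn" using rnd_cap xy le by simp
  have A1: "Ah x y \<le> ereal (real_of_int (rnd nu de) * uc)" by (rule Ah_le_yv) (use c xy in auto)
  show "Ah (tail UU e) (head UU e) \<le> ereal (ww e + uc)"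
    unfolding xy(1,2) by (rule order_trans[OF A1]) (use rnd_less[OF xy(4), of nu] xy in simp)
  assume "ww e = 0"
  then have "nu = 0" using xy by simp
  then show "Ah (tail UU e) (head UU e) \<le> 0" using A1 rnd_zero[OF xy(4)] xy by (simp add: zero_ereal_def)
qed

lemma weight_Epos: assumes "(x, y) \<in> EG" "0 < wE (x, y)"
  shows "x * n + y \<in> Epos" "wE (x, y) = real_of_int (gn (x * n + y)) / real_of_int (gd (x * n + y))"
proof -
  have xy: "x < n" "y < n" using weighted_vgraph[OF wgE assms(1)] by auto
  note s = stores_arc[OF stG xy assms(1), folded gn_def gd_def]
  show "wE (x, y) = real_of_int (gn (x * n + y)) / real_of_int (gd (x * n + y))" by (rule s(2))
  then show "x * n + y \<in> Epos" using s(1) assms(2) nn_idx[OF xy] by (auto simp: Epos_def zero_less_divide_iff)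
qed

lemma Epos_weight: assumes "k \<in> Epos"
  shows "(k div n, k mod n) \<in> EG" "wE (k div n, k mod n) = real_of_int (gn k) / real_of_int (gd k)" "0 < wE (k div n, k mod n)"
proof -
  have xy: "k div n < n" "k mod n < n" using assms n2 by (auto simp: Epos_def less_mult_imp_div_less)
  have k: "(k div n) * n + k mod n = k" by simp
  show e: "(k div n, k mod n) \<in> EG"
    using stores_nonarc[OF stG xy, unfolded k] assms by (auto simp: Epos_def gd_def)
  show w: "wE (k div n, k mod n) = real_of_int (gn k) / real_of_int (gd k)"
    using stores_arc(2)[OF stG xy e, unfolded k] by (simp add: gn_def gd_def)
  show "0 < wE (k div n, k mod n)" unfolding w using assms by (simp add: Epos_def)
qed

text \<open>The powers of two given by the bit lengths overestimate numerator and denominator by a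
  factor of at most 2 each, and in the quotient these errors point in opposite directions.\<close>

lemma ratio_ek: assumes "k \<in> Epos"
  shows "2 powr (real_of_int (ek k) - 1) \<le> real_of_int (gn k) / real_of_int (gd k)"
    "real_of_int (gn k) / real_of_int (gd k) \<le> 2 powr (real_of_int (ek k) + 1)"
proof -
  have pow: "real_of_int x < 2 powr (real (bit_length x)) \<and> 2 powr (real (bit_length x) - 1) \<le> real_of_int x" if x: "0 < x" for x
  proof
    have "x < 2 ^ bit_length x" using bit_length_pow[of x] x by simp
    then have "real_of_int x < real_of_int (2 ^ bit_length x)" by (simp only: of_int_less_iff)
    then show "real_of_int x < 2 powr (real (bit_length x))" by (simp add: powr_realpow)
    have b1: "1 \<le> bit_length x" using bit_length_pow[of x] x by (cases "bit_length x") auto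
    have "real_of_int (2 ^ (bit_length x - 1)) \<le> real_of_int x" using bit_length_pow_le[OF x] by (simp only: of_int_le_iff)
    then show "2 powr (real (bit_length x) - 1) \<le> real_of_int x" using b1 by (simp add: powr_realpow[symmetric] of_nat_diff)
  qed
  have g: "0 < gn k" "0 < gd k" using assms by (auto simp: Epos_def)
  note N = pow[OF g(1)] and D' = pow[OF g(2)]
  have "2 powr (real_of_int (ek k) - 1) = 2 powr (real (bit_length (gn k)) - 1) / 2 powr (real (bit_length (gd k)))"
    by (simp add: ek_def powr_diff[symmetric] algebra_simps)
  also have "\<dots> \<le> real_of_int (gn k) / real_of_int (gd k)" using N D' g by (intro frac_le) auto
  finally show "2 powr (real_of_int (ek k) - 1) \<le> real_of_int (gn k) / real_of_int (gd k)" .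
  have "real_of_int (gn k) / real_of_int (gd k) \<le> 2 powr (real (bit_length (gn k))) / 2 powr (real (bit_length (gd k)) - 1)"
    using N D' g by (intro frac_le) auto
  also have "\<dots> = 2 powr (real_of_int (ek k) + 1)" by (simp add: ek_def powr_diff[symmetric] algebra_simps)
  finally show "real_of_int (gn k) / real_of_int (gd k) \<le> 2 powr (real_of_int (ek k) + 1)" .
qed

abbreviation "mn \<equiv> 2 powr (real_of_int lo - 1)"
abbreviation "mx \<equiv> 2 powr (real_of_int hi + 1)"

lemma wE_mn: "e \<in> EG ==> 0 < wE e ==> mn \<le> wE e"
proof -
  assume e: "e \<in> EG" "0 < wE e"
  obtain x y where xy: "e = (x, y)" by force
  note W' = weight_Epos[OF e[unfolded xy]]
  have "mn \<le> 2 powr (real_of_int (ek (x * n + y)) - 1)" using lo_le[OF W'(1)] by simp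
  also note ratio_ek(1)[OF W'(1)]
  finally show ?thesis using W'(2) xy by (simp only:)
qed

lemma wE_mx: "e \<in> EG ==> wE e \<le> mx"
proof (cases "0 < wE e")
  case True
  assume e: "e \<in> EG"
  obtain x y where xy: "e = (x, y)" by force
  note W' = weight_Epos[OF e[unfolded xy] True[unfolded xy]]
  note ratio_ek(2)[OF W'(1)]
  also have "2 powr (real_of_int (ek (x * n + y)) + 1) \<le> mx" using hi_ge[OF W'(1)] by simp
  finally show ?thesis using W'(2) xy by (simp only:)
next
  case False
  moreover have "0 < mx" by simp
  ultimately show ?thesis by linarith
qed

text \<open>The factor \<open>2 ^ mm\<close> makes \<open>hops\<close> units small against
  \<open>eps * mn\<close>. The factor \<open>2 powr (a * lb)\<close>, which is at least
  \<open>n ^ a\<close>, allows for hopset weights that are smaller than \<open>mn\<close> by as much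
  and still have to be rounded with a small relative error.\<close>

lemma uc_eq: "uc = mn / (2 powr (real (a * lb)) * 2 ^ mm)"
proof -
  have "real_of_int sh = real tt - real_of_int lo" by (simp add: sh_def)
  also have "real tt = real (a * lb) + (real mm + 1)" unfolding tt_eq by simp
  finally have "- real_of_int sh = (real_of_int lo - 1) - (real (a * lb) + real mm)" by simp
  then have "uc = 2 powr ((real_of_int lo - 1) - (real (a * lb) + real mm))"
    unfolding uc_def by (simp only:)
  also have "\<dots> = mn / 2 powr (real (a * lb) + real mm)" by (rule powr_diff)
  finally show ?thesis by (simp add: powr_add powr_realpow)
qed

text \<open>\<open>2 ^ f * 2 ^ lb * mx\<close> covers \<open>(1 + eps) * n * mx\<close>, which no
  useful walk exceeds. The factor \<open>2 powr (a * lb)\<close> admits every hopset weight in the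
  range of \<open>within_range\<close>, so that under this condition nothing is dropped.\<close>

lemma cap_eq: "2 ^ tn * uc = 2 ^ f * 2 ^ lb * 2 powr (real (a * lb)) * mx * 2"
proof -
  have tn': "real tn = real f + (real a + 1) * real lb + (real_of_int hi - real_of_int lo) + real tt + 2"
    using lo_hi by (simp add: tn_def algebra_simps)
  have "2 ^ tn * uc = 2 powr (real tn + - real_of_int sh)" by (subst powr_add) (simp add: uc_def powr_realpow)
  also have "real tn + - real_of_int sh = real f + real lb + real (a * lb) + (real_of_int hi + 1) + 1"
    by (simp add: tn' sh_def algebra_simps)
  also have "2 powr \<dots> = 2 ^ f * 2 ^ lb * 2 powr (real (a * lb)) * mx * 2"
    unfolding powr_add by (simp add: powr_realpow)
  finally show ?thesis .
qed

lemma n_real_lb: "real n \<le> 2 ^ lb"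
proof -
  have "real n \<le> real (2 ^ lb)" using n_lb unfolding of_nat_le_iff by simp
  then show ?thesis by simp
qed

lemma cap_ge: "(1 + eps) * (real n * mx) \<le> 2 ^ tn * uc"
proof -
  have one: "1 \<le> 2 powr (real (a * lb))" by (intro ge_one_powr_ge_zero) auto
  have "(1 + eps) * (real n * mx) \<le> 2 ^ f * (2 ^ lb * mx)"
    using eps_f n_real_lb eps0 by (intro mult_mono) auto
  also have "\<dots> = (2 ^ f * 2 ^ lb * mx) * 1" by simp
  also have "\<dots> \<le> (2 ^ f * 2 ^ lb * mx) * (2 powr (real (a * lb)) * 2)" using one by (intro mult_left_mono) auto
  finally show ?thesis unfolding cap_eq by (simp add: mult_ac)
qed

lemma lb1: "1 \<le> lb" using n2 n_lb by (cases lb) auto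

lemma M_gt: "\<kappa> * acc * lb < 2 ^ mm"
proof -
  have "\<bar>int (\<kappa> * acc * lb)\<bar> < 2 ^ mm" unfolding mm_eq by (rule bit_length_pow)
  then have "int (\<kappa> * acc * lb) < int (2 ^ mm)" by simp
  then show ?thesis by (simp only: of_nat_less_iff)
qed

lemma M16: "16 < M"
proof -
  have "16 * 1 * 1 \<le> \<kappa> * acc * lb" using \<kappa>16 acc1 lb1 by (intro mult_le_mono) auto
  then have "(16::nat) < 2 ^ mm" using M_gt by simp
  then have "int 16 < int (2 ^ mm)" by (simp only: of_nat_less_iff)
  then show ?thesis by simp
qed

text \<open>\<open>\<kappa> * lb\<close> is at least \<open>hops\<close>, \<open>acc\<close> is at
  least \<open>1 / eps\<close>, and \<open>2 ^ mm\<close> exceeds the product of the three.\<close>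

lemma \<eta>_le: "real hops * uc \<le> eps * mn"
proof -
  have a1: "0 < real acc" using acc1 by simp
  have kl: "0 < \<kappa>" "0 < lb" using \<kappa>2 lb1 by auto
  have one: "1 \<le> 2 powr (real (a * lb))" by (intro ge_one_powr_ge_zero) auto
  have "uc \<le> mn / 2 ^ mm" unfolding uc_eq using one by (intro frac_le) auto
  also have "\<dots> \<le> mn / real (\<kappa> * acc * lb)"
  proof (rule frac_le)
    show "0 < real (\<kappa> * acc * lb)" using \<kappa>2 acc1 lb1 by simp
    have "real (\<kappa> * acc * lb) \<le> real (2 ^ mm)" unfolding of_nat_le_iff using M_gt by simp
    then show "real (\<kappa> * acc * lb) \<le> 2 ^ mm" by simp
  qed auto
  finally have u: "uc \<le> mn / real (\<kappa> * acc * lb)" .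
  have "real hops * uc \<le> real (\<kappa> * lb) * (mn / real (\<kappa> * acc * lb))"
    using u uc_pos hops_\<kappa> unfolding of_nat_le_iff[where 'a=real, symmetric] by (intro mult_mono) simp_all
  also have "\<dots> = mn * (1 / real acc)" using kl a1 by (simp add: field_simps)
  also have "\<dots> \<le> mn * eps" using acc_eps a1 eps0 by (intro mult_left_mono) (auto simp: field_simps)
  finally show ?thesis by (simp add: mult.commute)
qed

end

section \<open>Correctness of the computed matrix\<close>

lemma dist_product_mono_scaled:
  fixes n :: nat
  assumes n: "0 < n" and c: "0 \<le> c" and B: "\<And>t. t < n ==> B u t \<le> ereal c * B' u t" and A: "\<And>t. t < n ==> A t v \<le> ereal c * A' t v"
  shows "dist_product {..<n} B A u v \<le> ereal c * dist_product {..<n} B' A' u v"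
proof -
  obtain t where t: "t < n" "dist_product {..<n} B' A' u v = B' u t + A' t v"
    unfolding dist_product_def using n
    by (rule_tac INF_finite_attained[of "{..<n}" "\<lambda>t. B' u t + A' t v"]) auto
  have "dist_product {..<n} B A u v \<le> B u t + A t v" unfolding dist_product_def using t(1) by (intro INF_lower) auto
  also have "\<dots> \<le> ereal c * B' u t + ereal c * A' t v" using B A t(1) by (intro add_mono)
  also have "\<dots> = ereal c * (B' u t + A' t v)" using c by (simp add: ereal_pos_distrib)
  finally show ?thesis using t by simp
qed

lemma dist_product_mono:
  assumes "\<And>t. t \<in> X ==> B u t \<le> B' u t" "\<And>t. t \<in> X ==> A t v \<le> A' t v"
  shows "dist_product X B A u v \<le> dist_product X B' A' u v"
  unfolding dist_product_def using assms by (intro INF_mono) (auto intro: add_mono)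

lemma dist_product_nonneg:
  assumes "\<And>t. t \<in> X ==> 0 \<le> B u t" "\<And>t. t \<in> X ==> 0 \<le> A t v"
  shows "0 \<le> dist_product X B A u v"
  unfolding dist_product_def using assms by (intro INF_greatest) (auto intro: add_nonneg_nonneg)

lemma ereal_le_mult: "0 \<le> x ==> 1 \<le> c ==> x \<le> ereal c * x"
proof (cases x)
  case (real r)
  assume "0 \<le> x" "1 \<le> c"
  then have "1 * r \<le> c * r" using real by (intro mult_right_mono) auto
  then show ?thesis using real by simp
qed auto

context hopset_run
begin

text \<open>Rows in memory are numbered by positions in the source array, rows of the abstract
  matrices by the sources themselves.\<close>

definition idx where "idx = inv_into {..<s} sc"

lemma sc_bij: "bij_betw sc {..<s} Ss"
proof -
  have "bij_betw (\<lambda>i. int (sc i)) {..<s} (int ` Ss)"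
    using bij by (rule bij_betw_cong[THEN iffD1, rotated]) (simp add: sc_int)
  then have "inj_on (\<lambda>i. int (sc i)) {..<s}" "int ` (sc ` {..<s}) = int ` Ss" by (auto simp: bij_betw_def image_image)
  then show ?thesis by (auto simp: bij_betw_def inj_on_def inj_image_eq_iff)
qed

lemma idx_sc: "i < s ==> idx (sc i) = i"
  using sc_bij by (simp add: idx_def bij_betw_def)

lemma idx: "x \<in> Ss ==> idx x < s" "x \<in> Ss ==> sc (idx x) = x"
  using sc_bij inv_into_into[of x sc "{..<s}"] f_inv_into_f[of x sc "{..<s}"] by (auto simp: idx_def bij_betw_def)

text \<open>\<open>T\<close> contains two bits for each quadrupling and two spare ones; the spare
  factor 4 is the one in the condition \<open>4 * X \<le> I\<close> of
  \<open>dist_product_scaled\<close>.\<close>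

lemma four_pow_le: "y \<le> hops ==> 4 * (4 ^ y * 2 ^ tn) \<le> I"
proof -
  assume y: "y \<le> hops"
  have "4 * (4 ^ y * 2 ^ tn) = (2::int) ^ (2 + 2 * y + tn)" by (simp add: power_add power_mult)
  also have "\<dots> \<le> I" unfolding I_def T_def using y by (intro power_increasing) auto
  finally show ?thesis .
qed

context
  fixes m Bs assumes res: "result m Bs"
begin

lemma Bs_step: "y < hops - 1 ==> i < s ==> v < n ==> minplus_entry M I n (Bs y i) (\<lambda>t. A t v) (Bs (Suc y) i v)"
  and Bs_0: "i < s ==> v < n ==> Bs 0 i v = A (sc i) v"
  using res by (auto simp: result_def)

lemma Bs_nonneg: "y \<le> hops - 1 ==> i < s ==> v < n ==> 0 \<le> Bs y i v"
  using minplus_chain_bounds[of Bs y i v] Bs_step Bs_0 by blast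

lemma A_fin: "A x v < I ==> A x v \<le> 4 ^ y * 2 ^ tn"
proof -
  assume "A x v < I"
  then have "A x v \<le> 1 * 2 ^ tn" using A_bounds(3) by simp
  also have "\<dots> \<le> 4 ^ y * 2 ^ tn" by (intro mult_right_mono) auto
  finally show ?thesis .
qed

lemma Bs_fin: "y \<le> hops - 1 ==> i < s ==> v < n ==> Bs y i v < I ==> Bs y i v \<le> 4 ^ y * 2 ^ tn"
proof (induction y arbitrary: v)
  case 0
  then show ?case using Bs_0[of i v] A_bounds(3)[of "sc i" v] by simp
next
  case (Suc y)
  have "Bs (Suc y) i v \<le> 4 * (4 ^ y * 2 ^ tn)"
    using Suc.prems M16 four_pow_le[of y] A_fin Suc.IH
    by (intro minplus_entry_bound[OF Bs_step[of y i v]]) auto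
  then show ?case by simp
qed

definition Bh where "Bh y x v = scaled I uc (Bs y (idx x) v)"

lemma Bh_nonneg: "y \<le> hops - 1 ==> x \<in> Ss ==> v < n ==> 0 \<le> Bh y x v"
  using Bs_nonneg[OF _ idx(1)] uc_pos by (simp add: Bh_def scaled_def)

lemma Bh_0: "x \<in> Ss ==> v < n ==> Bh 0 x v = Ah x v"
  using Bs_0[OF idx(1)] idx(2) by (simp add: Bh_def Ah_def)

lemma Bh_step:
  assumes "y < hops - 1" "x \<in> Ss" "v < n"
  shows "dist_product {..<n} (Bh y) Ah x v \<le> Bh (Suc y) x v"
    "Bh (Suc y) x v \<le> ereal (1 + 4 / 2 ^ mm) * dist_product {..<n} (Bh y) Ah x v"
proof -
  note ix = idx(1)[OF assms(2)]
  have *: "Bh y = (\<lambda>x t. scaled I uc (Bs y (idx x) t))" "Ah = (\<lambda>t v. scaled I uc (A t v))"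
    by (auto simp: Bh_def Ah_def fun_eq_iff)
  have d: "dist_product {..<n} (Bh y) Ah x v \<le> scaled I uc (Bs (Suc y) (idx x) v) \<and>
     scaled I uc (Bs (Suc y) (idx x) v) \<le> ereal (1 + 4 / real_of_int M) * dist_product {..<n} (Bh y) Ah x v"
    unfolding *
    using dist_product_scaled[where B="\<lambda>x. Bs y (idx x)" and A=A and c=uc and X="4 ^ y * 2 ^ tn" and u=x and v=v,
        OF Bs_step[OF assms(1) ix assms(3)]]
      M16 I0 uc_pos Bs_nonneg[OF _ ix] A_bounds(1) assms four_pow_le[of y] Bs_fin[OF _ ix] A_fin by auto
  then show "dist_product {..<n} (Bh y) Ah x v \<le> Bh (Suc y) x v"
    "Bh (Suc y) x v \<le> ereal (1 + 4 / 2 ^ mm) * dist_product {..<n} (Bh y) Ah x v"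
    by (auto simp: Bh_def)
qed

text \<open>The rounded matrix takes the place of the exact one, and its products are accurate up to
  \<open>4 / 2 ^ mm\<close>. Rounding and dropping are justified by comparison with distances, not
  entry by entry.\<close>

lemma rounded_approx:
  assumes r: "(1 + xi) ^ (hops - 1) * (1 + 2 * eps) \<le> r"
  shows "approx_distances r GG wE HH Ss (Bh (hops - 1))"
proof -
  have M0: "0 < (2::real) ^ mm" by simp
  have x4: "4 / 2 ^ mm \<le> xi" using xi9 M0 by (simp add: divide_le_eq pos_divide_le_eq)
  have "(1 + 4 / 2 ^ mm) ^ (hops - 1) * (1 + 2 * eps) \<le> (1 + xi) ^ (hops - 1) * (1 + 2 * eps)"
    using x4 eps0 by (intro mult_right_mono power_mono) auto
  then have r': "(1 + 4 / 2 ^ mm) ^ (hops - 1) * (1 + 2 * eps) \<le> r" using r by simp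
  have "0 < (1 + 4 / 2 ^ mm) ^ (hops - 1) * (1 + 2 * eps)"
    using eps0 M0 by (intro mult_pos_pos zero_less_power) (auto intro: add_pos_pos)
  then have r0: "0 < r" using r' by linarith
  have it: "iterated_products (4 / 2 ^ mm) Ss (verts GG) Ah (hops - 1) Bh"
    unfolding iterated_products_def approx_dist_product_def using Bh_0 Bh_step by auto
  show ?thesis
  proof (rule hopset_approx_distances_rounded[OF wgE hs hops1 less_imp_le[OF eps0] _ _ r' r0 it])
    show "adj_matrix UU ww x y \<le> Ah x y" if "x \<in> verts GG" "y \<in> verts GG" for x y
      using that adj_AX AX_le_Ah by simp
    show "Ah x x \<le> 0" for x by (simp add: Ah_diag)
    show "mn \<le> wE e" if "e \<in> arcs GG" "0 < wE e" for e using that wE_mn by simp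
    show "wE e \<le> mx" if "e \<in> arcs GG" for e using that wE_mx by simp
    show "Ah (tail UU e) (head UU e) \<le> 0" if "e \<in> arcs UU" "ww e = 0" for e
      using Ah_arc[OF that(1)] that(2) uc_pos by simp
    show "Ah (tail UU e) (head UU e) \<le> ereal (ww e + uc)"
      if "e \<in> arcs UU" "ww e \<le> (1 + eps) * (real (card (verts GG)) * mx)" for e
      using that cap_ge by (intro Ah_arc(1)) auto
  qed (use Ssub uc_pos \<eta>_le in auto)
qed

context
  assumes wr: "within_range (real n ^ a) GG wE HH wH"
begin

abbreviation "Pa \<equiv> 2 powr (real (a * lb))"

lemma n_pow_Pa: "real n ^ a \<le> Pa"
proof -
  have "real n ^ a \<le> (2 ^ lb) ^ a" using n_real_lb by (intro power_mono) auto
  also have "\<dots> = Pa" by (subst powr_realpow) (simp_all add: power_mult[symmetric] mult.commute)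
  finally show ?thesis .
qed

lemma Pa1: "1 \<le> Pa" by (intro ge_one_powr_ge_zero) auto

lemma arc_within:
  assumes "e \<in> arcs UU"
  shows "ww e \<le> Pa * mx" "0 < ww e ==> mn \<le> Pa * ww e" "0 \<le> ww e"
proof -
  have GE: "wE x \<le> Pa * mx" "0 < wE x ==> mn \<le> Pa * wE x" "0 \<le> wE x" if "x \<in> EG" for x
  proof -
    have "1 * mx \<le> Pa * mx" using Pa1 by (intro mult_right_mono) auto
    then show "wE x \<le> Pa * mx" using wE_mx[OF that] by linarith
    show p: "0 \<le> wE x" using weighted_vgraph[OF wgE that] by simp
    have "1 * wE x \<le> Pa * wE x" using Pa1 p by (intro mult_right_mono) auto
    then show "mn \<le> Pa * wE x" if "0 < wE x" using wE_mn[OF \<open>x \<in> EG\<close> that] by linarith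
  qed
  have HE: "wH x \<le> Pa * mx" "0 < wH x ==> mn \<le> Pa * wH x" "0 \<le> wH x" if x: "x \<in> EH" for x
  proof -
    show p: "0 \<le> wH x" using weighted_vgraph[OF wgH that] by simp
    have both: "wH x \<le> Pa * mx \<and> mn \<le> Pa * wH x" if "0 < wH x"
    proof -
      have "\<exists>e\<in>EG. 0 < wE e \<and> wE e \<le> real n ^ a * wH x" "\<exists>g\<in>EG. wH x \<le> real n ^ a * wE g"
        using wr x that by (simp_all add: within_range_def)
      then obtain e g where eg: "e \<in> EG" "0 < wE e" "wE e \<le> real n ^ a * wH x" "g \<in> EG" "wH x \<le> real n ^ a * wE g"
        by blast
      have "real n ^ a * wH x \<le> Pa * wH x" using n_pow_Pa p by (intro mult_right_mono) auto
      moreover have "real n ^ a * wE g \<le> Pa * mx"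
        using n_pow_Pa wE_mx[OF eg(4)] GE(3)[OF eg(4)] by (intro mult_mono) auto
      ultimately show ?thesis using eg wE_mn[OF eg(1,2)] by linarith
    qed
    show "mn \<le> Pa * wH x" if "0 < wH x" using both that by simp
    have "0 \<le> Pa * mx" by simp
    then show "wH x \<le> Pa * mx" using both p by (cases "0 < wH x") auto
  qed
  show "ww e \<le> Pa * mx" "0 < ww e ==> mn \<le> Pa * ww e" "0 \<le> ww e"
    using assms GE HE by (auto simp: graph_union_def)
qed

text \<open>A positive weight is at least \<open>mn / Pa\<close>, and the unit is this number
  divided by \<open>2 ^ mm\<close>, so rounding is now a small relative error of the single
  entry.\<close>

lemma Ah_within_arc:
  assumes e: "e \<in> arcs UU"
  shows "Ah (tail UU e) (head UU e) \<le> ereal (1 + 1 / 2 ^ mm) * ereal (ww e)"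
proof -
  have one: "1 * 1 \<le> (2::real) ^ f * (2 ^ lb * 2)" by (intro mult_mono) (auto intro: order_trans[OF one_le_power[of 2 lb]])
  have "1 * (Pa * mx) \<le> (2 ^ f * (2 ^ lb * 2)) * (Pa * mx)" using one by (intro mult_right_mono) auto
  then have "Pa * mx \<le> 2 ^ tn * uc" unfolding cap_eq by (simp add: mult_ac)
  then have cap: "ww e \<le> 2 ^ tn * uc" using arc_within(1)[OF e] by linarith
  show ?thesis
  proof (cases "ww e = 0")
    case True
    then show ?thesis using Ah_arc(2)[OF e cap] by (simp flip: zero_ereal_def)
  next
    case False
    then have p: "0 < ww e" using arc_within(3)[OF e] by simp
    have "uc \<le> (Pa * ww e) / (Pa * 2 ^ mm)" unfolding uc_eq using arc_within(2)[OF e p] by (intro divide_right_mono) auto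
    also have "\<dots> = ww e / 2 ^ mm" by simp
    finally have "ww e + uc \<le> (1 + 1 / 2 ^ mm) * ww e" by (simp add: distrib_right)
    then show ?thesis using Ah_arc(1)[OF e cap] by (simp add: order_trans)
  qed
qed

lemma Ah_within: assumes xy: "x < n" "y < n" shows "Ah x y \<le> ereal (1 + 1 / 2 ^ mm) * AX x y"
proof -
  have c: "0 < 1 + 1 / (2::real) ^ mm" by (intro add_pos_pos) auto
  have "AX x y = min (if (x, y) \<in> EG then ereal (wE (x, y)) else \<infinity>) (if (x, y) \<in> EH then ereal (wH (x, y)) else \<infinity>)" if "x \<noteq> y"
    using that by (simp only: AX_def if_False stores_cell[OF stG xy] stores_cell[OF stH xy])
  then have "x = y \<or> x \<noteq> y \<and> (AX x y = \<infinity> \<or> (x, y) \<in> EG \<and> AX x y = ereal (wE (x, y)) \<or> (x, y) \<in> EH \<and> AX x y = ereal (wH (x, y)))"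
    by (auto simp: min_def split: if_splits)
  then consider "x = y" | "x \<noteq> y" "AX x y = \<infinity>" | "x \<noteq> y" "(x, y) \<in> EG" "AX x y = ereal (wE (x, y))"
    | "x \<noteq> y" "(x, y) \<in> EH" "AX x y = ereal (wH (x, y))"
    by blast
  then show ?thesis
  proof cases
    case 1
    then show ?thesis by (simp add: Ah_diag AX_def)
  next
    case 2
    then show ?thesis using c by simp
  next
    case 3
    then show ?thesis using Ah_within_arc[of "Inl (x, y)"] by (simp add: graph_union_def)
  next
    case 4
    then show ?thesis using Ah_within_arc[of "Inr (x, y)"] by (simp add: graph_union_def)
  qed
qed

text \<open>The sequence has to start with exact entries, so the rounding of the initial rows is
  charged to the first product.\<close>

definition Bx where "Bx y = (if y = 0 then AX else Bh y)"

lemma AX_nonneg: "x < n ==> y < n ==> 0 \<le> AX x y"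
  using g0[OF nn_idx[of x y]] unfolding gn_def gd_def hnu_def hde_def by (auto simp: AX_def cell_value_def)

lemma within_iterated: "iterated_products xi Ss {..<n} (adj_matrix UU ww) (hops - 1) Bx"
  unfolding iterated_products_def approx_dist_product_def
proof (intro conjI ballI allI impI)
  fix x v assume "x \<in> Ss" "v \<in> {..<n}"
  then show "Bx 0 x v = adj_matrix UU ww x v" using adj_AX[of x v] Ssub by (auto simp: Bx_def)
next
  fix y x v assume y: "y < hops - 1" and x: "x \<in> Ss" and v: "v \<in> {..<n}"
  have xn: "x < n" using x Ssub by auto
  have eq: "dist_product {..<n} (Bx y) (adj_matrix UU ww) x v = dist_product {..<n} (Bx y) AX x v"
    unfolding dist_product_def using v adj_AX by (intro INF_cong) auto
  have BS: "Bx (Suc y) x v = Bh (Suc y) x v" by (simp add: Bx_def)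
  let ?c = "1 + 1 / 2 ^ mm :: real"
  have c1: "1 \<le> ?c" by simp
  have lo': "Bx y x t \<le> Bh y x t" if "t < n" for t
    using AX_le_Ah[OF xn that] Bh_0[OF x that] by (simp add: Bx_def)
  have up: "Bh y x t \<le> ereal ?c * Bx y x t" if "t < n" for t
  proof (cases "y = 0")
    case True
    then show ?thesis using Ah_within[OF xn that] Bh_0[OF x that] by (simp add: Bx_def)
  next
    case False
    then show ?thesis using ereal_le_mult[OF Bh_nonneg[of y, OF _ x that] c1] y by (simp add: Bx_def)
  qed
  show "dist_product {..<n} (Bx y) (adj_matrix UU ww) x v \<le> Bx (Suc y) x v"
    unfolding eq BS
    by (rule order_trans[OF dist_product_mono Bh_step(1)[OF y x]]) (use lo' AX_le_Ah v in auto)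
  let ?d = "dist_product {..<n} (Bx y) AX x v"
  have d0: "0 \<le> ?d"
  proof (rule dist_product_nonneg)
    fix t assume t: "t \<in> {..<n}"
    show "0 \<le> Bx y x t" using AX_nonneg[OF xn] Bh_nonneg[of y x t] x y t by (simp add: Bx_def)
    show "0 \<le> AX t v" using AX_nonneg t v by simp
  qed
  have M0: "(1::real) \<le> 2 ^ mm" by simp
  \<comment> \<open>The 9 in \<open>xi9\<close> arises here: 4 from the product, 1 from the rounded
    weights, and at most 4 from the mixed term.\<close>
  have k: "(1 + 4 / 2 ^ mm) * ?c \<le> 1 + xi"
  proof -
    have sq: "4 / (2 ^ mm * 2 ^ mm) \<le> 4 / (2::real) ^ mm" using M0 by (intro divide_left_mono) auto
    have "(1 + 4 / 2 ^ mm) * ?c = 1 + 5 / 2 ^ mm + 4 / (2 ^ mm * 2 ^ mm)" by (simp add: field_simps)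
    also have "\<dots> \<le> 1 + 5 / 2 ^ mm + 4 / 2 ^ mm" using sq by simp
    also have "\<dots> = 1 + 9 / 2 ^ mm" by (simp add: field_simps)
    finally show ?thesis using xi9 by linarith
  qed
  have "Bh (Suc y) x v \<le> ereal (1 + 4 / 2 ^ mm) * dist_product {..<n} (Bh y) Ah x v"
    using Bh_step(2)[OF y x] v by simp
  also have "\<dots> \<le> ereal (1 + 4 / 2 ^ mm) * (ereal ?c * ?d)"
    using n2 c1 up Ah_within v by (intro ereal_mult_left_mono dist_product_mono_scaled) auto
  also have "\<dots> = ereal ((1 + 4 / 2 ^ mm) * ?c) * ?d" by (simp add: mult.assoc[symmetric])
  also have "\<dots> \<le> ereal (1 + xi) * ?d" using k d0 by (intro ereal_mult_right_mono) auto
  finally show "Bx (Suc y) x v \<le> ereal (1 + xi) * dist_product {..<n} (Bx y) (adj_matrix UU ww) x v"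
    unfolding eq BS .
qed

end

lemma xi_nonneg: "0 \<le> xi"
proof -
  have "0 \<le> 9 / (2::real) ^ mm" by simp
  then show ?thesis using xi9 by linarith
qed

lemma result_correct:
  assumes r: "(1 + xi) ^ (hops - 1) * (1 + 2 * eps) \<le> r"
  shows "\<exists>X. (\<forall>i<s. \<forall>v<n. cell_value m ''D_num'' ''D_den'' (int (i * n + v)) = X (sc i) v) \<and>
    approx_distances r GG wE HH Ss X \<and>
    (within_range (real n ^ a) GG wE HH wH \<longrightarrow>
       (\<exists>B. iterated_products xi Ss {..<n} (adj_matrix UU ww) (hops - 1) B \<and> (\<forall>x\<in>Ss. \<forall>v\<in>{..<n}. X x v = B (hops - 1) x v)))"
proof (cases "1 < hops")
  case True
  then have o: "outB m (Bs (hops - 1))" using res by (simp add: result_def)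
  show ?thesis
  proof (intro exI[of _ "Bh (hops - 1)"] conjI impI)
    show "\<forall>i<s. \<forall>v<n. cell_value m ''D_num'' ''D_den'' (int (i * n + v)) = Bh (hops - 1) (sc i) v"
      using o by (simp add: outB_def Bh_def idx_sc)
    show "approx_distances r GG wE HH Ss (Bh (hops - 1))" by (rule rounded_approx[OF r])
    assume wr: "within_range (real n ^ a) GG wE HH wH"
    show "\<exists>B. iterated_products xi Ss {..<n} (adj_matrix UU ww) (hops - 1) B \<and> (\<forall>x\<in>Ss. \<forall>v\<in>{..<n}. Bh (hops - 1) x v = B (hops - 1) x v)"
      by (intro exI[of _ Bx] conjI within_iterated[OF wr]) (use True in \<open>simp add: Bx_def[OF wr]\<close>)
  qed
next
  case False
  then have h: "hops = 1" and o: "outA m" using res hops1 by (auto simp: result_def)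
  have it: "iterated_products xi Ss (verts GG) (adj_matrix UU ww) (hops - 1) (\<lambda>_. AX)"
    using h Ssub adj_AX by (auto simp: iterated_products_def)
  have r1: "(1 + xi) ^ (hops - 1) * (1 + eps) \<le> r" "0 < r" using r h eps0 by auto
  show ?thesis
  proof (intro exI[of _ AX] conjI impI)
    show "\<forall>i<s. \<forall>v<n. cell_value m ''D_num'' ''D_den'' (int (i * n + v)) = AX (sc i) v"
      using o by (simp add: outA_def)
    show "approx_distances r GG wE HH Ss AX"
      by (rule hopset_approx_distances_exact[OF wgE hs hops1 less_imp_le[OF eps0] _ xi_nonneg r1 it]) (use Ssub in simp)
    show "\<exists>B. iterated_products xi Ss {..<n} (adj_matrix UU ww) (hops - 1) B \<and> (\<forall>x\<in>Ss. \<forall>v\<in>{..<n}. AX x v = B (hops - 1) x v)"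
      using it by (intro exI[of _ "\<lambda>_. AX"]) simp
  qed
qed

end
end

section \<open>Resource bounds\<close>

text \<open>The constant 2 is a crude bound for \<open>1 / ln 2\<close>.\<close>

lemma bit_length_ln: "1 \<le> z ==> real (bit_length z) \<le> 1 + 2 * ln (real_of_int z)"
proof -
  assume z: "1 \<le> z"
  have b1: "1 \<le> bit_length z" using bit_length_pow[of z] z by (cases "bit_length z") auto
  have "(2::int) ^ (bit_length z - 1) \<le> z" using bit_length_pow_le[of z] z by simp
  then have "real_of_int (2 ^ (bit_length z - 1)) \<le> real_of_int z" by (simp only: of_int_le_iff)
  then have "ln (2 ^ (bit_length z - 1)) \<le> ln (real_of_int z)" using z by (subst ln_le_cancel_iff) auto
  then have "real (bit_length z - 1) * ln 2 \<le> ln (real_of_int z)" by (simp add: ln_realpow)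
  moreover have "real (bit_length z - 1) * (1 / 2) \<le> real (bit_length z - 1) * ln 2"
    using ln2_ge_two_thirds by (intro mult_left_mono) auto
  ultimately show ?thesis using b1 by (simp add: of_nat_diff)
qed

lemma floorlog_ln: "1 \<le> x ==> real (floorlog 2 x) \<le> 1 + 2 * ln (real x)"
  using bit_length_ln[of "int x"] by (simp add: bit_length_def)

lemma ln_half_le: "2 \<le> x ==> 1 / 2 \<le> ln (x::real)"
proof -
  assume "2 \<le> x"
  then have "ln 2 \<le> ln x" by simp
  then show ?thesis using ln2_ge_two_thirds by linarith
qed

lemma mult_mono4:
  fixes x1 :: real
  assumes "0 \<le> x1" "x1 \<le> y1" "0 \<le> g" "0 \<le> x2" "x2 \<le> y2" "0 \<le> x3" "x3 \<le> y3"
  shows "x1 * (g * (x2 * x3)) \<le> y1 * (g * (y2 * y3))"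
proof -
  have "0 \<le> y1" "0 \<le> y2" "0 \<le> y3" using assms by linarith+
  then show ?thesis using assms by (intro mult_mono mult_left_mono mult_nonneg_nonneg)
qed

text \<open>The factors belong, in this order, to the number of steps, the cost of an expression,
  the branches of a loop and the words of a number, each stripped of its dependence on the
  instance.\<close>

definition work_const :: "nat => nat => nat => nat => nat => real => real => real" where
  "work_const \<kappa> a f cB G C1 e0 = 16 * real (140 + 42 * \<kappa>) * real G *
     (6 * (2 * (8 * (real f + 2 * real a + 6 + 2 * real \<kappa>) + 24 + 8 * real \<kappa>) + 24) * C1) *
     (real ((5 + cB) * (2 * \<kappa>)) * (1 + e0) * 16)"

definition depth_const :: "nat => nat => nat => nat => real" where
  "depth_const \<kappa> cB ce G = 16 * real (140 + 42 * \<kappa>) *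
     (real G * (44 + 8 * real ((5 + cB) * (2 * \<kappa>))) + 8 * (4 + real ce))"

text \<open>The minimum in \<open>Nxu\<close> gives two bounds: the one by \<open>J\<close>,
  proportional to \<open>ln Wr\<close>, enters the work, and the one by \<open>n\<close>, in which
  \<open>Wr\<close> does not occur, enters the depth.\<close>

locale hopset_run_cost = hopset_run +
  fixes cB :: nat and Wr C1 \<theta> e0 :: real
  assumes Bu: "B \<le> 4 * w + cB * (lb * 2 ^ mm)" and w1: "1 \<le> w"
    and Nxu: "Nx \<le> 4 * min J n * R ^ kk"
    and RC: "real (R ^ kk) \<le> C1 * real n powr \<theta>"
    and asp: "aspect_ratio_at_most GG wE Wr" and W2: "2 \<le> Wr"
    and accu: "real acc \<le> (1 + e0) / eps" and accL: "real acc \<le> 2 + 1 / eps"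
begin

abbreviation "NN \<equiv> ln (real n)"
abbreviation "LL \<equiv> ln (2 + 1 / eps)"
abbreviation "lW \<equiv> ln Wr"

lemma NN: "1 / 2 \<le> NN" and LL: "1 / 2 \<le> LL" and lW: "1 / 2 \<le> lW"
  using ln_half_le[of "real n"] ln_half_le[of "2 + 1 / eps"] ln_half_le[of Wr] n2 eps0 W2 by auto

text \<open>All logarithms are at least 1/2, so sums of them and constants can be collected into
  multiples of a product.\<close>

lemma NL: "1 \<le> 4 * (NN * LL)" "NN \<le> 2 * (NN * LL)" "LL \<le> 2 * (NN * LL)"
proof -
  have "(1/2) * (1/2) \<le> NN * LL" using NN LL by (intro mult_mono) auto
  then show "1 \<le> 4 * (NN * LL)" by simp
  have "NN * (1/2) \<le> NN * LL" using NN LL by (intro mult_left_mono) auto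
  then show "NN \<le> 2 * (NN * LL)" by simp
  have "(1/2) * LL \<le> NN * LL" using NN LL by (intro mult_right_mono) auto
  then show "LL \<le> 2 * (NN * LL)" by simp
qed

lemma lb_ln: "real lb \<le> 4 * NN"
proof -
  have "real lb \<le> 1 + 2 * NN" using bit_length_ln[of "int n"] n2 by (simp add: lb_eq)
  then show ?thesis using NN by linarith
qed

lemma lb2_ln: "real (lb * lb) \<le> 16 * NN ^ 2"
proof -
  have "real lb * real lb \<le> (4 * NN) * (4 * NN)" using lb_ln NN by (intro mult_mono) auto
  then show ?thesis by (simp add: power2_eq_square)
qed

lemma lb_NL: "real lb \<le> 8 * (NN * LL)"
  using lb_ln NL(2) by linarith

lemma kal1: "1 \<le> \<kappa> * acc * lb"
  using \<kappa>16 acc1 lb1 by simp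

lemma ln_acc: "ln (real acc) \<le> LL"
  using accL acc1 eps0 by (intro ln_mono) auto

lemma ln_nat_le: "1 \<le> x ==> ln (real x) \<le> real x"
  using ln_le_minus_one[of "real x"] by simp

lemma mm_le: "real mm \<le> (24 + 8 * real \<kappa>) * (NN * LL)"
proof -
  have "real mm \<le> 1 + 2 * ln (real (\<kappa> * acc * lb))"
    using bit_length_ln[of "int (\<kappa> * acc * lb)"] kal1 by (simp add: mm_eq del: of_nat_mult)
  also have "ln (real (\<kappa> * acc * lb)) = ln (real \<kappa>) + ln (real acc) + ln (real lb)"
    using \<kappa>16 acc1 lb1 by (simp add: ln_mult)
  also have "1 + 2 * \<dots> \<le> 1 + 2 * real \<kappa> + 2 * LL + 2 * real lb"
    using ln_nat_le[of \<kappa>] ln_nat_le[of lb] ln_acc \<kappa>16 lb1 by simp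
  also have "\<dots> \<le> 4 * (NN * LL) + 2 * real \<kappa> * (4 * (NN * LL)) + 4 * (NN * LL) + 16 * (NN * LL)"
    using NL lb_NL mult_left_mono[OF NL(1), of "2 * real \<kappa>"] by linarith
  finally show ?thesis by (simp add: algebra_simps)
qed

lemma M_le: "2 ^ mm \<le> 2 * (\<kappa> * acc * lb)"
proof -
  have "(2::int) ^ (mm - 1) \<le> int (\<kappa> * acc * lb)"
    unfolding mm_eq using kal1 by (intro bit_length_pow_le) linarith
  then have "int (2 ^ (mm - 1)) \<le> int (\<kappa> * acc * lb)" by simp
  then have "2 ^ (mm - 1) \<le> \<kappa> * acc * lb" by (simp only: of_nat_le_iff)
  moreover have "(2::nat) ^ mm \<le> 2 * 2 ^ (mm - 1)" by (cases mm) auto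
  ultimately show ?thesis by linarith
qed

text \<open>Both extreme exponents belong to positive weights, whose ratio is at most
  \<open>Wr\<close>; an exponent differs from the logarithm by at most 1.\<close>

lemma hilo: "real_of_int (hi - lo) \<le> 6 * lW"
proof (cases "Epos = {}")
  case True
  then show ?thesis using lW by (simp add: hi_def lo_def)
next
  case False
  obtain k1 where k1: "k1 \<in> Epos" "lo = ek k1" using lo_in[OF False] by auto
  obtain k2 where k2: "k2 \<in> Epos" "hi = ek k2" using hi_in[OF False] by auto
  note w1' = Epos_weight[OF k1(1)] and w2' = Epos_weight[OF k2(1)]
  have "wE (k2 div n, k2 mod n) \<le> Wr * wE (k1 div n, k1 mod n)"
    using asp w1'(1,3) w2'(1) by (auto simp: aspect_ratio_at_most_def)
  then have "2 powr (real_of_int hi - 1) \<le> Wr * wE (k1 div n, k1 mod n)"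
    using ratio_ek(1)[OF k2(1)] w2'(2) k2(2) by simp
  also have "\<dots> \<le> Wr * 2 powr (real_of_int lo + 1)"
    using ratio_ek(2)[OF k1(1)] w1'(2) k1(2) W2 by (intro mult_left_mono) auto
  finally have "2 powr (real_of_int hi - 1) / 2 powr (real_of_int lo + 1) \<le> Wr" by (simp add: divide_le_eq)
  then have "2 powr ((real_of_int hi - 1) - (real_of_int lo + 1)) \<le> Wr" by (simp only: powr_diff)
  then have "ln (2 powr ((real_of_int hi - 1) - (real_of_int lo + 1))) \<le> lW" using W2 by (subst ln_le_cancel_iff) auto
  then have h: "(real_of_int (hi - lo) - 2) * ln 2 \<le> lW" by (simp add: ln_powr)
  show ?thesis
  proof (cases "real_of_int (hi - lo) \<le> 2")
    case True
    then show ?thesis using lW by linarith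
  next
    case False
    then have "(real_of_int (hi - lo) - 2) * (1 / 2) \<le> (real_of_int (hi - lo) - 2) * ln 2"
      using ln2_ge_two_thirds by (intro mult_left_mono) auto
    then have "(real_of_int (hi - lo) - 2) * (1 / 2) \<le> lW" using h by linarith
    then show ?thesis using lW by simp
  qed
qed

abbreviation "cJ \<equiv> 2 * (8 * (real f + 2 * real a + 6 + 2 * real \<kappa>) + 24 + 8 * real \<kappa>) + 24"

text \<open>The aspect ratio enters the work through the number of scales, by way of
  \<open>hi - lo\<close>.\<close>

lemma J_le: "real J \<le> cJ * (NN * LL * lW)"
proof -
  let ?X = "NN * LL"
  have "J \<le> T" by (simp add: J_def)
  also have "T = f + (a + 1) * lb + nat (hi - lo) + (a * lb + (mm + 1)) + 2 + 2 * hops + 2"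
    unfolding T_def tn_def using tt_eq by simp
  also have "\<dots> \<le> (f + 2 * a + 6 + 2 * \<kappa>) * lb + mm + nat (hi - lo)"
  proof -
    have "f * 1 \<le> f * lb" using lb1 by (intro mult_le_mono) auto
    moreover have "2 * hops \<le> 2 * \<kappa> * lb" using hops_\<kappa> by simp
    ultimately show ?thesis using lb1 unfolding add_mult_distrib by linarith
  qed
  finally have "real J \<le> real ((f + 2 * a + 6 + 2 * \<kappa>) * lb + mm + nat (hi - lo))" by (simp only: of_nat_le_iff)
  also have "\<dots> = real (f + 2 * a + 6 + 2 * \<kappa>) * real lb + real mm + real_of_int (hi - lo)" using lo_hi by simp
  also have "\<dots> \<le> real (f + 2 * a + 6 + 2 * \<kappa>) * (8 * ?X) + (24 + 8 * real \<kappa>) * ?X + 6 * lW"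
    using lb_NL mm_le hilo by (intro add_mono mult_left_mono) auto
  also have "\<dots> = (8 * (real f + 2 * real a + 6 + 2 * real \<kappa>) + 24 + 8 * real \<kappa>) * (?X * 1) + 6 * (lW * 1)"
    by (simp add: algebra_simps)
  also have "\<dots> \<le> (8 * (real f + 2 * real a + 6 + 2 * real \<kappa>) + 24 + 8 * real \<kappa>) * (?X * (2 * lW)) + 6 * (lW * (4 * ?X))"
    using NL(1) lW NN LL by (intro add_mono mult_left_mono) auto
  also have "\<dots> = cJ * (?X * lW)" by (simp add: algebra_simps)
  finally show ?thesis .
qed

lemma J1: "1 \<le> J" using mm_T by (simp add: J_def)

text \<open>The part \<open>4 * w\<close> of the bits amounts to four words; the rest, about
  \<open>lb * 2 ^ mm\<close> bits, is bounded without regard to the word length. As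
  \<open>2 ^ mm\<close> is proportional to \<open>acc\<close>, this is the origin of the factor
  \<open>1 / eps\<close> in the work.\<close>

lemma u_le: "u \<le> (5 + cB) * (2 * \<kappa>) * acc * (lb * lb)"
proof -
  have "B div w \<le> (4 * w + cB * (lb * 2 ^ mm)) div w" using Bu by (rule div_le_mono)
  also have "\<dots> = 4 + cB * (lb * 2 ^ mm) div w" using w1 by (simp add: div_mult_self1)
  also have "\<dots> \<le> 4 + cB * (lb * 2 ^ mm)" by simp
  finally have "u \<le> 5 + cB * (lb * 2 ^ mm)" by (simp add: u_def)
  also have "\<dots> \<le> (5 + cB) * (lb * 2 ^ mm)" using lb1 by (simp add: distrib_right)
  also have "\<dots> \<le> (5 + cB) * (lb * (2 * (\<kappa> * acc * lb)))" using M_le by (intro mult_le_mono) auto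
  finally show ?thesis by (simp add: mult_ac)
qed

abbreviation "cU \<equiv> real ((5 + cB) * (2 * \<kappa>))"

lemma steps_le: "real steps \<le> 16 * real (140 + 42 * \<kappa>) * NN ^ 2"
proof -
  have "hops * (21 * lb + 21) \<le> (\<kappa> * lb) * (42 * lb)" using hops_\<kappa> lb1 by (intro mult_le_mono) auto
  moreover have "100 + 40 * lb \<le> 140 * (lb * lb)"
  proof -
    have "1 * lb \<le> lb * lb" using lb1 by (intro mult_le_mono) auto
    then show ?thesis using lb1 by linarith
  qed
  ultimately have "steps \<le> (140 + 42 * \<kappa>) * (lb * lb)" by (simp add: steps_def algebra_simps)
  then have "real steps \<le> real ((140 + 42 * \<kappa>) * (lb * lb))" by (simp only: of_nat_le_iff)
  also have "\<dots> = real (140 + 42 * \<kappa>) * real (lb * lb)" by simp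
  also have "\<dots> \<le> real (140 + 42 * \<kappa>) * (16 * NN ^ 2)" using lb2_ln by (intro mult_left_mono) auto
  finally show ?thesis by (simp only: mult_ac)
qed

lemma Nx_le: "real (Nx + 2) \<le> 6 * (cJ * (NN * LL * lW)) * (C1 * real n powr \<theta>)"
proof -
  have R1: "1 \<le> R ^ kk" using R4 by simp
  have "1 * 1 \<le> J * R ^ kk" using J1 R1 by (intro mult_le_mono)
  moreover have "4 * min J n * R ^ kk \<le> 4 * (J * R ^ kk)" by simp
  ultimately have "Nx + 2 \<le> 6 * (J * R ^ kk)" using Nxu by linarith
  then have "real (Nx + 2) \<le> real (6 * (J * R ^ kk))" by (simp only: of_nat_le_iff)
  also have "\<dots> = 6 * real J * real (R ^ kk)" by simp
  also have "\<dots> \<le> 6 * (cJ * (NN * LL * lW)) * (C1 * real n powr \<theta>)"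
    using RC J_le order_trans[OF of_nat_0_le_iff J_le] by (intro mult_mono) auto
  finally show ?thesis .
qed

abbreviation "cK \<equiv> 16 * real (140 + 42 * \<kappa>)"
abbreviation "cW \<equiv> cK * real G * (6 * cJ * C1) * (cU * (1 + e0) * 16)"

text \<open>Of the five logarithms of \<open>n\<close>, two come from the number of steps, one from
  the number of scales and two from the words of a number.\<close>

lemma work_le: "real (steps * Tu) \<le> work_const \<kappa> a f cB G C1 e0 * (NN ^ 5 * real n powr \<theta> * (LL * lW / eps))"
proof -
  have u': "real u \<le> cU * ((1 + e0) / eps) * (16 * NN ^ 2)"
  proof -
    have "real u \<le> real ((5 + cB) * (2 * \<kappa>) * acc * (lb * lb))" using u_le by (simp only: of_nat_le_iff)
    also have "\<dots> = cU * real acc * real (lb * lb)" by simp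
    also have "\<dots> \<le> cU * ((1 + e0) / eps) * (16 * NN ^ 2)"
      using accu lb2_ln order_trans[OF of_nat_0_le_iff accu] by (intro mult_mono mult_nonneg_nonneg) auto
    finally show ?thesis .
  qed
  have "real (steps * Tu) = real steps * (real G * (real (Nx + 2) * real u))" by (simp only: Tu_def of_nat_mult mult_ac)
  also have "\<dots> \<le> (cK * NN ^ 2) * (real G * ((6 * (cJ * (NN * LL * lW)) * (C1 * real n powr \<theta>)) * (cU * ((1 + e0) / eps) * (16 * NN ^ 2))))"
    by (rule mult_mono4[OF _ steps_le _ _ Nx_le _ u']) auto
  also have "\<dots> = cW * ((NN ^ 2 * NN * NN ^ 2) * real n powr \<theta> * (LL * lW / eps))"
    by (simp only: times_divide_eq_right times_divide_eq_left mult_ac)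
  also have "NN ^ 2 * NN * NN ^ 2 = NN ^ 5" by (simp add: power_numeral_reduce)
  finally show ?thesis unfolding work_const_def .
qed

abbreviation "cD \<equiv> real G * (44 + 8 * cU) + 8 * (4 + real ce)"

text \<open>Word counts and branch counts enter only through their logarithms, and
  \<open>Nx \<le> 4 * n * R ^ kk\<close> keeps the aspect ratio out.\<close>

lemma depth_le: "real (steps * Du) \<le> depth_const \<kappa> cB ce G * (NN ^ 3 * LL)"
proof -
  let ?X = "NN * LL"
  have "real du \<le> 1 + (1 + 2 * ln (real u))" using floorlog_ln[OF u1] by (simp add: du_def depth_cost_def)
  also have "ln (real u) \<le> cU + LL + 2 * real lb"
  proof -
    have c0: "0 < cU" using \<kappa>16 by simp
    have "ln (real u) \<le> ln (real ((5 + cB) * (2 * \<kappa>) * acc * (lb * lb)))"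
    proof (rule ln_mono)
      show "real u \<le> real ((5 + cB) * (2 * \<kappa>) * acc * (lb * lb))" using u_le by (simp only: of_nat_le_iff)
    qed (use u1 in auto)
    also have "\<dots> = ln (cU * (real acc * (real lb * real lb)))" by (simp only: of_nat_mult mult.assoc)
    also have "\<dots> = ln cU + ln (real acc) + (ln (real lb) + ln (real lb))"
      using acc1 lb1 c0 by (subst ln_mult) (auto simp: ln_mult)
    also have "\<dots> \<le> cU + LL + (real lb + real lb)"
      using ln_le_minus_one[OF c0] ln_acc ln_nat_le[OF lb1] by linarith
    finally show ?thesis by simp
  qed
  also have "1 + (1 + 2 * (cU + LL + 2 * real lb)) \<le> (44 + 8 * cU) * ?X"
    using NL lb_NL mult_left_mono[OF NL(1), of "2 * cU"] by (simp add: algebra_simps)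
  finally have du': "real du \<le> (44 + 8 * cU) * ?X" by simp
  have R2: "R \<le> 2 ^ ce"
  proof -
    have "int R * 1 \<le> int (R * R) * (cu + 1)" using cu0 R4 by (intro mult_mono) auto
    then have "int R < 2 ^ ce" using ce(1) by linarith
    then have "int R < int (2 ^ ce)" by simp
    then show ?thesis by (simp only: of_nat_less_iff less_imp_le)
  qed
  have "Nx \<le> 4 * n * R ^ kk" using Nxu by (rule order_trans) (intro mult_le_mono; simp)
  also have "\<dots> < 4 * 2 ^ lb * 2 ^ (ce * lb)"
  proof -
    have "R ^ kk \<le> (2 ^ ce) ^ kk" using R2 by (rule power_mono) simp
    also have "\<dots> \<le> 2 ^ (ce * lb)" unfolding power_mult[symmetric] using kk_le by (intro power_increasing) auto
    finally have "R ^ kk \<le> 2 ^ (ce * lb)" .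
    then have "4 * n * R ^ kk \<le> 4 * n * 2 ^ (ce * lb)" by (intro mult_le_mono) auto
    also have "\<dots> < 4 * 2 ^ lb * 2 ^ (ce * lb)" using n_lb by simp
    finally show ?thesis .
  qed
  also have "\<dots> = 2 ^ (2 + lb + ce * lb)" by (simp add: power_add)
  finally have "floorlog 2 Nx \<le> 2 + lb + ce * lb" by (subst floorlog_le_iff) auto
  then have "depth_cost Nx \<le> (4 + ce) * lb" using lb1 by (simp add: depth_cost_def distrib_right)
  then have "real (depth_cost Nx) \<le> real ((4 + ce) * lb)" by (simp only: of_nat_le_iff)
  also have "\<dots> = (4 + real ce) * real lb" by simp
  also have "\<dots> \<le> (4 + real ce) * (8 * ?X)" using lb_NL by (intro mult_left_mono) auto
  finally have dn: "real (depth_cost Nx) \<le> 8 * (4 + real ce) * ?X" by (simp only: mult_ac)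
  have "real Du = real G * real du + real (depth_cost Nx)" by (simp add: Du_def)
  also have "\<dots> \<le> real G * ((44 + 8 * cU) * ?X) + 8 * (4 + real ce) * ?X"
    using du' dn by (intro add_mono mult_left_mono) auto
  also have "\<dots> = cD * ?X" by (simp add: algebra_simps)
  finally have D': "real Du \<le> cD * ?X" .
  have "real (steps * Du) = real steps * real Du" by simp
  also have "\<dots> \<le> (cK * NN ^ 2) * (cD * ?X)" using steps_le D' by (intro mult_mono) auto
  also have "\<dots> = cK * cD * ((NN ^ 2 * NN) * LL)" by (simp only: mult_ac)
  also have "NN ^ 2 * NN = NN ^ 3" by (simp add: power_numeral_reduce)
  finally show ?thesis unfolding depth_const_def .
qed

end

section \<open>Running the program on an instance\<close>

lemma nat_ceiling_le: "0 \<le> x ==> real (nat \<lceil>x\<rceil>) \<le> x + 1"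
  by linarith

lemma hopset_program_run:
  fixes w B G n p q R D0 \<kappa> a f s hops acc ce mm tt cB lb :: nat and U V W :: "nat => nat => int" and D cu :: int
    and st :: state and EG EH :: "nat rel" and eps xi Wr C1 \<theta> e0 r \<sigma> :: real
  assumes n2: "2 \<le> n" and inst: "stores_instance w n EG wE EH wH Ss hops eps st"
    and lb_eq: "lb = bit_length (int n)" and mm_eq: "mm = bit_length (int (\<kappa> * acc * lb))" and tt_eq: "tt = a * lb + (mm + 1)"
    and acc_eq: "acc = nat \<lceil>1 / eps\<rceil>"
    and cB: "cB = 60 + 2 * f + 4 * a + 5 * \<kappa> + 3 * ce" and B: "B = 4 * w + cB * (lb * 2 ^ mm)"
    and hops1: "1 \<le> hops" and \<kappa>16: "16 \<le> \<kappa>"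
    and p: "p = power_ceil q \<sigma>" and \<sigma>: "0 \<le> \<sigma>" "\<sigma> \<le> 1" and s: "card Ss = s" "s = power_ceil n \<sigma>"
    and q: "2 \<le> q" "q * q \<le> R" and D1: "1 \<le> D"
    and alg: "\<And>x y i k. i < p ==> k < q ==>
      (\<Sum>\<rho><R. W (i * q + k) \<rho> * (\<Sum>t<p * q. U \<rho> t * x t) * (\<Sum>t<q * q. V \<rho> t * y t)) = D * (\<Sum>j<q. x (i * q + j) * y (j * q + k))"
    and UVW: "\<And>i j. \<bar>U i j\<bar> \<le> cu" "\<And>i j. \<bar>V i j\<bar> \<le> cu" "\<And>i j. \<bar>W i j\<bar> \<le> cu"
    and ce: "int (R * R) * (cu + 1) < 2 ^ ce" "D < 2 ^ ce"
    and wgE: "weighted_graph (vgraph n EG) wE"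
    and hs: "hopset eps hops (vgraph n EG) wE (vgraph n EH) wH"
    and Ssub: "Ss \<subseteq> {..<n}" and eps0: "0 < eps" and eps_f: "1 + eps \<le> 2 ^ f"
    and hops_\<kappa>: "hops \<le> \<kappa> * lb" and xi9: "9 / 2 ^ mm \<le> xi"
    and RC: "\<And>k. 1 \<le> k ==> q ^ (k - 1) < n ==> real (R ^ k) \<le> C1 * real n powr \<theta>"
    and asp: "aspect_ratio_at_most (vgraph n EG) wE Wr" and W2: "2 \<le> Wr" and accu: "real acc \<le> (1 + e0) / eps"
    and gk: "\<forall>e\<in>set (all_exprs p q R U V W D \<kappa> a f). 20 * (ecost e + 1) \<le> G"
    and r: "(1 + xi) ^ (hops - 1) * (1 + 2 * eps) \<le> r"
  shows "\<exists>st' work depth R' U' X. exec w (prog p q R U V W D \<kappa> a f) st st' work depth R' U' \<and> outputs n Ss st st' X \<and>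
    approx_distances r (vgraph n EG) wE (vgraph n EH) Ss X \<and>
    (within_range (real n ^ a) (vgraph n EG) wE (vgraph n EH) wH \<longrightarrow>
       (\<exists>B. iterated_products xi Ss {..<n} (adj_matrix (graph_union (vgraph n EG) (vgraph n EH)) (case_sum wE wH)) (hops - 1) B \<and>
            (\<forall>x\<in>Ss. \<forall>v\<in>{..<n}. X x v = B (hops - 1) x v))) \<and>
    real work \<le> work_const \<kappa> a f cB G C1 e0 * (ln (real n) ^ 5 * real n powr \<theta> * (ln (2 + 1 / eps) * ln Wr / eps)) \<and>
    real depth \<le> depth_const \<kappa> cB ce G * (ln (real n) ^ 3 * ln (2 + 1 / eps))"
proof -
  define m0 where "m0 = snd st"
  note I = inst[unfolded stores_instance_def, folded m0_def]
  have nw: "int n < 2 ^ w" and stG: "stores_graph w m0 ''G_num'' ''G_den'' n EG wE" and stH: "stores_graph w m0 ''H_num'' ''H_den'' n EH wH"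
    and bij: "bij_betw (\<lambda>i. m0 (''source'', int i)) {..<s} (int ` Ss)"
    using I s(1) by auto
  have cells: "0 \<le> m0 (num, int k) \<and> m0 (num, int k) < 2 ^ w" "0 \<le> m0 (den, int k) \<and> m0 (den, int k) < 2 ^ w"
    if "stores_graph w m0 num den n X wt" "k < n * n" for num den X wt k
  proof -
    have "k div n < n" "k mod n < n" using that(2) n2 by (auto simp: less_mult_imp_div_less)
    then show "0 \<le> m0 (num, int k) \<and> m0 (num, int k) < 2 ^ w" "0 \<le> m0 (den, int k) \<and> m0 (den, int k) < 2 ^ w"
      using that(1)[unfolded stores_graph_def Let_def, rule_format, of "k div n" "k mod n"] by auto
  qed
  note gin = cells[OF stG] and hin = cells[OF stH]
  have src: "0 \<le> m0 (''source'', int i) \<and> m0 (''source'', int i) < int n" if "i < s" for i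
  proof -
    have "m0 (''source'', int i) \<in> int ` Ss" using bij that by (auto simp: bij_betw_def)
    then show ?thesis using Ssub by auto
  qed
  have sn: "s \<le> n" using s n2 \<sigma> power_ceil_le by simp
  have pq: "1 \<le> p" "p \<le> q" using p q \<sigma> power_ceil_le[of \<sigma> q] power_ceil_pos[of q \<sigma>] by auto
  have acc1: "1 \<le> acc" unfolding acc_eq using eps0 by (simp add: Suc_le_eq)
  have acc_eps: "1 / eps \<le> real acc" unfolding acc_eq by (rule real_nat_ceiling_ge)
  have accL: "real acc \<le> 2 + 1 / eps" unfolding acc_eq by (rule order_trans[OF nat_ceiling_le]) (use eps0 in auto)
  have w1: "1 \<le> w" using nw n2 by (cases w) auto
  have n_lb: "n < 2 ^ lb"
  proof -
    have "int n < 2 ^ lb" using bit_length_pow[of "int n"] unfolding lb_eq by simp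
    then have "int n < int (2 ^ lb)" by simp
    then show ?thesis by (simp only: of_nat_less_iff)
  qed
  have lb_le: "2 ^ lb \<le> 2 * n"
  proof -
    have "(2::int) ^ (lb - 1) \<le> int n" unfolding lb_eq using n2 by (intro bit_length_pow_le) simp
    then have "int (2 ^ (lb - 1)) \<le> int n" by simp
    then have "2 ^ (lb - 1) \<le> n" by (simp only: of_nat_le_iff)
    moreover have "(2::nat) ^ lb \<le> 2 * 2 ^ (lb - 1)" by (cases lb) auto
    ultimately show ?thesis by linarith
  qed
  have lb1: "1 \<le> lb" using n_lb n2 by (cases lb) auto
  \<comment> \<open>All requirements on the bit length \<open>B\<close> are linear in
    \<open>w\<close> and in quantities bounded by constant multiples of \<open>Z\<close>;
    \<open>cB\<close> collects these constants.\<close>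
  define Z where "Z = lb * 2 ^ mm"
  have Mv: "\<kappa> * acc * lb < 2 ^ mm"
  proof -
    have "\<bar>int (\<kappa> * acc * lb)\<bar> < 2 ^ mm" unfolding mm_eq by (rule bit_length_pow)
    then have "int (\<kappa> * acc * lb) < int (2 ^ mm)" by simp
    then show ?thesis by (simp only: of_nat_less_iff)
  qed
  have MZ: "2 ^ mm \<le> Z" using lb1 by (simp add: Z_def)
  have Zs: "1 \<le> Z" "lb \<le> Z" "acc \<le> Z" "mm \<le> Z" "hops \<le> \<kappa> * Z"
  proof -
    have "1 * (1 * acc) \<le> (\<kappa> * lb) * acc" using \<kappa>16 lb1 by (intro mult_le_mono) auto
    then have "acc \<le> \<kappa> * acc * lb" by (simp add: mult_ac)
    then show "acc \<le> Z" using Mv MZ by linarith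
    show l: "lb \<le> Z" by (simp add: Z_def)
    show "1 \<le> Z" using lb1 l by linarith
    have "mm < 2 ^ mm" by (rule less_exp)
    then show "mm \<le> Z" using MZ by linarith
    have "\<kappa> * lb \<le> \<kappa> * Z" using l by simp
    then show "hops \<le> \<kappa> * Z" using hops_\<kappa> by linarith
  qed
  have BZ: "B = 4 * w + (60 * Z + 2 * (f * Z) + 4 * (a * Z) + 5 * (\<kappa> * Z) + 3 * (ce * Z))"
    unfolding B cB Z_def[symmetric] by (simp add: algebra_simps)
  have mZ: "c \<le> c * Z" for c using Zs(1) by (cases Z) auto
  have alb: "a * lb \<le> a * Z" "ce * lb \<le> ce * Z" using Zs(2) by auto
  have B1: "1 \<le> B" using BZ Zs(1) by linarith
  have Bw: "4 * w + 4 * lb + 10 \<le> B" using BZ Zs by linarith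
  have BK: "4 * w + 4 * lb + 2 * (f + (a + 1) * lb + tt + 2 * hops + 10) + \<kappa> + acc + ce \<le> B"
  proof -
    have "x1 + 2 * (f' + (a' + l) + (a' + (m' + 1)) + 2 * h + 10) + k + c + e \<le> x1 + (56 * z + 2 * F + 4 * A + 5 * K + 3 * E)"
      if "f' \<le> F" "a' \<le> A" "l \<le> z" "m' \<le> z" "h \<le> K" "k \<le> K" "c \<le> z" "e \<le> E" "1 \<le> z"
      for x1 f' a' l m' h k c e z F A K E :: nat
      using that by simp
    note this[OF mZ[of f] alb(1) Zs(2,4,5) mZ[of \<kappa>] Zs(3) mZ[of ce] Zs(1), of "4 * w + 4 * lb"]
    then show ?thesis unfolding BZ tt_eq add_mult_distrib nat_mult_1 using mult_le_mono2[OF Zs(2), of 4] by simp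
  qed
  have BM: "3 * ce * lb + 2 * lb * 2 ^ mm + 10 \<le> B"
  proof -
    have "2 * lb * 2 ^ mm = 2 * Z" by (simp add: Z_def)
    then show ?thesis unfolding BZ mult.assoc[of 3 ce lb] using Zs alb by linarith
  qed
  have \<kappa>2: "2 \<le> \<kappa>" using \<kappa>16 by simp
  have N0B: "2 ^ (2 * lb) < (2::nat) ^ B" using Bw by (intro power_strict_increasing) auto
  \<comment> \<open>A provisional interpretation with the loop bound of the range computation. It
    gives access to \<open>J\<close> and \<open>kk\<close>, on which the final \<open>Nx\<close>
    depends.\<close>
  interpret d: prun2 w B G "2 ^ (2 * lb)" n lb m0 p q R U V W D cu \<kappa> a f s hops acc ce mm tt
    by unfold_locales (fact B1 N0B n2 lb_eq gin le_refl Bw hin src sn hops1 acc1 \<kappa>2 pq q D1 alg UVW ce mm_eq tt_eq BK BM)+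
  \<comment> \<open>The factor 4 pays for tournaments whose sizes are rounded up to powers of two:
    \<open>2 ^ lb\<close> is at most \<open>2 * n\<close>, and this occurs squared.\<close>
  define Nx where "Nx = 4 * min d.J n * R ^ d.kk"
  have J1: "1 \<le> d.J" using d.mm_T by (simp add: d.J_def)
  have nnR: "n * n \<le> R ^ d.kk"
  proof -
    have "n * n \<le> q ^ d.kk * q ^ d.kk" by (rule mult_le_mono[OF d.n_le d.n_le])
    also have "\<dots> = (q * q) ^ d.kk" by (simp add: power_mult_distrib)
    also have "\<dots> \<le> R ^ d.kk" using q by (intro power_mono) auto
    finally show ?thesis .
  qed
  have R_ce: "R ^ d.kk \<le> 2 ^ (ce * lb)"
  proof -
    have "int R * 1 \<le> int (R * R) * (cu + 1)" using d.cu0 d.R4 by (intro mult_mono) auto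
    then have "int R < 2 ^ ce" using ce(1) by linarith
    then have "int R < int (2 ^ ce)" by simp
    then have R2: "R \<le> 2 ^ ce" by (simp only: of_nat_less_iff less_imp_le)
    have "R ^ d.kk \<le> (2 ^ ce) ^ d.kk" using R2 by (rule power_mono) simp
    also have "\<dots> \<le> 2 ^ (ce * lb)" unfolding power_mult[symmetric] using d.kk_le by (intro power_increasing) auto
    finally show ?thesis .
  qed
  have NxB: "Nx < 2 ^ B"
  proof -
    have "Nx \<le> 4 * n * R ^ d.kk" unfolding Nx_def by (intro mult_le_mono) auto
    also have "\<dots> \<le> 4 * 2 ^ lb * 2 ^ (ce * lb)" using n_lb R_ce by (intro mult_le_mono) auto
    also have "\<dots> = 2 ^ (2 + lb + ce * lb)" by (simp add: power_add)
    also have "\<dots> < 2 ^ B"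
    proof (rule power_strict_increasing)
      show "2 + lb + ce * lb < B" unfolding BZ using Zs alb by linarith
    qed simp
    finally show ?thesis .
  qed
  have Nx1: "2 ^ (2 * lb) \<le> Nx"
  proof -
    have "(2::nat) ^ (2 * lb) = 2 ^ lb * 2 ^ lb" by (simp add: mult_2 power_add)
    also have "\<dots> \<le> (2 * n) * (2 * n)" by (rule mult_le_mono[OF lb_le lb_le])
    also have "\<dots> = (4 * 1) * (n * n)" by simp
    also have "\<dots> \<le> (4 * min d.J n) * R ^ d.kk" using nnR J1 n2 by (intro mult_le_mono) auto
    finally show ?thesis by (simp add: Nx_def)
  qed
  have naive: "s * n * 2 ^ lb \<le> Nx" if "n < d.J"
  proof -
    have "s * n * 2 ^ lb \<le> (n * n) * (2 * n)" using sn lb_le by (intro mult_le_mono) auto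
    also have "\<dots> \<le> R ^ d.kk * (4 * n)" using nnR by (intro mult_le_mono) auto
    also have "\<dots> = Nx" using that by (simp add: Nx_def)
    finally show ?thesis .
  qed
  have fast: "d.J * R ^ d.kk \<le> Nx" "s * n * 2 ^ bit_length (int d.J) \<le> Nx" if "d.J \<le> n"
  proof -
    show "d.J * R ^ d.kk \<le> Nx" using that by (simp add: Nx_def)
    have "(2::int) ^ (bit_length (int d.J) - 1) \<le> int d.J" using J1 by (intro bit_length_pow_le) simp
    then have "int (2 ^ (bit_length (int d.J) - 1)) \<le> int d.J" by simp
    then have "2 ^ (bit_length (int d.J) - 1) \<le> d.J" by (simp only: of_nat_le_iff)
    moreover have "(2::nat) ^ bit_length (int d.J) \<le> 2 * 2 ^ (bit_length (int d.J) - 1)" by (cases "bit_length (int d.J)") auto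
    ultimately have b: "2 ^ bit_length (int d.J) \<le> 2 * d.J" by linarith
    have "s * n * 2 ^ bit_length (int d.J) \<le> (n * n) * (2 * d.J)" using sn b by (intro mult_le_mono) auto
    also have "\<dots> \<le> R ^ d.kk * (4 * d.J)" using nnR by (intro mult_le_mono) auto
    also have "\<dots> = Nx" using that by (simp add: Nx_def)
    finally show "s * n * 2 ^ bit_length (int d.J) \<le> Nx" .
  qed
  \<comment> \<open>Rounding up in \<open>p\<close> can only help:
    \<open>n powr \<sigma> \<le> (q powr \<sigma>) ^ kk \<le> p ^ kk\<close>, and as the last number
    is an integer, the ceiling does not exceed it.\<close>
  have sp: "s \<le> p ^ d.kk"
  proof -
    have qp: "real q powr \<sigma> \<le> real p" unfolding p power_ceil_def by (rule real_nat_ceiling_ge)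
    have "real n powr \<sigma> \<le> real (q ^ d.kk) powr \<sigma>" using d.n_le \<sigma> by (intro powr_mono2) (auto simp only: of_nat_le_iff of_nat_0_le_iff)
    also have "\<dots> = (real q powr \<sigma>) ^ d.kk" using q(1) by (simp add: powr_power powr_realpow[symmetric] powr_powr mult.commute)
    also have "\<dots> \<le> real p ^ d.kk" using qp by (intro power_mono) auto
    finally have "\<lceil>real n powr \<sigma>\<rceil> \<le> int (p ^ d.kk)" by (simp add: ceiling_le_iff)
    then show ?thesis unfolding s power_ceil_def by (simp only: nat_le_iff)
  qed
  have Bu: "B \<le> 4 * w + cB * (lb * 2 ^ mm)" using B by simp
  have Nxu: "Nx \<le> 4 * min d.J n * R ^ d.kk" by (simp add: Nx_def)
  have RCk: "real (R ^ d.kk) \<le> C1 * real n powr \<theta>"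
    using d.kk1 d.less_kk[of "d.kk - 1"] by (intro RC) auto
  interpret r: hopset_run_cost w B G Nx n lb m0 p q R U V W D cu \<kappa> a f s hops acc ce mm tt EG EH wE wH Ss eps xi cB Wr C1 \<theta> e0
    by unfold_locales (fact B1 NxB n2 lb_eq gin Nx1 Bw hin src sn hops1 acc1 \<kappa>2 pq q D1 alg UVW ce mm_eq tt_eq BK BM
      naive fast sp wgE hs stG stH Ssub s(1) bij eps0 eps_f acc_eps hops_\<kappa> xi9 \<kappa>16 Bu w1 Nxu RCk asp W2 accu accL)+
  have gok: "\<forall>e\<in>set (all_exprs p q R U V W D \<kappa> a f). r.gok e"
    using gk evok_all by (auto simp: r.gok_def)
  have ci: "0 \<le> \<lceil>1 / eps\<rceil>" using eps0 by (simp add: order_less_imp_le less_le_trans[of "-1" 0])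
  have sc: "r.clean (fst st) ''n'' = int n" "r.clean (fst st) ''s'' = int s" "r.clean (fst st) ''hops'' = int hops" "r.clean (fst st) ''accuracy'' = int acc"
    using I s(1) ci by (auto simp: r.clean_def acc_eq)
  from r.wpc_prog[OF gok sc] obtain s' m' t dd R' U' where
    ex: "exec w (prog p q R U V W D \<kappa> a f) (fst st, m0) (s', m') t dd R' U'"
    and res: "\<exists>Bs. r.result m' Bs" and td: "t \<le> r.steps * r.Tu" "dd \<le> r.steps * r.Du"
    unfolding r.wpc_def by blast
  from res obtain Bs where res: "r.result m' Bs" by blast
  from r.result_correct[OF res r] obtain X where
    X: "\<forall>i<s. \<forall>v<n. cell_value m' ''D_num'' ''D_den'' (int (i * n + v)) = X (r.sc i) v"
    "approx_distances r (vgraph n EG) wE (vgraph n EH) Ss X"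
    "within_range (real n ^ a) (vgraph n EG) wE (vgraph n EH) wH \<longrightarrow>
       (\<exists>B. iterated_products xi Ss {..<n} (adj_matrix (graph_union (vgraph n EG) (vgraph n EH)) (case_sum wE wH)) (hops - 1) B \<and>
            (\<forall>x\<in>Ss. \<forall>v\<in>{..<n}. X x v = B (hops - 1) x v))" by blast
  have ex': "exec w (prog p q R U V W D \<kappa> a f) st (s', m') t dd R' U'" using ex by (simp add: m0_def)
  have out: "outputs n Ss st (s', m') X"
    unfolding outputs_def using X(1)[unfolded r.sc_def, unfolded m0_def] by (simp add: s(1))
  have wk: "real t \<le> work_const \<kappa> a f cB G C1 e0 * (ln (real n) ^ 5 * real n powr \<theta> * (ln (2 + 1 / eps) * ln Wr / eps))"
    using td(1) by (intro order_trans[OF _ r.work_le]) (simp only: of_nat_le_iff)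
  have dp: "real dd \<le> depth_const \<kappa> cB ce G * (ln (real n) ^ 3 * ln (2 + 1 / eps))"
    using td(2) by (intro order_trans[OF _ r.depth_le]) (simp only: of_nat_le_iff)
  show ?thesis using ex' out X(2,3) wk dp by blast
qed

text \<open>The tables are replaced by zero outside the finite range used by the bilinear identity,
  so that one bound holds for all indices.\<close>

lemma bounded_table:
  fixes g :: "nat => nat => int"
  obtains c where "0 \<le> c" "\<And>i j. \<bar>if i < l \<and> j < k then g i j else 0\<bar> \<le> c"
proof
  let ?c = "\<Sum>i<l. \<Sum>j<k. \<bar>g i j\<bar>"
  show "0 \<le> ?c" by (intro sum_nonneg) auto
  show "\<bar>if i < l \<and> j < k then g i j else 0\<bar> \<le> ?c" for i j
  proof (cases "i < l \<and> j < k")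
    case True
    have "\<bar>g i j\<bar> \<le> (\<Sum>j<k. \<bar>g i j\<bar>)" using True by (intro member_le_sum) auto
    also have "\<dots> \<le> ?c" using True by (intro member_le_sum[of i "{..<l}" "\<lambda>i. \<Sum>j<k. \<bar>g i j\<bar>"] sum_nonneg) auto
    finally show ?thesis using True by simp
  next
    case False
    then show ?thesis by (auto intro!: sum_nonneg)
  qed
qed

lemma two_power_bound:
  fixes x y :: int
  obtains k :: nat where "x < 2 ^ k" "y < 2 ^ k"
proof
  have le: "z < 2 ^ (nat z + j)" for z :: int and j
  proof -
    have "z \<le> int (nat z)" by simp
    also have "\<dots> < 2 ^ nat z" by (rule of_nat_less_two_power)
    also have "\<dots> \<le> 2 ^ (nat z + j)" by (intro power_increasing) auto
    finally show ?thesis .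
  qed
  show "x < 2 ^ (nat x + nat y)" by (rule le)
  show "y < 2 ^ (nat x + nat y)" using le[of y "nat x"] by (simp add: add.commute)
qed

text \<open>The power is at most \<open>exp (c * \<epsilon>)\<close>, and
  \<open>exp y \<le> 1 + y * exp y\<close> makes its excess over 1 linear in
  \<open>\<epsilon>\<close>, with a constant that is finite because \<open>\<epsilon>\<close> is at
  most \<open>e0\<close>.\<close>

lemma power_product_le:
  fixes \<xi> :: real
  assumes "0 \<le> \<xi>" "\<xi> * real k \<le> c * \<epsilon>" "0 \<le> c" "0 < \<epsilon>" "\<epsilon> \<le> e0"
  shows "(1 + \<xi>) ^ k * (1 + 2 * \<epsilon>) \<le> 1 + (c * exp (c * e0) * (1 + 2 * e0) + 2) * \<epsilon>"
proof -
  have ce: "0 \<le> c * \<epsilon>" "c * \<epsilon> \<le> c * e0" using assms by (auto intro: mult_left_mono)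
  have e: "exp y \<le> 1 + y * exp y" if "0 \<le> y" for y :: real
  proof -
    have "1 - y \<le> exp (- y)" using exp_ge_add_one_self[of "- y"] by simp
    then have "(1 - y) * exp y \<le> exp (- y) * exp y" by (intro mult_right_mono) auto
    then show ?thesis by (simp add: algebra_simps exp_minus_inverse flip: exp_add)
  qed
  have "(1 + \<xi>) ^ k \<le> exp \<xi> ^ k" using assms(1) exp_ge_add_one_self[of \<xi>] by (intro power_mono) auto
  also have "\<dots> = exp (\<xi> * real k)" by (simp add: exp_of_nat_mult[symmetric] mult.commute)
  also have "\<dots> \<le> exp (c * \<epsilon>)" using assms by simp
  also have "\<dots> \<le> 1 + c * \<epsilon> * exp (c * \<epsilon>)" by (rule e[OF ce(1)])
  also have "\<dots> \<le> 1 + c * \<epsilon> * exp (c * e0)" using ce by (intro add_left_mono mult_left_mono) auto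
  finally have 1: "(1 + \<xi>) ^ k \<le> 1 + c * \<epsilon> * exp (c * e0)" .
  have "(1 + \<xi>) ^ k * (1 + 2 * \<epsilon>) \<le> (1 + c * \<epsilon> * exp (c * e0)) * (1 + 2 * \<epsilon>)"
    using 1 assms by (intro mult_right_mono) auto
  also have "\<dots> = 1 + 2 * \<epsilon> + c * \<epsilon> * exp (c * e0) * (1 + 2 * \<epsilon>)" by (simp add: algebra_simps)
  also have "\<dots> \<le> 1 + 2 * \<epsilon> + c * \<epsilon> * exp (c * e0) * (1 + 2 * e0)"
    using ce assms by (intro add_left_mono mult_left_mono) auto
  finally show ?thesis by (simp add: algebra_simps)
qed

theorem theoremA3:
  fixes \<sigma> \<delta> \<epsilon>0 b c1 c2 :: real and a :: nat
  assumes "0 \<le> \<sigma>" "\<sigma> \<le> 1" "\<delta> > 0" "\<epsilon>0 > 0" "b > 0" "0 < c1" "c1 \<le> c2"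
  shows "\<exists>(C::real) (K::nat) (P::com). C > 0 \<and>
    (\<forall>(n::nat) (E::nat rel) wE (H::nat rel) wH (S::nat set) (\<beta>::nat) (\<epsilon>::real) (\<xi>::real) (W::real).
       let G = vgraph n E; G' = vgraph n H; V = {..<n};
           A = adj_matrix (graph_union G G') (case_sum wE wH)
       in
       2 \<le> n \<and> 0 < \<epsilon> \<and> \<epsilon> \<le> \<epsilon>0 \<and>
       weighted_graph G wE \<and> 2 \<le> W \<and> aspect_ratio_at_most G wE W \<and>
       1 \<le> \<beta> \<and> real \<beta> \<le> b * ln n \<and> hopset \<epsilon> \<beta> G wE G' wH \<and>
       S \<subseteq> V \<and> card S = power_ceil n \<sigma> \<and>
       c1 * \<epsilon> / ln n \<le> \<xi> \<and> \<xi> \<le> c2 * \<epsilon> / ln n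
       \<longrightarrow>
       (\<forall>B. iterated_products \<xi> S V A (\<beta> - 1) B \<longrightarrow>
            approx_distances (1 + C * \<epsilon>) G wE G' S (B (\<beta> - 1))) \<and>
       (\<forall>w st. stores_instance w n E wE H wH S \<beta> \<epsilon> st \<longrightarrow>
          (\<exists>st' work depth R U X.
             exec w P st st' work depth R U \<and> outputs n S st st' X \<and>
             approx_distances (1 + C * \<epsilon>) G wE G' S X \<and>
             (within_range (real n ^ a) G wE G' wH \<longrightarrow>
                (\<exists>B. iterated_products \<xi> S V A (\<beta> - 1) B \<and>
                     (\<forall>u\<in>S. \<forall>v\<in>V. X u v = B (\<beta> - 1) u v))) \<and>
             real work \<le> C * ln W * ((1 / \<epsilon>) * ln (2 + 1 / \<epsilon>) ^ K) * real n powr (mm_exponent \<sigma> + \<delta>) \<and>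
             real depth \<le> C * (ln n * ln (2 + 1 / \<epsilon>)) ^ K)))"
proof (rule mm_algorithm[OF assms(1,2) half_gt_zero[OF assms(3)]])
  fix p q R :: nat and U0 V0 W0 :: "nat => nat => int" and D :: int and C1 :: real
  assume q: "2 \<le> q" "p = power_ceil q \<sigma>" "1 \<le> D" "q * q \<le> R" "0 < C1"
    and alg0: "\<And>x y i k. i < p ==> k < q ==>
      (\<Sum>\<rho><R. W0 (i * q + k) \<rho> * (\<Sum>t<p * q. U0 \<rho> t * x t) * (\<Sum>t<q * q. V0 \<rho> t * y t)) = D * (\<Sum>j<q. x (i * q + j) * y (j * q + k))"
    and RC: "\<And>n k. 1 \<le> k ==> q ^ (k - 1) < n ==> real (R ^ k) \<le> C1 * real n powr (mm_exponent \<sigma> + \<delta> / 2)"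
  define U where "U i j = (if i < R \<and> j < p * q then U0 i j else 0)" for i j
  define V where "V i j = (if i < R \<and> j < q * q then V0 i j else 0)" for i j
  define W where "W i j = (if i < p * q \<and> j < R then W0 i j else 0)" for i j
  have alg: "(\<Sum>\<rho><R. W (i * q + k) \<rho> * (\<Sum>t<p * q. U \<rho> t * x t) * (\<Sum>t<q * q. V \<rho> t * y t)) = D * (\<Sum>j<q. x (i * q + j) * y (j * q + k))"
    if ik: "i < p" "k < q" for x y i k
  proof -
    have "i * q + k < (i + 1) * q" using ik by simp
    also have "\<dots> \<le> p * q" using ik by (intro mult_le_mono1) simp
    finally have lt: "i * q + k < p * q" .
    have "(\<Sum>\<rho><R. W (i * q + k) \<rho> * (\<Sum>t<p * q. U \<rho> t * x t) * (\<Sum>t<q * q. V \<rho> t * y t)) =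
      (\<Sum>\<rho><R. W0 (i * q + k) \<rho> * (\<Sum>t<p * q. U0 \<rho> t * x t) * (\<Sum>t<q * q. V0 \<rho> t * y t))"
      using lt by (intro sum.cong arg_cong2[of _ _ _ _ "(*)"]) (auto simp: U_def V_def W_def)
    then show ?thesis using alg0[OF ik] by simp
  qed
  obtain cu1 where cu1: "0 \<le> cu1" "\<And>i j. \<bar>U i j\<bar> \<le> cu1" using bounded_table[of R "p * q" U0] unfolding U_def by metis
  obtain cu2 where cu2: "0 \<le> cu2" "\<And>i j. \<bar>V i j\<bar> \<le> cu2" using bounded_table[of R "q * q" V0] unfolding V_def by metis
  obtain cu3 where cu3: "0 \<le> cu3" "\<And>i j. \<bar>W i j\<bar> \<le> cu3" using bounded_table[of "p * q" R W0] unfolding W_def by metis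
  define cu where "cu = cu1 + cu2 + cu3"
  have "cu1 \<le> cu" "cu2 \<le> cu" "cu3 \<le> cu" using cu1(1) cu2(1) cu3(1) by (simp_all add: cu_def)
  then have UVW: "\<bar>U i j\<bar> \<le> cu" "\<bar>V i j\<bar> \<le> cu" "\<bar>W i j\<bar> \<le> cu" for i j
    using cu1(2)[of i j] cu2(2)[of i j] cu3(2)[of i j] by linarith+
  obtain ce where ce: "int (R * R) * (cu + 1) < 2 ^ ce" "D < 2 ^ ce" by (rule two_power_bound)
  \<comment> \<open>\<open>b\<close> serves to get \<open>\<beta> \<le> \<kappa> * lb\<close>,
    \<open>9 / c1\<close> to get \<open>9 / 2 ^ mm \<le> \<xi>\<close>, and 16 keeps
    \<open>2 ^ mm\<close> well above 4.\<close>
  define \<kappa> where "\<kappa> = 16 + nat \<lceil>b\<rceil> + nat \<lceil>9 / c1\<rceil>"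
  have \<kappa>: "16 \<le> \<kappa>" "b \<le> real \<kappa>" "9 / c1 \<le> real \<kappa>"
    using real_nat_ceiling_ge[of b] real_nat_ceiling_ge[of "9 / c1"] by (auto simp: \<kappa>_def)
  obtain f where f: "1 + \<epsilon>0 < 2 ^ f" using real_arch_pow[of 2 "1 + \<epsilon>0"] by auto
  define P where "P = prog p q R U V W D \<kappa> a f"
  define Gc where "Gc = sum_list (map (\<lambda>e. 20 * (ecost e + 1)) (all_exprs p q R U V W D \<kappa> a f))"
  have gk: "\<forall>e\<in>set (all_exprs p q R U V W D \<kappa> a f). 20 * (ecost e + 1) \<le> Gc"
    unfolding Gc_def by (auto intro!: member_le_sum_list)
  define cB where "cB = 60 + 2 * f + 4 * a + 5 * \<kappa> + 3 * ce"
  \<comment> \<open>One half of \<open>\<delta>\<close> has gone into the bilinear algorithm; the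
    other half absorbs the fifth power of the logarithm, since \<open>ln x\<close> is at most a
    multiple of \<open>x powr (\<delta> / 10)\<close>.\<close>
  define c5 where "c5 = 1 / (\<delta> / 10) ^ 5"
  have c50: "0 < c5" using assms by (simp add: c5_def)
  have ln5: "ln x ^ 5 \<le> c5 * x powr (\<delta> / 2)" if "1 \<le> x" for x :: real
  proof -
    have "ln x \<le> x powr (\<delta> / 10) / (\<delta> / 10)" using that assms by (intro ln_powr_bound) auto
    then have "ln x ^ 5 \<le> (x powr (\<delta> / 10) / (\<delta> / 10)) ^ 5" using that by (intro power_mono) auto
    also have "\<dots> = c5 * x powr (\<delta> / 2)" using that by (simp add: c5_def power_divide powr_power)
    finally show ?thesis .
  qed
  define cw where "cw = \<bar>work_const \<kappa> a f cB Gc C1 \<epsilon>0\<bar>"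
  define cd where "cd = \<bar>depth_const \<kappa> cB ce Gc\<bar>"
  define ca where "ca = (c2 * b) * exp ((c2 * b) * \<epsilon>0) * (1 + 2 * \<epsilon>0) + 2"
  have c2b: "0 \<le> c2 * b" using assms by simp
  have ca0: "0 < ca" using c2b assms unfolding ca_def by (intro add_nonneg_pos mult_nonneg_nonneg) auto
  define C where "C = ca + 4 * (cw * c5) + 4 * cd"
  have cwd: "0 \<le> cw" "0 \<le> cd" "0 \<le> cw * c5" using c50 by (auto simp: cw_def cd_def)
  have C: "0 < C" "ca \<le> C" "4 * (cw * c5) \<le> C" "4 * cd \<le> C" using ca0 cwd by (auto simp: C_def)
  have main: "(\<forall>B. iterated_products \<xi> S {..<n} (adj_matrix (graph_union (vgraph n E) (vgraph n H)) (case_sum wE wH)) (\<beta> - 1) B \<longrightarrow>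
            approx_distances (1 + C * \<epsilon>) (vgraph n E) wE (vgraph n H) S (B (\<beta> - 1))) \<and>
       (\<forall>w st. stores_instance w n E wE H wH S \<beta> \<epsilon> st \<longrightarrow>
          (\<exists>st' work depth R U X.
             exec w P st st' work depth R U \<and> outputs n S st st' X \<and>
             approx_distances (1 + C * \<epsilon>) (vgraph n E) wE (vgraph n H) S X \<and>
             (within_range (real n ^ a) (vgraph n E) wE (vgraph n H) wH \<longrightarrow>
                (\<exists>B. iterated_products \<xi> S {..<n} (adj_matrix (graph_union (vgraph n E) (vgraph n H)) (case_sum wE wH)) (\<beta> - 1) B \<and>
                     (\<forall>u\<in>S. \<forall>v\<in>{..<n}. X u v = B (\<beta> - 1) u v))) \<and>
             real work \<le> C * ln Wr * ((1 / \<epsilon>) * ln (2 + 1 / \<epsilon>) ^ 3) * real n powr (mm_exponent \<sigma> + \<delta>) \<and>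
             real depth \<le> C * (ln n * ln (2 + 1 / \<epsilon>)) ^ 3))"
    if n: "2 \<le> n" and \<epsilon>: "0 < \<epsilon>" "\<epsilon> \<le> \<epsilon>0" and wg: "weighted_graph (vgraph n E) wE" and Wr: "2 \<le> Wr"
      "aspect_ratio_at_most (vgraph n E) wE Wr" and \<beta>: "1 \<le> \<beta>" "real \<beta> \<le> b * ln n"
      and hs: "hopset \<epsilon> \<beta> (vgraph n E) wE (vgraph n H) wH" and S: "S \<subseteq> {..<n}" "card S = power_ceil n \<sigma>"
      and \<xi>: "c1 * \<epsilon> / ln n \<le> \<xi>" "\<xi> \<le> c2 * \<epsilon> / ln n"
    for n E wE H wH S \<beta> \<epsilon> \<xi> Wr
  proof -
    have lnn: "1 / 2 \<le> ln (real n)" using n ln_half_le[of "real n"] by simp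
    have ln0: "0 < ln (real n)" using lnn by linarith
    have L: "1 / 2 \<le> ln (2 + 1 / \<epsilon>)" using \<epsilon> by (intro ln_half_le) simp
    \<comment> \<open>A single exponent \<open>K\<close> has to serve work and depth, and the depth
      needs \<open>ln n ^ 3\<close>. The logarithm is at least 1/2, so raising it to the third power
      costs only the factor 4.\<close>
    have L3: "ln (2 + 1 / \<epsilon>) \<le> 4 * ln (2 + 1 / \<epsilon>) ^ 3"
    proof -
      have "(1/2) * (1/2) \<le> ln (2 + 1 / \<epsilon>) * ln (2 + 1 / \<epsilon>)" using L by (intro mult_mono) auto
      then have "ln (2 + 1 / \<epsilon>) * 1 \<le> ln (2 + 1 / \<epsilon>) * (4 * (ln (2 + 1 / \<epsilon>) * ln (2 + 1 / \<epsilon>)))"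
        using L by (intro mult_left_mono) auto
      then show ?thesis by (simp add: power3_eq_cube)
    qed
    have lW: "0 < ln Wr" using Wr by simp
    have \<xi>0: "0 \<le> \<xi>" by (rule order_trans[OF _ \<xi>(1)]) (use assms \<epsilon> ln0 in simp)
    \<comment> \<open>The logarithms in the bounds on \<open>\<xi>\<close> and
      \<open>\<beta>\<close> cancel, so the errors of all products together are proportional to
      \<open>\<epsilon>\<close>.\<close>
    have "\<xi> * real (\<beta> - 1) \<le> (c2 * \<epsilon> / ln n) * (b * ln n)" using \<xi> \<xi>0 \<beta> by (intro mult_mono) auto
    also have "\<dots> = (c2 * b) * \<epsilon>" using ln0 by simp
    finally have xk: "\<xi> * real (\<beta> - 1) \<le> (c2 * b) * \<epsilon>" .
    have pw: "(1 + \<xi>) ^ (\<beta> - 1) * (1 + 2 * \<epsilon>) \<le> 1 + ca * \<epsilon>"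
      unfolding ca_def by (rule power_product_le[OF \<xi>0 xk c2b \<epsilon>])
    also have "\<dots> \<le> 1 + C * \<epsilon>" using C(2) \<epsilon> by (intro add_left_mono mult_right_mono) auto
    finally have pw2: "(1 + \<xi>) ^ (\<beta> - 1) * (1 + 2 * \<epsilon>) \<le> 1 + C * \<epsilon>" .
    have "(1 + \<xi>) ^ (\<beta> - 1) * (1 + \<epsilon>) \<le> (1 + \<xi>) ^ (\<beta> - 1) * (1 + 2 * \<epsilon>)" using \<xi>0 \<epsilon> by (intro mult_left_mono) auto
    then have pw1: "(1 + \<xi>) ^ (\<beta> - 1) * (1 + \<epsilon>) \<le> 1 + C * \<epsilon>" using pw2 by linarith
    have r0: "0 < 1 + C * \<epsilon>" using C \<epsilon> by (intro add_pos_pos mult_pos_pos) auto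
    have vs: "verts (vgraph n E) = {..<n}" by (simp add: vgraph_def with_proj_def)
    have part1: "approx_distances (1 + C * \<epsilon>) (vgraph n E) wE (vgraph n H) S (B (\<beta> - 1))"
      if "iterated_products \<xi> S {..<n} (adj_matrix (graph_union (vgraph n E) (vgraph n H)) (case_sum wE wH)) (\<beta> - 1) B" for B
      using hopset_approx_distances_exact[OF wg hs \<beta>(1) less_imp_le[OF \<epsilon>(1)] _ \<xi>0 pw1 r0, of S B] S that vs by simp
    have part2: "\<exists>st' work depth R U X.
             exec w P st st' work depth R U \<and> outputs n S st st' X \<and>
             approx_distances (1 + C * \<epsilon>) (vgraph n E) wE (vgraph n H) S X \<and>
             (within_range (real n ^ a) (vgraph n E) wE (vgraph n H) wH \<longrightarrow>
                (\<exists>B. iterated_products \<xi> S {..<n} (adj_matrix (graph_union (vgraph n E) (vgraph n H)) (case_sum wE wH)) (\<beta> - 1) B \<and>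
                     (\<forall>u\<in>S. \<forall>v\<in>{..<n}. X u v = B (\<beta> - 1) u v))) \<and>
             real work \<le> C * ln Wr * ((1 / \<epsilon>) * ln (2 + 1 / \<epsilon>) ^ 3) * real n powr (mm_exponent \<sigma> + \<delta>) \<and>
             real depth \<le> C * (ln n * ln (2 + 1 / \<epsilon>)) ^ 3"
      if inst: "stores_instance w n E wE H wH S \<beta> \<epsilon> st" for w st
    proof -
      define lb where "lb = bit_length (int n)"
      define acc where "acc = nat \<lceil>1 / \<epsilon>\<rceil>"
      define mm where "mm = bit_length (int (\<kappa> * acc * lb))"
      have lnlb: "ln (real n) \<le> real lb"
      proof -
        have "int n < 2 ^ lb" using bit_length_pow[of "int n"] by (simp add: lb_def)
        then have "real_of_int (int n) \<le> real_of_int (2 ^ lb)" by (simp only: of_int_le_iff less_imp_le)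
        then have "real n \<le> 2 ^ lb" by simp
        then have "ln (real n) \<le> ln (2 ^ lb)" using n by (intro ln_mono) auto
        also have "\<dots> = real lb * ln 2" by (simp add: ln_realpow)
        also have "\<dots> \<le> real lb * 1" using ln_2_less_1 by (intro mult_left_mono) auto
        finally show ?thesis by simp
      qed
      have hk: "\<beta> \<le> \<kappa> * lb"
      proof -
        have "real \<beta> \<le> real \<kappa> * real lb" using \<beta>(2) mult_mono[OF \<kappa>(2) lnlb] ln0 by simp
        then show ?thesis by (simp only: of_nat_mult[symmetric] of_nat_le_iff)
      qed
      have x9: "9 / 2 ^ mm \<le> \<xi>"
      proof -
        have "\<bar>int (\<kappa> * acc * lb)\<bar> < 2 ^ mm" unfolding mm_def by (rule bit_length_pow)
        then have "int (\<kappa> * acc * lb) < 2 ^ mm" by simp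
        then have "real_of_int (int (\<kappa> * acc * lb)) < real_of_int (2 ^ mm)" by (simp only: of_int_less_iff)
        then have m1: "real \<kappa> * real acc * real lb < 2 ^ mm" by simp
        have "0 < 1 / \<epsilon>" using \<epsilon> by simp
        then have "- 1 < 1 / \<epsilon>" by linarith
        then have "(9 / c1) * (1 / \<epsilon>) * ln n \<le> real \<kappa> * real acc * real lb"
          using \<kappa>(3) lnlb ln0 assms \<epsilon> real_nat_ceiling_ge[of "1 / \<epsilon>"] by (intro mult_mono mult_nonneg_nonneg) (auto simp: acc_def)
        then have m2: "(9 / c1) * (1 / \<epsilon>) * ln n \<le> 2 ^ mm" using m1 by linarith
        have pos: "0 < (9 / c1) * (1 / \<epsilon>) * ln n" using ln0 assms \<epsilon> by (intro mult_pos_pos) auto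
        have "9 / 2 ^ mm \<le> 9 / ((9 / c1) * (1 / \<epsilon>) * ln n)" by (rule divide_left_mono[OF m2 _ mult_pos_pos[OF _ pos]]) auto
        also have "\<dots> = c1 * \<epsilon> / ln n" using ln0 assms \<epsilon> by (simp add: field_simps)
        finally show ?thesis using \<xi>(1) by linarith
      qed
      have accu: "real acc \<le> (1 + \<epsilon>0) / \<epsilon>"
      proof -
        have "real acc \<le> 1 / \<epsilon> + 1" unfolding acc_def using \<epsilon> by (intro nat_ceiling_le) simp
        also have "\<dots> \<le> (1 + \<epsilon>0) / \<epsilon>" using \<epsilon> by (simp add: field_simps)
        finally show ?thesis .
      qed
      have ef: "1 + \<epsilon> \<le> 2 ^ f" using f \<epsilon> by linarith
      obtain st' work depth R' U' X where X: "exec w P st st' work depth R' U'" "outputs n S st st' X"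
        "approx_distances (1 + C * \<epsilon>) (vgraph n E) wE (vgraph n H) S X"
        "within_range (real n ^ a) (vgraph n E) wE (vgraph n H) wH \<longrightarrow>
           (\<exists>B. iterated_products \<xi> S {..<n} (adj_matrix (graph_union (vgraph n E) (vgraph n H)) (case_sum wE wH)) (\<beta> - 1) B \<and>
                (\<forall>u\<in>S. \<forall>v\<in>{..<n}. X u v = B (\<beta> - 1) u v))"
        and wk: "real work \<le> work_const \<kappa> a f cB Gc C1 \<epsilon>0 *
           (ln (real n) ^ 5 * real n powr (mm_exponent \<sigma> + \<delta> / 2) * (ln (2 + 1 / \<epsilon>) * ln Wr / \<epsilon>))"
        and dp: "real depth \<le> depth_const \<kappa> cB ce Gc * (ln (real n) ^ 3 * ln (2 + 1 / \<epsilon>))"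
        unfolding P_def
        using hopset_program_run[OF n inst lb_def mm_def refl acc_def cB_def refl \<beta>(1) \<kappa>(1) q(2) assms(1,2) S(2) refl q(1,4,3) alg UVW ce
          wg hs S(1) \<epsilon>(1) ef hk x9 RC Wr(2,1) accu gk pw2] by blast
      have Z0: "0 \<le> ln (2 + 1 / \<epsilon>) * ln Wr / \<epsilon>" using L lW \<epsilon> by (intro divide_nonneg_pos mult_nonneg_nonneg) auto
      let ?L = "ln (2 + 1 / \<epsilon>)" and ?N = "ln (real n)"
      have "real work \<le> cw * (?N ^ 5 * real n powr (mm_exponent \<sigma> + \<delta> / 2) * (?L * ln Wr / \<epsilon>))"
      proof (rule order_trans[OF wk mult_right_mono])
        show "0 \<le> ?N ^ 5 * real n powr (mm_exponent \<sigma> + \<delta> / 2) * (?L * ln Wr / \<epsilon>)"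
          by (intro mult_nonneg_nonneg zero_le_power Z0 powr_ge_zero less_imp_le[OF ln0])
      qed (simp add: cw_def)
      also have "\<dots> \<le> cw * ((c5 * real n powr (\<delta> / 2)) * real n powr (mm_exponent \<sigma> + \<delta> / 2) * ((4 * ?L ^ 3) * ln Wr / \<epsilon>))"
        using ln5[of "real n"] n L3 L lW \<epsilon> cwd(1) c50 ln0
        by (intro mult_left_mono mult_mono divide_right_mono mult_nonneg_nonneg) (auto intro!: divide_nonneg_pos mult_nonneg_nonneg)
      also have "\<dots> = (4 * (cw * c5)) * (ln Wr * ((1 / \<epsilon>) * ?L ^ 3) * (real n powr (\<delta> / 2) * real n powr (mm_exponent \<sigma> + \<delta> / 2)))"
        by (simp add: field_simps)
      also have "real n powr (\<delta> / 2) * real n powr (mm_exponent \<sigma> + \<delta> / 2) = real n powr (mm_exponent \<sigma> + \<delta>)"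
        by (simp add: powr_add[symmetric] add_ac)
      also have "(4 * (cw * c5)) * (ln Wr * ((1 / \<epsilon>) * ?L ^ 3) * real n powr (mm_exponent \<sigma> + \<delta>))
          \<le> C * (ln Wr * ((1 / \<epsilon>) * ?L ^ 3) * real n powr (mm_exponent \<sigma> + \<delta>))"
        using C(3) L lW \<epsilon> by (intro mult_right_mono mult_nonneg_nonneg) auto
      finally have wk': "real work \<le> C * ln Wr * ((1 / \<epsilon>) * ?L ^ 3) * real n powr (mm_exponent \<sigma> + \<delta>)" by (simp add: mult_ac)
      have "real depth \<le> cd * (?N ^ 3 * ?L)"
        by (rule order_trans[OF dp]) (use L ln0 in \<open>auto simp: cd_def intro!: mult_right_mono mult_nonneg_nonneg\<close>)
      also have "\<dots> \<le> cd * (?N ^ 3 * (4 * ?L ^ 3))" using L3 ln0 cwd(2) by (intro mult_left_mono) auto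
      also have "\<dots> = (4 * cd) * (?N * ?L) ^ 3" by (simp add: power_mult_distrib)
      also have "\<dots> \<le> C * (?N * ?L) ^ 3" using C(4) ln0 L by (intro mult_right_mono) auto
      finally have dp': "real depth \<le> C * (ln n * ?L) ^ 3" .
      show ?thesis using X wk' dp' by blast
    qed
    show ?thesis using part1 part2 by blast
  qed
  show ?thesis unfolding Let_def
    by (intro exI[of _ C] exI[of _ 3] exI[of _ P] conjI[OF C(1)] allI impI) (elim conjE, rule main; assumption)
qed

end
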